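(* Let $R$ be a local Gorenstein ring with infinite residue field and let $I$ be a Cohen-Macaulay $R$-ideal of positive codimension. Let $\underline{x}\subseteq R$ be a sequence that is regular on $R$ and on $R/I$. If $I$ is maximal in its linkage class, then so is $(I,\underline{x})$.
   Context: All rings are commutative and Noetherian. A proper ideal $I$ of a local ring $R$ is Cohen-Macaulay (CM) if $R/I$ is a Cohen-Macaulay ring, and unmixed if all its associated primes have the same height. A complete intersection is a proper ideal generated by a regular sequence. Two proper ideals $I,J$ of a local Gorenstein ring are directly linked if there is a complete intersection $(\underline{\alpha})\subseteq I\cap J$ with $I=(\underline{\alpha}):J$ and $J=(\underline{\alpha}):I$. The equivalence relation on unmixed ideals generated by direct linkage is called linkage; its classes are linkage classes. An ideal is maximal in its linkage class if it contains every ideal in its linkage class. *)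

theory Defs
  imports "HOL-Algebra.Algebra" "HOL-Library.Extended_Nat"
begin

section \<open>Noetherian local rings\<close>

text \<open>Throughout, local rings are commutative and Noetherian.\<close>

definition local_ring :: "('a, 'x) ring_scheme \<Rightarrow> bool" where
  "local_ring R \<longleftrightarrow> cring R \<and> noetherian_ring R \<and> (\<exists>!m. maximalideal m R)"

definition the_maximal_ideal :: "('a, 'x) ring_scheme \<Rightarrow> 'a set" where
  "the_maximal_ideal R = (THE m. maximalideal m R)"

definition residue_field :: "('a, 'x) ring_scheme \<Rightarrow> 'a set ring" where
  "residue_field R = R Quot the_maximal_ideal R"

definition proper_ideal :: "('a, 'x) ring_scheme \<Rightarrow> 'a set \<Rightarrow> bool" where
  "proper_ideal R I \<longleftrightarrow> ideal I R \<and> I \<noteq> carrier R"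

section \<open>Dimension, height, depth\<close>

definition prime_chain :: "('a, 'x) ring_scheme \<Rightarrow> nat \<Rightarrow> (nat \<Rightarrow> 'a set) \<Rightarrow> bool" where
  "prime_chain R n P \<longleftrightarrow> (\<forall>i\<le>n. primeideal (P i) R) \<and> (\<forall>i<n. P i \<subset> P (Suc i))"

definition krull_dim :: "('a, 'x) ring_scheme \<Rightarrow> enat" where
  "krull_dim R = Sup {enat n |n. \<exists>P. prime_chain R n P}"

definition prime_height :: "('a, 'x) ring_scheme \<Rightarrow> 'a set \<Rightarrow> enat" where
  "prime_height R Q = Sup {enat n |n. \<exists>P. prime_chain R n P \<and> P n = Q}"

definition ideal_height :: "('a, 'x) ring_scheme \<Rightarrow> 'a set \<Rightarrow> enat" where
  "ideal_height R I = Inf {prime_height R Q |Q. primeideal Q R \<and> I \<subseteq> Q}"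

definition regular_sequence :: "('a, 'x) ring_scheme \<Rightarrow> 'a list \<Rightarrow> bool" where
  "regular_sequence R xs \<longleftrightarrow>
     set xs \<subseteq> carrier R \<and>
     (\<forall>i<length xs. \<forall>a\<in>carrier R.
        a \<otimes>\<^bsub>R\<^esub> xs ! i \<in> Idl\<^bsub>R\<^esub> (set (take i xs)) \<longrightarrow> a \<in> Idl\<^bsub>R\<^esub> (set (take i xs))) \<and>
     Idl\<^bsub>R\<^esub> (set xs) \<noteq> carrier R"

text \<open>A sequence in \<open>R\<close> is regular on the \<open>R\<close>-module \<open>R/I\<close> iff its image is a regular
  sequence of the ring \<open>R/I\<close>, since \<open>R\<close> acts on \<open>R/I\<close> through \<open>R/I\<close>.\<close>

definition regular_on_quotient :: "('a, 'x) ring_scheme \<Rightarrow> 'a set \<Rightarrow> 'a list \<Rightarrow> bool" where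
  "regular_on_quotient R I xs \<longleftrightarrow>
     set xs \<subseteq> carrier R \<and> regular_sequence (R Quot I) (map (\<lambda>x. I +>\<^bsub>R\<^esub> x) xs)"

definition ring_depth :: "('a, 'x) ring_scheme \<Rightarrow> enat" where
  "ring_depth R =
     Sup {enat (length xs) |xs. regular_sequence R xs \<and> set xs \<subseteq> the_maximal_ideal R}"

definition cohen_macaulay_local_ring :: "('a, 'x) ring_scheme \<Rightarrow> bool" where
  "cohen_macaulay_local_ring R \<longleftrightarrow> local_ring R \<and> ring_depth R = krull_dim R"

definition cohen_macaulay_ideal :: "('a, 'x) ring_scheme \<Rightarrow> 'a set \<Rightarrow> bool" where
  "cohen_macaulay_ideal R I \<longleftrightarrow> proper_ideal R I \<and> cohen_macaulay_local_ring (R Quot I)"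

section \<open>Gorenstein local rings\<close>

definition module_hom ::
    "('a, 'x) ring_scheme \<Rightarrow> ('a, 'b) module \<Rightarrow> ('a, 'c) module \<Rightarrow> ('b \<Rightarrow> 'c) set" where
  "module_hom R M N = {f \<in> carrier M \<rightarrow> carrier N.
     (\<forall>u\<in>carrier M. \<forall>v\<in>carrier M. f (u \<oplus>\<^bsub>M\<^esub> v) = f u \<oplus>\<^bsub>N\<^esub> f v) \<and>
     (\<forall>r\<in>carrier R. \<forall>u\<in>carrier M. f (r \<odot>\<^bsub>M\<^esub> u) = r \<odot>\<^bsub>N\<^esub> f u)}"

definition regular_module :: "('a, 'x) ring_scheme \<Rightarrow> ('a, 'a) module" where
  "regular_module R = \<lparr>carrier = carrier R, monoid.mult = monoid.mult R, one = one R,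
     ring.zero = ring.zero R, ring.add = ring.add R, smult = monoid.mult R\<rparr>"

text \<open>The test modules \<open>A\<close> and \<open>B\<close> live in the same type as \<open>E\<close>. Whenever \<open>R\<close> injects into
  that type (as it does into \<open>'a list\<close>, the type used below), the inclusions of ideals
  into \<open>R\<close> occur among the test maps up to isomorphism, so by Baer's criterion this is
  injectivity with respect to all \<open>R\<close>-modules.\<close>

definition injective_module :: "('a, 'x) ring_scheme \<Rightarrow> ('a, 'm) module \<Rightarrow> bool" where
  "injective_module R E \<longleftrightarrow> module R E \<and>
     (\<forall>(A :: ('a, 'm) module) (B :: ('a, 'm) module) f g.
        module R A \<and> module R B \<and> f \<in> module_hom R A B \<and> inj_on f (carrier A) \<and>
        g \<in> module_hom R A E \<longrightarrow>
        (\<exists>h \<in> module_hom R B E. \<forall>a\<in>carrier A. h (f a) = g a))"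

text \<open>An injective resolution \<open>0 \<rightarrow> M \<rightarrow> E 0 \<rightarrow> E 1 \<rightarrow> \<dots>\<close> with \<open>E i = 0\<close> for \<open>i > n\<close>.\<close>

definition injective_resolution ::
    "('a, 'x) ring_scheme \<Rightarrow> ('a, 'b) module \<Rightarrow> nat \<Rightarrow> ('b \<Rightarrow> 'm) \<Rightarrow>
      (nat \<Rightarrow> ('a, 'm) module) \<Rightarrow> (nat \<Rightarrow> 'm \<Rightarrow> 'm) \<Rightarrow> bool" where
  "injective_resolution R M n \<epsilon> E d \<longleftrightarrow>
     (\<forall>i. injective_module R (E i)) \<and>
     \<epsilon> \<in> module_hom R M (E 0) \<and> (\<forall>i. d i \<in> module_hom R (E i) (E (Suc i))) \<and>
     inj_on \<epsilon> (carrier M) \<and>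
     \<epsilon> ` carrier M = a_kernel (E 0) (E 1) (d 0) \<and>
     (\<forall>i. d i ` carrier (E i) = a_kernel (E (Suc i)) (E (Suc (Suc i))) (d (Suc i))) \<and>
     (\<forall>i>n. carrier (E i) = {\<zero>\<^bsub>E i\<^esub>})"

text \<open>\<open>R\<close> has finite injective dimension as a module over itself. Taking the resolving modules
  in \<open>'a list\<close> is no restriction: for Noetherian \<open>R\<close> the terms of the minimal injective
  resolution of \<open>R\<close> have cardinality at most that of the finite lists over \<open>R\<close>.\<close>

definition gorenstein_local_ring :: "('a, 'x) ring_scheme \<Rightarrow> bool" where
  "gorenstein_local_ring R \<longleftrightarrow> local_ring R \<and>
     (\<exists>n (\<epsilon> :: 'a \<Rightarrow> 'a list) E d. injective_resolution R (regular_module R) n \<epsilon> E d)"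

section \<open>Linkage\<close>

definition associated_primes :: "('a, 'x) ring_scheme \<Rightarrow> 'a set \<Rightarrow> 'a set set" where
  "associated_primes R I =
     {P. primeideal P R \<and> (\<exists>a\<in>carrier R. P = {r \<in> carrier R. r \<otimes>\<^bsub>R\<^esub> a \<in> I})}"

definition unmixed_ideal :: "('a, 'x) ring_scheme \<Rightarrow> 'a set \<Rightarrow> bool" where
  "unmixed_ideal R I \<longleftrightarrow> proper_ideal R I \<and>
     (\<forall>P\<in>associated_primes R I. \<forall>Q\<in>associated_primes R I. prime_height R P = prime_height R Q)"

definition complete_intersection :: "('a, 'x) ring_scheme \<Rightarrow> 'a set \<Rightarrow> bool" where
  "complete_intersection R A \<longleftrightarrow>
     proper_ideal R A \<and> (\<exists>xs. regular_sequence R xs \<and> A = Idl\<^bsub>R\<^esub> (set xs))"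

definition ideal_colon :: "('a, 'x) ring_scheme \<Rightarrow> 'a set \<Rightarrow> 'a set \<Rightarrow> 'a set" where
  "ideal_colon R A J = {r \<in> carrier R. \<forall>j\<in>J. r \<otimes>\<^bsub>R\<^esub> j \<in> A}"

definition directly_linked :: "('a, 'x) ring_scheme \<Rightarrow> 'a set \<Rightarrow> 'a set \<Rightarrow> bool" where
  "directly_linked R I J \<longleftrightarrow> proper_ideal R I \<and> proper_ideal R J \<and>
     (\<exists>A. complete_intersection R A \<and> A \<subseteq> I \<inter> J \<and>
          I = ideal_colon R A J \<and> J = ideal_colon R A I)"

text \<open>The equivalence relation generated by direct linkage on the set of unmixed ideals.\<close>

definition direct_linkage :: "('a, 'x) ring_scheme \<Rightarrow> ('a set \<times> 'a set) set" where
  "direct_linkage R =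
     {(I, J). unmixed_ideal R I \<and> unmixed_ideal R J \<and> directly_linked R I J}"

definition linkage :: "('a, 'x) ring_scheme \<Rightarrow> ('a set \<times> 'a set) set" where
  "linkage R = {(I, J). unmixed_ideal R I \<and> unmixed_ideal R J \<and>
     (I, J) \<in> (direct_linkage R \<union> (direct_linkage R)\<inverse>)\<^sup>*}"

definition linkage_class :: "('a, 'x) ring_scheme \<Rightarrow> 'a set \<Rightarrow> 'a set set" where
  "linkage_class R I = linkage R `` {I}"

text \<open>Unmixedness is part of the notion: only unmixed ideals have a linkage class.\<close>

definition maximal_in_linkage_class :: "('a, 'x) ring_scheme \<Rightarrow> 'a set \<Rightarrow> bool" where
  "maximal_in_linkage_class R I \<longleftrightarrow> unmixed_ideal R I \<and> (\<forall>J\<in>linkage_class R I. J \<subseteq> I)"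

end

theory Submission
  imports Defs
begin

text \<open>Adjoin the members of the sequence one at a time, and let \<open>J = (I, x)\<close>. Over the
  Gorenstein ring \<open>R\<close> links and heights are controlled by the modules \<open>Ext^j(R/J, R)\<close>, read off
  a finite injective resolution of \<open>R\<close>.

  First, \<open>J\<close> contains each of its direct links \<open>a : J\<close>, and the same holds for \<open>J[[t]]\<close> in
  \<open>R[[t]]\<close>: exchange the members of \<open>a\<close> one by one for general generators of \<open>J\<close>. A generator with
  a unit coefficient at \<open>x\<close> turns the link of \<open>J\<close> into a link of \<open>I\<close>, which lies in \<open>I\<close> because \<open>I\<close>
  is maximal in its class and not a complete intersection.

  Next, lift a chain of links \<open>J = P_0, P_1, \<dots>\<close> to \<open>R[[t]]\<close>. Colon ideals of lifted regular
  sequences are flat over \<open>t\<close>. If the sequence defining every second link is perturbed by \<open>t^M\<close>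
  times the preceding one for a general \<open>M\<close>, the even lifts coincide with \<open>J[[t]]\<close> up to a
  multiplier outside the prime \<open>m[[t]]\<close>, so all lifts stay inside \<open>J[[t]]\<close>. At \<open>t = 0\<close> every
  \<open>P_i\<close> is contained in \<open>J\<close>.\<close>

section \<open>Ideals, colons and regular sequences relative to an ideal\<close>

text \<open>Linking twice by the same sequence \<open>a\<close> leads back to \<open>J\<close>. This
  is the reason for the perturbation: as soon as \<open>t\<close> is inverted,
  \<open>b + t^M a\<close> behaves for most \<open>M\<close> like \<open>a\<close>, so every second
  ideal of the deformed chain is generically \<open>J\<close>, while at \<open>t = 0\<close> the
  chain is the given one. The inclusion in \<open>J[[t]]\<close> specializes to
  \<open>t = 0\<close>; the equality does not, since it holds only up to a multiplier. That most
  \<open>M\<close> work is an eigenvalue count on the product of \<open>J[[t]]\<close> with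
  \<open>(a)\<close>; therefore the direct links of \<open>J[[t]]\<close> have to be controlled up
  to this product and not just inside \<open>(a)\<close>.

  No localization is formed: statements at a prime are written with multipliers outside it.
  \<open>R[[t]]\<close> is used as a commutative ring only. Noetherian and homological arguments
  stay over \<open>R\<close> and pass to \<open>R[[t]]\<close> coefficient by coefficient, since
  finitely generated ideals are closed under \<open>t\<close>-adic sums.\<close>

definition adjoin :: "('a, 'x) ring_scheme \<Rightarrow> 'a set \<Rightarrow> 'a \<Rightarrow> 'a set" where
  "adjoin R N a = {n \<oplus>\<^bsub>R\<^esub> r \<otimes>\<^bsub>R\<^esub> a |n r. n \<in> N \<and> r \<in> carrier R}"

definition gen :: "('a, 'x) ring_scheme \<Rightarrow> 'a set \<Rightarrow> 'a list \<Rightarrow> 'a set" where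
  "gen R N xs = foldl (adjoin R) N xs"

definition colon :: "('a, 'x) ring_scheme \<Rightarrow> 'a set \<Rightarrow> 'a \<Rightarrow> 'a set" where
  "colon R N c = {r \<in> carrier R. r \<otimes>\<^bsub>R\<^esub> c \<in> N}"

definition nonzerodivisor :: "('a, 'x) ring_scheme \<Rightarrow> 'a set \<Rightarrow> 'a \<Rightarrow> bool" where
  "nonzerodivisor R N x \<longleftrightarrow> (\<forall>r\<in>carrier R. r \<otimes>\<^bsub>R\<^esub> x \<in> N \<longrightarrow> r \<in> N)"

text \<open>Weak regularity: properness of the final ideal is not asked, so that concatenation
  splits without side conditions (\<open>reg_append\<close>). In the local ring properness is
  regained from containment in the maximal ideal.\<close>

fun reg :: "('a, 'x) ring_scheme \<Rightarrow> 'a set \<Rightarrow> 'a list \<Rightarrow> bool" where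
  "reg R N [] \<longleftrightarrow> True"
| "reg R N (x # xs) \<longleftrightarrow> x \<in> carrier R \<and> nonzerodivisor R N x \<and> reg R (adjoin R N x) xs"

lemma gen_Nil [simp]: "gen R N [] = N"
  and gen_Cons [simp]: "gen R N (x # xs) = gen R (adjoin R N x) xs"
  and gen_append [simp]: "gen R N (xs @ ys) = gen R (gen R N xs) ys"
  by (simp_all add: gen_def)

lemma reg_append [simp]: "reg R N (xs @ ys) \<longleftrightarrow> reg R N xs \<and> reg R (gen R N xs) ys"
  by (induction xs arbitrary: N) auto

lemma reg_carrier: "reg R N xs \<Longrightarrow> set xs \<subseteq> carrier R"
  by (induction xs arbitrary: N) auto

context cring begin

lemma iadd: "ideal I R \<Longrightarrow> a \<in> I \<Longrightarrow> b \<in> I \<Longrightarrow> a \<oplus> b \<in> I"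
  by (simp add: additive_subgroup.a_closed ideal.axioms(1))

lemma icarr: "ideal I R \<Longrightarrow> a \<in> I \<Longrightarrow> a \<in> carrier R"
  by (rule ideal.Icarr)

lemma isub: "ideal I R \<Longrightarrow> I \<subseteq> carrier R"
  by (auto intro: icarr)

lemma imult: "ideal I R \<Longrightarrow> a \<in> I \<Longrightarrow> r \<in> carrier R \<Longrightarrow> r \<otimes> a \<in> I"
  by (rule ideal.I_l_closed)

lemma imultr: "ideal I R \<Longrightarrow> a \<in> I \<Longrightarrow> r \<in> carrier R \<Longrightarrow> a \<otimes> r \<in> I"
  by (rule ideal.I_r_closed)

lemma izero: "ideal I R \<Longrightarrow> \<zero> \<in> I"
  by (simp add: additive_subgroup.zero_closed ideal.axioms(1))

lemma ineg: "ideal I R \<Longrightarrow> a \<in> I \<Longrightarrow> \<ominus> a \<in> I"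
  by (simp add: additive_subgroup.a_inv_closed ideal.axioms(1))

lemma iminus: "ideal I R \<Longrightarrow> a \<in> I \<Longrightarrow> b \<in> I \<Longrightarrow> a \<ominus> b \<in> I"
  unfolding a_minus_def by (intro iadd ineg)

lemma iadd_cancel:
  assumes "ideal I R" "a \<oplus> b \<in> I" "b \<in> I" "a \<in> carrier R" shows "a \<in> I"
proof -
  have "b \<in> carrier R" using assms icarr by blast
  then have "a = (a \<oplus> b) \<ominus> b" using assms(4) by algebra
  then show ?thesis using iminus assms by metis
qed

lemma iminus_cancel:
  assumes "ideal I R" "a \<ominus> b \<in> I" "b \<in> I" "a \<in> carrier R" shows "a \<in> I"
proof -
  have "b \<in> carrier R" using assms icarr by blast
  then have "a = (a \<ominus> b) \<oplus> b" using assms(4) by algebra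
  then show ?thesis using iadd assms by metis
qed

lemma ideal_oneI: "ideal I R \<Longrightarrow> \<one> \<in> I \<Longrightarrow> I = carrier R"
  by (rule ideal.one_imp_carrier)

lemma idealI':
  assumes "N \<subseteq> carrier R" "\<zero> \<in> N" "\<And>a b. a \<in> N \<Longrightarrow> b \<in> N \<Longrightarrow> a \<oplus> b \<in> N"
    "\<And>r a. r \<in> carrier R \<Longrightarrow> a \<in> N \<Longrightarrow> r \<otimes> a \<in> N"
  shows "ideal N R"
proof (rule idealI)
  show "ring R" by (rule ring_axioms)
  have neg: "\<ominus> a \<in> N" if "a \<in> N" for a
  proof -
    have "\<ominus> a = (\<ominus> \<one>) \<otimes> a" using that assms(1) by (auto simp: l_minus)
    then show ?thesis using assms(4)[of "\<ominus> \<one>" a] that by simp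
  qed
  show "subgroup N (add_monoid R)"
    by (rule subgroup.intro) (use assms neg in \<open>auto simp flip: a_inv_def\<close>)
  show "\<And>a x. a \<in> N \<Longrightarrow> x \<in> carrier R \<Longrightarrow> x \<otimes> a \<in> N" using assms by blast
  show "\<And>a x. a \<in> N \<Longrightarrow> x \<in> carrier R \<Longrightarrow> a \<otimes> x \<in> N"
    using assms(1,4) m_comm by (metis subsetD)
qed

lemma adjoinI:
  "n \<in> N \<Longrightarrow> r \<in> carrier R \<Longrightarrow> n \<oplus> r \<otimes> a \<in> adjoin R N a"
  unfolding adjoin_def by blast

lemma adjoinE:
  assumes "u \<in> adjoin R N a"
  obtains n r where "n \<in> N" "r \<in> carrier R" "u = n \<oplus> r \<otimes> a"
  using assms unfolding adjoin_def by blast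

text \<open>The coefficients range over an ideal \<open>P\<close>. Besides \<open>adjoin\<close>,
  where \<open>P\<close> is the whole ring, this serves for \<open>nonunit_part\<close> and, over
  power series, for coefficients in \<open>fps_ext J\<close>.\<close>

lemma ideal_add_mult:
  assumes N: "ideal N R" and P: "ideal P R" and a: "a \<in> carrier R"
  shows "ideal {n \<oplus> s \<otimes> a |n s. n \<in> N \<and> s \<in> P} R" (is "ideal ?D R")
proof (rule idealI')
  show "?D \<subseteq> carrier R" using icarr[OF N] icarr[OF P] a by auto
  show "\<zero> \<in> ?D" using izero[OF N] izero[OF P] a by (intro CollectI exI[of _ \<zero>]) simp
  show "u \<oplus> v \<in> ?D" if "u \<in> ?D" "v \<in> ?D" for u v
  proof -
    obtain n s m t where n: "n \<in> N" "s \<in> P" "u = n \<oplus> s \<otimes> a" "m \<in> N" "t \<in> P" "v = m \<oplus> t \<otimes> a" using \<open>u \<in> ?D\<close> \<open>v \<in> ?D\<close> by auto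
    have "u \<oplus> v = (n \<oplus> m) \<oplus> (s \<oplus> t) \<otimes> a"
      unfolding n(3,6) using icarr[OF N n(1)] icarr[OF N n(4)] icarr[OF P n(2)] icarr[OF P n(5)] a by algebra
    then show ?thesis using iadd[OF N n(1,4)] iadd[OF P n(2,5)] by blast
  qed
  show "r \<otimes> u \<in> ?D" if r: "r \<in> carrier R" and "u \<in> ?D" for r u
  proof -
    obtain n s where n: "n \<in> N" "s \<in> P" "u = n \<oplus> s \<otimes> a" using \<open>u \<in> ?D\<close> by auto
    have "r \<otimes> u = r \<otimes> n \<oplus> (r \<otimes> s) \<otimes> a"
      unfolding n(3) using icarr[OF N n(1)] icarr[OF P n(2)] a r by algebra
    then show ?thesis using imult[OF N n(1) r] imult[OF P n(2) r] by blast
  qed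
qed

lemma ideal_adjoin:
  assumes N: "ideal N R" and a: "a \<in> carrier R" shows "ideal (adjoin R N a) R"
  unfolding adjoin_def by (rule ideal_add_mult[OF N oneideal a])

lemma adjoin_sub: "ideal N R \<Longrightarrow> a \<in> carrier R \<Longrightarrow> N \<subseteq> adjoin R N a"
  using adjoinI[of _ N \<zero> a] icarr[of N] by (metis l_null r_zero subsetI zero_closed)

lemma adjoin_mem: "ideal N R \<Longrightarrow> a \<in> carrier R \<Longrightarrow> a \<in> adjoin R N a"
  using adjoinI[OF izero, of N \<one> a] by simp

lemma adjoin_least: "ideal K R \<Longrightarrow> N \<subseteq> K \<Longrightarrow> a \<in> K \<Longrightarrow> adjoin R N a \<subseteq> K"
  unfolding adjoin_def by (auto intro!: iadd imult)

lemma ideal_gen: "ideal N R \<Longrightarrow> set xs \<subseteq> carrier R \<Longrightarrow> ideal (gen R N xs) R"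
  by (induction xs arbitrary: N) (auto intro: ideal_adjoin)

lemma gen_sub: "ideal N R \<Longrightarrow> set xs \<subseteq> carrier R \<Longrightarrow> N \<subseteq> gen R N xs"
proof (induction xs arbitrary: N)
  case (Cons a xs)
  then show ?case using adjoin_sub[of N a] ideal_adjoin[of N a] by simp blast
qed simp

lemma gen_mem: "ideal N R \<Longrightarrow> set xs \<subseteq> carrier R \<Longrightarrow> set xs \<subseteq> gen R N xs"
proof (induction xs arbitrary: N)
  case (Cons a xs)
  then show ?case
    using adjoin_mem[of N a] ideal_adjoin[of N a] gen_sub[of "adjoin R N a" xs] by simp blast
qed simp

lemma gen_least: "ideal K R \<Longrightarrow> N \<subseteq> K \<Longrightarrow> set xs \<subseteq> K \<Longrightarrow> gen R N xs \<subseteq> K"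
  by (induction xs arbitrary: N) (auto simp: adjoin_least)

lemma gen_mono:
  assumes "ideal K R" "N \<subseteq> K" "set ys \<subseteq> carrier R" "set xs \<subseteq> gen R K ys"
  shows "gen R N xs \<subseteq> gen R K ys"
  using assms gen_sub[of K ys] by (intro gen_least ideal_gen) auto

lemma gen_cong:
  assumes "ideal N R" "set xs = set ys" "set xs \<subseteq> carrier R"
  shows "gen R N xs = gen R N ys"
  using assms gen_mono[of N N ys xs] gen_mono[of N N xs ys] gen_mem[of N xs] gen_mem[of N ys]
  by auto

lemma gen_eq_Idl:
  assumes "ideal N R" "set xs \<subseteq> carrier R" shows "gen R N xs = Idl (N \<union> set xs)"
proof
  have c: "N \<union> set xs \<subseteq> carrier R" using assms isub by auto
  show "gen R N xs \<subseteq> Idl (N \<union> set xs)"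
    using genideal_self[OF c] by (intro gen_least genideal_ideal c) auto
  show "Idl (N \<union> set xs) \<subseteq> gen R N xs"
    using gen_sub[OF assms] gen_mem[OF assms] by (intro genideal_minimal ideal_gen assms) auto
qed

abbreviation ci :: "'a list \<Rightarrow> 'a set" where "ci xs \<equiv> gen R {\<zero>} xs"

lemma gen_zero_eq_Idl: "set xs \<subseteq> carrier R \<Longrightarrow> gen R {\<zero>} xs = Idl (set xs)"
proof -
  assume a: "set xs \<subseteq> carrier R"
  have "\<zero> \<in> Idl (set xs)" using izero[OF genideal_ideal[OF a]] .
  then have "Idl ({\<zero>} \<union> set xs) = Idl (set xs)"
    using a genideal_self[of "set xs"] genideal_self[of "{\<zero>} \<union> set xs"]
    by (intro antisym genideal_minimal genideal_ideal) auto
  then show ?thesis using gen_eq_Idl[OF zeroideal a] by simp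
qed

lemma ideal_colon:
  assumes N: "ideal N R" and c: "c \<in> carrier R" shows "ideal (colon R N c) R"
proof (rule idealI')
  show "colon R N c \<subseteq> carrier R" unfolding colon_def by auto
  show "\<zero> \<in> colon R N c" unfolding colon_def using c izero[OF N] by simp
  show "a \<oplus> b \<in> colon R N c" if "a \<in> colon R N c" "b \<in> colon R N c" for a b
    using that iadd[OF N] c unfolding colon_def by (auto simp: l_distr)
  show "r \<otimes> a \<in> colon R N c" if "r \<in> carrier R" "a \<in> colon R N c" for r a
    using that imult[OF N] c unfolding colon_def by (auto simp: m_assoc)
qed

lemma colon_sub: "ideal N R \<Longrightarrow> c \<in> carrier R \<Longrightarrow> N \<subseteq> colon R N c"
  unfolding colon_def using icarr[of N] imultr[of N] by auto

lemma colon_mult_mono: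
  assumes "ideal N R" "b \<in> carrier R" "c \<in> carrier R"
  shows "colon R N c \<subseteq> colon R N (b \<otimes> c)"
proof
  fix r assume r: "r \<in> colon R N c"
  then have "r \<in> carrier R" "r \<otimes> c \<in> N" unfolding colon_def by auto
  moreover have "r \<otimes> (b \<otimes> c) = b \<otimes> (r \<otimes> c)" using \<open>r \<in> carrier R\<close> assms by algebra
  ultimately show "r \<in> colon R N (b \<otimes> c)" using assms imult unfolding colon_def by auto
qed

lemma ideal_colon_ideal:
  assumes A: "ideal A R" and P: "P \<subseteq> carrier R" shows "ideal (ideal_colon R A P) R"
proof (rule idealI')
  have D: "a \<in> carrier R" "a \<otimes> p \<in> A" if "a \<in> ideal_colon R A P" "p \<in> P" for a p
    using that unfolding ideal_colon_def by auto
  show 1: "ideal_colon R A P \<subseteq> carrier R" unfolding ideal_colon_def by auto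
  have "\<zero> \<otimes> p \<in> A" if "p \<in> P" for p using that P izero[OF A] l_null by fastforce
  then show "\<zero> \<in> ideal_colon R A P" unfolding ideal_colon_def by simp
  show "a \<oplus> b \<in> ideal_colon R A P" if ab: "a \<in> ideal_colon R A P" "b \<in> ideal_colon R A P" for a b
  proof -
    have "(a \<oplus> b) \<otimes> p \<in> A" if p: "p \<in> P" for p
    proof -
      have "(a \<oplus> b) \<otimes> p = a \<otimes> p \<oplus> b \<otimes> p" using ab p P 1 by (intro l_distr) auto
      then show ?thesis using iadd[OF A D(2)[OF ab(1) p] D(2)[OF ab(2) p]] by simp
    qed
    then show ?thesis using ab 1 unfolding ideal_colon_def by auto
  qed
  show "r \<otimes> a \<in> ideal_colon R A P" if r: "r \<in> carrier R" and a: "a \<in> ideal_colon R A P" for r a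
  proof -
    have "(r \<otimes> a) \<otimes> p \<in> A" if p: "p \<in> P" for p
    proof -
      have "(r \<otimes> a) \<otimes> p = r \<otimes> (a \<otimes> p)" using r a p P 1 by (intro m_assoc) auto
      then show ?thesis using imult[OF A D(2)[OF a p] r] by simp
    qed
    then show ?thesis using r a 1 unfolding ideal_colon_def by auto
  qed
qed

lemma ideal_colon_sub: "ideal A R \<Longrightarrow> P \<subseteq> carrier R \<Longrightarrow> A \<subseteq> ideal_colon R A P"
  unfolding ideal_colon_def using icarr[of A] imultr[of A] by blast

lemma ideal_colonD: "v \<in> ideal_colon R A P \<Longrightarrow> p \<in> P \<Longrightarrow> v \<otimes> p \<in> A"
  unfolding ideal_colon_def by auto

lemma prime_ideal: "primeideal Q R \<Longrightarrow> ideal Q R"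
  by (simp add: primeideal.axioms(1))

lemma prime_mult: "primeideal Q R \<Longrightarrow> a \<in> carrier R \<Longrightarrow> b \<in> carrier R \<Longrightarrow> a \<otimes> b \<in> Q \<Longrightarrow> a \<notin> Q \<Longrightarrow> b \<in> Q"
  using primeideal.I_prime[of Q R a b] by auto

lemma prime_one: "primeideal Q R \<Longrightarrow> \<one> \<notin> Q"
  using ideal_oneI[OF prime_ideal, of Q] primeideal.I_notcarr[of Q R] by auto

lemma prime_mult_notin:
  "primeideal Q R \<Longrightarrow> a \<in> carrier R - Q \<Longrightarrow> b \<in> carrier R - Q \<Longrightarrow> a \<otimes> b \<in> carrier R - Q"
  using prime_mult by auto

lemma prime_minus_notin:
  assumes "primeideal Q R" "a \<in> carrier R - Q" "q \<in> Q" shows "a \<ominus> q \<in> carrier R - Q"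
  using assms iminus_cancel[OF prime_ideal, of Q a q] icarr[OF prime_ideal, of Q q] by auto

lemma nonzerodivisorD:
  "nonzerodivisor R N x \<Longrightarrow> r \<in> carrier R \<Longrightarrow> r \<otimes> x \<in> N \<Longrightarrow> r \<in> N"
  unfolding nonzerodivisor_def by blast

lemma nonzerodivisorD':
  "nonzerodivisor R N x \<Longrightarrow> x \<in> carrier R \<Longrightarrow> r \<in> carrier R \<Longrightarrow> x \<otimes> r \<in> N \<Longrightarrow> r \<in> N"
  unfolding nonzerodivisor_def by (metis m_comm)

lemma nonzerodivisor_cong:
  assumes N: "ideal N R" and x: "x \<in> carrier R" "y \<in> carrier R" "x \<ominus> y \<in> N"
    and "nonzerodivisor R N x"
  shows "nonzerodivisor R N y"
  unfolding nonzerodivisor_def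
proof (intro ballI impI)
  fix r assume r: "r \<in> carrier R" "r \<otimes> y \<in> N"
  have "r \<otimes> x = r \<otimes> (x \<ominus> y) \<oplus> r \<otimes> y" using r x by algebra
  then have "r \<otimes> x \<in> N" using r x iadd[OF N imult[OF N x(3)]] by simp
  then show "r \<in> N" using assms(5) r nonzerodivisorD by blast
qed

lemma adjoin_cong:
  assumes N: "ideal N R" and x: "x \<in> carrier R" "y \<in> carrier R" "x \<ominus> y \<in> N"
  shows "adjoin R N x = adjoin R N y"
proof -
  have "adjoin R N x \<subseteq> adjoin R N y" if x: "x \<in> carrier R" "y \<in> carrier R" "x \<ominus> y \<in> N" for x y
  proof (rule adjoin_least[OF ideal_adjoin[OF N x(2)] adjoin_sub[OF N x(2)]])
    have "x = (x \<ominus> y) \<oplus> \<one> \<otimes> y" using x by algebra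
    then show "x \<in> adjoin R N y" using adjoinI[OF x(3), of \<one> y] by simp
  qed
  moreover have "y \<ominus> x \<in> N"
  proof -
    have "y \<ominus> x = \<ominus> (x \<ominus> y)" using x by algebra
    then show ?thesis using ineg[OF N x(3)] by simp
  qed
  ultimately show ?thesis using x by blast
qed

text \<open>Applied with \<open>N = (e)\<close> for one member \<open>e\<close> of a regular
  sequence, this allows the other members to be changed by multiples of \<open>e\<close>.\<close>

lemma reg_cong:
  assumes "ideal N R" "list_all2 (\<lambda>x y. x \<in> carrier R \<and> y \<in> carrier R \<and> x \<ominus> y \<in> N) xs ys" "reg R N xs"
  shows "reg R N ys \<and> gen R N xs = gen R N ys"
  using assms
proof (induction xs arbitrary: N ys)
  case (Cons x xs N zs)
  then obtain y ys where zs: "zs = y # ys" and x: "x \<in> carrier R" "y \<in> carrier R" "x \<ominus> y \<in> N"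
    and l: "list_all2 (\<lambda>x y. x \<in> carrier R \<and> y \<in> carrier R \<and> x \<ominus> y \<in> N) xs ys"
    by (auto simp: list_all2_Cons1)
  have N: "ideal N R" by fact
  have r: "nonzerodivisor R N x" "reg R (adjoin R N x) xs" using Cons.prems(3) by auto
  have e: "adjoin R N x = adjoin R N y" by (rule adjoin_cong[OF N x])
  have i: "ideal (adjoin R N x) R" by (rule ideal_adjoin[OF N x(1)])
  have "list_all2 (\<lambda>x y. x \<in> carrier R \<and> y \<in> carrier R \<and> x \<ominus> y \<in> adjoin R N x') xs ys" if "x' = x" for x'
    using l adjoin_sub[OF N x(1)] unfolding that by (auto elim!: list_all2_mono)
  then have "reg R (adjoin R N x) ys \<and> gen R (adjoin R N x) xs = gen R (adjoin R N x) ys"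
    using Cons.IH[OF i _ r(2)] by simp
  then show ?case using e zs x(2) nonzerodivisor_cong[OF N x r(1)] by simp
qed simp

end

section \<open>Spans and Nakayama's lemma\<close>

text \<open>An inductive span replaces finite sums, so that membership is analysed by adding one
  multiple at a time.\<close>

inductive_set spn :: "('a, 'x) ring_scheme \<Rightarrow> ('a, 'b, 'y) module_scheme \<Rightarrow> 'b set \<Rightarrow> 'b set"
  for R :: "('a, 'x) ring_scheme" and M :: "('a, 'b, 'y) module_scheme" and A :: "'b set" where
  spn_zero: "\<zero>\<^bsub>M\<^esub> \<in> spn R M A"
| spn_step: "x \<in> spn R M A \<Longrightarrow> a \<in> A \<Longrightarrow> r \<in> carrier R \<Longrightarrow> x \<oplus>\<^bsub>M\<^esub> r \<odot>\<^bsub>M\<^esub> a \<in> spn R M A"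

context module begin

lemma submodule_sub: "submodule D R M \<Longrightarrow> D \<subseteq> carrier M"
  by (rule submoduleE(1))
lemma submodule_zero: "submodule D R M \<Longrightarrow> \<zero>\<^bsub>M\<^esub> \<in> D"
  using subgroup.one_closed[OF submodule.axioms(1)] by fastforce
lemma submodule_add: "submodule D R M \<Longrightarrow> x \<in> D \<Longrightarrow> y \<in> D \<Longrightarrow> x \<oplus>\<^bsub>M\<^esub> y \<in> D"
  by (rule submoduleE(5))
lemma submodule_smult: "submodule D R M \<Longrightarrow> r \<in> carrier R \<Longrightarrow> x \<in> D \<Longrightarrow> r \<odot>\<^bsub>M\<^esub> x \<in> D"
  by (rule submoduleE(4))
lemma submodule_neg: "submodule D R M \<Longrightarrow> x \<in> D \<Longrightarrow> \<ominus>\<^bsub>M\<^esub> x \<in> D"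
  by (rule submoduleE(3))
lemma submodule_minus: "submodule D R M \<Longrightarrow> x \<in> D \<Longrightarrow> y \<in> D \<Longrightarrow> x \<ominus>\<^bsub>M\<^esub> y \<in> D"
  unfolding M.minus_eq by (intro submodule_add submodule_neg)

lemma submoduleI':
  assumes "D \<subseteq> carrier M" "\<zero>\<^bsub>M\<^esub> \<in> D" "\<And>x y. x \<in> D \<Longrightarrow> y \<in> D \<Longrightarrow> x \<oplus>\<^bsub>M\<^esub> y \<in> D"
    "\<And>r x. r \<in> carrier R \<Longrightarrow> x \<in> D \<Longrightarrow> r \<odot>\<^bsub>M\<^esub> x \<in> D"
  shows "submodule D R M"
proof (rule submoduleI)
  fix a assume a: "a \<in> D"
  have "(\<ominus> \<one>) \<odot>\<^bsub>M\<^esub> a = \<ominus>\<^bsub>M\<^esub> a" using smult_l_minus[of \<one> a] a assms(1) by auto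
  then show "\<ominus>\<^bsub>M\<^esub> a \<in> D" using assms(4)[of "\<ominus> \<one>" a] a by auto
qed (use assms in auto)

lemma spn_carrier: "A \<subseteq> carrier M \<Longrightarrow> x \<in> spn R M A \<Longrightarrow> x \<in> carrier M"
  by (erule spn.induct) auto

lemma spn_least: "submodule K R M \<Longrightarrow> A \<subseteq> K \<Longrightarrow> spn R M A \<subseteq> K"
proof
  fix x assume K: "submodule K R M" "A \<subseteq> K" and "x \<in> spn R M A"
  from this(3) show "x \<in> K"
    by induction (use K submodule_zero[OF K(1)] submodule_add[OF K(1)] submodule_smult[OF K(1)] in auto)
qed

lemma submodule_spn: assumes A: "A \<subseteq> carrier M" shows "submodule (spn R M A) R M"
proof (rule submoduleI')
  note c = spn_carrier[OF A]
  show "spn R M A \<subseteq> carrier M" using c by auto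
  show "\<zero>\<^bsub>M\<^esub> \<in> spn R M A" by (rule spn_zero)
  show "x \<oplus>\<^bsub>M\<^esub> y \<in> spn R M A" if x: "x \<in> spn R M A" and y: "y \<in> spn R M A" for x y
    using y
  proof induction
    case (spn_step z a r)
    have "x \<oplus>\<^bsub>M\<^esub> (z \<oplus>\<^bsub>M\<^esub> r \<odot>\<^bsub>M\<^esub> a) = (x \<oplus>\<^bsub>M\<^esub> z) \<oplus>\<^bsub>M\<^esub> r \<odot>\<^bsub>M\<^esub> a"
      using c x spn_step A by (auto simp: M.a_assoc)
    then show ?case using spn.spn_step[OF spn_step.IH spn_step(2,3)] by simp
  qed (use x c in \<open>auto simp: spn_zero\<close>)
  show "s \<odot>\<^bsub>M\<^esub> x \<in> spn R M A" if s: "s \<in> carrier R" and x: "x \<in> spn R M A" for s x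
    using x
  proof induction
    case (spn_step z a r)
    have "s \<odot>\<^bsub>M\<^esub> (z \<oplus>\<^bsub>M\<^esub> r \<odot>\<^bsub>M\<^esub> a) = s \<odot>\<^bsub>M\<^esub> z \<oplus>\<^bsub>M\<^esub> (s \<otimes> r) \<odot>\<^bsub>M\<^esub> a"
      using c[OF spn_step(1)] s spn_step(2,3) A by (auto simp: smult_r_distr smult_assoc1)
    then show ?case using spn.spn_step[OF spn_step.IH spn_step(2), of "s \<otimes> r"] s spn_step(3) by simp
  qed (use s in \<open>simp add: spn_zero\<close>)
qed

lemma spn_mem: assumes "A \<subseteq> carrier M" "a \<in> A" shows "a \<in> spn R M A"
proof -
  have "a \<in> carrier M" using assms by auto
  then show ?thesis using spn_step[OF spn_zero, of a A \<one> R M] assms by simp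
qed

lemma spn_mono: assumes "A \<subseteq> spn R M B" "B \<subseteq> carrier M" shows "spn R M A \<subseteq> spn R M B"
  by (rule spn_least[OF submodule_spn]) (use assms in auto)

lemma spn_Un_split:
  assumes D: "submodule D R M" and F: "F \<subseteq> carrier M" and x: "x \<in> spn R M (D \<union> F)"
  obtains d y where "d \<in> D" "y \<in> spn R M F" "x = d \<oplus>\<^bsub>M\<^esub> y"
proof -
  note cD = submodule_sub[OF D] and cF = spn_carrier[OF F]
  have "\<exists>d y. d \<in> D \<and> y \<in> spn R M F \<and> x = d \<oplus>\<^bsub>M\<^esub> y" using x
  proof induction
    case spn_zero
    show ?case using submodule_zero[OF D] spn.spn_zero[of M R F] by force
  next
    case (spn_step z a r)
    then obtain d y where dy: "d \<in> D" "y \<in> spn R M F" "z = d \<oplus>\<^bsub>M\<^esub> y" by blast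
    have c: "d \<in> carrier M" "y \<in> carrier M" "a \<in> carrier M" using dy cD cF F spn_step(2) by auto
    then have ca: "r \<odot>\<^bsub>M\<^esub> a \<in> carrier M" using spn_step(3) by simp
    show ?case
    proof (cases "a \<in> D")
      case True
      have "z \<oplus>\<^bsub>M\<^esub> r \<odot>\<^bsub>M\<^esub> a = (d \<oplus>\<^bsub>M\<^esub> r \<odot>\<^bsub>M\<^esub> a) \<oplus>\<^bsub>M\<^esub> y" using c ca dy(3) by (simp add: M.a_ac)
      moreover have "d \<oplus>\<^bsub>M\<^esub> r \<odot>\<^bsub>M\<^esub> a \<in> D"
        using submodule_add[OF D dy(1) submodule_smult[OF D spn_step(3) True]] .
      ultimately show ?thesis using dy(2) by blast
    next
      case False
      then have "a \<in> F" using spn_step by auto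
      moreover have "z \<oplus>\<^bsub>M\<^esub> r \<odot>\<^bsub>M\<^esub> a = d \<oplus>\<^bsub>M\<^esub> (y \<oplus>\<^bsub>M\<^esub> r \<odot>\<^bsub>M\<^esub> a)" using c ca dy(3) by (simp add: M.a_assoc)
      ultimately show ?thesis using spn.spn_step[OF dy(2) _ spn_step(3)] dy(1) by blast
    qed
  qed
  then show ?thesis using that by blast
qed

text \<open>All multiples \<open>q y\<close> collect into a single one because \<open>Q\<close> is
  an ideal. This isolates one generator in the proof of Nakayama's lemma.\<close>

lemma spn_insert_split:
  assumes Q: "ideal Q R" and D: "submodule D R M" and y: "y \<in> carrier M" and G: "G \<subseteq> carrier M"
    and x: "x \<in> spn R M (D \<union> (G \<union> (\<lambda>q. q \<odot>\<^bsub>M\<^esub> y) ` Q))"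
  obtains w q where "w \<in> spn R M (D \<union> G)" "q \<in> Q" "x = w \<oplus>\<^bsub>M\<^esub> q \<odot>\<^bsub>M\<^esub> y"
proof -
  have cG: "D \<union> G \<subseteq> carrier M" using submodule_sub[OF D] G by auto
  note cw = spn_carrier[OF cG] and cQ = icarr[OF Q]
  have "\<exists>w q. w \<in> spn R M (D \<union> G) \<and> q \<in> Q \<and> x = w \<oplus>\<^bsub>M\<^esub> q \<odot>\<^bsub>M\<^esub> y" using x
  proof induction
    case spn_zero
    have "\<zero>\<^bsub>M\<^esub> = \<zero>\<^bsub>M\<^esub> \<oplus>\<^bsub>M\<^esub> \<zero> \<odot>\<^bsub>M\<^esub> y" using y by simp
    then show ?case using izero[OF Q] spn.spn_zero by blast
  next
    case (spn_step z a r)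
    then obtain w q where wq: "w \<in> spn R M (D \<union> G)" "q \<in> Q" "z = w \<oplus>\<^bsub>M\<^esub> q \<odot>\<^bsub>M\<^esub> y" by blast
    have c: "w \<in> carrier M" "q \<in> carrier R" using cw cQ wq by auto
    show ?case
    proof (cases "a \<in> D \<union> G")
      case True
      have "a \<in> carrier M" using True cG by auto
      then have "z \<oplus>\<^bsub>M\<^esub> r \<odot>\<^bsub>M\<^esub> a = (w \<oplus>\<^bsub>M\<^esub> r \<odot>\<^bsub>M\<^esub> a) \<oplus>\<^bsub>M\<^esub> q \<odot>\<^bsub>M\<^esub> y"
        using wq(3) c y spn_step(3) by (simp add: M.a_ac)
      then show ?thesis using spn.spn_step[OF wq(1) True spn_step(3)] wq(2) by blast
    next
      case False
      then obtain p where p: "p \<in> Q" "a = p \<odot>\<^bsub>M\<^esub> y" using spn_step(2) by auto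
      have "z \<oplus>\<^bsub>M\<^esub> r \<odot>\<^bsub>M\<^esub> a = w \<oplus>\<^bsub>M\<^esub> (q \<oplus> r \<otimes> p) \<odot>\<^bsub>M\<^esub> y"
        using wq(3) c y spn_step(3) p(2) cQ[OF p(1)]
        by (simp add: M.a_ac smult_l_distr smult_assoc1)
      moreover have "q \<oplus> r \<otimes> p \<in> Q" using iadd[OF Q wq(2) imult[OF Q p(1) spn_step(3)]] .
      ultimately show ?thesis using wq(1) by blast
    qed
  qed
  then show ?thesis using that by blast
qed

lemma smult_minus_distr:
  "s \<in> carrier R \<Longrightarrow> q \<in> carrier R \<Longrightarrow> y \<in> carrier M \<Longrightarrow> (s \<ominus> q) \<odot>\<^bsub>M\<^esub> y = s \<odot>\<^bsub>M\<^esub> y \<ominus>\<^bsub>M\<^esub> q \<odot>\<^bsub>M\<^esub> y"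
  by (simp add: a_minus_def smult_l_distr smult_l_minus)

lemma smult_rminus_distr:
  "s \<in> carrier R \<Longrightarrow> x \<in> carrier M \<Longrightarrow> y \<in> carrier M \<Longrightarrow> s \<odot>\<^bsub>M\<^esub> (x \<ominus>\<^bsub>M\<^esub> y) = s \<odot>\<^bsub>M\<^esub> x \<ominus>\<^bsub>M\<^esub> s \<odot>\<^bsub>M\<^esub> y"
  by (simp add: a_minus_def smult_r_distr smult_r_minus)

lemma smult_commute:
  "s \<in> carrier R \<Longrightarrow> q \<in> carrier R \<Longrightarrow> y \<in> carrier M \<Longrightarrow> s \<odot>\<^bsub>M\<^esub> (q \<odot>\<^bsub>M\<^esub> y) = q \<odot>\<^bsub>M\<^esub> (s \<odot>\<^bsub>M\<^esub> y)"
  by (metis m_comm smult_assoc1)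

text \<open>Nakayama's lemma after localization at the prime \<open>Q\<close>, proved by eliminating one
  generator at a time.\<close>

lemma nakayama:
  assumes Q: "primeideal Q R" and D: "submodule D R M" and F: "finite F" "F \<subseteq> carrier M"
    and H: "\<And>y. y \<in> F \<Longrightarrow> \<exists>s\<in>carrier R - Q. s \<odot>\<^bsub>M\<^esub> y \<in> spn R M (D \<union> (\<Union>y\<in>F. (\<lambda>q. q \<odot>\<^bsub>M\<^esub> y) ` Q))"
  shows "\<exists>s\<in>carrier R - Q. \<forall>y\<in>F. s \<odot>\<^bsub>M\<^esub> y \<in> D"
  using F H
proof (induction F rule: finite_induct)
  case empty
  have "\<one> \<in> carrier R - Q" using prime_one[OF Q] by simp
  then show ?case by blast
next
  case (insert y F)
  define G where "G = (\<Union>y\<in>F. (\<lambda>q. q \<odot>\<^bsub>M\<^esub> y) ` Q)"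
  have iQ: "ideal Q R" by (rule prime_ideal[OF Q])
  note cQ = icarr[OF iQ]
  have y: "y \<in> carrier M" and cF: "F \<subseteq> carrier M" using insert.prems by auto
  have G: "G \<subseteq> carrier M" unfolding G_def using cF cQ by auto
  have DG: "D \<union> G \<subseteq> carrier M" using G submodule_sub[OF D] by auto
  note smS = submodule_spn[OF DG]
  have eq: "D \<union> (\<Union>y\<in>insert y F. (\<lambda>q. q \<odot>\<^bsub>M\<^esub> y) ` Q) = D \<union> (G \<union> (\<lambda>q. q \<odot>\<^bsub>M\<^esub> y) ` Q)"
    unfolding G_def by auto
  obtain s where s: "s \<in> carrier R - Q" "s \<odot>\<^bsub>M\<^esub> y \<in> spn R M (D \<union> (G \<union> (\<lambda>q. q \<odot>\<^bsub>M\<^esub> y) ` Q))"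
    using insert.prems(2)[of y] eq by auto
  obtain w q where w: "w \<in> spn R M (D \<union> G)" "q \<in> Q" "s \<odot>\<^bsub>M\<^esub> y = w \<oplus>\<^bsub>M\<^esub> q \<odot>\<^bsub>M\<^esub> y"
    by (rule spn_insert_split[OF iQ D y G s(2)])
  have wc: "w \<in> carrier M" using spn_carrier[OF DG w(1)] .
  \<comment> \<open>From \<open>s y = w + q y\<close> with \<open>q\<close> in \<open>Q\<close>: the
    multiplier \<open>s - q\<close> is still outside \<open>Q\<close> and sends \<open>y\<close> to
    the part not involving \<open>y\<close>.\<close>
  define s0 where "s0 = s \<ominus> q"
  have s0: "s0 \<in> carrier R - Q" unfolding s0_def using prime_minus_notin[OF Q s(1) w(2)] .
  have s0y: "s0 \<odot>\<^bsub>M\<^esub> y = w"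
    unfolding s0_def using s(1) w(3) wc cQ[OF w(2)] y by (simp add: smult_minus_distr M.minus_eq M.a_assoc M.r_neg)
  \<comment> \<open>Multiplying the relation of \<open>z\<close> by \<open>s0\<close> replaces its
    term in \<open>y\<close> by one in \<open>w\<close>, which gives the hypothesis for the smaller
    set of generators.\<close>
  have "\<exists>s\<in>carrier R - Q. s \<odot>\<^bsub>M\<^esub> z \<in> spn R M (D \<union> (\<Union>y\<in>F. (\<lambda>q. q \<odot>\<^bsub>M\<^esub> y) ` Q))" if z: "z \<in> F" for z
  proof -
    have zc: "z \<in> carrier M" using z cF by auto
    obtain s' where s': "s' \<in> carrier R - Q" "s' \<odot>\<^bsub>M\<^esub> z \<in> spn R M (D \<union> (G \<union> (\<lambda>q. q \<odot>\<^bsub>M\<^esub> y) ` Q))"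
      using insert.prems(2)[of z] eq z by auto
    obtain w' q' where w': "w' \<in> spn R M (D \<union> G)" "q' \<in> Q" "s' \<odot>\<^bsub>M\<^esub> z = w' \<oplus>\<^bsub>M\<^esub> q' \<odot>\<^bsub>M\<^esub> y"
      by (rule spn_insert_split[OF iQ D y G s'(2)])
    have "(s0 \<otimes> s') \<odot>\<^bsub>M\<^esub> z = s0 \<odot>\<^bsub>M\<^esub> w' \<oplus>\<^bsub>M\<^esub> q' \<odot>\<^bsub>M\<^esub> (s0 \<odot>\<^bsub>M\<^esub> y)"
      using s0 s' w' zc y spn_carrier[OF DG w'(1)] cQ[OF w'(2)]
      by (simp add: smult_assoc1 smult_r_distr smult_commute)
    also have "\<dots> \<in> spn R M (D \<union> G)" unfolding s0y
      using s0 w'(1) w(1) cQ[OF w'(2)] by (intro submodule_add[OF smS] submodule_smult[OF smS]) auto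
    finally show ?thesis unfolding G_def[symmetric] using prime_mult_notin[OF Q s0 s'(1)] by blast
  qed
  then obtain h where h: "h \<in> carrier R - Q" "\<And>z. z \<in> F \<Longrightarrow> h \<odot>\<^bsub>M\<^esub> z \<in> D"
    using insert.IH[OF cF] by blast
  \<comment> \<open>Since \<open>h\<close> sends the remaining generators into \<open>D\<close>, it
    sends \<open>w = s0 y\<close> there as well.\<close>
  have hS: "h \<odot>\<^bsub>M\<^esub> x \<in> D" if "x \<in> spn R M (D \<union> G)" for x
    using that
  proof induction
    case spn_zero then show ?case using h submodule_zero[OF D] by simp
  next
    case (spn_step x a r)
    have ac: "a \<in> carrier M" "x \<in> carrier M" using DG spn_step spn_carrier[OF DG] by auto
    have "h \<odot>\<^bsub>M\<^esub> a \<in> D"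
    proof (cases "a \<in> D")
      case True then show ?thesis using submodule_smult[OF D] h by auto
    next
      case False
      then obtain z q where zq: "z \<in> F" "q \<in> Q" "a = q \<odot>\<^bsub>M\<^esub> z" using spn_step(2) unfolding G_def by auto
      then have "h \<odot>\<^bsub>M\<^esub> a = q \<odot>\<^bsub>M\<^esub> (h \<odot>\<^bsub>M\<^esub> z)" using h(1) cQ cF smult_commute by auto
      then show ?thesis using submodule_smult[OF D cQ[OF zq(2)] h(2)[OF zq(1)]] by simp
    qed
    moreover have "h \<odot>\<^bsub>M\<^esub> (x \<oplus>\<^bsub>M\<^esub> r \<odot>\<^bsub>M\<^esub> a) = h \<odot>\<^bsub>M\<^esub> x \<oplus>\<^bsub>M\<^esub> r \<odot>\<^bsub>M\<^esub> (h \<odot>\<^bsub>M\<^esub> a)"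
      using h(1) ac spn_step(3) by (simp add: smult_r_distr smult_commute)
    ultimately show ?case using submodule_add[OF D spn_step.IH submodule_smult[OF D spn_step(3)]] by simp
  qed
  have "(h \<otimes> s0) \<odot>\<^bsub>M\<^esub> z \<in> D" if z: "z \<in> insert y F" for z
  proof (cases "z = y")
    case True
    then have "(h \<otimes> s0) \<odot>\<^bsub>M\<^esub> z = h \<odot>\<^bsub>M\<^esub> w" using h s0 y s0y by (simp add: smult_assoc1)
    then show ?thesis using hS[OF w(1)] by simp
  next
    case False
    then have zF: "z \<in> F" using z by auto
    then have "(h \<otimes> s0) \<odot>\<^bsub>M\<^esub> z = s0 \<odot>\<^bsub>M\<^esub> (h \<odot>\<^bsub>M\<^esub> z)" using h s0 cF by (auto simp: smult_assoc1 smult_commute)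
    then show ?thesis using submodule_smult[OF D _ h(2)[OF zF], of s0] s0 by simp
  qed
  then show ?case using prime_mult_notin[OF Q h(1) s0] by blast
qed

text \<open>\<open>U / D\<close> is a Noetherian module.\<close>

definition noeth_mod :: "'c set \<Rightarrow> 'c set \<Rightarrow> bool" where
  "noeth_mod U D \<longleftrightarrow> (\<forall>W. submodule W R M \<and> W \<subseteq> U \<longrightarrow> (\<exists>F. finite F \<and> F \<subseteq> W \<and> W \<subseteq> spn R M (D \<union> F)))"

text \<open>Locally at \<open>Q\<close> the hypothesis reads \<open>U = D + x U\<close> with
  \<open>x\<close> in \<open>Q\<close>. A finite generating set then satisfies the condition of
  \<open>nakayama\<close>, and the multiplier found for the generators serves every
  \<open>u\<close>.\<close>

lemma nakayama_divisible:
  assumes Q: "primeideal Q R" and D: "submodule D R M" and U: "submodule U R M"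
    and NF: "noeth_mod U D" and x: "x \<in> Q"
    and div: "\<And>u. u \<in> U \<Longrightarrow> \<exists>s\<in>carrier R - Q. \<exists>v\<in>U. s \<odot>\<^bsub>M\<^esub> u \<ominus>\<^bsub>M\<^esub> x \<odot>\<^bsub>M\<^esub> v \<in> D"
    and u: "u \<in> U"
  shows "\<exists>s\<in>carrier R - Q. s \<odot>\<^bsub>M\<^esub> u \<in> D"
proof -
  obtain F where F: "finite F" "F \<subseteq> U" "U \<subseteq> spn R M (D \<union> F)"
    using NF U unfolding noeth_mod_def by blast
  have iQ: "ideal Q R" by (rule prime_ideal[OF Q])
  have xc: "x \<in> carrier R" using icarr[OF iQ x] .
  have cU: "U \<subseteq> carrier M" "D \<subseteq> carrier M" "F \<subseteq> carrier M" using submodule_sub[OF U] submodule_sub[OF D] F by auto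
  define G where "G = (\<Union>y\<in>F. (\<lambda>q. q \<odot>\<^bsub>M\<^esub> y) ` Q)"
  have G: "G \<subseteq> carrier M" unfolding G_def using cU(3) icarr[OF iQ] by auto
  have DG: "D \<union> G \<subseteq> carrier M" using G cU by auto
  note smS = submodule_spn[OF DG]
  have xs: "x \<odot>\<^bsub>M\<^esub> v \<in> spn R M (D \<union> G)" if "v \<in> spn R M (D \<union> F)" for v
    using that
  proof induction
    case spn_zero then show ?case using xc by (simp add: spn.spn_zero)
  next
    case (spn_step v a r)
    have c: "v \<in> carrier M" "a \<in> carrier M" using spn_carrier[OF _ spn_step(1)] spn_step(2) cU by auto
    have "x \<odot>\<^bsub>M\<^esub> a \<in> spn R M (D \<union> G)"
    proof (cases "a \<in> D")
      case True then show ?thesis using submodule_smult[OF D xc True] spn_mem[OF DG] by auto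
    next
      case False
      then have "x \<odot>\<^bsub>M\<^esub> a \<in> G" unfolding G_def using spn_step(2) x by auto
      then show ?thesis using spn_mem[OF DG] by auto
    qed
    moreover have "x \<odot>\<^bsub>M\<^esub> (v \<oplus>\<^bsub>M\<^esub> r \<odot>\<^bsub>M\<^esub> a) = x \<odot>\<^bsub>M\<^esub> v \<oplus>\<^bsub>M\<^esub> r \<odot>\<^bsub>M\<^esub> (x \<odot>\<^bsub>M\<^esub> a)"
      using c xc spn_step(3) by (simp add: smult_r_distr smult_commute)
    ultimately show ?case using submodule_add[OF smS spn_step.IH submodule_smult[OF smS spn_step(3)]] by simp
  qed
  have "\<exists>s\<in>carrier R - Q. s \<odot>\<^bsub>M\<^esub> y \<in> spn R M (D \<union> (\<Union>y\<in>F. (\<lambda>q. q \<odot>\<^bsub>M\<^esub> y) ` Q))" if y: "y \<in> F" for y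
  proof -
    obtain s v where sv: "s \<in> carrier R - Q" "v \<in> U" "s \<odot>\<^bsub>M\<^esub> y \<ominus>\<^bsub>M\<^esub> x \<odot>\<^bsub>M\<^esub> v \<in> D"
      using div[of y] y F(2) by blast
    have c: "s \<odot>\<^bsub>M\<^esub> y \<in> carrier M" "x \<odot>\<^bsub>M\<^esub> v \<in> carrier M" using sv y cU xc by auto
    have "s \<odot>\<^bsub>M\<^esub> y = (s \<odot>\<^bsub>M\<^esub> y \<ominus>\<^bsub>M\<^esub> x \<odot>\<^bsub>M\<^esub> v) \<oplus>\<^bsub>M\<^esub> x \<odot>\<^bsub>M\<^esub> v"
      using c by (simp add: M.minus_eq M.a_assoc M.l_neg)
    also have "\<dots> \<in> spn R M (D \<union> G)"
      using xs[of v] sv F(3) spn_mem[OF DG, of "s \<odot>\<^bsub>M\<^esub> y \<ominus>\<^bsub>M\<^esub> x \<odot>\<^bsub>M\<^esub> v"] by (intro submodule_add[OF smS]) auto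
    finally show ?thesis using sv(1) unfolding G_def by blast
  qed
  then obtain s where s: "s \<in> carrier R - Q" "\<And>y. y \<in> F \<Longrightarrow> s \<odot>\<^bsub>M\<^esub> y \<in> D"
    using nakayama[OF Q D F(1) cU(3)] by blast
  have "s \<odot>\<^bsub>M\<^esub> v \<in> D" if "v \<in> spn R M (D \<union> F)" for v
    using that
  proof induction
    case spn_zero then show ?case using s submodule_zero[OF D] by simp
  next
    case (spn_step v a r)
    have c: "v \<in> carrier M" "a \<in> carrier M" using spn_carrier[OF _ spn_step(1)] spn_step(2) cU by auto
    have "s \<odot>\<^bsub>M\<^esub> a \<in> D" using s submodule_smult[OF D] spn_step(2) by auto
    moreover have "s \<odot>\<^bsub>M\<^esub> (v \<oplus>\<^bsub>M\<^esub> r \<odot>\<^bsub>M\<^esub> a) = s \<odot>\<^bsub>M\<^esub> v \<oplus>\<^bsub>M\<^esub> r \<odot>\<^bsub>M\<^esub> (s \<odot>\<^bsub>M\<^esub> a)"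
      using c s(1) spn_step(3) by (simp add: smult_r_distr smult_commute)
    ultimately show ?case using submodule_add[OF D spn_step.IH submodule_smult[OF D spn_step(3)]] by simp
  qed
  then show ?thesis using s(1) u F(3) by blast
qed

end

section \<open>The ring as a module over itself\<close>

context cring begin

lemma module_regular: "module R (regular_module R)"
  by (rule moduleI)
    (auto simp: regular_module_def is_cring m_assoc l_distr r_distr
      intro!: abelian_groupI a_assoc a_comm l_neg bexI[of _ "\<ominus> _"])

lemma submodule_regular: "ideal N R \<Longrightarrow> submodule N R (regular_module R)"
proof -
  assume N: "ideal N R"
  interpret M: module R "regular_module R" by (rule module_regular)
  show ?thesis
    by (rule M.submoduleI')
      (use isub[OF N] izero[OF N] iadd[OF N] imult[OF N] in \<open>auto simp: regular_module_def\<close>)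
qed

lemma submodule_regularD: "submodule N R (regular_module R) \<Longrightarrow> ideal N R"
proof -
  assume N: "submodule N R (regular_module R)"
  interpret M: module R "regular_module R" by (rule module_regular)
  show ?thesis
    by (rule idealI')
      (use M.submodule_sub[OF N] M.submodule_zero[OF N] M.submodule_add[OF N] M.submodule_smult[OF N]
        in \<open>auto simp: regular_module_def\<close>)
qed

text \<open>The span of \<open>D\<close> and \<open>Q F\<close> is replaced by an arbitrary ideal
  \<open>N\<close> containing both, so that applications deal with ideal membership only. Finiteness
  is asked of \<open>F\<close> alone, which permits the use over power series.\<close>

lemma nakayama_ideal:
  assumes Q: "primeideal Q R" and D: "ideal D R" and F: "finite F" "F \<subseteq> carrier R"
    and H: "\<And>y N. y \<in> F \<Longrightarrow> ideal N R \<Longrightarrow> D \<subseteq> N \<Longrightarrow> (\<And>q z. q \<in> Q \<Longrightarrow> z \<in> F \<Longrightarrow> q \<otimes> z \<in> N) \<Longrightarrow>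
      \<exists>s\<in>carrier R - Q. s \<otimes> y \<in> N"
  shows "\<exists>s\<in>carrier R - Q. \<forall>y\<in>F. s \<otimes> y \<in> D"
proof -
  interpret M: module R "regular_module R" by (rule module_regular)
  let ?G = "D \<union> (\<Union>y\<in>F. (\<lambda>q. q \<otimes> y) ` Q)"
  have c: "?G \<subseteq> carrier (regular_module R)"
    using isub[OF D] F(2) isub[OF prime_ideal[OF Q]] by (auto simp: regular_module_def)
  have I: "ideal (spn R (regular_module R) ?G) R" by (rule submodule_regularD[OF M.submodule_spn[OF c]])
  have "\<exists>s\<in>carrier R - Q. \<forall>y\<in>F. s \<odot>\<^bsub>regular_module R\<^esub> y \<in> D"
  proof (rule M.nakayama[OF Q submodule_regular[OF D] F(1)])
    show "F \<subseteq> carrier (regular_module R)" using F(2) by (simp add: regular_module_def)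
    show "\<exists>s\<in>carrier R - Q. s \<odot>\<^bsub>regular_module R\<^esub> y
        \<in> spn R (regular_module R) (D \<union> (\<Union>y\<in>F. (\<lambda>q. q \<odot>\<^bsub>regular_module R\<^esub> y) ` Q))" if "y \<in> F" for y
      using H[OF that I] M.spn_mem[OF c] by (auto simp: regular_module_def)
  qed
  then show ?thesis by (simp add: regular_module_def)
qed

end

section \<open>Associated primes in Noetherian rings\<close>

locale noeth_cring = cring R + noetherian_ring R for R (structure)
begin

lemma noeth_maximal_ex:
  assumes "\<F> \<noteq> {}" "\<And>I. I \<in> \<F> \<Longrightarrow> ideal I R"
  shows "\<exists>I\<in>\<F>. \<forall>J\<in>\<F>. I \<subseteq> J \<longrightarrow> J = I"
proof (rule subset_Zorn_nonempty[OF assms(1)])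
  fix C assume C: "C \<noteq> {}" "subset.chain \<F> C"
  then have "C \<subseteq> \<F>" unfolding pred_on.chain_def by auto
  moreover have "subset.chain {I. ideal I R} C"
    using C assms(2) unfolding pred_on.chain_def by auto
  ultimately show "\<Union> C \<in> \<F>" using ideal_chain_is_trivial[OF C(1)] by auto
qed

lemma noeth_maximal:
  assumes "\<F> \<noteq> {}" "\<And>I. I \<in> \<F> \<Longrightarrow> ideal I R"
  obtains I where "I \<in> \<F>" "\<And>J. J \<in> \<F> \<Longrightarrow> I \<subseteq> J \<Longrightarrow> J = I"
  using noeth_maximal_ex[OF assms] that by blast

lemma noeth_induct [consumes 1, case_names step]:
  assumes "ideal N R" "\<And>N. ideal N R \<Longrightarrow> (\<And>K. ideal K R \<Longrightarrow> N \<subset> K \<Longrightarrow> P K) \<Longrightarrow> P N"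
  shows "P N"
proof (rule ccontr)
  assume "\<not> P N"
  then obtain I where I: "I \<in> {I. ideal I R \<and> \<not> P I}"
    "\<And>J. J \<in> {I. ideal I R \<and> \<not> P I} \<Longrightarrow> I \<subseteq> J \<Longrightarrow> J = I"
    using noeth_maximal[of "{I. ideal I R \<and> \<not> P I}"] assms(1) by blast
  then have "P I" using assms(2)[of I] by blast
  then show False using I by simp
qed

lemma fin_gen:
  assumes "ideal N R" obtains xs where "set xs \<subseteq> N" "N = gen R {\<zero>} xs"
proof -
  obtain A where A: "A \<subseteq> carrier R" "finite A" "N = Idl A" using finetely_gen[OF assms] by blast
  obtain xs where xs: "set xs = A" using finite_list[OF A(2)] by blast
  show ?thesis using that[of xs] A xs genideal_self[OF A(1)] gen_zero_eq_Idl[of xs] by simp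
qed

lemma assoc_primesI:
  "primeideal Q R \<Longrightarrow> c \<in> carrier R \<Longrightarrow> Q = colon R N c \<Longrightarrow> Q \<in> associated_primes R N"
  unfolding associated_primes_def colon_def by blast

lemma assoc_primesE:
  assumes "Q \<in> associated_primes R N"
  obtains c where "primeideal Q R" "c \<in> carrier R" "Q = colon R N c"
  using assms unfolding associated_primes_def colon_def by blast

lemma assoc_prime: "Q \<in> associated_primes R N \<Longrightarrow> primeideal Q R"
  unfolding associated_primes_def by blast

lemma assoc_prime_sub: assumes "ideal N R" "Q \<in> associated_primes R N" shows "N \<subseteq> Q"
proof -
  obtain c where "c \<in> carrier R" "Q = colon R N c" using assms(2) by (rule assoc_primesE)
  then show ?thesis using colon_sub[OF assms(1)] by simp
qed

lemma colon_proper: "ideal N R \<Longrightarrow> c \<in> carrier R \<Longrightarrow> c \<notin> N \<Longrightarrow> \<one> \<notin> colon R N c"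
  unfolding colon_def by simp

lemma colon_prime_notin:
  assumes "primeideal Q R" "c \<in> carrier R" "Q = colon R N c" shows "c \<notin> N"
  using prime_one[OF assms(1)] assms(2,3) unfolding colon_def by auto

text \<open>Among the proper colon ideals \<open>N : c'\<close> above \<open>N : c\<close> a maximal
  one is prime.\<close>

lemma assoc_prime_above_colon:
  assumes N: "ideal N R" and c: "c \<in> carrier R" "c \<notin> N"
  obtains Q where "Q \<in> associated_primes R N" "colon R N c \<subseteq> Q"
proof -
  let ?F = "{colon R N c' |c'. c' \<in> carrier R \<and> c' \<notin> N \<and> colon R N c \<subseteq> colon R N c'}"
  have "colon R N c \<in> ?F" using c by blast
  then obtain I where I: "I \<in> ?F" and mx: "\<And>J. J \<in> ?F \<Longrightarrow> I \<subseteq> J \<Longrightarrow> J = I"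
    using noeth_maximal[of ?F] ideal_colon[OF N] by blast
  obtain d where d: "I = colon R N d" "d \<in> carrier R" "d \<notin> N" "colon R N c \<subseteq> colon R N d"
    using I by blast
  have "primeideal I R"
  proof (rule primeidealI[OF _ is_cring])
    show "ideal I R" using d ideal_colon[OF N] by simp
    show "carrier R \<noteq> I" using colon_proper[OF N d(2,3)] d(1) by auto
    fix a b assume ab: "a \<in> carrier R" "b \<in> carrier R" "a \<otimes> b \<in> I"
    show "a \<in> I \<or> b \<in> I"
    proof (cases "b \<in> I")
      case False
      then have bd: "b \<otimes> d \<notin> N" using d ab unfolding colon_def by auto
      have sub: "I \<subseteq> colon R N (b \<otimes> d)" using colon_mult_mono[OF N ab(2) d(2)] d(1) by simp
      then have "colon R N (b \<otimes> d) \<in> ?F" using bd d ab by blast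
      then have "colon R N (b \<otimes> d) = I" using mx sub by blast
      moreover have "a \<in> colon R N (b \<otimes> d)"
        using ab d unfolding d(1) colon_def by (simp add: m_assoc)
      ultimately show ?thesis by simp
    qed simp
  qed
  then show ?thesis using that[of I] d assoc_primesI by auto
qed

text \<open>A colon ideal maximal among those inside \<open>P\<close> plays the role of an
  associated prime of the localization at \<open>P\<close>.\<close>

lemma assoc_prime_below:
  assumes N: "ideal N R" and P: "primeideal P R" "N \<subseteq> P"
  obtains Q where "Q \<in> associated_primes R N" "Q \<subseteq> P"
proof -
  let ?F = "{colon R N c' |c'. c' \<in> carrier R \<and> colon R N c' \<subseteq> P}"
  have "colon R N \<one> = N" unfolding colon_def using isub[OF N] by auto
  then have "colon R N \<one> \<in> ?F" using P(2) by auto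
  then obtain I where I: "I \<in> ?F" and mx: "\<And>J. J \<in> ?F \<Longrightarrow> I \<subseteq> J \<Longrightarrow> J = I"
    using noeth_maximal[of ?F] ideal_colon[OF N] by blast
  obtain d where d: "I = colon R N d" "d \<in> carrier R" "colon R N d \<subseteq> P" using I by blast
  have "primeideal I R"
  proof (rule primeidealI[OF _ is_cring])
    show "ideal I R" using d ideal_colon[OF N] by simp
    show "carrier R \<noteq> I" using prime_one[OF P(1)] d by auto
    fix a b assume ab: "a \<in> carrier R" "b \<in> carrier R" "a \<otimes> b \<in> I"
    show "a \<in> I \<or> b \<in> I"
    proof (rule ccontr)
      assume nt: "\<not> (a \<in> I \<or> b \<in> I)"
      \<comment> \<open>If \<open>N : x d\<close> stayed inside \<open>P\<close>, maximality would
        make it equal to \<open>I\<close>, although it contains \<open>y\<close>.\<close>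
      have big: "\<exists>s\<in>carrier R - P. s \<otimes> (x \<otimes> d) \<in> N" if x: "x \<in> carrier R" "y \<in> carrier R" "x \<otimes> y \<in> I" "y \<notin> I" for x y
      proof (rule ccontr)
        assume "\<not> ?thesis"
        then have "colon R N (x \<otimes> d) \<subseteq> P" unfolding colon_def by auto
        moreover have sub: "I \<subseteq> colon R N (x \<otimes> d)" using colon_mult_mono[OF N x(1) d(2)] d(1) by simp
        ultimately have "colon R N (x \<otimes> d) = I" using mx x d(2) by blast
        moreover have "y \<in> colon R N (x \<otimes> d)"
        proof -
          have "y \<otimes> (x \<otimes> d) = (x \<otimes> y) \<otimes> d" using x d(2) by algebra
          then show ?thesis using x d unfolding colon_def by simp
        qed
        ultimately show False using x by simp
      qed
      obtain s where s: "s \<in> carrier R - P" "s \<otimes> (a \<otimes> d) \<in> N" using big[of a b] ab nt by blast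
      \<comment> \<open>Replacing \<open>d\<close> by \<open>s d\<close> keeps the colon ideal
        inside \<open>P\<close>, hence equal to \<open>I\<close> by maximality; but \<open>a\<close>
        sends \<open>s d\<close> into \<open>N\<close>.\<close>
      have "colon R N (s \<otimes> d) \<subseteq> P"
      proof
        fix r assume r: "r \<in> colon R N (s \<otimes> d)"
        then have rc: "r \<in> carrier R" "r \<otimes> (s \<otimes> d) \<in> N" unfolding colon_def by auto
        then have "s \<otimes> r \<in> I" using s d unfolding colon_def by (simp add: m_ac)
        then show "r \<in> P" using prime_mult[OF P(1), of s r] s rc d by auto
      qed
      moreover have sub: "I \<subseteq> colon R N (s \<otimes> d)" using colon_mult_mono[OF N, of s d] s d by simp
      ultimately have "colon R N (s \<otimes> d) = I" using mx s d(2) by blast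
      moreover have "a \<in> colon R N (s \<otimes> d)" using s d ab unfolding colon_def by (simp add: m_ac)
      ultimately show False using nt by simp
    qed
  qed
  then show ?thesis using that[of I] d assoc_primesI by auto
qed

text \<open>Noetherian induction: with \<open>P = N : c\<close>, the submodule of \<open>R/N\<close>
  generated by \<open>c\<close> is a copy of \<open>R/P\<close>, whose only associated prime is
  \<open>P\<close>; all other associated primes survive in \<open>R/(N, c)\<close>.\<close>

lemma finite_assoc_primes: "ideal N R \<Longrightarrow> finite (associated_primes R N)"
proof (induction rule: noeth_induct)
  case (step N)
  show ?case
  proof (cases "\<one> \<in> N")
    case True
    then have "associated_primes R N = {}"
      using assoc_prime_sub[OF step(1)] assoc_prime prime_one by blast
    then show ?thesis by simp
  next
    case False
    obtain P where P: "P \<in> associated_primes R N" using assoc_prime_above_colon[OF step(1) _ False] by auto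
    then obtain c where c: "primeideal P R" "c \<in> carrier R" "P = colon R N c" by (rule assoc_primesE)
    have cN: "c \<notin> N" using colon_prime_notin[OF c] .
    have N': "ideal (adjoin R N c) R" using ideal_adjoin[OF step(1) c(2)] .
    have "N \<subset> adjoin R N c" using adjoin_sub[OF step(1) c(2)] adjoin_mem[OF step(1) c(2)] cN by blast
    then have fin: "finite (associated_primes R (adjoin R N c))" using step(2)[OF N'] by blast
    have "Q = P \<or> Q \<in> associated_primes R (adjoin R N c)" if Q: "Q \<in> associated_primes R N" for Q
    proof -
      obtain d where d: "primeideal Q R" "d \<in> carrier R" "Q = colon R N d" using Q by (rule assoc_primesE)
      show ?thesis
      proof (cases "\<exists>r\<in>carrier R. r \<otimes> d \<notin> N \<and> r \<otimes> d \<in> adjoin R N c")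
        case True
        then obtain r where r: "r \<in> carrier R" "r \<otimes> d \<notin> N" "r \<otimes> d \<in> adjoin R N c" by blast
        then obtain n s where ns: "n \<in> N" "s \<in> carrier R" "r \<otimes> d = n \<oplus> s \<otimes> c" using adjoinE by metis
        have nc: "n \<in> carrier R" using icarr[OF step(1) ns(1)] .
        have sc: "s \<otimes> c \<notin> N" using r(2) ns iadd[OF step(1) ns(1)] by auto
        have rQ: "r \<notin> Q" using r d(3) unfolding colon_def by auto
        have sP: "s \<notin> P" using sc ns(2) c(3) unfolding colon_def by auto
        \<comment> \<open>\<open>r d\<close> and \<open>s c\<close> agree modulo \<open>N\<close>,
          with \<open>r\<close> outside \<open>Q\<close> and \<open>s\<close> outside
          \<open>P\<close>, so both primes are read off the same element.\<close>
        have "a \<in> Q \<longleftrightarrow> a \<in> P" if a: "a \<in> carrier R" for a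
        proof -
          have "a \<in> Q \<longleftrightarrow> a \<otimes> r \<in> Q"
            using prime_mult[OF d(1), of r a] imultr[OF prime_ideal[OF d(1)], of a r] a r(1) rQ by (auto simp: m_comm)
          also have "\<dots> \<longleftrightarrow> a \<otimes> (r \<otimes> d) \<in> N" using a r d unfolding d(3) colon_def by (simp add: m_assoc)
          also have "\<dots> \<longleftrightarrow> a \<otimes> n \<oplus> a \<otimes> (s \<otimes> c) \<in> N" using ns a nc c(2) by (simp add: r_distr)
          also have "\<dots> \<longleftrightarrow> a \<otimes> (s \<otimes> c) \<in> N"
            using iadd_cancel[OF step(1), of "a \<otimes> (s \<otimes> c)" "a \<otimes> n"] iadd[OF step(1), of "a \<otimes> n" "a \<otimes> (s \<otimes> c)"]
              imult[OF step(1) ns(1) a] a ns(2) c(2) nc by (auto simp: a_comm)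
          also have "\<dots> \<longleftrightarrow> a \<otimes> s \<in> P" using a ns c(2) unfolding c(3) colon_def by (simp add: m_assoc)
          also have "\<dots> \<longleftrightarrow> a \<in> P"
            using prime_mult[OF c(1), of s a] imultr[OF prime_ideal[OF c(1)], of a s] a ns(2) sP by (auto simp: m_comm)
          finally show ?thesis .
        qed
        then have "Q = P" using isub[OF prime_ideal[OF d(1)]] isub[OF prime_ideal[OF c(1)]] by blast
        then show ?thesis ..
      next
        case False
        then have "Q = colon R (adjoin R N c) d"
          using adjoin_sub[OF step(1) c(2)] d(3) unfolding colon_def by blast
        then show ?thesis using assoc_primesI[OF d(1,2)] by blast
      qed
    qed
    then have "associated_primes R N \<subseteq> insert P (associated_primes R (adjoin R N c))" by blast
    then show ?thesis using fin finite_subset by blast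
  qed
qed

lemma nonzerodivisor_if_avoids:
  assumes N: "ideal N R" and a: "a \<in> carrier R" "\<And>Q. Q \<in> associated_primes R N \<Longrightarrow> a \<notin> Q"
  shows "nonzerodivisor R N a"
  unfolding nonzerodivisor_def
proof (intro ballI impI, rule ccontr)
  fix r assume r: "r \<in> carrier R" "r \<otimes> a \<in> N" "r \<notin> N"
  obtain Q where "Q \<in> associated_primes R N" "colon R N r \<subseteq> Q"
    using assoc_prime_above_colon[OF N r(1,3)] .
  moreover have "a \<in> colon R N r" unfolding colon_def using r a by (simp add: m_comm)
  ultimately show False using a(2) by blast
qed

lemma nonzerodivisor_notin_assoc:
  assumes "nonzerodivisor R N a" "a \<in> carrier R" "Q \<in> associated_primes R N" shows "a \<notin> Q"
proof
  obtain c where c: "primeideal Q R" "c \<in> carrier R" "Q = colon R N c" using assms(3) by (rule assoc_primesE)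
  assume "a \<in> Q"
  then have "a \<otimes> c \<in> N" using c unfolding colon_def by simp
  then have "c \<in> N" using nonzerodivisorD'[OF assms(1,2) c(2)] by simp
  then show False using colon_prime_notin[OF c] by simp
qed

text \<open>\<open>R/(A : P)\<close> embeds into a finite power of \<open>R/A\<close> through
  multiplication by generators of \<open>P\<close>; a prime annihilator is then already the
  annihilator of one component.\<close>

lemma assoc_ideal_colon:
  assumes A: "ideal A R" and P: "ideal P R" and Q: "Q \<in> associated_primes R (ideal_colon R A P)"
  shows "Q \<in> associated_primes R A"
proof -
  obtain c where c: "primeideal Q R" "c \<in> carrier R" "Q = colon R (ideal_colon R A P) c"
    using Q by (rule assoc_primesE)
  obtain ps where ps: "set ps \<subseteq> P" "P = gen R {\<zero>} ps" using fin_gen[OF P] .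
  \<comment> \<open>Otherwise each generator \<open>p\<close> has a multiplier outside
    \<open>Q\<close> sending \<open>c p\<close> into \<open>A\<close>; the product of these
    multipliers sends \<open>c\<close> into \<open>A : P\<close>, against
    \<open>Q = (A : P) : c\<close>.\<close>
  have "\<exists>p\<in>P. colon R A (c \<otimes> p) \<subseteq> Q"
  proof (rule ccontr)
    assume nt: "\<not> ?thesis"
    have cP: "\<And>p. p \<in> P \<Longrightarrow> p \<in> carrier R" using icarr[OF P] .
    have "\<exists>s\<in>carrier R - Q. \<forall>p\<in>set ps. s \<otimes> (c \<otimes> p) \<in> A" using ps(1)
    proof (induction ps)
      case Nil
      then show ?case using prime_one[OF c(1)] by (intro bexI[of _ \<one>]) auto
    next
      case (Cons p ps)
      then obtain s where s: "s \<in> carrier R - Q" "\<And>p. p \<in> set ps \<Longrightarrow> s \<otimes> (c \<otimes> p) \<in> A" by auto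
      have p: "p \<in> P" using Cons by simp
      then have "\<not> colon R A (c \<otimes> p) \<subseteq> Q" using nt by simp
      then obtain t where t: "t \<in> carrier R - Q" "t \<otimes> (c \<otimes> p) \<in> A" unfolding colon_def by auto
      have "(s \<otimes> t) \<otimes> (c \<otimes> p') \<in> A" if p': "p' \<in> set (p # ps)" for p'
      proof (cases "p' = p")
        case True
        then have "(s \<otimes> t) \<otimes> (c \<otimes> p') = s \<otimes> (t \<otimes> (c \<otimes> p))" using s t c(2) cP[OF p] by (simp add: m_assoc)
        then show ?thesis using imult[OF A t(2)] s by simp
      next
        case False
        then have p'': "p' \<in> set ps" using p' by simp
        then have "p' \<in> carrier R" using Cons.prems cP by auto
        then have "(s \<otimes> t) \<otimes> (c \<otimes> p') = t \<otimes> (s \<otimes> (c \<otimes> p'))" using s t c(2) by (simp add: m_ac)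
        then show ?thesis using imult[OF A s(2)[OF p'']] t by simp
      qed
      then show ?case using prime_mult_notin[OF c(1) s(1) t(1)] by blast
    qed
    then obtain s where s: "s \<in> carrier R - Q" "\<And>p. p \<in> set ps \<Longrightarrow> s \<otimes> (c \<otimes> p) \<in> A" by blast
    have sc: "s \<otimes> c \<in> carrier R" using s c by simp
    have I: "ideal {p \<in> carrier R. s \<otimes> c \<otimes> p \<in> A} R" using ideal.helper_max_prime[OF A is_cring sc] .
    have "gen R {\<zero>} ps \<subseteq> {p \<in> carrier R. s \<otimes> c \<otimes> p \<in> A}"
    proof (rule gen_least[OF I])
      show "{\<zero>} \<subseteq> {p \<in> carrier R. s \<otimes> c \<otimes> p \<in> A}" using izero[OF I] by simp
      show "set ps \<subseteq> {p \<in> carrier R. s \<otimes> c \<otimes> p \<in> A}"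
        using s ps(1) cP c(2) by (auto simp: m_assoc)
    qed
    then have "s \<otimes> c \<in> ideal_colon R A P" unfolding ideal_colon_def using ps(2) sc by auto
    then have "s \<in> Q" using c(3) s(1) unfolding colon_def by auto
    then show False using s by simp
  qed
  then obtain p where p: "p \<in> P" "colon R A (c \<otimes> p) \<subseteq> Q" by blast
  have pc: "p \<in> carrier R" using icarr[OF P p(1)] .
  have "Q \<subseteq> colon R A (c \<otimes> p)"
  proof
    fix r assume r: "r \<in> Q"
    then have "r \<in> carrier R" "r \<otimes> c \<in> ideal_colon R A P" using c(3) unfolding colon_def by auto
    then show "r \<in> colon R A (c \<otimes> p)"
      using ideal_colonD[OF _ p(1), of "r \<otimes> c" A] c(2) pc unfolding colon_def by (simp add: m_assoc)
  qed
  then show ?thesis using assoc_primesI[OF c(1), of "c \<otimes> p" A] p c(2) pc by auto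
qed

lemma noeth_mod_regular:
  assumes D: "ideal D R" shows "module.noeth_mod R (regular_module R) U D"
proof -
  interpret M: module R "regular_module R" by (rule module_regular)
  show ?thesis unfolding M.noeth_mod_def
  proof (intro allI impI)
    fix W assume W: "submodule W R (regular_module R) \<and> W \<subseteq> U"
    then have iW: "ideal W R" using submodule_regularD by blast
    then obtain xs where xs: "set xs \<subseteq> W" "W = gen R {\<zero>} xs" by (rule fin_gen)
    have c: "D \<union> set xs \<subseteq> carrier (regular_module R)"
      using xs(1) isub[OF iW] isub[OF D] unfolding regular_module_def by auto
    have I: "ideal (spn R (regular_module R) (D \<union> set xs)) R"
      by (rule submodule_regularD[OF M.submodule_spn[OF c]])
    have "W \<subseteq> spn R (regular_module R) (D \<union> set xs)"
      unfolding xs(2) using M.spn_mem[OF c] izero[OF I] by (intro gen_least[OF I]) auto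
    then show "\<exists>F. finite F \<and> F \<subseteq> W \<and> W \<subseteq> spn R (regular_module R) (D \<union> F)"
      using xs(1) by blast
  qed
qed

end

section \<open>Ext modules computed from a finite injective resolution\<close>

text \<open>The element \<open>e1\<close> generates the image of \<open>R\<close> in \<open>E 0\<close>.\<close>

locale injres = noeth_cring R for R (structure) +
  fixes E :: "nat \<Rightarrow> ('a, 'e) module" and d :: "nat \<Rightarrow> 'e \<Rightarrow> 'e" and e1 :: 'e and len :: nat
  assumes mod_E: "module R (E i)"
    and d_hom: "d i \<in> module_hom R (E i) (E (Suc i))"
    and e1: "e1 \<in> carrier (E 0)"
    and e1_faithful: "r \<in> carrier R \<Longrightarrow> r \<odot>\<^bsub>E 0\<^esub> e1 = \<zero>\<^bsub>E 0\<^esub> \<Longrightarrow> r = \<zero>"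
    and ker0: "e \<in> carrier (E 0) \<Longrightarrow> d 0 e = \<zero>\<^bsub>E (Suc 0)\<^esub> \<longleftrightarrow> (\<exists>r\<in>carrier R. e = r \<odot>\<^bsub>E 0\<^esub> e1)"
    and exact: "e \<in> carrier (E (Suc i)) \<Longrightarrow> d (Suc i) e = \<zero>\<^bsub>E (Suc (Suc i))\<^esub> \<longleftrightarrow> e \<in> d i ` carrier (E i)"
    and vanish: "i > len \<Longrightarrow> carrier (E i) = {\<zero>\<^bsub>E i\<^esub>}"
    and hom_ext: "ideal J R \<Longrightarrow> (\<And>a. a \<in> J \<Longrightarrow> f a \<in> carrier (E i)) \<Longrightarrow>
      (\<And>a b. a \<in> J \<Longrightarrow> b \<in> J \<Longrightarrow> f (a \<oplus> b) = f a \<oplus>\<^bsub>E i\<^esub> f b) \<Longrightarrow>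
      (\<And>r a. r \<in> carrier R \<Longrightarrow> a \<in> J \<Longrightarrow> f (r \<otimes> a) = r \<odot>\<^bsub>E i\<^esub> f a) \<Longrightarrow>
      \<exists>\<eta>\<in>carrier (E i). \<forall>a\<in>J. f a = a \<odot>\<^bsub>E i\<^esub> \<eta>"

sublocale injres \<subseteq> E: module R "E i" for i
  by (rule mod_E)

context injres begin

text \<open>Evaluation at \<open>1\<close> identifies \<open>Hom(R/J, E k)\<close> with this
  annihilator, so that no module of homomorphisms is constructed.\<close>

definition T :: "nat \<Rightarrow> 'a set \<Rightarrow> 'e set" where
  "T k J = {e \<in> carrier (E k). \<forall>a\<in>J. a \<odot>\<^bsub>E k\<^esub> e = \<zero>\<^bsub>E k\<^esub>}"

definition Z :: "nat \<Rightarrow> 'a set \<Rightarrow> 'e set" where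
  "Z k J = {e \<in> T k J. d k e = \<zero>\<^bsub>E (Suc k)\<^esub>}"

text \<open>The quotient \<open>Z k J / B k J\<close> is the module \<open>Ext^k(R/J, R)\<close>.\<close>

primrec B :: "nat \<Rightarrow> 'a set \<Rightarrow> 'e set" where
  "B 0 J = {\<zero>\<^bsub>E 0\<^esub>}"
| "B (Suc k) J = d k ` T k J"

definition ext_vanish :: "nat \<Rightarrow> 'a set \<Rightarrow> bool" where
  "ext_vanish k J \<longleftrightarrow> Z k J \<subseteq> B k J"

text \<open>For a prime \<open>Q\<close>, the vanishing of the localization of
  \<open>Ext^k(R/J, R)\<close> at \<open>Q\<close>, written with multipliers outside
  \<open>Q\<close>.\<close>

definition ext_vanish_at :: "'a set \<Rightarrow> nat \<Rightarrow> 'a set \<Rightarrow> bool" where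
  "ext_vanish_at Q k J \<longleftrightarrow> (\<forall>\<zeta>\<in>Z k J. \<exists>s\<in>carrier R - Q. s \<odot>\<^bsub>E k\<^esub> \<zeta> \<in> B k J)"

section \<open>The complex of annihilators, its cocycles and boundaries\<close>

lemma d_closed: "e \<in> carrier (E k) \<Longrightarrow> d k e \<in> carrier (E (Suc k))"
  using d_hom[of k] unfolding module_hom_def by auto

lemma d_add: "u \<in> carrier (E k) \<Longrightarrow> v \<in> carrier (E k) \<Longrightarrow> d k (u \<oplus>\<^bsub>E k\<^esub> v) = d k u \<oplus>\<^bsub>E (Suc k)\<^esub> d k v"
  using d_hom[of k] unfolding module_hom_def by auto

lemma d_smult: "r \<in> carrier R \<Longrightarrow> v \<in> carrier (E k) \<Longrightarrow> d k (r \<odot>\<^bsub>E k\<^esub> v) = r \<odot>\<^bsub>E (Suc k)\<^esub> d k v"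
  using d_hom[of k] unfolding module_hom_def by auto

lemma d_zero: "d k \<zero>\<^bsub>E k\<^esub> = \<zero>\<^bsub>E (Suc k)\<^esub>"
  using d_smult[of \<zero> "\<zero>\<^bsub>E k\<^esub>" k] d_closed[of "\<zero>\<^bsub>E k\<^esub>" k] by simp

lemma d_neg: assumes v: "v \<in> carrier (E k)" shows "d k (\<ominus>\<^bsub>E k\<^esub> v) = \<ominus>\<^bsub>E (Suc k)\<^esub> d k v"
proof -
  have "\<ominus>\<^bsub>E k\<^esub> v = (\<ominus> \<one>) \<odot>\<^bsub>E k\<^esub> v" using E.smult_l_minus[of \<one> v k] v by simp
  moreover have "(\<ominus> \<one>) \<odot>\<^bsub>E (Suc k)\<^esub> d k v = \<ominus>\<^bsub>E (Suc k)\<^esub> d k v"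
    using E.smult_l_minus[of \<one> "d k v" "Suc k"] d_closed[OF v] by simp
  ultimately show ?thesis using d_smult[of "\<ominus> \<one>" v k] v by simp
qed

lemma d_minus: "u \<in> carrier (E k) \<Longrightarrow> v \<in> carrier (E k) \<Longrightarrow> d k (u \<ominus>\<^bsub>E k\<^esub> v) = d k u \<ominus>\<^bsub>E (Suc k)\<^esub> d k v"
  by (simp add: a_minus_def d_add d_neg)

lemma dd: "e \<in> carrier (E k) \<Longrightarrow> d (Suc k) (d k e) = \<zero>\<^bsub>E (Suc (Suc k))\<^esub>"
  using exact[of "d k e" k] d_closed[of e k] by blast

lemma T_carr: "e \<in> T k J \<Longrightarrow> e \<in> carrier (E k)" unfolding T_def by simp
lemma T_ann: "e \<in> T k J \<Longrightarrow> a \<in> J \<Longrightarrow> a \<odot>\<^bsub>E k\<^esub> e = \<zero>\<^bsub>E k\<^esub>" unfolding T_def by simp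
lemma Z_carr: "e \<in> Z k J \<Longrightarrow> e \<in> carrier (E k)" unfolding Z_def T_def by simp
lemma Z_T: "e \<in> Z k J \<Longrightarrow> e \<in> T k J" unfolding Z_def by simp
lemma Z_d: "e \<in> Z k J \<Longrightarrow> d k e = \<zero>\<^bsub>E (Suc k)\<^esub>" unfolding Z_def by simp
lemma ZI: "e \<in> T k J \<Longrightarrow> d k e = \<zero>\<^bsub>E (Suc k)\<^esub> \<Longrightarrow> e \<in> Z k J" unfolding Z_def by simp
lemma T_mono: "J \<subseteq> K \<Longrightarrow> T k K \<subseteq> T k J" unfolding T_def by auto
lemma Z_mono: "J \<subseteq> K \<Longrightarrow> Z k K \<subseteq> Z k J" unfolding Z_def T_def by auto
lemma B_mono: "J \<subseteq> K \<Longrightarrow> B k K \<subseteq> B k J" using T_mono[of J K] by (cases k) (auto intro!: imageI)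

lemma submodule_T: assumes J: "J \<subseteq> carrier R" shows "submodule (T k J) R (E k)"
proof (rule E.submoduleI')
  show "r \<odot>\<^bsub>E k\<^esub> x \<in> T k J" if r: "r \<in> carrier R" and x: "x \<in> T k J" for r x
  proof -
    have "a \<odot>\<^bsub>E k\<^esub> (r \<odot>\<^bsub>E k\<^esub> x) = \<zero>\<^bsub>E k\<^esub>" if a: "a \<in> J" for a
      using E.smult_commute[of a r x k] J a r T_carr[OF x] T_ann[OF x a] by auto
    then show ?thesis using r T_carr[OF x] unfolding T_def by simp
  qed
qed (use J in \<open>auto simp: T_def E.smult_r_distr subset_iff\<close>)

lemma submodule_Z: assumes J: "J \<subseteq> carrier R" shows "submodule (Z k J) R (E k)"
proof (rule E.submoduleI')
  note sT = submodule_T[OF J, of k]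
  show "Z k J \<subseteq> carrier (E k)" using Z_carr by auto
  show "\<zero>\<^bsub>E k\<^esub> \<in> Z k J" using E.submodule_zero[OF sT] d_zero by (auto intro: ZI)
  show "x \<oplus>\<^bsub>E k\<^esub> y \<in> Z k J" if "x \<in> Z k J" "y \<in> Z k J" for x y
    using E.submodule_add[OF sT Z_T Z_T, OF that] that by (auto intro!: ZI simp: d_add Z_carr Z_d)
  show "r \<odot>\<^bsub>E k\<^esub> x \<in> Z k J" if "r \<in> carrier R" "x \<in> Z k J" for r x
    using E.submodule_smult[OF sT that(1) Z_T[OF that(2)]] that by (auto intro!: ZI simp: d_smult Z_carr Z_d)
qed

lemma submodule_B: assumes J: "J \<subseteq> carrier R" shows "submodule (B k J) R (E k)"
proof (cases k)
  case 0 then show ?thesis by (auto intro: E.submoduleI')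
next
  case (Suc i)
  note sT = submodule_T[OF J, of i]
  have "submodule (d i ` T i J) R (E (Suc i))"
  proof (rule E.submoduleI')
    show "d i ` T i J \<subseteq> carrier (E (Suc i))" using d_closed T_carr by auto
    show "\<zero>\<^bsub>E (Suc i)\<^esub> \<in> d i ` T i J" using E.submodule_zero[OF sT] d_zero[of i] by (auto intro!: rev_image_eqI)
    show "x \<oplus>\<^bsub>E (Suc i)\<^esub> y \<in> d i ` T i J" if "x \<in> d i ` T i J" "y \<in> d i ` T i J" for x y
    proof -
      obtain u v where u: "u \<in> T i J" "x = d i u" and v: "v \<in> T i J" "y = d i v" using \<open>x \<in> _\<close> \<open>y \<in> _\<close> by blast
      have "x \<oplus>\<^bsub>E (Suc i)\<^esub> y = d i (u \<oplus>\<^bsub>E i\<^esub> v)" using u v d_add T_carr by auto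
      then show ?thesis using E.submodule_add[OF sT u(1) v(1)] by blast
    qed
    show "r \<odot>\<^bsub>E (Suc i)\<^esub> x \<in> d i ` T i J" if r: "r \<in> carrier R" and "x \<in> d i ` T i J" for r x
    proof -
      obtain u where u: "u \<in> T i J" "x = d i u" using \<open>x \<in> _\<close> by blast
      have "r \<odot>\<^bsub>E (Suc i)\<^esub> x = d i (r \<odot>\<^bsub>E i\<^esub> u)" using u d_smult[OF r] T_carr by auto
      then show ?thesis using E.submodule_smult[OF sT r u(1)] by blast
    qed
  qed
  then show ?thesis using Suc by simp
qed

lemma B_Z: assumes J: "J \<subseteq> carrier R" shows "B k J \<subseteq> Z k J"
proof (cases k)
  case 0 then show ?thesis using E.submodule_zero[OF submodule_Z[OF J]] by simp
next
  case (Suc i)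
  have "d i u \<in> Z (Suc i) J" if u: "u \<in> T i J" for u
  proof (rule ZI)
    show "d (Suc i) (d i u) = \<zero>\<^bsub>E (Suc (Suc i))\<^esub>" using dd T_carr[OF u] by simp
    have "a \<odot>\<^bsub>E (Suc i)\<^esub> d i u = \<zero>\<^bsub>E (Suc i)\<^esub>" if a: "a \<in> J" for a
      using d_smult[of a u i] T_ann[OF u a] T_carr[OF u] J a d_zero by auto
    then show "d i u \<in> T (Suc i) J" using d_closed[OF T_carr[OF u]] unfolding T_def by simp
  qed
  then show ?thesis using Suc by auto
qed

lemma T_adjoin:
  assumes J: "ideal J R" and a: "a \<in> carrier R"
  shows "e \<in> T k (adjoin R J a) \<longleftrightarrow> e \<in> T k J \<and> a \<odot>\<^bsub>E k\<^esub> e = \<zero>\<^bsub>E k\<^esub>"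
proof
  assume "e \<in> T k (adjoin R J a)"
  then show "e \<in> T k J \<and> a \<odot>\<^bsub>E k\<^esub> e = \<zero>\<^bsub>E k\<^esub>"
    using adjoin_sub[OF J a] adjoin_mem[OF J a] T_mono T_ann by blast
next
  assume e: "e \<in> T k J \<and> a \<odot>\<^bsub>E k\<^esub> e = \<zero>\<^bsub>E k\<^esub>"
  have "u \<odot>\<^bsub>E k\<^esub> e = \<zero>\<^bsub>E k\<^esub>" if u: "u \<in> adjoin R J a" for u
  proof -
    obtain n r where n: "n \<in> J" "r \<in> carrier R" "u = n \<oplus> r \<otimes> a" using u by (rule adjoinE)
    have "n \<in> carrier R" using icarr[OF J n(1)] .
    then show ?thesis using n e T_carr[of e k J] T_ann[of e k J n] a
      by (simp add: E.smult_l_distr E.smult_assoc1)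
  qed
  then show "e \<in> T k (adjoin R J a)" using e T_carr[of e k J] unfolding T_def by simp
qed

lemma smult_eqI:
  assumes "r \<in> carrier R" "r' \<in> carrier R" "\<zeta> \<in> carrier (E k)" "(r \<ominus> r') \<odot>\<^bsub>E k\<^esub> \<zeta> = \<zero>\<^bsub>E k\<^esub>"
  shows "r \<odot>\<^bsub>E k\<^esub> \<zeta> = r' \<odot>\<^bsub>E k\<^esub> \<zeta>"
proof -
  have "r \<odot>\<^bsub>E k\<^esub> \<zeta> = (r \<odot>\<^bsub>E k\<^esub> \<zeta> \<ominus>\<^bsub>E k\<^esub> r' \<odot>\<^bsub>E k\<^esub> \<zeta>) \<oplus>\<^bsub>E k\<^esub> r' \<odot>\<^bsub>E k\<^esub> \<zeta>"
    using assms by (simp add: E.minus_eq E.a_assoc E.l_neg)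
  then show ?thesis using assms by (simp add: E.smult_minus_distr)
qed

text \<open>Baer's criterion for one element: \<open>a\<close> congruent to \<open>r c\<close>
  modulo \<open>J\<close> is sent to \<open>r \<zeta>\<close>, which is well defined because
  \<open>J : c\<close> kills \<open>\<zeta>\<close>. The divisibility statements for
  \<open>T\<close> and \<open>B\<close> come from here.\<close>

lemma cyclic_ext:
  assumes J: "ideal J R" and c: "c \<in> carrier R" and \<zeta>: "\<zeta> \<in> carrier (E k)"
    and H: "\<And>r. r \<in> carrier R \<Longrightarrow> r \<otimes> c \<in> J \<Longrightarrow> r \<odot>\<^bsub>E k\<^esub> \<zeta> = \<zero>\<^bsub>E k\<^esub>"
  obtains \<eta> where "\<eta> \<in> T k J" "c \<odot>\<^bsub>E k\<^esub> \<eta> = \<zeta>"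
proof -
  define rep where "rep a = (SOME r. r \<in> carrier R \<and> a \<ominus> r \<otimes> c \<in> J)" for a
  let ?A = "adjoin R J c"
  have A: "ideal ?A R" by (rule ideal_adjoin[OF J c])
  have rep: "rep a \<in> carrier R \<and> a \<ominus> rep a \<otimes> c \<in> J" if a: "a \<in> ?A" for a
    unfolding rep_def
  proof (rule someI_ex)
    obtain n r where n: "n \<in> J" "r \<in> carrier R" "a = n \<oplus> r \<otimes> c" using a by (rule adjoinE)
    have "n \<in> carrier R" using icarr[OF J n(1)] .
    then have "a \<ominus> r \<otimes> c = n" unfolding n(3) using n(2) c by algebra
    then show "\<exists>r. r \<in> carrier R \<and> a \<ominus> r \<otimes> c \<in> J" using n by auto
  qed
  have uniq: "rep a \<odot>\<^bsub>E k\<^esub> \<zeta> = r \<odot>\<^bsub>E k\<^esub> \<zeta>" if a: "a \<in> ?A" "r \<in> carrier R" "a \<ominus> r \<otimes> c \<in> J" for a r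
  proof (rule smult_eqI[OF _ a(2) \<zeta>])
    show rc: "rep a \<in> carrier R" using rep[OF a(1)] by simp
    have ac: "a \<in> carrier R" using icarr[OF A a(1)] .
    have "(rep a \<ominus> r) \<otimes> c = (a \<ominus> r \<otimes> c) \<ominus> (a \<ominus> rep a \<otimes> c)" using rc a(2) ac c by algebra
    then have "(rep a \<ominus> r) \<otimes> c \<in> J" using iminus[OF J a(3)] rep[OF a(1)] by simp
    then show "(rep a \<ominus> r) \<odot>\<^bsub>E k\<^esub> \<zeta> = \<zero>\<^bsub>E k\<^esub>" using H rc a(2) by simp
  qed
  have "\<exists>\<eta>\<in>carrier (E k). \<forall>a\<in>?A. rep a \<odot>\<^bsub>E k\<^esub> \<zeta> = a \<odot>\<^bsub>E k\<^esub> \<eta>"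
  proof (rule hom_ext[OF A])
    show "rep a \<odot>\<^bsub>E k\<^esub> \<zeta> \<in> carrier (E k)" if "a \<in> ?A" for a using rep[OF that] \<zeta> by simp
    show "rep (a \<oplus> b) \<odot>\<^bsub>E k\<^esub> \<zeta> = rep a \<odot>\<^bsub>E k\<^esub> \<zeta> \<oplus>\<^bsub>E k\<^esub> rep b \<odot>\<^bsub>E k\<^esub> \<zeta>" if a: "a \<in> ?A" and b: "b \<in> ?A" for a b
    proof -
      have c': "rep a \<in> carrier R" "rep b \<in> carrier R" "a \<in> carrier R" "b \<in> carrier R"
        using rep[OF a] rep[OF b] icarr[OF A a] icarr[OF A b] by auto
      have "(a \<oplus> b) \<ominus> (rep a \<oplus> rep b) \<otimes> c = (a \<ominus> rep a \<otimes> c) \<oplus> (b \<ominus> rep b \<otimes> c)" using c' c by algebra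
      then have "rep (a \<oplus> b) \<odot>\<^bsub>E k\<^esub> \<zeta> = (rep a \<oplus> rep b) \<odot>\<^bsub>E k\<^esub> \<zeta>"
        using uniq[OF iadd[OF A a b], of "rep a \<oplus> rep b"] c' iadd[OF J] rep[OF a] rep[OF b] by simp
      then show ?thesis using c' \<zeta> by (simp add: E.smult_l_distr)
    qed
    show "rep (r \<otimes> a) \<odot>\<^bsub>E k\<^esub> \<zeta> = r \<odot>\<^bsub>E k\<^esub> (rep a \<odot>\<^bsub>E k\<^esub> \<zeta>)" if r: "r \<in> carrier R" and a: "a \<in> ?A" for r a
    proof -
      have c': "rep a \<in> carrier R" "a \<in> carrier R" using rep[OF a] icarr[OF A a] by auto
      have "(r \<otimes> a) \<ominus> (r \<otimes> rep a) \<otimes> c = r \<otimes> (a \<ominus> rep a \<otimes> c)" using c' c r by algebra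
      then have "rep (r \<otimes> a) \<odot>\<^bsub>E k\<^esub> \<zeta> = (r \<otimes> rep a) \<odot>\<^bsub>E k\<^esub> \<zeta>"
        using uniq[OF imult[OF A a r], of "r \<otimes> rep a"] c' r imult[OF J] rep[OF a] by simp
      then show ?thesis using c' \<zeta> r by (simp add: E.smult_assoc1)
    qed
  qed
  then obtain \<eta> where \<eta>: "\<eta> \<in> carrier (E k)" "\<And>a. a \<in> ?A \<Longrightarrow> rep a \<odot>\<^bsub>E k\<^esub> \<zeta> = a \<odot>\<^bsub>E k\<^esub> \<eta>" by blast
  have "a \<odot>\<^bsub>E k\<^esub> \<eta> = \<zero>\<^bsub>E k\<^esub>" if a: "a \<in> J" for a
  proof -
    have a': "a \<in> ?A" using adjoin_sub[OF J c] a by auto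
    have "a \<ominus> \<zero> \<otimes> c \<in> J" using a c icarr[OF J a] by (simp add: a_minus_def)
    then have "rep a \<odot>\<^bsub>E k\<^esub> \<zeta> = \<zero>\<^bsub>E k\<^esub>" using uniq[OF a', of \<zero>] \<zeta> by simp
    then show ?thesis using \<eta>(2)[OF a'] by simp
  qed
  then have "\<eta> \<in> T k J" using \<eta>(1) unfolding T_def by simp
  moreover have "c \<odot>\<^bsub>E k\<^esub> \<eta> = \<zeta>"
  proof -
    have "c \<ominus> \<one> \<otimes> c \<in> J" using c izero[OF J] by (simp add: r_neg a_minus_def)
    then have "rep c \<odot>\<^bsub>E k\<^esub> \<zeta> = \<zeta>" using uniq[OF adjoin_mem[OF J c], of \<one>] \<zeta> by simp
    then show ?thesis using \<eta>(2)[OF adjoin_mem[OF J c]] by simp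
  qed
  ultimately show ?thesis using that by blast
qed

section \<open>Ext modules of complete intersections\<close>

lemma T_divisible:
  assumes N: "ideal N R" and x: "x \<in> carrier R" "nonzerodivisor R N x" and \<theta>: "\<theta> \<in> T k N"
  obtains \<theta>' where "\<theta>' \<in> T k N" "x \<odot>\<^bsub>E k\<^esub> \<theta>' = \<theta>"
proof (rule cyclic_ext[OF N x(1) T_carr[OF \<theta>]])
  show "r \<odot>\<^bsub>E k\<^esub> \<theta> = \<zero>\<^bsub>E k\<^esub>" if "r \<in> carrier R" "r \<otimes> x \<in> N" for r
    using nonzerodivisorD[OF x(2) that] T_ann[OF \<theta>] by simp
qed

lemma B_divisible:
  assumes N: "ideal N R" and x: "x \<in> carrier R" "nonzerodivisor R N x" and b: "b \<in> B k N"
  obtains b' where "b' \<in> B k N" "x \<odot>\<^bsub>E k\<^esub> b' = b"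
proof (cases k)
  case 0 then show ?thesis using that[of "\<zero>\<^bsub>E 0\<^esub>"] b x by simp
next
  case (Suc i)
  then obtain \<theta> where \<theta>: "\<theta> \<in> T i N" "b = d i \<theta>" using b by auto
  obtain \<theta>' where \<theta>': "\<theta>' \<in> T i N" "x \<odot>\<^bsub>E i\<^esub> \<theta>' = \<theta>" using T_divisible[OF N x \<theta>(1)] .
  then have "x \<odot>\<^bsub>E k\<^esub> d i \<theta>' = b" using d_smult[OF x(1) T_carr[OF \<theta>'(1)]] Suc \<theta> by simp
  then show ?thesis using that[of "d i \<theta>'"] \<theta>' Suc by simp
qed

text \<open>If \<open>N\<close> is generated by a regular sequence of length \<open>k\<close>, then \<open>Ext^k(R/N, R)\<close> is
  isomorphic to \<open>R/N\<close>; \<open>z\<close> represents a generator.\<close>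

definition ext_gen :: "'a set \<Rightarrow> nat \<Rightarrow> 'e \<Rightarrow> bool" where
  "ext_gen N k z \<longleftrightarrow> z \<in> Z k N \<and> (\<forall>\<zeta>\<in>Z k N. \<exists>r\<in>carrier R. \<zeta> \<ominus>\<^bsub>E k\<^esub> r \<odot>\<^bsub>E k\<^esub> z \<in> B k N) \<and>
     (\<forall>r\<in>carrier R. r \<odot>\<^bsub>E k\<^esub> z \<in> B k N \<longrightarrow> r \<in> N)"

text \<open>The connecting map read backwards: when \<open>Ext^(k+1)(R/N, R)\<close> vanishes, a
  cocycle for \<open>(N, x)\<close> is a boundary over \<open>N\<close>, and \<open>x\<close> times
  its primitive is a cocycle one degree lower.\<close>

lemma ext_lift:
  assumes N: "ideal N R" and x: "x \<in> carrier R" and V: "ext_vanish (Suc k) N" and \<zeta>: "\<zeta> \<in> Z (Suc k) (adjoin R N x)"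
  obtains \<eta> where "\<eta> \<in> T k N" "\<zeta> = d k \<eta>" "x \<odot>\<^bsub>E k\<^esub> \<eta> \<in> Z k N"
proof -
  have "\<zeta> \<in> B (Suc k) N" using Z_mono[OF adjoin_sub[OF N x]] \<zeta> V unfolding ext_vanish_def by blast
  then obtain \<eta> where \<eta>: "\<eta> \<in> T k N" "\<zeta> = d k \<eta>" by auto
  have "d k (x \<odot>\<^bsub>E k\<^esub> \<eta>) = x \<odot>\<^bsub>E (Suc k)\<^esub> \<zeta>" using d_smult[OF x T_carr[OF \<eta>(1)]] \<eta> by simp
  also have "\<dots> = \<zero>\<^bsub>E (Suc k)\<^esub>" using T_ann[OF Z_T[OF \<zeta>] adjoin_mem[OF N x]] .
  finally have "x \<odot>\<^bsub>E k\<^esub> \<eta> \<in> Z k N"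
    using E.submodule_smult[OF submodule_T[OF isub[OF N]] x \<eta>(1)] by (intro ZI)
  then show ?thesis using \<eta> that by blast
qed

lemma ext_vanish_adjoin:
  assumes N: "ideal N R" and x: "x \<in> carrier R" "nonzerodivisor R N x"
    and V: "ext_vanish k N" "ext_vanish (Suc k) N"
  shows "ext_vanish (Suc k) (adjoin R N x)"
  unfolding ext_vanish_def
proof
  note sN = isub[OF N]
  fix \<zeta> assume \<zeta>: "\<zeta> \<in> Z (Suc k) (adjoin R N x)"
  obtain \<eta> where \<eta>: "\<eta> \<in> T k N" "\<zeta> = d k \<eta>" "x \<odot>\<^bsub>E k\<^esub> \<eta> \<in> Z k N" using ext_lift[OF N x(1) V(2) \<zeta>] .
  note \<eta>c = T_carr[OF \<eta>(1)]
  have "x \<odot>\<^bsub>E k\<^esub> \<eta> \<in> B k N" using V(1) \<eta>(3) unfolding ext_vanish_def by blast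
  then obtain b where b: "b \<in> B k N" "x \<odot>\<^bsub>E k\<^esub> b = x \<odot>\<^bsub>E k\<^esub> \<eta>" using B_divisible[OF N x] by metis
  have bZ: "b \<in> Z k N" using b B_Z[OF sN] by blast
  note bc = Z_carr[OF bZ]
  have "\<eta> \<ominus>\<^bsub>E k\<^esub> b \<in> T k N"
    using \<eta>(1) Z_T[OF bZ] submodule_T[OF sN, of k] E.submodule_minus by metis
  moreover have "x \<odot>\<^bsub>E k\<^esub> (\<eta> \<ominus>\<^bsub>E k\<^esub> b) = \<zero>\<^bsub>E k\<^esub>"
    using b(2) x(1) \<eta>c bc by (simp add: E.smult_rminus_distr) (simp add: E.minus_eq E.r_neg)
  ultimately have "\<eta> \<ominus>\<^bsub>E k\<^esub> b \<in> T k (adjoin R N x)" using T_adjoin[OF N x(1)] by blast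
  moreover have "d k (\<eta> \<ominus>\<^bsub>E k\<^esub> b) = \<zeta>"
    using \<eta>(2) \<eta>c bc Z_d[OF bZ] d_closed[OF \<eta>c] by (simp add: d_minus) (simp add: E.minus_eq)
  ultimately show "\<zeta> \<in> B (Suc k) (adjoin R N x)" by (auto intro!: rev_image_eqI)
qed

text \<open>\<open>Ext^(i+1)(R/(N, x), R)\<close> is the cokernel of \<open>x\<close> on
  \<open>Ext^i(R/N, R)\<close>. The new generator is the image of \<open>z\<close> under the
  connecting map: divide \<open>z\<close> by \<open>x\<close> inside \<open>T i N\<close> and apply
  \<open>d i\<close>.\<close>

lemma ext_gen_adjoin:
  assumes N: "ideal N R" and x: "x \<in> carrier R" "nonzerodivisor R N x"
    and z: "ext_gen N i z" and V: "\<And>j. j > i \<Longrightarrow> ext_vanish j N"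
  shows "\<exists>z'. ext_gen (adjoin R N x) (Suc i) z'"
    and "\<And>j. j > Suc i \<Longrightarrow> ext_vanish j (adjoin R N x)"
proof -
  let ?N = "adjoin R N x"
  have N': "ideal ?N R" by (rule ideal_adjoin[OF N x(1)])
  have NN: "N \<subseteq> ?N" by (rule adjoin_sub[OF N x(1)])
  note sN = isub[OF N] and sN' = isub[OF N']
  have zZ: "z \<in> Z i N" using z unfolding ext_gen_def by simp
  have gen: "\<exists>r\<in>carrier R. \<zeta> \<ominus>\<^bsub>E i\<^esub> r \<odot>\<^bsub>E i\<^esub> z \<in> B i N" if "\<zeta> \<in> Z i N" for \<zeta>
    using z that unfolding ext_gen_def by simp
  have ann: "r \<in> N" if "r \<in> carrier R" "r \<odot>\<^bsub>E i\<^esub> z \<in> B i N" for r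
    using z that unfolding ext_gen_def by simp
  obtain e where e: "e \<in> T i N" "x \<odot>\<^bsub>E i\<^esub> e = z" using T_divisible[OF N x Z_T[OF zZ]] .
  note ec = T_carr[OF e(1)] and zc = Z_carr[OF zZ]
  define z' where "z' = d i e"
  have z'T: "z' \<in> B (Suc i) N" unfolding z'_def using e by simp
  have z'Z: "z' \<in> Z (Suc i) ?N"
  proof (rule ZI)
    show "d (Suc i) z' = \<zero>\<^bsub>E (Suc (Suc i))\<^esub>" unfolding z'_def using dd[OF ec] .
    have "x \<odot>\<^bsub>E (Suc i)\<^esub> z' = \<zero>\<^bsub>E (Suc i)\<^esub>" unfolding z'_def
      using d_smult[OF x(1) ec] e(2) Z_d[OF zZ] by simp
    then show "z' \<in> T (Suc i) ?N" using T_adjoin[OF N x(1)] z'T B_Z[OF sN] Z_T by blast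
  qed
  have "ext_gen ?N (Suc i) z'"
    unfolding ext_gen_def
  proof (intro conjI ballI impI)
    show "z' \<in> Z (Suc i) ?N" by (rule z'Z)
  next
    fix \<zeta> assume \<zeta>: "\<zeta> \<in> Z (Suc i) ?N"
    obtain \<eta> where \<eta>: "\<eta> \<in> T i N" "\<zeta> = d i \<eta>" "x \<odot>\<^bsub>E i\<^esub> \<eta> \<in> Z i N" using ext_lift[OF N x(1) V[OF lessI] \<zeta>] .
    note \<eta>c = T_carr[OF \<eta>(1)]
    obtain a where a: "a \<in> carrier R" "x \<odot>\<^bsub>E i\<^esub> \<eta> \<ominus>\<^bsub>E i\<^esub> a \<odot>\<^bsub>E i\<^esub> z \<in> B i N" using gen[OF \<eta>(3)] by blast
    obtain b where b: "b \<in> B i N" "x \<odot>\<^bsub>E i\<^esub> b = x \<odot>\<^bsub>E i\<^esub> \<eta> \<ominus>\<^bsub>E i\<^esub> a \<odot>\<^bsub>E i\<^esub> z"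
      using B_divisible[OF N x a(2)] .
    have bZ: "b \<in> Z i N" using b B_Z[OF sN] by blast
    note bc = Z_carr[OF bZ]
    \<comment> \<open>Correcting the primitive by \<open>a e\<close> and \<open>b\<close> makes
      \<open>x\<close> kill it, so that it lives over \<open>(N, x)\<close>.\<close>
    let ?h = "(\<eta> \<ominus>\<^bsub>E i\<^esub> a \<odot>\<^bsub>E i\<^esub> e) \<ominus>\<^bsub>E i\<^esub> b"
    have "a \<odot>\<^bsub>E i\<^esub> z = x \<odot>\<^bsub>E i\<^esub> (a \<odot>\<^bsub>E i\<^esub> e)" using e(2) E.smult_commute a(1) x(1) ec by metis
    then have "x \<odot>\<^bsub>E i\<^esub> ?h = (x \<odot>\<^bsub>E i\<^esub> \<eta> \<ominus>\<^bsub>E i\<^esub> a \<odot>\<^bsub>E i\<^esub> z) \<ominus>\<^bsub>E i\<^esub> x \<odot>\<^bsub>E i\<^esub> b"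
      using x(1) \<eta>c a(1) ec bc by (simp add: E.smult_rminus_distr)
    also have "\<dots> = \<zero>\<^bsub>E i\<^esub>" unfolding b(2) using \<eta>c x a zc by (simp add: E.minus_eq E.r_neg)
    finally have xh: "x \<odot>\<^bsub>E i\<^esub> ?h = \<zero>\<^bsub>E i\<^esub>" .
    have "?h \<in> T i N"
      using \<eta>(1) e(1) a(1) Z_T[OF bZ] submodule_T[OF sN, of i] E.submodule_minus E.submodule_smult by metis
    then have "?h \<in> T i ?N" using xh T_adjoin[OF N x(1)] by blast
    moreover have "d i ?h = \<zeta> \<ominus>\<^bsub>E (Suc i)\<^esub> a \<odot>\<^bsub>E (Suc i)\<^esub> z'"
      using \<eta>c a(1) ec bc Z_d[OF bZ] \<eta>(2) d_closed[OF ec] d_closed[OF \<eta>c]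
      by (simp add: d_minus d_smult z'_def) (simp add: E.minus_eq)
    ultimately show "\<exists>r\<in>carrier R. \<zeta> \<ominus>\<^bsub>E (Suc i)\<^esub> r \<odot>\<^bsub>E (Suc i)\<^esub> z' \<in> B (Suc i) ?N"
      using a(1) by (intro bexI[of _ a]) (auto intro!: rev_image_eqI)
  next
    fix r assume r: "r \<in> carrier R" "r \<odot>\<^bsub>E (Suc i)\<^esub> z' \<in> B (Suc i) ?N"
    then obtain \<eta> where \<eta>: "\<eta> \<in> T i ?N" "r \<odot>\<^bsub>E (Suc i)\<^esub> z' = d i \<eta>" by auto
    note \<eta>c = T_carr[OF \<eta>(1)]
    let ?u = "r \<odot>\<^bsub>E i\<^esub> e \<ominus>\<^bsub>E i\<^esub> \<eta>"
    have \<eta>N: "\<eta> \<in> T i N" using \<eta>(1) T_mono[OF NN] by blast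
    have "d i ?u = \<zero>\<^bsub>E (Suc i)\<^esub>"
      using \<eta>(2) r(1) ec \<eta>c d_closed[OF \<eta>c] by (simp add: d_minus d_smult z'_def) (simp add: E.minus_eq E.r_neg)
    moreover have "?u \<in> T i N"
      using \<eta>N e(1) r(1) submodule_T[OF sN, of i] E.submodule_minus E.submodule_smult by metis
    ultimately have "?u \<in> Z i N" by (intro ZI)
    then obtain a where a: "a \<in> carrier R" "?u \<ominus>\<^bsub>E i\<^esub> a \<odot>\<^bsub>E i\<^esub> z \<in> B i N" using gen by blast
    \<comment> \<open>\<open>\<eta>\<close> is killed by \<open>x\<close> and
      \<open>x e = z\<close>, so \<open>x\<close> turns the cocycle \<open>r e - \<eta>\<close> into
      \<open>r z\<close>; this compares \<open>r\<close> with a multiple of \<open>x\<close> modulo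
      \<open>N\<close>.\<close>
    have "x \<odot>\<^bsub>E i\<^esub> (?u \<ominus>\<^bsub>E i\<^esub> a \<odot>\<^bsub>E i\<^esub> z) = (r \<ominus> a \<otimes> x) \<odot>\<^bsub>E i\<^esub> z"
    proof -
      have "x \<odot>\<^bsub>E i\<^esub> \<eta> = \<zero>\<^bsub>E i\<^esub>" using T_ann[OF \<eta>(1) adjoin_mem[OF N x(1)]] .
      moreover have "x \<odot>\<^bsub>E i\<^esub> (r \<odot>\<^bsub>E i\<^esub> e) = r \<odot>\<^bsub>E i\<^esub> z" using e(2) E.smult_commute r(1) x(1) ec by metis
      ultimately have "x \<odot>\<^bsub>E i\<^esub> ?u = r \<odot>\<^bsub>E i\<^esub> z"
        using r x ec \<eta>c zc by (simp add: E.smult_rminus_distr) (simp add: E.minus_eq)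
      then show ?thesis using r x ec \<eta>c zc a(1)
        by (simp add: E.smult_rminus_distr E.smult_minus_distr E.smult_assoc1 E.smult_commute)
    qed
    then have "(r \<ominus> a \<otimes> x) \<odot>\<^bsub>E i\<^esub> z \<in> B i N"
      using E.submodule_smult[OF submodule_B[OF sN] x(1) a(2)] by simp
    then have "r \<ominus> a \<otimes> x \<in> N" using ann r(1) a(1) x(1) by simp
    then have "(r \<ominus> a \<otimes> x) \<oplus> a \<otimes> x \<in> ?N" using adjoinI a(1) by metis
    moreover have "(r \<ominus> a \<otimes> x) \<oplus> a \<otimes> x = r" using r(1) a(1) x(1) by algebra
    ultimately show "r \<in> ?N" by simp
  qed
  then show "\<exists>z'. ext_gen ?N (Suc i) z'" by blast
  show "ext_vanish j ?N" if j: "j > Suc i" for j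
  proof -
    obtain k where k: "j = Suc k" "k > i" using j by (cases j) auto
    then show ?thesis using ext_vanish_adjoin[OF N x V V, of k] by simp
  qed
qed

lemma ext_gen_zero: "\<exists>z. ext_gen {\<zero>} 0 z" "j > 0 \<Longrightarrow> ext_vanish j {\<zero>}"
proof -
  have T0: "T k {\<zero>} = carrier (E k)" for k unfolding T_def by auto
  have "ext_gen {\<zero>} 0 e1"
    unfolding ext_gen_def
  proof (intro conjI ballI impI)
    have "\<exists>r\<in>carrier R. e1 = r \<odot>\<^bsub>E 0\<^esub> e1" using e1 by (intro bexI[of _ \<one>]) auto
    then show "e1 \<in> Z 0 {\<zero>}" using ker0[OF e1] e1 T0 by (intro ZI) auto
    show "\<exists>r\<in>carrier R. \<zeta> \<ominus>\<^bsub>E 0\<^esub> r \<odot>\<^bsub>E 0\<^esub> e1 \<in> B 0 {\<zero>}" if \<zeta>: "\<zeta> \<in> Z 0 {\<zero>}" for \<zeta>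
    proof -
      obtain r where "r \<in> carrier R" "\<zeta> = r \<odot>\<^bsub>E 0\<^esub> e1" using ker0[OF Z_carr[OF \<zeta>]] Z_d[OF \<zeta>] by auto
      then show ?thesis using e1 by (intro bexI[of _ r]) (auto simp: E.minus_eq E.r_neg)
    qed
    show "r \<in> {\<zero>}" if "r \<in> carrier R" "r \<odot>\<^bsub>E 0\<^esub> e1 \<in> B 0 {\<zero>}" for r
      using e1_faithful that by simp
  qed
  then show "\<exists>z. ext_gen {\<zero>} 0 z" by blast
  show "ext_vanish j {\<zero>}" if j0: "j > 0"
    unfolding ext_vanish_def
  proof
    obtain k where k: "j = Suc k" using j0 by (cases j) auto
    fix \<zeta> assume \<zeta>: "\<zeta> \<in> Z j {\<zero>}"
    then show "\<zeta> \<in> B j {\<zero>}" using exact[of \<zeta> k] Z_carr[OF \<zeta>] Z_d[OF \<zeta>] T0 k by auto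
  qed
qed

lemma ext_gen_reg:
  assumes "reg R {\<zero>} xs"
  shows "\<exists>z. ext_gen (gen R {\<zero>} xs) (length xs) z"
    and "\<And>j. j > length xs \<Longrightarrow> ext_vanish j (gen R {\<zero>} xs)"
proof -
  have "(\<exists>z. ext_gen (gen R N xs) (i + length xs) z) \<and> (\<forall>j > i + length xs. ext_vanish j (gen R N xs))"
    if "reg R N xs" "ideal N R" "\<exists>z. ext_gen N i z" "\<And>j. j > i \<Longrightarrow> ext_vanish j N" for N i
    using that
  proof (induction xs arbitrary: N i)
    case (Cons x xs)
    have x: "x \<in> carrier R" "nonzerodivisor R N x" "reg R (adjoin R N x) xs" using Cons.prems(1) by auto
    obtain z where z: "ext_gen N i z" using Cons.prems(3) by blast
    show ?case
      using Cons.IH[OF x(3) ideal_adjoin[OF Cons.prems(2) x(1)]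
        ext_gen_adjoin(1)[OF Cons.prems(2) x(1,2) z Cons.prems(4)]
        ext_gen_adjoin(2)[OF Cons.prems(2) x(1,2) z Cons.prems(4)]] by simp
  qed simp
  from this[OF assms zeroideal ext_gen_zero] show
    "\<exists>z. ext_gen (gen R {\<zero>} xs) (length xs) z"
    "\<And>j. j > length xs \<Longrightarrow> ext_vanish j (gen R {\<zero>} xs)" by auto
qed

text \<open>An element killed by \<open>N : c\<close> is \<open>c\<close> times one killed by
  \<open>N\<close>; applying \<open>d\<close> carries this over to boundaries.\<close>

lemma B_colon:
  assumes N: "ideal N R" and c: "c \<in> carrier R" and b: "b \<in> B k (colon R N c)"
  obtains \<beta> where "\<beta> \<in> B k N" "c \<odot>\<^bsub>E k\<^esub> \<beta> = b"
proof (cases k)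
  case 0 then show ?thesis using that[of "\<zero>\<^bsub>E 0\<^esub>"] b c by simp
next
  case (Suc i)
  then obtain \<theta> where \<theta>: "\<theta> \<in> T i (colon R N c)" "b = d i \<theta>" using b by auto
  obtain \<theta>' where \<theta>': "\<theta>' \<in> T i N" "c \<odot>\<^bsub>E i\<^esub> \<theta>' = \<theta>"
  proof (rule cyclic_ext[OF N c T_carr[OF \<theta>(1)]])
    show "r \<odot>\<^bsub>E i\<^esub> \<theta> = \<zero>\<^bsub>E i\<^esub>" if "r \<in> carrier R" "r \<otimes> c \<in> N" for r
      using T_ann[OF \<theta>(1), of r] that unfolding colon_def by simp
  qed
  then have "c \<odot>\<^bsub>E k\<^esub> d i \<theta>' = b" using d_smult[OF c T_carr[OF \<theta>'(1)]] Suc \<theta> by simp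
  then show ?thesis using that[of "d i \<theta>'"] \<theta>' Suc by simp
qed

section \<open>Finite generation of Ext modules\<close>

lemma spn_smult_preimage:
  assumes c: "c \<in> carrier R" and G: "G \<subseteq> carrier (E k)" and y: "y \<in> spn R (E k) ((\<lambda>e. c \<odot>\<^bsub>E k\<^esub> e) ` G)"
  obtains \<eta> where "\<eta> \<in> spn R (E k) G" "y = c \<odot>\<^bsub>E k\<^esub> \<eta>"
proof -
  have "\<exists>\<eta>. \<eta> \<in> spn R (E k) G \<and> y = c \<odot>\<^bsub>E k\<^esub> \<eta>" using y
  proof induction
    case spn_zero
    show ?case using spn.spn_zero[of "E k" R G] c by (intro exI[of _ "\<zero>\<^bsub>E k\<^esub>"]) auto
  next
    case (spn_step x a r)
    then obtain \<eta> g where *: "\<eta> \<in> spn R (E k) G" "x = c \<odot>\<^bsub>E k\<^esub> \<eta>" "g \<in> G" "a = c \<odot>\<^bsub>E k\<^esub> g" by blast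
    have cc: "\<eta> \<in> carrier (E k)" "g \<in> carrier (E k)" using E.spn_carrier[OF G *(1)] * G by auto
    have "x \<oplus>\<^bsub>E k\<^esub> r \<odot>\<^bsub>E k\<^esub> a = c \<odot>\<^bsub>E k\<^esub> (\<eta> \<oplus>\<^bsub>E k\<^esub> r \<odot>\<^bsub>E k\<^esub> g)"
      using cc c spn_step(3) E.smult_commute[OF c spn_step(3) cc(2)] * by (simp add: E.smult_r_distr)
    then show ?case using spn.spn_step[OF *(1,3) spn_step(3)] by blast
  qed
  then show ?thesis using that by blast
qed

lemma spn_d_image:
  assumes G: "G \<subseteq> carrier (E k)" and y: "y \<in> spn R (E k) G"
  shows "d k y \<in> spn R (E (Suc k)) (d k ` G)"
  using y
proof induction
  case spn_zero then show ?case using d_zero[of k] spn.spn_zero[of "E (Suc k)"] by simp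
next
  case (spn_step x a r)
  have "x \<in> carrier (E k)" "a \<in> carrier (E k)" using E.spn_carrier[OF G spn_step(1)] G spn_step by auto
  then show ?case using spn.spn_step[OF spn_step.IH _ spn_step(3), of "d k a"] spn_step(2,3)
    by (simp add: d_add d_smult)
qed

lemma noeth_ext_0:
  assumes J: "ideal J R" shows "module.noeth_mod R (E 0) (Z 0 J) (B 0 J)"
  unfolding module.noeth_mod_def[OF mod_E]
proof (intro allI impI)
  fix W assume W: "submodule W R (E 0) \<and> W \<subseteq> Z 0 J"
  define A where "A = {r \<in> carrier R. r \<odot>\<^bsub>E 0\<^esub> e1 \<in> W}"
  have A: "ideal A R"
    by (rule idealI')
      (use W e1 E.submodule_zero[of W 0] E.submodule_add[of W 0] E.submodule_smult[of W 0] in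
        \<open>auto simp: A_def E.smult_l_distr E.smult_assoc1\<close>)
  obtain xs where xs: "set xs \<subseteq> A" "A = gen R {\<zero>} xs" using fin_gen[OF A] .
  define F where "F = (\<lambda>r. r \<odot>\<^bsub>E 0\<^esub> e1) ` set xs"
  have FW: "F \<subseteq> W" unfolding F_def using xs(1) by (auto simp: A_def)
  have Wc: "W \<subseteq> carrier (E 0)" using W Z_carr by blast
  have Fc: "B 0 J \<union> F \<subseteq> carrier (E 0)" using FW Wc by auto
  note sS = E.submodule_spn[OF Fc]
  have "ideal {r \<in> carrier R. r \<odot>\<^bsub>E 0\<^esub> e1 \<in> spn R (E 0) (B 0 J \<union> F)} R"
    by (rule idealI')
      (use e1 E.submodule_zero[OF sS] E.submodule_add[OF sS] E.submodule_smult[OF sS] in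
        \<open>auto simp: E.smult_l_distr E.smult_assoc1\<close>)
  note I = this
  have "gen R {\<zero>} xs \<subseteq> {r \<in> carrier R. r \<odot>\<^bsub>E 0\<^esub> e1 \<in> spn R (E 0) (B 0 J \<union> F)}"
  proof (rule gen_least[OF I])
    show "{\<zero>} \<subseteq> {r \<in> carrier R. r \<odot>\<^bsub>E 0\<^esub> e1 \<in> spn R (E 0) (B 0 J \<union> F)}" using izero[OF I] by simp
    show "set xs \<subseteq> {r \<in> carrier R. r \<odot>\<^bsub>E 0\<^esub> e1 \<in> spn R (E 0) (B 0 J \<union> F)}"
      using xs(1) E.spn_mem[OF Fc] unfolding A_def F_def by auto
  qed
  then have *: "r \<odot>\<^bsub>E 0\<^esub> e1 \<in> spn R (E 0) (B 0 J \<union> F)" if "r \<in> A" for r using xs(2) that by blast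
  have "W \<subseteq> spn R (E 0) (B 0 J \<union> F)"
  proof
    fix w assume w: "w \<in> W"
    then have "w \<in> Z 0 J" using W by blast
    then obtain r where r: "r \<in> carrier R" "w = r \<odot>\<^bsub>E 0\<^esub> e1" using ker0[OF Z_carr] Z_d by blast
    then show "w \<in> spn R (E 0) (B 0 J \<union> F)" using *[of r] w unfolding A_def by simp
  qed
  then show "\<exists>F. finite F \<and> F \<subseteq> W \<and> W \<subseteq> spn R (E 0) (B 0 J \<union> F)"
    using FW unfolding F_def by blast
qed

text \<open>With only injective modules at hand, finiteness is obtained by induction on
  \<open>k\<close> and on the generators of \<open>J\<close>. Primitives of elements of
  \<open>W\<close> are considered over \<open>(bs)\<close> for prefixes \<open>bs\<close> of these
  generators. The next generator \<open>c\<close> maps them to cocycles for \<open>(bs) : c\<close>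
  in degree \<open>k\<close>, where finitely many suffice; what is left over is killed by
  \<open>c\<close> and belongs to the longer prefix.\<close>

lemma noeth_ext: "ideal J R \<Longrightarrow> module.noeth_mod R (E k) (Z k J) (B k J)"
proof (induction k arbitrary: J)
  case 0 then show ?case by (rule noeth_ext_0)
next
  case (Suc k)
  note J = Suc.prems
  obtain as where as: "set as \<subseteq> J" "J = gen R {\<zero>} as" using fin_gen[OF J] .
  have asc: "set as \<subseteq> carrier R" using as(1) isub[OF J] by simp
  note sB = submodule_B[OF isub[OF J], of "Suc k"]
  show ?case
    unfolding module.noeth_mod_def[OF mod_E]
  proof (intro allI impI)
    fix W assume W0: "submodule W R (E (Suc k)) \<and> W \<subseteq> Z (Suc k) J"
    then have W: "submodule W R (E (Suc k))" "W \<subseteq> Z (Suc k) J" by auto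
    define V where "V = {\<eta> \<in> carrier (E k). d k \<eta> \<in> W}"
    have sV: "submodule V R (E k)"
      by (rule E.submoduleI')
        (use E.submodule_zero[OF W(1)] E.submodule_add[OF W(1)] E.submodule_smult[OF W(1)] in
          \<open>auto simp: V_def d_add d_smult d_zero\<close>)
    have "\<exists>F. finite F \<and> F \<subseteq> W \<and> (\<forall>\<eta>\<in>V \<inter> T k (gen R {\<zero>} bs). d k \<eta> \<in> spn R (E (Suc k)) (B (Suc k) J \<union> F))"
      if "as = bs @ cs" for bs cs
      using that
    proof (induction cs arbitrary: bs)
      \<comment> \<open>The prefix is the whole list, so the primitive lies in \<open>T k J\<close>
        and its image under \<open>d k\<close> is a boundary.\<close>
      case Nil
      have "d k \<eta> \<in> spn R (E (Suc k)) (B (Suc k) J \<union> {})" if "\<eta> \<in> V \<inter> T k (gen R {\<zero>} bs)" for \<eta>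
        using that Nil as(2) E.submodule_sub[OF sB] by (intro E.spn_mem) auto
      then show ?case by blast
    next
      case (Cons c cs)
      define N where "N = gen R {\<zero>} bs"
      have bsc: "set bs \<subseteq> carrier R" and c: "c \<in> carrier R" and cJ: "c \<in> J" using Cons.prems asc as(1) by auto
      have N: "ideal N R" unfolding N_def using ideal_gen[OF zeroideal bsc] .
      note sTN = submodule_T[OF isub[OF N], of k]
      define L where "L = colon R N c"
      have L: "ideal L R" unfolding L_def using ideal_colon[OF N c] .
      obtain F0 where F0: "finite F0" "F0 \<subseteq> W"
        "\<And>\<eta>. \<eta> \<in> V \<inter> T k (gen R {\<zero>} (bs @ [c])) \<Longrightarrow> d k \<eta> \<in> spn R (E (Suc k)) (B (Suc k) J \<union> F0)"
        using Cons.IH[of "bs @ [c]"] Cons.prems by auto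
      define VN where "VN = V \<inter> T k N"
      have sVN: "submodule VN R (E k)"
        by (rule E.submoduleI')
          (use E.submodule_zero[OF sV] E.submodule_add[OF sV] E.submodule_smult[OF sV] E.submodule_sub[OF sV]
            E.submodule_zero[OF sTN] E.submodule_add[OF sTN] E.submodule_smult[OF sTN] in
          \<open>auto simp: VN_def\<close>)
      have cVN: "VN \<subseteq> carrier (E k)" using E.submodule_sub[OF sVN] .
      let ?cV = "(\<lambda>e. c \<odot>\<^bsub>E k\<^esub> e) ` VN"
      have scV: "submodule ?cV R (E k)"
      proof (rule E.submoduleI')
        show "?cV \<subseteq> carrier (E k)" using cVN c by auto
        show "\<zero>\<^bsub>E k\<^esub> \<in> ?cV" using E.submodule_zero[OF sVN] c by (auto intro!: rev_image_eqI)
        show "x \<oplus>\<^bsub>E k\<^esub> y \<in> ?cV" if "x \<in> ?cV" "y \<in> ?cV" for x y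
        proof -
          obtain u v where u: "u \<in> VN" "x = c \<odot>\<^bsub>E k\<^esub> u" "v \<in> VN" "y = c \<odot>\<^bsub>E k\<^esub> v" using \<open>x \<in> _\<close> \<open>y \<in> _\<close> by blast
          then have "x \<oplus>\<^bsub>E k\<^esub> y = c \<odot>\<^bsub>E k\<^esub> (u \<oplus>\<^bsub>E k\<^esub> v)" using E.smult_r_distr[OF c subsetD[OF cVN u(1)] subsetD[OF cVN u(3)]] by simp
          then show ?thesis using E.submodule_add[OF sVN u(1,3)] by blast
        qed
        show "r \<odot>\<^bsub>E k\<^esub> x \<in> ?cV" if r: "r \<in> carrier R" and "x \<in> ?cV" for r x
        proof -
          obtain u where u: "u \<in> VN" "x = c \<odot>\<^bsub>E k\<^esub> u" using \<open>x \<in> _\<close> by blast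
          have "r \<odot>\<^bsub>E k\<^esub> x = c \<odot>\<^bsub>E k\<^esub> (r \<odot>\<^bsub>E k\<^esub> u)" using u r c cVN E.smult_commute[of r c u k] by auto
          then show ?thesis using E.submodule_smult[OF sVN r u(1)] by blast
        qed
      qed
      \<comment> \<open>\<open>c\<close> kills \<open>d k u\<close> since \<open>c\<close> is in
        \<open>J\<close>, and \<open>(N : c) c\<close> lies in \<open>N\<close>, which kills
        \<open>u\<close>.\<close>
      have "?cV \<subseteq> Z k L"
      proof
        fix x assume "x \<in> ?cV"
        then obtain u where u: "u \<in> V" "u \<in> T k N" "x = c \<odot>\<^bsub>E k\<^esub> u" unfolding VN_def by blast
        have uc: "u \<in> carrier (E k)" using T_carr[OF u(2)] .
        have dZ: "d k u \<in> Z (Suc k) J" using u(1) W(2) unfolding V_def by blast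
        then have "d k x = \<zero>\<^bsub>E (Suc k)\<^esub>" using u(3) d_smult[OF c uc] T_ann[OF Z_T[OF dZ] cJ] by simp
        moreover have "r \<odot>\<^bsub>E k\<^esub> x = \<zero>\<^bsub>E k\<^esub>" if r: "r \<in> L" for r
        proof -
          have "r \<in> carrier R" "r \<otimes> c \<in> N" using r unfolding L_def colon_def by auto
          then show ?thesis using T_ann[OF u(2)] u(3) uc c E.smult_assoc1[of r c u k] by simp
        qed
        ultimately show "x \<in> Z k L" using u(3) uc c unfolding Z_def T_def by simp
      qed
      then obtain F' where F': "finite F'" "F' \<subseteq> ?cV" "?cV \<subseteq> spn R (E k) (B k L \<union> F')"
        using Suc.IH[OF L] scV unfolding module.noeth_mod_def[OF mod_E] by meson
      obtain G where G: "G \<subseteq> VN" "finite G" "F' = (\<lambda>e. c \<odot>\<^bsub>E k\<^esub> e) ` G"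
        using finite_subset_image[OF F'(1,2)] by blast
      have Gc: "G \<subseteq> carrier (E k)" using G cVN by auto
      have dGW: "d k ` G \<subseteq> W" using G(1) unfolding VN_def V_def by auto
      let ?S = "B (Suc k) J \<union> (F0 \<union> d k ` G)"
      have Sc: "?S \<subseteq> carrier (E (Suc k))" using E.submodule_sub[OF sB] F0(2) dGW E.submodule_sub[OF W(1)] by blast
      note sS = E.submodule_spn[OF Sc]
      have "d k \<eta> \<in> spn R (E (Suc k)) ?S" if \<eta>: "\<eta> \<in> V \<inter> T k N" for \<eta>
      proof -
        have \<eta>c: "\<eta> \<in> carrier (E k)" using \<eta> T_carr by blast
        have c\<eta>: "c \<odot>\<^bsub>E k\<^esub> \<eta> \<in> spn R (E k) (B k L \<union> F')" using F'(3) \<eta> unfolding VN_def by blast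
        have F'c: "F' \<subseteq> carrier (E k)" using F'(2) E.submodule_sub[OF scV] by blast
        obtain b y where by': "b \<in> B k L" "y \<in> spn R (E k) F'" "c \<odot>\<^bsub>E k\<^esub> \<eta> = b \<oplus>\<^bsub>E k\<^esub> y"
          by (rule E.spn_Un_split[OF submodule_B[OF isub[OF L]] F'c c\<eta>])
        obtain \<eta>' where \<eta>': "\<eta>' \<in> spn R (E k) G" "y = c \<odot>\<^bsub>E k\<^esub> \<eta>'"
          using spn_smult_preimage[OF c Gc] by'(2) G(3) by blast
        have \<eta>'V: "\<eta>' \<in> VN" using E.spn_least[OF sVN G(1)] \<eta>'(1) by blast
        obtain \<beta> where \<beta>: "\<beta> \<in> B k N" "c \<odot>\<^bsub>E k\<^esub> \<beta> = b" using B_colon[OF N c] by'(1) unfolding L_def by blast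
        have \<beta>Z: "\<beta> \<in> Z k N" using \<beta>(1) B_Z[OF isub[OF N]] by blast
        note \<beta>c = Z_carr[OF \<beta>Z]
        have \<eta>'c: "\<eta>' \<in> carrier (E k)" using \<eta>'V cVN by blast
        have \<beta>V: "\<beta> \<in> VN" using \<beta>c Z_d[OF \<beta>Z] Z_T[OF \<beta>Z] E.submodule_zero[OF W(1)] unfolding VN_def V_def by simp
        \<comment> \<open>\<open>\<eta>'\<close> accounts for the finitely many generators,
          \<open>\<beta>\<close> for the boundary part. As \<open>\<beta>\<close> is itself a
          cocycle, subtracting it does not change the image under \<open>d k\<close>.\<close>
        let ?u = "(\<eta> \<ominus>\<^bsub>E k\<^esub> \<eta>') \<ominus>\<^bsub>E k\<^esub> \<beta>"
        have uVN: "?u \<in> VN"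
          using E.submodule_minus[OF sVN E.submodule_minus[OF sVN _ \<eta>'V] \<beta>V] \<eta> unfolding VN_def by blast
        have bc: "b \<in> carrier (E k)" using \<beta> \<beta>c c by auto
        have "c \<odot>\<^bsub>E k\<^esub> ?u = ((b \<oplus>\<^bsub>E k\<^esub> y) \<ominus>\<^bsub>E k\<^esub> y) \<ominus>\<^bsub>E k\<^esub> b"
          using \<eta>c \<eta>'c \<beta>c c \<beta>(2) \<eta>'(2) by'(3) by (simp add: E.smult_rminus_distr)
        also have "\<dots> = \<zero>\<^bsub>E k\<^esub>" using bc \<eta>'(2) \<eta>'c c by (simp add: E.minus_eq E.a_assoc E.r_neg)
        finally have "?u \<in> T k (gen R {\<zero>} (bs @ [c]))"
          using uVN T_adjoin[OF N c] unfolding VN_def N_def by simp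
        then have 1: "d k ?u \<in> spn R (E (Suc k)) (B (Suc k) J \<union> F0)"
          using F0(3) uVN unfolding VN_def by blast
        have 2: "d k ?u \<in> spn R (E (Suc k)) ?S"
          using E.spn_mono[of "B (Suc k) J \<union> F0" "Suc k" ?S] E.spn_mem[OF Sc] Sc 1 by blast
        have 3: "d k \<eta>' \<in> spn R (E (Suc k)) ?S"
          using spn_d_image[OF Gc \<eta>'(1)] E.spn_mono[of "d k ` G" "Suc k" ?S] E.spn_mem[OF Sc] Sc by blast
        have "d k ?u = d k \<eta> \<ominus>\<^bsub>E (Suc k)\<^esub> d k \<eta>'"
          using \<eta>c \<eta>'c \<beta>c Z_d[OF \<beta>Z] d_closed[OF \<eta>c] d_closed[OF \<eta>'c] by (simp add: d_minus) (simp add: E.minus_eq)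
        then have "d k \<eta> = d k ?u \<oplus>\<^bsub>E (Suc k)\<^esub> d k \<eta>'"
          using d_closed[OF \<eta>c] d_closed[OF \<eta>'c] by (simp add: E.minus_eq E.a_assoc E.l_neg)
        then show ?thesis using E.submodule_add[OF sS 2 3] by simp
      qed
      then show ?case using F0(1,2) G(2) dGW unfolding N_def
        by (intro exI[of _ "F0 \<union> d k ` G"]) auto
    qed
    from this[of "[]" as] obtain F where F: "finite F" "F \<subseteq> W"
      "\<And>\<eta>. \<eta> \<in> V \<inter> T k {\<zero>} \<Longrightarrow> d k \<eta> \<in> spn R (E (Suc k)) (B (Suc k) J \<union> F)" by auto
    have "W \<subseteq> spn R (E (Suc k)) (B (Suc k) J \<union> F)"
    proof
      fix w assume w: "w \<in> W"
      then have wZ: "w \<in> Z (Suc k) J" using W(2) by blast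
      then obtain \<eta> where \<eta>: "\<eta> \<in> carrier (E k)" "w = d k \<eta>" using exact[OF Z_carr[OF wZ]] Z_d[OF wZ] by blast
      then have "\<eta> \<in> V \<inter> T k {\<zero>}" using w unfolding V_def T_def by auto
      then show "w \<in> spn R (E (Suc k)) (B (Suc k) J \<union> F)" using F(3) \<eta>(2) by blast
    qed
    then show "\<exists>F. finite F \<and> F \<subseteq> W \<and> W \<subseteq> spn R (E (Suc k)) (B (Suc k) J \<union> F)"
      using F by blast
  qed
qed

text \<open>\<open>d j \<eta>\<close> is a cocycle killed by \<open>J\<close> and \<open>c\<close>.
  Its class vanishes at \<open>Q\<close>, so after a multiplier \<open>s\<close> it has a primitive
  \<open>\<eta>'\<close> killed by \<open>c\<close>, and \<open>s \<eta> - \<eta>'\<close> is a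
  cocycle with the same multiple by \<open>c\<close> as \<open>s \<eta>\<close>.\<close>

lemma ext_correct:
  assumes Q: "primeideal Q R" and J: "ideal J R" and c: "c \<in> carrier R" and \<eta>: "\<eta> \<in> T j J"
    and \<zeta>: "d j (c \<odot>\<^bsub>E j\<^esub> \<eta>) = \<zero>\<^bsub>E (Suc j)\<^esub>" and V: "ext_vanish_at Q (Suc j) (adjoin R J c)"
  obtains s v where "s \<in> carrier R - Q" "v \<in> Z j J" "c \<odot>\<^bsub>E j\<^esub> v = s \<odot>\<^bsub>E j\<^esub> (c \<odot>\<^bsub>E j\<^esub> \<eta>)"
proof -
  note sJ = isub[OF J] and \<eta>c = T_carr[OF \<eta>]
  have "d j \<eta> \<in> T (Suc j) J" using \<eta> B_Z[OF sJ, of "Suc j"] Z_T by auto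
  moreover have "c \<odot>\<^bsub>E (Suc j)\<^esub> d j \<eta> = \<zero>\<^bsub>E (Suc j)\<^esub>" using d_smult[OF c \<eta>c] \<zeta> by simp
  ultimately have "d j \<eta> \<in> Z (Suc j) (adjoin R J c)" using T_adjoin[OF J c] dd[OF \<eta>c] by (intro ZI) auto
  then obtain s where s: "s \<in> carrier R - Q" "s \<odot>\<^bsub>E (Suc j)\<^esub> d j \<eta> \<in> B (Suc j) (adjoin R J c)"
    using V unfolding ext_vanish_at_def by blast
  then obtain \<eta>' where \<eta>': "\<eta>' \<in> T j (adjoin R J c)" "s \<odot>\<^bsub>E (Suc j)\<^esub> d j \<eta> = d j \<eta>'" by auto
  have \<eta>'J: "\<eta>' \<in> T j J" "c \<odot>\<^bsub>E j\<^esub> \<eta>' = \<zero>\<^bsub>E j\<^esub>" using \<eta>'(1) T_adjoin[OF J c] by auto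
  note \<eta>'c = T_carr[OF \<eta>'(1)]
  let ?v = "s \<odot>\<^bsub>E j\<^esub> \<eta> \<ominus>\<^bsub>E j\<^esub> \<eta>'"
  have sc: "s \<in> carrier R" using s by simp
  have "d j ?v = \<zero>\<^bsub>E (Suc j)\<^esub>"
    using \<eta>'(2) sc \<eta>c \<eta>'c d_closed[OF \<eta>'c] by (simp add: d_minus d_smult) (simp add: E.minus_eq E.r_neg)
  moreover have "?v \<in> T j J"
    using E.submodule_minus[OF submodule_T[OF sJ] E.submodule_smult[OF submodule_T[OF sJ] sc \<eta>] \<eta>'J(1)] .
  ultimately have vZ: "?v \<in> Z j J" by (intro ZI)
  have "c \<odot>\<^bsub>E j\<^esub> ?v = s \<odot>\<^bsub>E j\<^esub> (c \<odot>\<^bsub>E j\<^esub> \<eta>)"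
    using sc c \<eta>c \<eta>'c \<eta>'J(2) E.smult_commute[OF c sc \<eta>c]
    by (simp add: E.smult_rminus_distr) (simp add: E.minus_eq)
  then show ?thesis using that s(1) vZ by blast
qed

text \<open>By the long exact sequence, multiplication by \<open>x\<close> is surjective on \<open>Ext^j(R/J, R)\<close> locally
  at \<open>Q\<close>, so Nakayama's lemma applies.\<close>

lemma ext_vanish_at_divisible:
  assumes Q: "primeideal Q R" and J: "ideal J R" and x: "x \<in> Q" "nonzerodivisor R J x"
    and V: "ext_vanish_at Q (Suc j) (adjoin R J x)"
  shows "ext_vanish_at Q j J"
  unfolding ext_vanish_at_def
proof
  fix \<zeta>0 assume \<zeta>0: "\<zeta>0 \<in> Z j J"
  have xc: "x \<in> carrier R" using icarr[OF prime_ideal[OF Q] x(1)] .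
  note sJ = isub[OF J]
  have "\<exists>s\<in>carrier R - Q. \<exists>v\<in>Z j J. s \<odot>\<^bsub>E j\<^esub> \<zeta> \<ominus>\<^bsub>E j\<^esub> x \<odot>\<^bsub>E j\<^esub> v \<in> B j J" if \<zeta>: "\<zeta> \<in> Z j J" for \<zeta>
  proof -
    obtain \<eta> where \<eta>: "\<eta> \<in> T j J" "x \<odot>\<^bsub>E j\<^esub> \<eta> = \<zeta>" using T_divisible[OF J xc x(2) Z_T[OF \<zeta>]] .
    obtain s v where s: "s \<in> carrier R - Q" and vZ: "v \<in> Z j J" and v: "x \<odot>\<^bsub>E j\<^esub> v = s \<odot>\<^bsub>E j\<^esub> \<zeta>"
      using ext_correct[OF Q J xc \<eta>(1) _ V] \<eta>(2) Z_d[OF \<zeta>] by auto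
    then have "s \<odot>\<^bsub>E j\<^esub> \<zeta> \<ominus>\<^bsub>E j\<^esub> x \<odot>\<^bsub>E j\<^esub> v = \<zero>\<^bsub>E j\<^esub>"
      using s Z_carr[OF \<zeta>] by (simp add: E.minus_eq E.r_neg)
    then show ?thesis using s vZ E.submodule_zero[OF submodule_B[OF sJ], of j] by (intro bexI[of _ s] bexI[of _ v]) auto
  qed
  then show "\<exists>s\<in>carrier R - Q. s \<odot>\<^bsub>E j\<^esub> \<zeta>0 \<in> B j J"
    by (rule E.nakayama_divisible[OF Q submodule_B[OF sJ] submodule_Z[OF sJ] noeth_ext[OF J] x(1) _ \<zeta>0])
qed

text \<open>Exactness of Ext in the middle for
  \<open>0 -> R/(J : a) -> R/J -> R/(J, a) -> 0\<close>.\<close>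

lemma ext_vanish_at_extension:
  assumes Q: "primeideal Q R" and J: "ideal J R" and a: "a \<in> carrier R"
    and V: "ext_vanish_at Q j (adjoin R J a)" "ext_vanish_at Q j (colon R J a)"
  shows "ext_vanish_at Q j J"
  unfolding ext_vanish_at_def
proof
  fix \<zeta> assume \<zeta>: "\<zeta> \<in> Z j J"
  note sJ = isub[OF J] and \<zeta>c = Z_carr[OF \<zeta>]
  have "a \<odot>\<^bsub>E j\<^esub> \<zeta> \<in> Z j (colon R J a)"
  proof (rule ZI)
    have "r \<odot>\<^bsub>E j\<^esub> (a \<odot>\<^bsub>E j\<^esub> \<zeta>) = \<zero>\<^bsub>E j\<^esub>" if r: "r \<in> colon R J a" for r
      using T_ann[OF Z_T[OF \<zeta>], of "r \<otimes> a"] r a \<zeta>c unfolding colon_def by (simp add: E.smult_assoc1)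
    then show "a \<odot>\<^bsub>E j\<^esub> \<zeta> \<in> T j (colon R J a)" unfolding T_def using a \<zeta>c by simp
    show "d j (a \<odot>\<^bsub>E j\<^esub> \<zeta>) = \<zero>\<^bsub>E (Suc j)\<^esub>" using d_smult[OF a \<zeta>c] Z_d[OF \<zeta>] a by simp
  qed
  then obtain s where s: "s \<in> carrier R - Q" "s \<odot>\<^bsub>E j\<^esub> (a \<odot>\<^bsub>E j\<^esub> \<zeta>) \<in> B j (colon R J a)"
    using V(2) unfolding ext_vanish_at_def by blast
  obtain b where b: "b \<in> B j J" "a \<odot>\<^bsub>E j\<^esub> b = s \<odot>\<^bsub>E j\<^esub> (a \<odot>\<^bsub>E j\<^esub> \<zeta>)" using B_colon[OF J a s(2)] .
  have bZ: "b \<in> Z j J" using b B_Z[OF sJ] by blast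
  have sc: "s \<in> carrier R" using s by simp
  let ?u = "s \<odot>\<^bsub>E j\<^esub> \<zeta> \<ominus>\<^bsub>E j\<^esub> b"
  have uZ: "?u \<in> Z j J"
    using E.submodule_minus[OF submodule_Z[OF sJ] E.submodule_smult[OF submodule_Z[OF sJ] sc \<zeta>] bZ] .
  have "a \<odot>\<^bsub>E j\<^esub> ?u = \<zero>\<^bsub>E j\<^esub>"
    using b(2) a sc \<zeta>c Z_carr[OF bZ] E.smult_commute[OF a sc \<zeta>c]
    by (simp add: E.smult_rminus_distr) (simp add: E.minus_eq E.r_neg)
  then have "?u \<in> Z j (adjoin R J a)" using T_adjoin[OF J a] Z_T[OF uZ] Z_d[OF uZ] by (intro ZI) auto
  then obtain t where t: "t \<in> carrier R - Q" "t \<odot>\<^bsub>E j\<^esub> ?u \<in> B j (adjoin R J a)"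
    using V(1) unfolding ext_vanish_at_def by blast
  have tc: "t \<in> carrier R" using t by simp
  have "t \<odot>\<^bsub>E j\<^esub> ?u \<in> B j J" using B_mono[OF adjoin_sub[OF J a]] t by blast
  then have "t \<odot>\<^bsub>E j\<^esub> ?u \<oplus>\<^bsub>E j\<^esub> t \<odot>\<^bsub>E j\<^esub> b \<in> B j J"
    using E.submodule_add[OF submodule_B[OF sJ]] E.submodule_smult[OF submodule_B[OF sJ] tc b(1)] by blast
  moreover have "t \<odot>\<^bsub>E j\<^esub> ?u \<oplus>\<^bsub>E j\<^esub> t \<odot>\<^bsub>E j\<^esub> b = (t \<otimes> s) \<odot>\<^bsub>E j\<^esub> \<zeta>"
    using tc sc \<zeta>c Z_carr[OF bZ]
    by (simp add: E.smult_rminus_distr E.smult_assoc1) (simp add: E.minus_eq E.a_assoc E.l_neg)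
  ultimately show "\<exists>s\<in>carrier R - Q. s \<odot>\<^bsub>E j\<^esub> \<zeta> \<in> B j J"
    using prime_mult_notin[OF Q t(1) s(1)] by auto
qed

text \<open>Multiplication by \<open>w\<close> embeds \<open>R/Q\<close> into \<open>R/N\<close>
  with cokernel \<open>R/(N, w)\<close>, so at \<open>Q\<close> the map from
  \<open>Ext^j(R/N, R)\<close> to \<open>Ext^j(R/Q, R)\<close> is surjective.\<close>

lemma ext_vanish_at_assoc:
  assumes N: "ideal N R" and w: "primeideal Q R" "w \<in> carrier R" "Q = colon R N w"
    and V: "ext_vanish j N" and V': "ext_vanish_at Q (Suc j) (adjoin R N w)"
  shows "ext_vanish_at Q j Q"
  unfolding ext_vanish_at_def
proof
  fix \<zeta> assume \<zeta>: "\<zeta> \<in> Z j Q"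
  note sN = isub[OF N] and \<zeta>c = Z_carr[OF \<zeta>]
  have NQ: "N \<subseteq> Q" using colon_sub[OF N w(2)] w(3) by simp
  have iQ: "ideal Q R" using prime_ideal[OF w(1)] .
  obtain \<eta> where \<eta>: "\<eta> \<in> T j N" "w \<odot>\<^bsub>E j\<^esub> \<eta> = \<zeta>"
  proof (rule cyclic_ext[OF N w(2) \<zeta>c])
    show "r \<odot>\<^bsub>E j\<^esub> \<zeta> = \<zero>\<^bsub>E j\<^esub>" if "r \<in> carrier R" "r \<otimes> w \<in> N" for r
      using T_ann[OF Z_T[OF \<zeta>], of r] w(3) that unfolding colon_def by simp
  qed
  obtain s v where s: "s \<in> carrier R - Q" and vZ: "v \<in> Z j N" and wv: "w \<odot>\<^bsub>E j\<^esub> v = s \<odot>\<^bsub>E j\<^esub> \<zeta>"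
    using ext_correct[OF w(1) N w(2) \<eta>(1) _ V'] \<eta>(2) Z_d[OF \<zeta>] by auto
  have "v \<in> B j N" using vZ V unfolding ext_vanish_def by blast
  moreover have "w \<odot>\<^bsub>E j\<^esub> v \<in> B j Q" if v: "v \<in> B j N" for v
  proof (cases j)
    case 0 then show ?thesis using v w(2) by simp
  next
    case (Suc k)
    then obtain \<theta> where \<theta>: "\<theta> \<in> T k N" "v = d k \<theta>" using v by auto
    have "q \<odot>\<^bsub>E k\<^esub> (w \<odot>\<^bsub>E k\<^esub> \<theta>) = \<zero>\<^bsub>E k\<^esub>" if q: "q \<in> Q" for q
      using T_ann[OF \<theta>(1), of "q \<otimes> w"] q w(2,3) T_carr[OF \<theta>(1)] unfolding colon_def by (simp add: E.smult_assoc1)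
    then have "w \<odot>\<^bsub>E k\<^esub> \<theta> \<in> T k Q" unfolding T_def using w(2) T_carr[OF \<theta>(1)] by simp
    then show ?thesis using \<theta>(2) d_smult[OF w(2) T_carr[OF \<theta>(1)]] Suc by (auto intro!: rev_image_eqI)
  qed
  ultimately show "\<exists>s\<in>carrier R - Q. s \<odot>\<^bsub>E j\<^esub> \<zeta> \<in> B j Q" using s wv by metis
qed

lemma ext_vanish_at_notsub:
  assumes J: "ideal J R" and "\<not> J \<subseteq> Q" shows "ext_vanish_at Q j J"
  unfolding ext_vanish_at_def
proof
  obtain s where s: "s \<in> J" "s \<notin> Q" using assms by blast
  fix \<zeta> assume "\<zeta> \<in> Z j J"
  then have "s \<odot>\<^bsub>E j\<^esub> \<zeta> \<in> B j J" using T_ann[OF Z_T s(1)] E.submodule_zero[OF submodule_B[OF isub[OF J]]] by simp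
  then show "\<exists>s\<in>carrier R - Q. s \<odot>\<^bsub>E j\<^esub> \<zeta> \<in> B j J" using s icarr[OF J s(1)] by blast
qed

text \<open>Locally at an associated prime of \<open>N\<close> the ring \<open>R\<close> has injective dimension at most \<open>g\<close>.
  The finiteness of the resolution starts a downward induction on \<open>j\<close>.\<close>

lemma ext_vanish_at_all:
  assumes N: "ideal N R" and w: "primeideal Q R" "w \<in> carrier R" "Q = colon R N w"
    and V: "\<And>j. j > g \<Longrightarrow> ext_vanish j N"
  shows "j > g \<Longrightarrow> ideal J R \<Longrightarrow> ext_vanish_at Q j J"
proof (induction "Suc len - j" arbitrary: j J)
  case 0
  then have j: "j > len" by simp
  have "\<zeta> \<in> B j J" if "\<zeta> \<in> Z j J" for \<zeta>
    using Z_carr[OF that] vanish[OF j] E.submodule_zero[OF submodule_B[OF isub[OF 0(3)]]] by simp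
  then have "\<one> \<odot>\<^bsub>E j\<^esub> \<zeta> \<in> B j J" if "\<zeta> \<in> Z j J" for \<zeta> using that Z_carr[OF that] by simp
  then show ?case unfolding ext_vanish_at_def using prime_one[OF w(1)] one_closed by blast
next
  case (Suc m)
  then have m: "m = Suc len - Suc j" and gj: "g < Suc j" by auto
  have IH: "ext_vanish_at Q (Suc j) J'" if "ideal J' R" for J'
    using Suc.hyps(1)[OF m gj that] .
  from \<open>ideal J R\<close> show ?case
  proof (induction rule: noeth_induct)
    case (step J)
    note J = step(1)
    \<comment> \<open>A prime filtration of \<open>R/J\<close> in the form of Noetherian induction.
      Primes strictly inside \<open>Q\<close> are handled by an element of \<open>Q\<close> outside
      \<open>J\<close>, which shifts the question to degree \<open>j + 1\<close>.\<close>
    consider "\<not> J \<subseteq> Q" | "J = Q" | "J \<subset> Q" "primeideal J R" | "J \<subset> Q" "\<not> primeideal J R" by blast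
    then show ?case
    proof cases
      case 1 then show ?thesis by (rule ext_vanish_at_notsub[OF J])
    next
      case 2
      then show ?thesis using ext_vanish_at_assoc[OF N w V[OF \<open>g < j\<close>] IH[OF ideal_adjoin[OF N w(2)]]] by simp
    next
      case 3
      then obtain x where x: "x \<in> Q" "x \<notin> J" by blast
      have xc: "x \<in> carrier R" using icarr[OF prime_ideal[OF w(1)] x(1)] .
      have "nonzerodivisor R J x"
        unfolding nonzerodivisor_def using prime_mult[OF 3(2) xc] x(2) xc by (auto simp: m_comm)
      then show ?thesis using ext_vanish_at_divisible[OF w(1) J x(1) _ IH[OF ideal_adjoin[OF J xc]]] by simp
    next
      case 4
      have "carrier R \<noteq> J" using 4(1) prime_one[OF w(1)] by auto
      then obtain a b where ab: "a \<in> carrier R" "b \<in> carrier R" "a \<otimes> b \<in> J" "a \<notin> J" "b \<notin> J"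
        using 4(2) primeidealI[OF J is_cring] by blast
      have "b \<in> colon R J a" using ab unfolding colon_def by (simp add: m_comm)
      then have "J \<subset> colon R J a" using colon_sub[OF J ab(1)] ab(5) by blast
      moreover have "J \<subset> adjoin R J a" using adjoin_sub[OF J ab(1)] adjoin_mem[OF J ab(1)] ab(4) by blast
      ultimately show ?thesis
        using ext_vanish_at_extension[OF w(1) J ab(1)] step(2) ideal_adjoin[OF J ab(1)] ideal_colon[OF J ab(1)] by blast
    qed
  qed
qed

end

section \<open>Regular sequences in a ring of finite injective dimension\<close>

context injres begin

text \<open>For an ideal \<open>P\<close> of height \<open>h\<close> in a local Gorenstein ring this
  characterizes Cohen-Macaulay quotients \<open>R/P\<close>. In this form the property passes to
  links and to quotients modulo regular elements.\<close>

definition ext_bound :: "nat \<Rightarrow> 'a set \<Rightarrow> bool" where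
  "ext_bound h P \<longleftrightarrow> (\<forall>j>h. ext_vanish j P)"

lemma ideal_ci: "reg R {\<zero>} xs \<Longrightarrow> ideal (ci xs) R"
  using ideal_gen[OF zeroideal reg_carrier] .

lemma ext_bound_ci: "reg R {\<zero>} xs \<Longrightarrow> ext_bound (length xs) (ci xs)"
  using ext_gen_reg(2) unfolding ext_bound_def by blast

lemma ext_bound_adjoin:
  assumes "ideal N R" "x \<in> carrier R" "nonzerodivisor R N x" "ext_bound h N"
  shows "ext_bound (Suc h) (adjoin R N x)"
  unfolding ext_bound_def
proof (intro allI impI)
  fix j assume "Suc h < j"
  then obtain k where "j = Suc k" "h < k" by (cases j) auto
  then show "ext_vanish j (adjoin R N x)"
    using ext_vanish_adjoin[OF assms(1-3), of k] assms(4) unfolding ext_bound_def by simp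
qed

lemma ext_bound_at:
  assumes N: "ideal N R" "ext_bound h N" and Q: "Q \<in> associated_primes R N" and "j > h" "ideal J R"
  shows "ext_vanish_at Q j J"
proof -
  obtain w where w: "primeideal Q R" "w \<in> carrier R" "Q = colon R N w" using Q by (rule assoc_primesE)
  show ?thesis using ext_vanish_at_all[OF N(1) w, of h] assms(2,4,5) unfolding ext_bound_def by blast
qed

text \<open>For a longer sequence \<open>ys\<close> the module
  \<open>Ext^(length ys)(R/(ys), R)\<close> would vanish at \<open>Q\<close>, yet it is a copy of
  \<open>R/(ys)\<close> and \<open>(ys)\<close> lies in \<open>Q\<close>.\<close>

lemma reg_length_le:
  assumes xs: "reg R {\<zero>} xs" and Q: "Q \<in> associated_primes R (ci xs)"
    and ys: "reg R {\<zero>} ys" "set ys \<subseteq> Q"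
  shows "length ys \<le> length xs"
proof (rule ccontr)
  assume "\<not> ?thesis"
  then have "ext_vanish_at Q (length ys) (ci ys)"
    using ext_bound_at[OF ideal_ci[OF xs] ext_bound_ci[OF xs] Q _ ideal_ci[OF ys(1)]] by simp
  moreover obtain z where z: "ext_gen (ci ys) (length ys) z" using ext_gen_reg(1)[OF ys(1)] by blast
  ultimately obtain s where s: "s \<in> carrier R - Q" "s \<odot>\<^bsub>E (length ys)\<^esub> z \<in> B (length ys) (ci ys)"
    unfolding ext_vanish_at_def ext_gen_def by blast
  then have "s \<in> ci ys" using z unfolding ext_gen_def by blast
  moreover have "ci ys \<subseteq> Q"
    using izero[OF prime_ideal[OF assoc_prime[OF Q]]] ys(2) by (intro gen_least prime_ideal[OF assoc_prime[OF Q]]) auto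
  ultimately show False using s by blast
qed

text \<open>Self-injectivity of \<open>R/(xs)\<close> at \<open>Q\<close> in terms of elements: the
  map from \<open>R/(J : c)\<close> to \<open>R/(xs)\<close> sending \<open>1\<close> to
  \<open>w\<close> extends, up to the multiplier \<open>s\<close>, along multiplication by
  \<open>c\<close> to a map from \<open>R/J\<close> sending \<open>1\<close> to
  \<open>u\<close>.\<close>

lemma self_injective_at:
  assumes xs: "reg R {\<zero>} xs" and Q: "Q \<in> associated_primes R (ci xs)"
    and J: "ideal J R" "ci xs \<subseteq> J" and c: "c \<in> carrier R" and w: "w \<in> carrier R"
    and H: "\<And>r. r \<in> carrier R \<Longrightarrow> r \<otimes> c \<in> J \<Longrightarrow> r \<otimes> w \<in> ci xs"
  obtains s u where "s \<in> carrier R - Q" "u \<in> carrier R" "\<And>a. a \<in> J \<Longrightarrow> a \<otimes> u \<in> ci xs"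
    "s \<otimes> w \<ominus> c \<otimes> u \<in> ci xs"
proof -
  let ?g = "length xs" and ?\<alpha> = "ci xs"
  note A = ideal_ci[OF xs] and sB = submodule_B[OF isub[OF ideal_ci[OF xs]], of ?g]
  obtain z where z: "ext_gen ?\<alpha> ?g z" using ext_gen_reg(1)[OF xs] by blast
  then have zZ: "z \<in> Z ?g ?\<alpha>" unfolding ext_gen_def by simp
  note zc = Z_carr[OF zZ]
  have ann: "r \<in> ?\<alpha>" if "r \<in> carrier R" "r \<odot>\<^bsub>E ?g\<^esub> z \<in> B ?g ?\<alpha>" for r
    using z that unfolding ext_gen_def by simp
  have wzc: "w \<odot>\<^bsub>E ?g\<^esub> z \<in> carrier (E ?g)" using w zc by simp
  obtain \<eta> where \<eta>: "\<eta> \<in> T ?g J" "c \<odot>\<^bsub>E ?g\<^esub> \<eta> = w \<odot>\<^bsub>E ?g\<^esub> z"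
  proof (rule cyclic_ext[OF J(1) c wzc])
    show "r \<odot>\<^bsub>E ?g\<^esub> (w \<odot>\<^bsub>E ?g\<^esub> z) = \<zero>\<^bsub>E ?g\<^esub>" if "r \<in> carrier R" "r \<otimes> c \<in> J" for r
      using T_ann[OF Z_T[OF zZ] H[OF that]] that w zc by (simp add: E.smult_assoc1)
  qed
  have dz: "d ?g (c \<odot>\<^bsub>E ?g\<^esub> \<eta>) = \<zero>\<^bsub>E (Suc ?g)\<^esub>" unfolding \<eta>(2) using d_smult[OF w zc] Z_d[OF zZ] w by simp
  obtain s v where s: "s \<in> carrier R - Q" "v \<in> Z ?g J" "c \<odot>\<^bsub>E ?g\<^esub> v = s \<odot>\<^bsub>E ?g\<^esub> (c \<odot>\<^bsub>E ?g\<^esub> \<eta>)"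
    by (rule ext_correct[OF assoc_prime[OF Q] J(1) c \<eta>(1) dz
      ext_bound_at[OF A ext_bound_ci[OF xs] Q lessI ideal_adjoin[OF J(1) c]]])
  have sc: "s \<in> carrier R" using s by simp
  note vc = Z_carr[OF s(2)]
  have "v \<in> Z ?g ?\<alpha>" using Z_mono[OF J(2)] s(2) by blast
  then obtain u where u: "u \<in> carrier R" "v \<ominus>\<^bsub>E ?g\<^esub> u \<odot>\<^bsub>E ?g\<^esub> z \<in> B ?g ?\<alpha>" using z unfolding ext_gen_def by blast
  have "a \<otimes> u \<in> ?\<alpha>" if a: "a \<in> J" for a
  proof -
    have ac: "a \<in> carrier R" using icarr[OF J(1) a] .
    have "a \<odot>\<^bsub>E ?g\<^esub> (v \<ominus>\<^bsub>E ?g\<^esub> u \<odot>\<^bsub>E ?g\<^esub> z) = (\<ominus> (a \<otimes> u)) \<odot>\<^bsub>E ?g\<^esub> z"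
      using ac u(1) vc zc T_ann[OF Z_T[OF s(2)] a]
      by (simp add: E.smult_rminus_distr E.smult_l_minus E.smult_assoc1) (simp add: E.minus_eq)
    then have "\<ominus> (a \<otimes> u) \<in> ?\<alpha>" using ann[of "\<ominus> (a \<otimes> u)"] E.submodule_smult[OF sB ac u(2)] ac u(1) by simp
    then show ?thesis using ineg[OF A, of "\<ominus> (a \<otimes> u)"] ac u(1) by simp
  qed
  moreover have "s \<otimes> w \<ominus> c \<otimes> u \<in> ?\<alpha>"
  proof (rule ann)
    have "c \<odot>\<^bsub>E ?g\<^esub> (v \<ominus>\<^bsub>E ?g\<^esub> u \<odot>\<^bsub>E ?g\<^esub> z) = (s \<otimes> w \<ominus> c \<otimes> u) \<odot>\<^bsub>E ?g\<^esub> z"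
      using c w sc u(1) vc zc s(3) \<eta>(2)
      by (simp add: E.smult_rminus_distr E.smult_minus_distr E.smult_assoc1)
    then show "(s \<otimes> w \<ominus> c \<otimes> u) \<odot>\<^bsub>E ?g\<^esub> z \<in> B ?g ?\<alpha>" using E.submodule_smult[OF sB c u(2)] by simp
  qed (use sc w c u in auto)
  ultimately show ?thesis using that s(1) u(1) by blast
qed

lemma colon_power_stable:
  assumes N: "ideal N R" and b: "b \<in> carrier R"
  obtains n :: nat where "colon R N (b [^] Suc n) = colon R N (b [^] n)"
proof -
  define F where "F = range (\<lambda>n :: nat. colon R N (b [^] n))"
  have ne: "F \<noteq> {}" unfolding F_def by simp
  have idl: "ideal J R" if "J \<in> F" for J using that ideal_colon[OF N nat_pow_closed[OF b]] unfolding F_def by auto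
  obtain I where "I \<in> F" and mx: "\<forall>J\<in>F. I \<subseteq> J \<longrightarrow> J = I"
    using noeth_maximal_ex[OF ne idl] by (rule bexE)
  then have I: "I \<in> F" "\<And>J. J \<in> F \<Longrightarrow> I \<subseteq> J \<Longrightarrow> J = I" by simp_all
  then obtain n :: nat where n: "I = colon R N (b [^] n)" unfolding F_def by auto
  have "colon R N (b [^] n) \<subseteq> colon R N (b [^] Suc n)"
    using colon_mult_mono[OF N b, of "b [^] n"] b by (simp add: m_comm)
  then have "colon R N (b [^] Suc n) = colon R N (b [^] n)" using I(2)[of "colon R N (b [^] Suc n)"] n unfolding F_def by blast
  then show ?thesis using that by blast
qed

text \<open>Once \<open>(xs) : b^n\<close> has stabilized, self-injectivity gives
  \<open>s b^n = b^(n+1) u\<close> modulo \<open>(xs)\<close>, and \<open>s - b u\<close> is a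
  multiplier outside \<open>Q\<close> that kills \<open>b^n\<close>.\<close>

lemma assoc_ci_nilpotent:
  assumes xs: "reg R {\<zero>} xs" and Q: "Q \<in> associated_primes R (ci xs)" and b: "b \<in> Q"
  obtains s n where "s \<in> carrier R - Q" "s \<otimes> b [^] (n :: nat) \<in> ci xs"
proof -
  note A = ideal_ci[OF xs] and Qp = assoc_prime[OF Q]
  have bc: "b \<in> carrier R" using icarr[OF prime_ideal[OF Qp] b] .
  obtain n :: nat where n: "colon R (ci xs) (b [^] Suc n) = colon R (ci xs) (b [^] n)"
    using colon_power_stable[OF A bc] .
  obtain s u where su: "s \<in> carrier R - Q" "u \<in> carrier R" "s \<otimes> b [^] n \<ominus> b [^] Suc n \<otimes> u \<in> ci xs"
  proof (rule self_injective_at[OF xs Q A subset_refl, of "b [^] Suc n" "b [^] n"])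
    show "r \<otimes> b [^] n \<in> ci xs" if "r \<in> carrier R" "r \<otimes> b [^] Suc n \<in> ci xs" for r
      using n that unfolding colon_def by blast
  qed (use bc in auto)
  have "s \<otimes> b [^] n \<ominus> b [^] Suc n \<otimes> u = (s \<ominus> b \<otimes> u) \<otimes> b [^] n"
  proof -
    have "b [^] n \<in> carrier R" using bc by simp
    then show ?thesis using su(1,2) bc by (simp, algebra)
  qed
  moreover have "s \<ominus> b \<otimes> u \<in> carrier R - Q"
    using prime_minus_notin[OF Qp su(1) imultr[OF prime_ideal[OF Qp] b su(2)]] .
  ultimately show ?thesis using that su(3) by metis
qed

lemma prime_pow:
  assumes "primeideal P R" "b \<in> carrier R" "b [^] (n :: nat) \<in> P" shows "b \<in> P"
  using assms(3)
proof (induction n)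
  case 0 then show ?case using prime_one[OF assms(1)] by simp
next
  case (Suc n)
  then have "b [^] n \<otimes> b \<in> P" by simp
  then show ?case using Suc.IH prime_mult[OF assms(1), of "b [^] n" b] assms(2) by auto
qed

text \<open>Complete intersections have no embedded primes: locally at \<open>Q\<close> the elements
  of \<open>Q\<close> are nilpotent modulo \<open>(xs)\<close>.\<close>

lemma assoc_ci_minimal:
  assumes xs: "reg R {\<zero>} xs" and Q: "Q \<in> associated_primes R (ci xs)"
    and P: "primeideal P R" "ci xs \<subseteq> P" "P \<subseteq> Q"
  shows "P = Q"
proof
  show "Q \<subseteq> P"
  proof
    fix b assume b: "b \<in> Q"
    obtain s and n :: nat where s: "s \<in> carrier R - Q" "s \<otimes> b [^] n \<in> ci xs"
      using assoc_ci_nilpotent[OF xs Q b] .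
    have bc: "b \<in> carrier R" using icarr[OF prime_ideal[OF assoc_prime[OF Q]] b] .
    have "b [^] n \<in> P" using prime_mult[OF P(1), of s "b [^] n"] s P(2,3) bc by auto
    then show "b \<in> P" by (rule prime_pow[OF P(1) bc])
  qed
qed (rule P(3))

text \<open>The obstruction to extending a homomorphism \<open>P/(xs) -> R/(xs)\<close> to all of
  \<open>R\<close> lies in \<open>Ext^1(R/P, R/(xs))\<close> over \<open>R/(xs)\<close>, which is
  \<open>Ext^(g+1)(R/P, R)\<close> for \<open>g = length xs\<close>.\<close>

lemma hom_extends:
  assumes xs: "reg R {\<zero>} xs" and P: "ideal P R" "ci xs \<subseteq> P" and V: "ext_bound (length xs) P"
    and f: "\<And>p. p \<in> P \<Longrightarrow> f p \<in> carrier R"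
    "\<And>p q. p \<in> P \<Longrightarrow> q \<in> P \<Longrightarrow> f (p \<oplus> q) \<ominus> (f p \<oplus> f q) \<in> ci xs"
    "\<And>r p. r \<in> carrier R \<Longrightarrow> p \<in> P \<Longrightarrow> f (r \<otimes> p) \<ominus> r \<otimes> f p \<in> ci xs"
    "\<And>a. a \<in> ci xs \<Longrightarrow> f a \<in> ci xs"
  obtains u where "u \<in> carrier R" "\<And>p. p \<in> P \<Longrightarrow> f p \<ominus> p \<otimes> u \<in> ci xs"
proof -
  let ?g = "length xs" and ?\<alpha> = "ci xs"
  note A = ideal_ci[OF xs] and sB = submodule_B[OF isub[OF ideal_ci[OF xs]], of ?g]
  obtain z where z: "ext_gen ?\<alpha> ?g z" using ext_gen_reg(1)[OF xs] by blast
  then have zZ: "z \<in> Z ?g ?\<alpha>" unfolding ext_gen_def by simp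
  note zc = Z_carr[OF zZ]
  have ann: "r \<in> ?\<alpha>" if "r \<in> carrier R" "r \<odot>\<^bsub>E ?g\<^esub> z \<in> B ?g ?\<alpha>" for r
    using z that unfolding ext_gen_def by simp
  have eq: "a \<odot>\<^bsub>E ?g\<^esub> z = b \<odot>\<^bsub>E ?g\<^esub> z" if "a \<in> carrier R" "b \<in> carrier R" "a \<ominus> b \<in> ?\<alpha>" for a b
    using smult_eqI[OF that(1,2) zc T_ann[OF Z_T[OF zZ] that(3)]] .
  \<comment> \<open>Multiplication into \<open>z\<close> carries \<open>R/(xs)\<close> to
    \<open>E ?g\<close>; there Baer's criterion extends the composite with \<open>f\<close>.\<close>
  have "\<exists>\<eta>\<in>carrier (E ?g). \<forall>p\<in>P. f p \<odot>\<^bsub>E ?g\<^esub> z = p \<odot>\<^bsub>E ?g\<^esub> \<eta>"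
  proof (rule hom_ext[OF P(1)])
    show "f p \<odot>\<^bsub>E ?g\<^esub> z \<in> carrier (E ?g)" if "p \<in> P" for p using f(1)[OF that] zc by simp
    show "f (p \<oplus> q) \<odot>\<^bsub>E ?g\<^esub> z = f p \<odot>\<^bsub>E ?g\<^esub> z \<oplus>\<^bsub>E ?g\<^esub> f q \<odot>\<^bsub>E ?g\<^esub> z" if "p \<in> P" "q \<in> P" for p q
      using eq[OF f(1)[OF iadd[OF P(1) that]] _ f(2)[OF that]] f(1) that zc by (simp add: E.smult_l_distr)
    show "f (r \<otimes> p) \<odot>\<^bsub>E ?g\<^esub> z = r \<odot>\<^bsub>E ?g\<^esub> (f p \<odot>\<^bsub>E ?g\<^esub> z)" if "r \<in> carrier R" "p \<in> P" for r p
      using eq[OF f(1)[OF imult[OF P(1) that(2,1)]] _ f(3)[OF that]] f(1) that zc by (simp add: E.smult_assoc1)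
  qed
  then obtain \<eta> where \<eta>: "\<eta> \<in> carrier (E ?g)" "\<And>p. p \<in> P \<Longrightarrow> p \<odot>\<^bsub>E ?g\<^esub> \<eta> = f p \<odot>\<^bsub>E ?g\<^esub> z" by fastforce
  have \<eta>T: "\<eta> \<in> T ?g ?\<alpha>"
    using \<eta> T_ann[OF Z_T[OF zZ]] f(4) P(2) unfolding T_def by auto
  have "d ?g \<eta> \<in> Z (Suc ?g) P"
  proof (rule ZI[OF _ dd[OF \<eta>(1)]])
    have "p \<odot>\<^bsub>E (Suc ?g)\<^esub> d ?g \<eta> = \<zero>\<^bsub>E (Suc ?g)\<^esub>" if p: "p \<in> P" for p
      using d_smult[OF icarr[OF P(1) p] \<eta>(1)] \<eta>(2)[OF p] d_smult[OF f(1)[OF p] zc] Z_d[OF zZ] f(1)[OF p] by simp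
    then show "d ?g \<eta> \<in> T (Suc ?g) P" using d_closed[OF \<eta>(1)] unfolding T_def by simp
  qed
  then have "d ?g \<eta> \<in> B (Suc ?g) P" using V unfolding ext_bound_def ext_vanish_def by blast
  then obtain \<eta>' where \<eta>': "\<eta>' \<in> T ?g P" "d ?g \<eta> = d ?g \<eta>'" by auto
  note \<eta>'c = T_carr[OF \<eta>'(1)]
  \<comment> \<open>\<open>d ?g \<eta>\<close> is a cocycle over \<open>P\<close> and, by the Ext
    bound, has a primitive \<open>\<eta>'\<close> killed by \<open>P\<close>. Subtracting it gives a
    cocycle over \<open>(xs)\<close> without changing the products with elements of
    \<open>P\<close>.\<close>
  let ?v = "\<eta> \<ominus>\<^bsub>E ?g\<^esub> \<eta>'"
  have "?v \<in> Z ?g ?\<alpha>"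
  proof (rule ZI)
    show "?v \<in> T ?g ?\<alpha>"
      using E.submodule_minus[OF submodule_T[OF isub[OF A]] \<eta>T] \<eta>'(1) T_mono[OF P(2)] by blast
    show "d ?g ?v = \<zero>\<^bsub>E (Suc ?g)\<^esub>"
      using \<eta>(1) \<eta>'c \<eta>'(2) d_closed[OF \<eta>'c] by (simp add: d_minus) (simp add: E.minus_eq E.r_neg)
  qed
  then obtain u where u: "u \<in> carrier R" "?v \<ominus>\<^bsub>E ?g\<^esub> u \<odot>\<^bsub>E ?g\<^esub> z \<in> B ?g ?\<alpha>" using z unfolding ext_gen_def by blast
  have "f p \<ominus> p \<otimes> u \<in> ?\<alpha>" if p: "p \<in> P" for p
  proof (rule ann)
    have pc: "p \<in> carrier R" using icarr[OF P(1) p] .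
    have "p \<odot>\<^bsub>E ?g\<^esub> ?v = f p \<odot>\<^bsub>E ?g\<^esub> z"
      using pc \<eta> \<eta>'c T_ann[OF \<eta>'(1) p] p zc f(1)[OF p] by (simp add: E.smult_rminus_distr) (simp add: E.minus_eq)
    then have "p \<odot>\<^bsub>E ?g\<^esub> (?v \<ominus>\<^bsub>E ?g\<^esub> u \<odot>\<^bsub>E ?g\<^esub> z) = (f p \<ominus> p \<otimes> u) \<odot>\<^bsub>E ?g\<^esub> z"
      using pc u(1) \<eta>(1) \<eta>'c zc f(1)[OF p]
      by (simp add: E.smult_rminus_distr E.smult_minus_distr E.smult_assoc1)
    then show "(f p \<ominus> p \<otimes> u) \<odot>\<^bsub>E ?g\<^esub> z \<in> B ?g ?\<alpha>" using E.submodule_smult[OF sB pc u(2)] by simp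
  qed (use f(1)[OF p] icarr[OF P(1) p] u(1) in simp)
  then show ?thesis using that u(1) by blast
qed

text \<open>For \<open>p\<close> in \<open>P\<close> write \<open>v p = f p y\<close> modulo
  \<open>(xs)\<close>. As \<open>y\<close> is regular, \<open>f\<close> is a homomorphism modulo
  \<open>(xs)\<close>, hence multiplication by some \<open>u\<close>, and \<open>v - u y\<close>
  multiplies \<open>P\<close> into \<open>(xs)\<close>.\<close>

lemma colon_adjoin_lift:
  assumes xs: "reg R {\<zero>} xs" and P: "ideal P R" "ci xs \<subseteq> P" and V: "ext_bound (length xs) P"
    and y: "y \<in> carrier R" "nonzerodivisor R (ci xs) y"
    and v: "v \<in> ideal_colon R (adjoin R (ci xs) y) P"
  obtains u where "u \<in> carrier R" "v \<ominus> u \<otimes> y \<in> ideal_colon R (ci xs) P"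
proof -
  let ?\<alpha> = "ci xs"
  note A = ideal_ci[OF xs]
  have vc: "v \<in> carrier R" using v unfolding ideal_colon_def by simp
  define f where "f p = (SOME w. w \<in> carrier R \<and> v \<otimes> p \<ominus> w \<otimes> y \<in> ?\<alpha>)" for p
  have f: "f p \<in> carrier R \<and> v \<otimes> p \<ominus> f p \<otimes> y \<in> ?\<alpha>" if p: "p \<in> P" for p
    unfolding f_def
  proof (rule someI_ex)
    obtain n w where n: "n \<in> ?\<alpha>" "w \<in> carrier R" "v \<otimes> p = n \<oplus> w \<otimes> y"
      using ideal_colonD[OF v p] by (rule adjoinE)
    have "n \<in> carrier R" using icarr[OF A n(1)] .
    then have "v \<otimes> p \<ominus> w \<otimes> y = n" unfolding n(3) using n(2) y by algebra
    then show "\<exists>w. w \<in> carrier R \<and> v \<otimes> p \<ominus> w \<otimes> y \<in> ?\<alpha>" using n by auto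
  qed
  have cancel: "a \<in> ?\<alpha>" if "a \<in> carrier R" "a \<otimes> y \<in> ?\<alpha>" for a using nonzerodivisorD[OF y(2) that] .
  obtain u where u: "u \<in> carrier R" "\<And>p. p \<in> P \<Longrightarrow> f p \<ominus> p \<otimes> u \<in> ?\<alpha>"
  proof (rule hom_extends[OF xs P V, of f])
    show "f p \<in> carrier R" if "p \<in> P" for p using f[OF that] by simp
    show "f (p \<oplus> q) \<ominus> (f p \<oplus> f q) \<in> ?\<alpha>" if p: "p \<in> P" "q \<in> P" for p q
    proof (rule cancel)
      have c: "f (p \<oplus> q) \<in> carrier R" "f p \<in> carrier R" "f q \<in> carrier R" "p \<in> carrier R" "q \<in> carrier R"
        using f iadd[OF P(1) p] p icarr[OF P(1)] by auto
      then show "f (p \<oplus> q) \<ominus> (f p \<oplus> f q) \<in> carrier R" by simp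
      have "(f (p \<oplus> q) \<ominus> (f p \<oplus> f q)) \<otimes> y =
        ((v \<otimes> p \<ominus> f p \<otimes> y) \<oplus> (v \<otimes> q \<ominus> f q \<otimes> y)) \<ominus> (v \<otimes> (p \<oplus> q) \<ominus> f (p \<oplus> q) \<otimes> y)"
        using c vc y by algebra
      then show "(f (p \<oplus> q) \<ominus> (f p \<oplus> f q)) \<otimes> y \<in> ?\<alpha>"
        using f p iadd[OF P(1) p] iadd[OF A] iminus[OF A] by simp
    qed
    show "f (r \<otimes> p) \<ominus> r \<otimes> f p \<in> ?\<alpha>" if r: "r \<in> carrier R" and p: "p \<in> P" for r p
    proof (rule cancel)
      have c: "f (r \<otimes> p) \<in> carrier R" "f p \<in> carrier R" "p \<in> carrier R"
        using f imult[OF P(1) p r] p icarr[OF P(1)] by auto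
      then show "f (r \<otimes> p) \<ominus> r \<otimes> f p \<in> carrier R" using r by simp
      have "(f (r \<otimes> p) \<ominus> r \<otimes> f p) \<otimes> y = r \<otimes> (v \<otimes> p \<ominus> f p \<otimes> y) \<ominus> (v \<otimes> (r \<otimes> p) \<ominus> f (r \<otimes> p) \<otimes> y)"
        using c vc y r by algebra
      then show "(f (r \<otimes> p) \<ominus> r \<otimes> f p) \<otimes> y \<in> ?\<alpha>"
        using f p imult[OF P(1) p r] imult[OF A _ r] iminus[OF A] by simp
    qed
    show "f a \<in> ?\<alpha>" if a: "a \<in> ?\<alpha>" for a
    proof (rule cancel)
      have aP: "a \<in> P" using a P by blast
      have c: "f a \<in> carrier R" "a \<in> carrier R" using f[OF aP] icarr[OF A a] by auto
      then show "f a \<in> carrier R" by simp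
      have "v \<otimes> a \<ominus> (v \<otimes> a \<ominus> f a \<otimes> y) = f a \<otimes> y" using c vc y by algebra
      then show "f a \<otimes> y \<in> ?\<alpha>" using iminus[OF A imult[OF A a vc] conjunct2[OF f[OF aP]]] by simp
    qed
  qed blast
  have "(v \<ominus> u \<otimes> y) \<otimes> p \<in> ?\<alpha>" if p: "p \<in> P" for p
  proof -
    have c: "f p \<in> carrier R" "p \<in> carrier R" using f[OF p] icarr[OF P(1) p] by auto
    have "(v \<ominus> u \<otimes> y) \<otimes> p = (v \<otimes> p \<ominus> f p \<otimes> y) \<oplus> (f p \<ominus> p \<otimes> u) \<otimes> y" using c vc y u(1) by algebra
    then show ?thesis using f[OF p] imultr[OF A u(2)[OF p] y(1)] iadd[OF A] by simp
  qed
  then show ?thesis using that[OF u(1)] vc u(1) y unfolding ideal_colon_def by simp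
qed

text \<open>\<open>R/Q\<close> embeds into both \<open>R/P\<close> and \<open>R/(ys)\<close>. The
  nonzero class \<open>w z\<close> over \<open>Q\<close> extends near \<open>Q\<close> to a class
  over \<open>P\<close>, so \<open>Ext^(length ys)(R/P, R)\<close> cannot vanish.\<close>

lemma ext_bound_assoc_le:
  assumes P: "ideal P R" "ext_bound h P" and Q: "Q \<in> associated_primes R P"
    and ys: "reg R {\<zero>} ys" "Q \<in> associated_primes R (ci ys)"
  shows "length ys \<le> h"
proof (rule ccontr)
  assume "\<not> ?thesis"
  then have h: "h < length ys" by simp
  let ?k = "length ys"
  note A = ideal_ci[OF ys(1)] and Qp = assoc_prime[OF Q]
  obtain c where c: "c \<in> carrier R" "Q = colon R P c" using Q by (rule assoc_primesE)
  obtain w where w: "w \<in> carrier R" "Q = colon R (ci ys) w" using ys(2) by (rule assoc_primesE)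
  obtain z where z: "ext_gen (ci ys) ?k z" using ext_gen_reg(1)[OF ys(1)] by blast
  then have zZ: "z \<in> Z ?k (ci ys)" unfolding ext_gen_def by simp
  note zc = Z_carr[OF zZ]
  have wzc: "w \<odot>\<^bsub>E ?k\<^esub> z \<in> carrier (E ?k)" using w zc by simp
  obtain \<eta> where \<eta>: "\<eta> \<in> T ?k P" "c \<odot>\<^bsub>E ?k\<^esub> \<eta> = w \<odot>\<^bsub>E ?k\<^esub> z"
  proof (rule cyclic_ext[OF P(1) c(1) wzc])
    show "r \<odot>\<^bsub>E ?k\<^esub> (w \<odot>\<^bsub>E ?k\<^esub> z) = \<zero>\<^bsub>E ?k\<^esub>" if "r \<in> carrier R" "r \<otimes> c \<in> P" for r
    proof -
      have "r \<otimes> w \<in> ci ys" using that c(2) w(2) unfolding colon_def by blast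
      then show ?thesis using T_ann[OF Z_T[OF zZ]] that w zc E.smult_assoc1[of r w z ?k] by simp
    qed
  qed
  have dz: "d ?k (c \<odot>\<^bsub>E ?k\<^esub> \<eta>) = \<zero>\<^bsub>E (Suc ?k)\<^esub>" unfolding \<eta>(2) using d_smult[OF w(1) zc] Z_d[OF zZ] w by simp
  obtain s v where s: "s \<in> carrier R - Q" "v \<in> Z ?k P" "c \<odot>\<^bsub>E ?k\<^esub> v = s \<odot>\<^bsub>E ?k\<^esub> (c \<odot>\<^bsub>E ?k\<^esub> \<eta>)"
    by (rule ext_correct[OF Qp P(1) c(1) \<eta>(1) dz
      ext_bound_at[OF A ext_bound_ci[OF ys(1)] ys(2) lessI ideal_adjoin[OF P(1) c(1)]]])
  have "v \<in> B ?k P" using P(2) h s(2) unfolding ext_bound_def ext_vanish_def by blast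
  moreover obtain k where k: "?k = Suc k" using h by (cases ?k) auto
  ultimately obtain \<theta> where \<theta>: "\<theta> \<in> T k P" "v = d k \<theta>" by auto
  note \<theta>c = T_carr[OF \<theta>(1)]
  have "c \<odot>\<^bsub>E k\<^esub> \<theta> \<in> T k (ci ys)"
  proof -
    have "a \<odot>\<^bsub>E k\<^esub> (c \<odot>\<^bsub>E k\<^esub> \<theta>) = \<zero>\<^bsub>E k\<^esub>" if a: "a \<in> ci ys" for a
    proof -
      have "a \<in> Q" using assoc_prime_sub[OF A ys(2)] a by blast
      then have "a \<in> carrier R" "a \<otimes> c \<in> P" using c(2) unfolding colon_def by auto
      then show ?thesis using T_ann[OF \<theta>(1)] c \<theta>c E.smult_assoc1[of a c \<theta> k] by simp
    qed
    then show ?thesis unfolding T_def using c(1) \<theta>c by simp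
  qed
  moreover have "d k (c \<odot>\<^bsub>E k\<^esub> \<theta>) = (s \<otimes> w) \<odot>\<^bsub>E ?k\<^esub> z"
    using d_smult[OF c(1) \<theta>c] \<theta>(2) s(1,3) \<eta>(2) w(1) zc k by (simp add: E.smult_assoc1)
  ultimately have "(s \<otimes> w) \<odot>\<^bsub>E ?k\<^esub> z \<in> B ?k (ci ys)" unfolding k by (auto intro!: rev_image_eqI)
  then have "s \<otimes> w \<in> ci ys" using z s(1) w(1) unfolding ext_gen_def by simp
  then have "s \<in> Q" using w s(1) unfolding colon_def by simp
  then show False using s by simp
qed

text \<open>If \<open>r\<close> is outside \<open>P\<close>, choose an associated prime
  \<open>Q = (xs) : w\<close> above \<open>P : r\<close>. Self-injectivity at \<open>Q\<close>
  yields \<open>u\<close> in \<open>(xs) : P\<close> with \<open>r u\<close> congruent to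
  \<open>s w\<close>, which is not in \<open>(xs)\<close>.\<close>

lemma double_colon_if_assoc:
  assumes xs: "reg R {\<zero>} xs" and P: "ideal P R" "ci xs \<subseteq> P"
    and Ass: "associated_primes R P \<subseteq> associated_primes R (ci xs)"
  shows "ideal_colon R (ci xs) (ideal_colon R (ci xs) P) = P"
proof
  note A = ideal_ci[OF xs]
  show "P \<subseteq> ideal_colon R (ci xs) (ideal_colon R (ci xs) P)"
    unfolding ideal_colon_def using icarr[OF P(1)] by (auto simp: m_comm)
  show "ideal_colon R (ci xs) (ideal_colon R (ci xs) P) \<subseteq> P"
  proof (rule subsetI, rule ccontr)
    fix r assume r: "r \<in> ideal_colon R (ci xs) (ideal_colon R (ci xs) P)" "r \<notin> P"
    have rc: "r \<in> carrier R" using r(1) unfolding ideal_colon_def by simp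
    obtain Q where Q: "Q \<in> associated_primes R P" "colon R P r \<subseteq> Q"
      using assoc_prime_above_colon[OF P(1) rc r(2)] .
    have QA: "Q \<in> associated_primes R (ci xs)" using Q(1) Ass by blast
    obtain w where w: "primeideal Q R" "w \<in> carrier R" "Q = colon R (ci xs) w" using QA by (rule assoc_primesE)
    obtain s u where su: "s \<in> carrier R - Q" "u \<in> carrier R" "\<And>a. a \<in> P \<Longrightarrow> a \<otimes> u \<in> ci xs" "s \<otimes> w \<ominus> r \<otimes> u \<in> ci xs"
    proof (rule self_injective_at[OF xs QA P rc w(2)])
      show "x \<otimes> w \<in> ci xs" if "x \<in> carrier R" "x \<otimes> r \<in> P" for x
        using Q(2) that w(3) unfolding colon_def by blast
    qed auto
    have "u \<in> ideal_colon R (ci xs) P"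
      unfolding ideal_colon_def using su(2,3) icarr[OF P(1)] by (auto simp: m_comm)
    then have "r \<otimes> u \<in> ci xs" using ideal_colonD[OF r(1)] by blast
    then have "s \<otimes> w \<in> ci xs" using iminus_cancel[OF A su(4)] su(1) w(2) by simp
    then show False using su(1) w unfolding colon_def by auto
  qed
qed

end

section \<open>Local rings: avoidance, permutability and heights\<close>

locale gor = injres +
  assumes unique_max: "\<exists>!M. maximalideal M R"
    and inf_res: "infinite (carrier (residue_field R))"
begin

abbreviation mm :: "'a set" where "mm \<equiv> the_maximal_ideal R"

lemma maximal_mm: "maximalideal mm R"
  unfolding the_maximal_ideal_def by (rule theI'[OF unique_max])

lemma mm_unique: "maximalideal M R \<Longrightarrow> M = mm"
  using unique_max maximal_mm by blast

lemma prime_mm: "primeideal mm R" by (rule maximalideal_prime[OF maximal_mm])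
lemma ideal_mm: "ideal mm R" by (rule prime_ideal[OF prime_mm])

lemma proper_sub_mm: assumes I: "ideal I R" "\<one> \<notin> I" shows "I \<subseteq> mm"
proof -
  let ?F = "{J. ideal J R \<and> I \<subseteq> J \<and> \<one> \<notin> J}"
  have "I \<in> ?F" using I by simp
  then obtain M where M: "M \<in> ?F" "\<And>J. J \<in> ?F \<Longrightarrow> M \<subseteq> J \<Longrightarrow> J = M"
    using noeth_maximal[of ?F] by blast
  have "maximalideal M R"
  proof (rule maximalidealI)
    show "ideal M R" using M(1) by simp
    show "carrier R \<noteq> M" using M(1) by auto
    show "J = M \<or> J = carrier R" if "ideal J R" "M \<subseteq> J" "J \<subseteq> carrier R" for J
      using M(1) M(2)[of J] that ideal_oneI[OF that(1)] by auto
  qed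
  then show ?thesis using mm_unique[of M] M(1) by auto
qed

lemma unit_notin_mm:
  assumes "s \<in> carrier R - mm" obtains t where "t \<in> carrier R" "t \<otimes> s = \<one>"
proof -
  have s: "s \<in> carrier R" using assms by simp
  have "\<one> \<in> adjoin R {\<zero>} s"
    using proper_sub_mm[OF ideal_adjoin[OF zeroideal s]] adjoin_mem[OF zeroideal s] assms by blast
  then obtain n r where "n \<in> {\<zero>}" "r \<in> carrier R" "\<one> = n \<oplus> r \<otimes> s" by (rule adjoinE)
  then show ?thesis using that[of r] s by simp
qed

lemma in_ideal_unit:
  assumes "ideal N R" "s \<in> carrier R - mm" "a \<in> carrier R" "s \<otimes> a \<in> N" shows "a \<in> N"
proof -
  obtain t where t: "t \<in> carrier R" "t \<otimes> s = \<one>" using unit_notin_mm[OF assms(2)] .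
  have "a = t \<otimes> (s \<otimes> a)" using t assms(2,3) m_assoc[of t s a] by simp
  then show ?thesis using imult[OF assms(1,4) t(1)] by simp
qed

lemma ext_vanish_if_at_mm:
  assumes J: "ideal J R" and V: "ext_vanish_at mm j J" shows "ext_vanish j J"
  unfolding ext_vanish_def
proof
  fix \<zeta> assume \<zeta>: "\<zeta> \<in> Z j J"
  then obtain s where s: "s \<in> carrier R - mm" "s \<odot>\<^bsub>E j\<^esub> \<zeta> \<in> B j J" using V unfolding ext_vanish_at_def by blast
  obtain t where t: "t \<in> carrier R" "t \<otimes> s = \<one>" using unit_notin_mm[OF s(1)] .
  have "t \<odot>\<^bsub>E j\<^esub> (s \<odot>\<^bsub>E j\<^esub> \<zeta>) = \<zeta>" using t s(1) Z_carr[OF \<zeta>] E.smult_assoc1[of t s \<zeta> j] by simp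
  then show "\<zeta> \<in> B j J" using E.submodule_smult[OF submodule_B[OF isub[OF J]] t(1) s(2)] by simp
qed

text \<open>Used with colon ideals \<open>A\<close>, which it collapses to \<open>N\<close>: every
  \<open>a\<close> in \<open>A\<close> is congruent to \<open>y a'\<close> with \<open>a'\<close>
  again in \<open>A\<close>.\<close>

lemma nakayama_element:
  assumes A: "ideal A R" and N: "ideal N R" and y: "y \<in> mm"
    and H: "\<And>a. a \<in> A \<Longrightarrow> \<exists>a'\<in>A. a \<ominus> y \<otimes> a' \<in> N"
  shows "A \<subseteq> N"
proof
  interpret M: module R "regular_module R" by (rule module_regular)
  have yc: "y \<in> carrier R" using icarr[OF ideal_mm y] .
  have minus: "a \<ominus>\<^bsub>regular_module R\<^esub> b = a \<ominus> b" if "b \<in> carrier R" for a b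
  proof -
    have "\<ominus>\<^bsub>regular_module R\<^esub> b = \<ominus> b"
      by (simp add: regular_module_def a_inv_def m_inv_def)
    then show ?thesis by (simp add: a_minus_def regular_module_def)
  qed
  fix a assume a: "a \<in> A"
  have "\<exists>s\<in>carrier R - mm. s \<odot>\<^bsub>regular_module R\<^esub> a \<in> N"
  proof (rule M.nakayama_divisible[OF prime_mm submodule_regular[OF N] submodule_regular[OF A] noeth_mod_regular[OF N] y _ a])
    fix u assume u: "u \<in> A"
    then obtain v where v: "v \<in> A" "u \<ominus> y \<otimes> v \<in> N" using H by blast
    have "\<one> \<in> carrier R - mm" using prime_one[OF prime_mm] by simp
    moreover have "\<one> \<odot>\<^bsub>regular_module R\<^esub> u \<ominus>\<^bsub>regular_module R\<^esub> y \<odot>\<^bsub>regular_module R\<^esub> v \<in> N"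
      using v u icarr[OF A] yc minus by (simp add: regular_module_def)
    ultimately show "\<exists>s\<in>carrier R - mm. \<exists>v\<in>A. s \<odot>\<^bsub>regular_module R\<^esub> u \<ominus>\<^bsub>regular_module R\<^esub> y \<odot>\<^bsub>regular_module R\<^esub> v \<in> N"
      using v(1) by blast
  qed
  then show "a \<in> N" using in_ideal_unit[OF N _ icarr[OF A a]] by (auto simp: regular_module_def)
qed

lemma residue_reps:
  obtains \<Lambda> where "infinite \<Lambda>" "\<Lambda> \<subseteq> carrier R" "\<And>a b. a \<in> \<Lambda> \<Longrightarrow> b \<in> \<Lambda> \<Longrightarrow> a \<noteq> b \<Longrightarrow> a \<ominus> b \<notin> mm"
proof -
  let ?C = "carrier (residue_field R)"
  define rep :: "'a set \<Rightarrow> 'a" where "rep = (\<lambda>C. SOME a. a \<in> carrier R \<and> C = mm +> a)"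
  have rep: "rep C \<in> carrier R \<and> C = mm +> rep C" if "C \<in> ?C" for C
    unfolding rep_def
  proof (rule someI_ex)
    show "\<exists>a. a \<in> carrier R \<and> C = mm +> a"
      using that unfolding residue_field_def FactRing_def A_RCOSETS_def' by auto
  qed
  have inj: "inj_on rep ?C" using rep by (metis inj_onI)
  have "infinite (rep ` ?C)" using inf_res finite_imageD[OF _ inj] by blast
  moreover have "rep ` ?C \<subseteq> carrier R" using rep by blast
  moreover have "a \<ominus> b \<notin> mm" if "a \<in> rep ` ?C" "b \<in> rep ` ?C" "a \<noteq> b" for a b
  proof
    assume "a \<ominus> b \<in> mm"
    moreover obtain C D where CD: "C \<in> ?C" "D \<in> ?C" "a = rep C" "b = rep D" using \<open>a \<in> _\<close> \<open>b \<in> _\<close> by blast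
    ultimately have "mm +> a = mm +> b"
      using quotient_eq_iff_same_a_r_cos[OF ideal_mm] rep by blast
    then have "C = D" using rep[OF CD(1)] rep[OF CD(2)] CD by simp
    then show False using CD that(3) by simp
  qed
  ultimately show ?thesis using that by blast
qed

text \<open>Arbitrary ideals are avoided, not only primes: of the elements \<open>b + l a\<close>,
  with \<open>l\<close> running through representatives of distinct residue classes, an ideal not
  containing \<open>a\<close> contains at most one. The infinite residue field enters here.\<close>

lemma avoidance:
  assumes A: "ideal A R" and fin: "finite \<N>" and N: "\<And>N. N \<in> \<N> \<Longrightarrow> ideal N R \<and> \<not> A \<subseteq> N"
  obtains a where "a \<in> A" "\<And>N. N \<in> \<N> \<Longrightarrow> a \<notin> N"
proof -
  obtain \<Lambda> where L: "infinite \<Lambda>" "\<Lambda> \<subseteq> carrier R" "\<And>a b. a \<in> \<Lambda> \<Longrightarrow> b \<in> \<Lambda> \<Longrightarrow> a \<noteq> b \<Longrightarrow> a \<ominus> b \<notin> mm"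
    using residue_reps by blast
  have "\<exists>a\<in>A. \<forall>N\<in>\<N>. a \<notin> N" using fin N
  proof (induction \<N> rule: finite_induct)
    case empty then show ?case using izero[OF A] by blast
  next
    case (insert N \<N>)
    then obtain a where a: "a \<in> A" "\<And>K. K \<in> \<N> \<Longrightarrow> a \<notin> K" by auto
    show ?case
    proof (cases "a \<in> N")
      case False then show ?thesis using a by blast
    next
      case True
      have iN: "ideal N R" using insert.prems by blast
      obtain b where b: "b \<in> A" "b \<notin> N" using insert.prems by blast
      have ac: "a \<in> carrier R" "b \<in> carrier R" using icarr[OF A] a(1) b(1) by auto
      have nN: "b \<oplus> l \<otimes> a \<notin> N" if l: "l \<in> \<Lambda>" for l
      proof
        assume "b \<oplus> l \<otimes> a \<in> N"
        then show False using iadd_cancel[OF iN _ imult[OF iN True, of l] ac(2)] l L(2) b(2) by blast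
      qed
      have "finite {l \<in> \<Lambda>. b \<oplus> l \<otimes> a \<in> K}" if K: "K \<in> \<N>" for K
      proof (cases "\<exists>l\<in>\<Lambda>. b \<oplus> l \<otimes> a \<in> K")
        case True
        then obtain l where l: "l \<in> \<Lambda>" "b \<oplus> l \<otimes> a \<in> K" by blast
        have iK: "ideal K R" using insert.prems K by blast
        have "l' = l" if l': "l' \<in> \<Lambda>" "b \<oplus> l' \<otimes> a \<in> K" for l'
        proof (rule ccontr)
          assume ne: "l' \<noteq> l"
          have lc: "l \<in> carrier R" "l' \<in> carrier R" using l l' L(2) by auto
          have "(l' \<ominus> l) \<otimes> a = (b \<oplus> l' \<otimes> a) \<ominus> (b \<oplus> l \<otimes> a)" using lc ac by algebra
          then have "(l' \<ominus> l) \<otimes> a \<in> K" using iminus[OF iK l'(2) l(2)] by simp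
          then have "a \<in> K" using in_ideal_unit[OF iK, of "l' \<ominus> l" a] L(3)[OF l'(1) l(1) ne] lc ac by simp
          then show False using a(2)[OF K] by simp
        qed
        then have "{l \<in> \<Lambda>. b \<oplus> l \<otimes> a \<in> K} \<subseteq> {l}" by blast
        then show ?thesis using finite_subset by blast
      next
        case False
        then have "{l \<in> \<Lambda>. b \<oplus> l \<otimes> a \<in> K} = {}" by blast
        then show ?thesis by (simp only: finite.emptyI)
      qed
      then have "finite (\<Union>K\<in>\<N>. {l \<in> \<Lambda>. b \<oplus> l \<otimes> a \<in> K})" using insert.hyps(1) by blast
      then obtain l where l: "l \<in> \<Lambda>" "l \<notin> (\<Union>K\<in>\<N>. {l \<in> \<Lambda>. b \<oplus> l \<otimes> a \<in> K})"
        using L(1) by (meson finite_subset subsetI)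
      have "b \<oplus> l \<otimes> a \<in> A" using iadd[OF A b(1) imult[OF A a(1)]] l(1) L(2) by blast
      then show ?thesis using nN[OF l(1)] l by blast
    qed
  qed
  then show ?thesis using that by blast
qed

lemma regular_avoiding:
  assumes A: "ideal A R" and fin: "finite \<N>" and N: "\<And>N. N \<in> \<N> \<Longrightarrow> ideal N R \<and> \<not> A \<subseteq> N"
    and finK: "finite \<K>" and K: "\<And>K. K \<in> \<K> \<Longrightarrow> ideal K R"
    and Ass: "\<And>K Q. K \<in> \<K> \<Longrightarrow> Q \<in> associated_primes R K \<Longrightarrow> \<not> A \<subseteq> Q"
  obtains a where "a \<in> A" "\<And>N. N \<in> \<N> \<Longrightarrow> a \<notin> N" "\<And>K. K \<in> \<K> \<Longrightarrow> nonzerodivisor R K a"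
proof -
  obtain a where a: "a \<in> A" "\<And>N. N \<in> \<N> \<union> (\<Union>K\<in>\<K>. associated_primes R K) \<Longrightarrow> a \<notin> N"
  proof (rule avoidance[OF A])
    show "finite (\<N> \<union> (\<Union>K\<in>\<K>. associated_primes R K))"
      using fin finK finite_assoc_primes K by blast
    show "ideal N R \<and> \<not> A \<subseteq> N" if "N \<in> \<N> \<union> (\<Union>K\<in>\<K>. associated_primes R K)" for N
      using that N Ass prime_ideal[OF assoc_prime] by blast
  qed blast
  show ?thesis
  proof (rule that[OF a(1)])
    show "nonzerodivisor R K a" if "K \<in> \<K>" for K
      using nonzerodivisor_if_avoids[OF K[OF that] icarr[OF A a(1)]] a(2) that by blast
  qed (use a(2) in blast)
qed

section \<open>Permutation of regular sequences\<close>

lemma reg_swap: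
  assumes N: "ideal N R" and a: "a \<in> mm" "nonzerodivisor R N a"
    and b: "b \<in> carrier R" "nonzerodivisor R (adjoin R N a) b"
  shows "nonzerodivisor R N b" "nonzerodivisor R (adjoin R N b) a" "adjoin R (adjoin R N a) b = adjoin R (adjoin R N b) a"
proof -
  have ac: "a \<in> carrier R" using icarr[OF ideal_mm a(1)] .
  \<comment> \<open>An element sending \<open>b\<close> into \<open>N\<close> is a multiple of
    \<open>a\<close> modulo \<open>N\<close>, and the cofactor again sends \<open>b\<close> into
    \<open>N\<close>. Nakayama's lemma applies because \<open>a\<close> is in the maximal
    ideal.\<close>
  have "colon R N b \<subseteq> N"
  proof (rule nakayama_element[OF ideal_colon[OF N b(1)] N a(1)])
    fix r assume "r \<in> colon R N b"
    then have r: "r \<in> carrier R" "r \<otimes> b \<in> N" unfolding colon_def by auto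
    then have "r \<in> adjoin R N a" using nonzerodivisorD[OF b(2) r(1)] adjoin_sub[OF N ac] by blast
    then obtain n s where n: "n \<in> N" "s \<in> carrier R" "r = n \<oplus> s \<otimes> a" by (rule adjoinE)
    have nc: "n \<in> carrier R" using icarr[OF N n(1)] .
    have "(s \<otimes> b) \<otimes> a = r \<otimes> b \<ominus> b \<otimes> n" unfolding n(3) using nc n(2) ac b(1) by algebra
    then have "(s \<otimes> b) \<otimes> a \<in> N" using iminus[OF N r(2) imult[OF N n(1) b(1)]] by simp
    then have "s \<otimes> b \<in> N" using nonzerodivisorD[OF a(2)] n(2) b(1) by simp
    then have "s \<in> colon R N b" using n(2) unfolding colon_def by simp
    moreover have "r \<ominus> a \<otimes> s = n" unfolding n(3) using nc n(2) ac by algebra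
    ultimately show "\<exists>a'\<in>colon R N b. r \<ominus> a \<otimes> a' \<in> N" using n(1) by auto
  qed
  then show nb: "nonzerodivisor R N b" unfolding nonzerodivisor_def colon_def by blast
  show "nonzerodivisor R (adjoin R N b) a"
    unfolding nonzerodivisor_def
  proof (intro ballI impI)
    fix r assume r: "r \<in> carrier R" "r \<otimes> a \<in> adjoin R N b"
    obtain n s where n: "n \<in> N" "s \<in> carrier R" "r \<otimes> a = n \<oplus> s \<otimes> b" using r(2) by (rule adjoinE)
    have nc: "n \<in> carrier R" using icarr[OF N n(1)] .
    have "s \<otimes> b = \<ominus> n \<oplus> r \<otimes> a" using n nc r(1) ac b(1) by algebra
    then have "s \<otimes> b \<in> adjoin R N a" using adjoinI[OF ineg[OF N n(1)] r(1)] by simp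
    then have "s \<in> adjoin R N a" using nonzerodivisorD[OF b(2) n(2)] by simp
    then obtain n' s' where n': "n' \<in> N" "s' \<in> carrier R" "s = n' \<oplus> s' \<otimes> a" by (rule adjoinE)
    have nc': "n' \<in> carrier R" using icarr[OF N n'(1)] .
    have "(r \<ominus> s' \<otimes> b) \<otimes> a = r \<otimes> a \<ominus> s' \<otimes> b \<otimes> a" using r(1) n'(2) b(1) ac by algebra
    also have "\<dots> = n \<oplus> b \<otimes> n'" unfolding n(3) n'(3) using nc nc' n'(2) ac b(1) by algebra
    finally have "(r \<ominus> s' \<otimes> b) \<otimes> a \<in> N" using iadd[OF N n(1) imult[OF N n'(1) b(1)]] by simp
    then have "r \<ominus> s' \<otimes> b \<in> N" using nonzerodivisorD[OF a(2)] r(1) n'(2) b(1) by simp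
    then have "(r \<ominus> s' \<otimes> b) \<oplus> s' \<otimes> b \<in> adjoin R N b" using adjoinI[OF _ n'(2)] by blast
    moreover have "(r \<ominus> s' \<otimes> b) \<oplus> s' \<otimes> b = r" using r(1) n'(2) b(1) by algebra
    ultimately show "r \<in> adjoin R N b" by simp
  qed
  show "adjoin R (adjoin R N a) b = adjoin R (adjoin R N b) a"
    using gen_cong[OF N, of "[a, b]" "[b, a]"] ac b(1) by auto
qed

lemma reg_move_front:
  "ideal N R \<Longrightarrow> set as \<subseteq> mm \<Longrightarrow> reg R N (as @ y # bs) \<Longrightarrow> reg R N (y # as @ bs)"
proof (induction as arbitrary: N)
  case (Cons a as)
  have a: "a \<in> mm" "nonzerodivisor R N a" "a \<in> carrier R" using Cons.prems by auto
  have "reg R (adjoin R N a) (y # as @ bs)"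
    using Cons.IH[OF ideal_adjoin[OF Cons.prems(1) a(3)]] Cons.prems by auto
  then have y: "y \<in> carrier R" "nonzerodivisor R (adjoin R N a) y" "reg R (adjoin R (adjoin R N a) y) (as @ bs)"
    by auto
  show ?case using reg_swap[OF Cons.prems(1) a(1,2) y(1,2)] y a by simp
qed simp

lemma reg_perm:
  "ideal N R \<Longrightarrow> set xs \<subseteq> mm \<Longrightarrow> mset xs = mset ys \<Longrightarrow> reg R N xs \<Longrightarrow> reg R N ys"
proof (induction ys arbitrary: N xs)
  case (Cons y ys)
  have "y \<in> set xs" using Cons.prems(3) by (metis list.set_intros(1) set_mset_mset)
  then obtain as bs where xs: "xs = as @ y # bs" by (meson split_list)
  have r: "reg R N (y # as @ bs)" using reg_move_front[of N as y bs] Cons.prems xs by auto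
  have "mset (as @ bs) = mset ys" using Cons.prems(3) xs by simp
  then have "reg R (adjoin R N y) ys"
    using Cons.IH[OF ideal_adjoin[OF Cons.prems(1)], of y "as @ bs"] r Cons.prems(2) xs by auto
  then show ?case using r by simp
qed simp

lemma reg_subset:
  assumes N: "ideal N R" and "set xs \<subseteq> mm" "mset ys \<subseteq># mset xs" "reg R N xs" shows "reg R N ys"
proof -
  obtain zs where "mset zs = mset xs - mset ys" using ex_mset by blast
  then have "mset xs = mset (ys @ zs)" using assms(3) by simp
  then have "reg R N (ys @ zs)" using reg_perm[OF N assms(2) _ assms(4)] by metis
  then show ?thesis by simp
qed

lemma ci_sub: "ideal A R \<Longrightarrow> set xs \<subseteq> A \<Longrightarrow> ci xs \<subseteq> A"
  using izero[of A] by (intro gen_least) auto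

text \<open>Extending the sequence inside \<open>A\<close> stops because the generated ideals grow
  strictly. Then \<open>A\<close> consists of zero divisors, and avoidance places it inside one
  associated prime.\<close>

lemma maximal_regular:
  assumes A: "ideal A R" "\<one> \<notin> A" and xs: "reg R {\<zero>} xs" "set xs \<subseteq> A"
  obtains us Q where "reg R {\<zero>} (xs @ us)" "set us \<subseteq> A" "Q \<in> associated_primes R (ci (xs @ us))" "A \<subseteq> Q"
proof -
  define F where "F = {ci (xs @ us) |us. reg R {\<zero>} (xs @ us) \<and> set us \<subseteq> A}"
  have "ci (xs @ []) \<in> F" unfolding F_def using xs by fastforce
  then have ne: "F \<noteq> {}" by blast
  have idl: "ideal J R" if "J \<in> F" for J using that ideal_ci unfolding F_def by blast
  obtain M where "M \<in> F" and mx: "\<forall>J\<in>F. M \<subseteq> J \<longrightarrow> J = M"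
    using noeth_maximal_ex[OF ne idl] by (rule bexE)
  then have M: "M \<in> F" "\<And>J. J \<in> F \<Longrightarrow> M \<subseteq> J \<Longrightarrow> J = M" by simp_all
  then obtain us where us: "M = ci (xs @ us)" "reg R {\<zero>} (xs @ us)" "set us \<subseteq> A" unfolding F_def by blast
  have iM: "ideal M R" unfolding us(1) by (rule ideal_ci[OF us(2)])
  have MA: "M \<subseteq> A" unfolding us(1) by (rule ci_sub[OF A(1)]) (use xs us in simp)
  have "\<exists>Q\<in>associated_primes R M. A \<subseteq> Q"
  proof (rule ccontr)
    assume nt: "\<not> ?thesis"
    obtain a where a: "a \<in> A" "nonzerodivisor R M a"
      using regular_avoiding[OF A(1), of "{}" "{M}"] iM nt by auto
    have ac: "a \<in> carrier R" using icarr[OF A(1) a(1)] .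
    have r: "reg R {\<zero>} (xs @ (us @ [a]))" using us a(2) ac by simp
    have "set (us @ [a]) \<subseteq> A" using us(3) a(1) by simp
    then have "ci (xs @ (us @ [a])) \<in> F" unfolding F_def using r by blast
    then have "adjoin R M a \<in> F" using us(1) by simp
    then have "adjoin R M a = M" using M(2) adjoin_sub[OF iM ac] by blast
    then have "\<one> \<otimes> a \<in> M" using adjoin_mem[OF iM ac] ac by simp
    then have "\<one> \<in> M" using nonzerodivisorD[OF a(2)] by simp
    then show False using MA A(2) by blast
  qed
  then show ?thesis using that us by blast
qed

section \<open>Heights of primes associated to complete intersections\<close>

lemma chain_below:
  "reg R {\<zero>} xs \<Longrightarrow> primeideal Q R \<Longrightarrow> ci xs \<subseteq> Q \<Longrightarrow> \<exists>P. prime_chain R (length xs) P \<and> P (length xs) = Q"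
proof (induction xs arbitrary: Q rule: rev_induct)
  case Nil
  then show ?case unfolding prime_chain_def by (auto intro!: exI[of _ "\<lambda>_. Q"])
next
  case (snoc x xs)
  have xs: "reg R {\<zero>} xs" and x: "x \<in> carrier R" "nonzerodivisor R (ci xs) x" using snoc.prems(1) by auto
  have iA: "ideal (ci xs) R" using ideal_ci[OF xs] .
  have sub: "ci xs \<subseteq> Q" "x \<in> Q" using snoc.prems(3) adjoin_sub[OF iA x(1)] adjoin_mem[OF iA x(1)] by auto
  obtain Q' where Q': "Q' \<in> associated_primes R (ci xs)" "Q' \<subseteq> Q"
    using assoc_prime_below[OF iA snoc.prems(2) sub(1)] .
  have "x \<notin> Q'" using nonzerodivisor_notin_assoc[OF x(2,1) Q'(1)] .
  then have lt: "Q' \<subset> Q" using Q' sub by blast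
  obtain P where P: "prime_chain R (length xs) P" "P (length xs) = Q'"
    using snoc.IH[OF xs assoc_prime[OF Q'(1)] assoc_prime_sub[OF iA Q'(1)]] by blast
  let ?P = "\<lambda>i. if i \<le> length xs then P i else Q"
  have "prime_chain R (length (xs @ [x])) ?P"
    using P lt snoc.prems(2) unfolding prime_chain_def by (auto simp: less_Suc_eq)
  then show ?case by (intro exI[of _ ?P]) simp
qed

text \<open>Associated primes of \<open>(ys)\<close> are minimal over it, so the next prime of the
  chain is contained in none of them and supplies a further regular element.\<close>

lemma regular_in_chain:
  "prime_chain R n P \<Longrightarrow> \<exists>ys. reg R {\<zero>} ys \<and> length ys = n \<and> set ys \<subseteq> P n"
proof (induction n)
  case 0 then show ?case by (intro exI[of _ "[]"]) simp
next
  case (Suc n)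
  then have "prime_chain R n P" unfolding prime_chain_def by auto
  then obtain ys where ys: "reg R {\<zero>} ys" "length ys = n" "set ys \<subseteq> P n" using Suc.IH by blast
  have Pn: "primeideal (P n) R" "primeideal (P (Suc n)) R" "P n \<subset> P (Suc n)"
    using Suc.prems unfolding prime_chain_def by auto
  note iA = ideal_ci[OF ys(1)]
  have "\<not> P (Suc n) \<subseteq> Q" if Q: "Q \<in> associated_primes R (ci ys)" for Q
    using assoc_ci_minimal[OF ys(1) Q Pn(1) ci_sub[OF prime_ideal[OF Pn(1)] ys(3)]] Pn(3) by blast
  then obtain a where a: "a \<in> P (Suc n)" "nonzerodivisor R (ci ys) a"
    using regular_avoiding[OF prime_ideal[OF Pn(2)], of "{}" "{ci ys}"] iA by auto
  have "reg R {\<zero>} (ys @ [a])" using ys a icarr[OF prime_ideal[OF Pn(2)] a(1)] by simp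
  then show ?case using ys a Pn(3) by (intro exI[of _ "ys @ [a]"]) auto
qed

lemma prime_height_ge:
  assumes "reg R {\<zero>} xs" "set xs \<subseteq> Q" "primeideal Q R" shows "enat (length xs) \<le> prime_height R Q"
  unfolding prime_height_def
  using chain_below[OF assms(1,3) ci_sub[OF prime_ideal[OF assms(3)] assms(2)]] by (intro Sup_upper) blast

lemma prime_height_assoc:
  assumes xs: "reg R {\<zero>} xs" and Q: "Q \<in> associated_primes R (ci xs)"
  shows "prime_height R Q = enat (length xs)"
proof (rule antisym)
  show "prime_height R Q \<le> enat (length xs)"
    unfolding prime_height_def
  proof (rule Sup_least)
    fix h assume "h \<in> {enat n |n. \<exists>P. prime_chain R n P \<and> P n = Q}"
    then obtain n P where P: "h = enat n" "prime_chain R n P" "P n = Q" by blast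
    then obtain ys where "reg R {\<zero>} ys" "length ys = n" "set ys \<subseteq> Q" using regular_in_chain by blast
    then show "h \<le> enat (length xs)" using reg_length_le[OF xs Q] P by auto
  qed
  have "set xs \<subseteq> Q"
    using assoc_prime_sub[OF ideal_ci[OF xs] Q] gen_mem[OF zeroideal reg_carrier[OF xs]] by blast
  then show "enat (length xs) \<le> prime_height R Q" using prime_height_ge[OF xs _ assoc_prime[OF Q]] by simp
qed

text \<open>Extending \<open>xs\<close> inside \<open>Q\<close> would raise the height, so
  \<open>xs\<close> is already maximal in \<open>Q\<close>, and minimality of associated primes
  identifies \<open>Q\<close>.\<close>

lemma assoc_if_height:
  assumes xs: "reg R {\<zero>} xs" "set xs \<subseteq> Q" and Q: "primeideal Q R" "prime_height R Q = enat (length xs)"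
  shows "Q \<in> associated_primes R (ci xs)"
proof -
  note iQ = prime_ideal[OF Q(1)]
  obtain us Q' where us: "reg R {\<zero>} (xs @ us)" "set us \<subseteq> Q" "Q' \<in> associated_primes R (ci (xs @ us))" "Q \<subseteq> Q'"
    using maximal_regular[OF iQ prime_one[OF Q(1)] xs] .
  have "enat (length (xs @ us)) \<le> enat (length xs)"
    using prime_height_ge[OF us(1) _ Q(1)] us(2) xs(2) Q(2) by simp
  then have "us = []" by simp
  then have Q': "Q' \<in> associated_primes R (ci xs)" using us(3) by simp
  then show ?thesis using assoc_ci_minimal[OF xs(1) Q' Q(1) ci_sub[OF iQ xs(2)] us(4)] by simp
qed

lemma double_colon:
  assumes xs: "reg R {\<zero>} xs" "set xs \<subseteq> P" and P: "ideal P R"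
    and ht: "\<And>Q. Q \<in> associated_primes R P \<Longrightarrow> prime_height R Q = enat (length xs)"
  shows "ideal_colon R (ci xs) (ideal_colon R (ci xs) P) = P"
proof (rule double_colon_if_assoc[OF xs(1) P ci_sub[OF P xs(2)]])
  show "associated_primes R P \<subseteq> associated_primes R (ci xs)"
    using assoc_if_height[OF xs(1) _ assoc_prime ht] assoc_prime_sub[OF P] xs(2) by blast
qed

end

section \<open>Cohen-Macaulay ideals and links\<close>

lemma (in cring) reg_iff_nth:
  assumes "ideal N R" "set xs \<subseteq> carrier R"
  shows "reg R N xs \<longleftrightarrow> (\<forall>i<length xs. nonzerodivisor R (gen R N (take i xs)) (xs ! i))"
  using assms(2)
proof (induction xs rule: rev_induct)
  case (snoc x xs)
  have "(\<forall>i<length (xs @ [x]). nonzerodivisor R (gen R N (take i (xs @ [x]))) ((xs @ [x]) ! i)) \<longleftrightarrow>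
    (\<forall>i<length xs. nonzerodivisor R (gen R N (take i xs)) (xs ! i)) \<and> nonzerodivisor R (gen R N xs) x"
    by (auto simp: nth_append less_Suc_eq all_conj_distrib)
  then show ?case using snoc by simp
qed simp

lemma (in cring) reg_iff_regular_sequence:
  "regular_sequence R xs \<longleftrightarrow> set xs \<subseteq> carrier R \<and> reg R {\<zero>} xs \<and> Idl (set xs) \<noteq> carrier R"
proof (cases "set xs \<subseteq> carrier R")
  case True
  have "gen R {\<zero>} (take i xs) = Idl (set (take i xs))" for i
    using True set_take_subset[of i xs] by (intro gen_zero_eq_Idl) blast
  then show ?thesis using True reg_iff_nth[OF zeroideal True]
    unfolding regular_sequence_def nonzerodivisor_def by simp
next
  case False then show ?thesis unfolding regular_sequence_def by simp
qed

section \<open>Ext bounds, colon ideals and chains of primes\<close>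

context gor begin

lemma ext_vanish_at_of: assumes "ext_vanish j J" shows "ext_vanish_at mm j J"
  unfolding ext_vanish_at_def
proof
  fix \<zeta> assume "\<zeta> \<in> Z j J"
  then have "\<one> \<odot>\<^bsub>E j\<^esub> \<zeta> \<in> B j J" using assms Z_carr unfolding ext_vanish_def by auto
  then show "\<exists>s\<in>carrier R - mm. s \<odot>\<^bsub>E j\<^esub> \<zeta> \<in> B j J" using prime_one[OF prime_mm] one_closed by blast
qed

text \<open>When the maximal ideal is associated to \<open>(xs)\<close>, \<open>length xs\<close>
  bounds the injective dimension of \<open>R\<close>; multipliers outside the maximal ideal are
  units, so the local bound is a global one.\<close>

lemma ext_bound_if_mm_assoc:
  "reg R {\<zero>} xs \<Longrightarrow> mm \<in> associated_primes R (ci xs) \<Longrightarrow> ideal N R \<Longrightarrow> ext_bound (length xs) N"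
  using ext_bound_at[OF ideal_ci ext_bound_ci] ext_vanish_if_at_mm unfolding ext_bound_def by blast

text \<open>Converse of \<open>ext_bound_adjoin\<close>, by Nakayama's lemma. It allows bounds to be
  checked after dividing out regular elements.\<close>

lemma ext_bound_of_adjoin:
  assumes N: "ideal N R" and y: "y \<in> mm" "nonzerodivisor R N y" and V: "ext_bound (Suc h) (adjoin R N y)"
  shows "ext_bound h N"
  unfolding ext_bound_def
proof (intro allI impI)
  fix j assume "h < j"
  then have "ext_vanish_at mm (Suc j) (adjoin R N y)"
    using V ext_vanish_at_of unfolding ext_bound_def by simp
  then show "ext_vanish j N"
    using ext_vanish_if_at_mm[OF N] ext_vanish_at_divisible[OF prime_mm N y] by blast
qed

lemma ext_bound_of_gen:
  "ideal N R \<Longrightarrow> reg R N ys \<Longrightarrow> set ys \<subseteq> mm \<Longrightarrow> ext_bound (h + length ys) (gen R N ys) \<Longrightarrow> ext_bound h N"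
proof (induction ys arbitrary: N h)
  case (Cons y ys)
  have "ext_bound (Suc h) (adjoin R N y)"
    using Cons.IH[OF ideal_adjoin[OF Cons.prems(1)], of y "Suc h"] Cons.prems by simp
  then show ?case using ext_bound_of_adjoin[OF Cons.prems(1), of y h] Cons.prems by simp
qed simp

lemma ext_bound_mono: "ext_bound h N \<Longrightarrow> h \<le> k \<Longrightarrow> ext_bound k N"
  unfolding ext_bound_def by auto

lemma assoc_eq_mm: "Q \<in> associated_primes R N \<Longrightarrow> mm \<subseteq> Q \<Longrightarrow> Q = mm"
  using proper_sub_mm[OF prime_ideal prime_one] assoc_prime by blast

lemma adjoin_proper: "ideal N R \<Longrightarrow> N \<subseteq> mm \<Longrightarrow> y \<in> mm \<Longrightarrow> adjoin R N y \<subseteq> mm"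
  using adjoin_least[OF ideal_mm] .

lemma adjoin_strict:
  assumes "ideal N R" "N \<subseteq> mm" "y \<in> carrier R" "nonzerodivisor R N y" shows "N \<subset> adjoin R N y"
proof -
  have "y \<notin> N"
  proof
    assume "y \<in> N"
    then have "\<one> \<in> N" using nonzerodivisorD[OF assms(4), of \<one>] assms(3) by simp
    then show False using assms(2) prime_one[OF prime_mm] by blast
  qed
  then show ?thesis using adjoin_sub[OF assms(1,3)] adjoin_mem[OF assms(1,3)] by blast
qed

text \<open>Linking commutes with reduction modulo a regular element. The nontrivial inclusion is
  \<open>colon_adjoin_lift\<close>, where the Ext bound of \<open>P\<close> enters.\<close>

lemma colon_adjoin_eq:
  assumes xs: "reg R {\<zero>} xs" and P: "ideal P R" "ci xs \<subseteq> P" and V: "ext_bound (length xs) P"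
    and y: "y \<in> carrier R" "nonzerodivisor R (ci xs) y"
  shows "ideal_colon R (adjoin R (ci xs) y) (adjoin R P y) = adjoin R (ideal_colon R (ci xs) P) y"
proof
  note A = ideal_ci[OF xs]
  have J: "ideal (ideal_colon R (ci xs) P) R" by (rule ideal_colon_ideal[OF A isub[OF P(1)]])
  have A': "ideal (adjoin R (ci xs) y) R" by (rule ideal_adjoin[OF A y(1)])
  have P': "ideal (adjoin R P y) R" by (rule ideal_adjoin[OF P(1) y(1)])
  have J': "ideal (ideal_colon R (adjoin R (ci xs) y) (adjoin R P y)) R"
    by (rule ideal_colon_ideal[OF A' isub[OF P']])
  show "ideal_colon R (adjoin R (ci xs) y) (adjoin R P y) \<subseteq> adjoin R (ideal_colon R (ci xs) P) y"
  proof
    fix v assume v: "v \<in> ideal_colon R (adjoin R (ci xs) y) (adjoin R P y)"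
    have vc: "v \<in> carrier R" using icarr[OF J' v] .
    have "v \<in> ideal_colon R (adjoin R (ci xs) y) P"
      using v adjoin_sub[OF P(1) y(1)] unfolding ideal_colon_def by blast
    then obtain u where u: "u \<in> carrier R" "v \<ominus> u \<otimes> y \<in> ideal_colon R (ci xs) P"
      using colon_adjoin_lift[OF xs P V y] by blast
    have "(v \<ominus> u \<otimes> y) \<oplus> u \<otimes> y = v" using vc u(1) y(1) by algebra
    then show "v \<in> adjoin R (ideal_colon R (ci xs) P) y" using adjoinI[OF u(2,1), of y] by simp
  qed
  show "adjoin R (ideal_colon R (ci xs) P) y \<subseteq> ideal_colon R (adjoin R (ci xs) y) (adjoin R P y)"
  proof (rule adjoin_least[OF J'])
    show "y \<in> ideal_colon R (adjoin R (ci xs) y) (adjoin R P y)"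
      unfolding ideal_colon_def
      using y(1) imultr[OF A' adjoin_mem[OF A y(1)]] icarr[OF P'] by auto
    show "ideal_colon R (ci xs) P \<subseteq> ideal_colon R (adjoin R (ci xs) y) (adjoin R P y)"
    proof
      fix v assume v: "v \<in> ideal_colon R (ci xs) P"
      have vc: "v \<in> carrier R" using icarr[OF J v] .
      have "v \<otimes> q \<in> adjoin R (ci xs) y" if q: "q \<in> adjoin R P y" for q
      proof -
        obtain p r where p: "p \<in> P" "r \<in> carrier R" "q = p \<oplus> r \<otimes> y" using q by (rule adjoinE)
        have pc: "p \<in> carrier R" using icarr[OF P(1) p(1)] .
        have "v \<otimes> q = v \<otimes> p \<oplus> (v \<otimes> r) \<otimes> y" unfolding p(3) using vc pc p(2) y(1) by algebra
        then show ?thesis using adjoinI[OF ideal_colonD[OF v p(1)], of "v \<otimes> r" y] vc p(2) by simp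
      qed
      then show "v \<in> ideal_colon R (adjoin R (ci xs) y) (adjoin R P y)"
        unfolding ideal_colon_def using vc by simp
    qed
  qed
qed

lemma nonzerodivisor_ideal_colon:
  assumes A: "ideal A R" and P: "P \<subseteq> carrier R" and y: "y \<in> carrier R" "nonzerodivisor R A y"
  shows "nonzerodivisor R (ideal_colon R A P) y"
  unfolding nonzerodivisor_def
proof (intro ballI impI)
  fix r assume r: "r \<in> carrier R" "r \<otimes> y \<in> ideal_colon R A P"
  have "r \<otimes> p \<in> A" if p: "p \<in> P" for p
  proof -
    have pc: "p \<in> carrier R" using p P by blast
    have "r \<otimes> p \<otimes> y = r \<otimes> y \<otimes> p" using r(1) pc y(1) by algebra
    then show ?thesis using nonzerodivisorD[OF y(2), of "r \<otimes> p"] ideal_colonD[OF r(2) p] r(1) pc by simp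
  qed
  then show "r \<in> ideal_colon R A P" unfolding ideal_colon_def using r(1) by simp
qed

text \<open>Modulo an element \<open>y\<close> that is regular on both sides the claim passes to a larger complete
  intersection, so Noetherian induction applies.\<close>

lemma ext_bound_link:
  assumes "reg R {\<zero>} xs" "ideal P R" "P \<subseteq> mm" "ci xs \<subseteq> P" "ext_bound (length xs) P"
  shows "ext_bound (length xs) (ideal_colon R (ci xs) P)"
proof -
  have "\<forall>xs P. A = ci xs \<longrightarrow> reg R {\<zero>} xs \<longrightarrow> ideal P R \<longrightarrow> P \<subseteq> mm \<longrightarrow> ci xs \<subseteq> P \<longrightarrow>
    ext_bound (length xs) P \<longrightarrow> ext_bound (length xs) (ideal_colon R (ci xs) P)" if "ideal A R" for A
    using that
  proof (induction rule: noeth_induct)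
    case (step A)
    show ?case
    proof (intro allI impI)
      fix xs P assume Aeq: "A = ci xs" and xs: "reg R {\<zero>} xs" and P: "ideal P R" "P \<subseteq> mm" "ci xs \<subseteq> P"
        and V: "ext_bound (length xs) P"
      note A = ideal_ci[OF xs]
      have J: "ideal (ideal_colon R (ci xs) P) R" by (rule ideal_colon_ideal[OF A isub[OF P(1)]])
      show "ext_bound (length xs) (ideal_colon R (ci xs) P)"
      proof (cases "mm \<in> associated_primes R (ci xs)")
        case True
        then show ?thesis using ext_bound_if_mm_assoc[OF xs _ J] by simp
      next
        case False
        have set_xs: "set xs \<subseteq> mm" using gen_mem[OF zeroideal reg_carrier[OF xs]] P by blast
        \<comment> \<open>Otherwise the Ext bound of \<open>P\<close> limits a maximal regular
          sequence extending \<open>xs\<close> to \<open>length xs\<close>, so \<open>xs\<close>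
          itself would be maximal, against the case assumption.\<close>
        have "mm \<notin> associated_primes R P"
        proof
          assume mP: "mm \<in> associated_primes R P"
          obtain us Q where us: "reg R {\<zero>} (xs @ us)" "set us \<subseteq> mm" "Q \<in> associated_primes R (ci (xs @ us))" "mm \<subseteq> Q"
            by (rule maximal_regular[OF ideal_mm prime_one[OF prime_mm] xs set_xs])
          have Q: "Q = mm" using assoc_eq_mm[OF us(3,4)] .
          have "length (xs @ us) \<le> length xs" using ext_bound_assoc_le[OF P(1) V mP us(1)] us(3) Q by simp
          then have "us = []" by simp
          then show False using us(3) Q False by simp
        qed
        then have nt: "\<not> mm \<subseteq> Q" if "Q \<in> associated_primes R K" "K \<in> {ci xs, P}" for Q K
          using assoc_eq_mm that False by blast
        obtain y where y: "y \<in> mm" "\<And>K. K \<in> {ci xs, P} \<Longrightarrow> nonzerodivisor R K y"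
        proof (rule regular_avoiding[OF ideal_mm, of "{}" "{ci xs, P}"])
          show "ideal K R" if "K \<in> {ci xs, P}" for K using that A P(1) by auto
        qed (use nt in auto)
        have yc: "y \<in> carrier R" using icarr[OF ideal_mm y(1)] .
        have nz: "nonzerodivisor R (ci xs) y" "nonzerodivisor R P y" using y(2) by auto
        have ci': "ci (xs @ [y]) = adjoin R (ci xs) y" by simp
        have sub: "A \<subset> ci (xs @ [y])"
          unfolding ci' Aeq using adjoin_strict[OF A _ yc nz(1)] P by blast
        have r': "reg R {\<zero>} (xs @ [y])" using xs yc nz(1) by simp
        have P': "ideal (adjoin R P y) R" "adjoin R P y \<subseteq> mm"
          using ideal_adjoin[OF P(1) yc] adjoin_proper[OF P(1,2) y(1)] by auto
        have "ci (xs @ [y]) \<subseteq> adjoin R P y"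
          unfolding ci' using adjoin_sub[OF P(1) yc] P(3) by (intro adjoin_least[OF P'(1) _ adjoin_mem[OF P(1) yc]]) blast
        moreover have "ext_bound (length (xs @ [y])) (adjoin R P y)"
          using ext_bound_adjoin[OF P(1) yc nz(2) V] by simp
        ultimately have "ext_bound (length (xs @ [y])) (ideal_colon R (ci (xs @ [y])) (adjoin R P y))"
          using step(2)[OF ideal_ci[OF r'] sub] r' P' by blast
        then have "ext_bound (Suc (length xs)) (adjoin R (ideal_colon R (ci xs) P) y)"
          using colon_adjoin_eq[OF xs P(1,3) V yc nz(1)] ci' by simp
        then show ?thesis
          using ext_bound_of_adjoin[OF J y(1) nonzerodivisor_ideal_colon[OF A isub[OF P(1)] yc nz(1)]] by simp
      qed
    qed
  qed
  then show ?thesis using assms ideal_ci by blast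
qed

text \<open>By Nakayama's lemma some \<open>a\<close> in \<open>N : Q\<close> stays outside
  \<open>(N, y)\<close>. Its annihilator modulo \<open>(N, y)\<close> contains \<open>Q\<close> and
  lies in an associated prime, which contains \<open>y\<close> as well.\<close>

lemma assoc_prime_step:
  assumes N: "ideal N R" and Q: "Q \<in> associated_primes R N" and y: "y \<in> mm" "nonzerodivisor R N y"
  obtains Q' where "Q' \<in> associated_primes R (adjoin R N y)" "Q \<subset> Q'"
proof -
  have yc: "y \<in> carrier R" using icarr[OF ideal_mm y(1)] .
  have N': "ideal (adjoin R N y) R" by (rule ideal_adjoin[OF N yc])
  obtain c where c: "primeideal Q R" "c \<in> carrier R" "Q = colon R N c" using Q by (rule assoc_primesE)
  note iQ = prime_ideal[OF c(1)]
  have A: "ideal (ideal_colon R N Q) R" by (rule ideal_colon_ideal[OF N isub[OF iQ]])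
  have "\<exists>a\<in>ideal_colon R N Q. a \<notin> adjoin R N y"
  proof (rule ccontr)
    assume nt: "\<not> ?thesis"
    have "ideal_colon R N Q \<subseteq> N"
    proof (rule nakayama_element[OF A N y(1)])
      fix a assume a: "a \<in> ideal_colon R N Q"
      then have "a \<in> adjoin R N y" using nt by blast
      then obtain n r where n: "n \<in> N" "r \<in> carrier R" "a = n \<oplus> r \<otimes> y" by (rule adjoinE)
      have nc: "n \<in> carrier R" using icarr[OF N n(1)] .
      have "r \<otimes> q \<in> N" if q: "q \<in> Q" for q
      proof -
        have qc: "q \<in> carrier R" using icarr[OF iQ q] .
        have "(r \<otimes> q) \<otimes> y = a \<otimes> q \<ominus> q \<otimes> n" unfolding n(3) using nc n(2) yc qc by algebra
        then have "(r \<otimes> q) \<otimes> y \<in> N" using iminus[OF N ideal_colonD[OF a q] imult[OF N n(1) qc]] by simp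
        then show ?thesis using nonzerodivisorD[OF y(2), of "r \<otimes> q"] n(2) qc by simp
      qed
      then have "r \<in> ideal_colon R N Q" unfolding ideal_colon_def using n(2) by simp
      moreover have "a \<ominus> y \<otimes> r = n" unfolding n(3) using nc n(2) yc by algebra
      ultimately show "\<exists>a'\<in>ideal_colon R N Q. a \<ominus> y \<otimes> a' \<in> N" using n(1) by auto
    qed
    moreover have "c \<in> ideal_colon R N Q"
      unfolding ideal_colon_def using c(2,3) unfolding colon_def by (auto simp: m_comm)
    ultimately show False using colon_prime_notin[OF c] by blast
  qed
  then obtain a where a: "a \<in> ideal_colon R N Q" "a \<notin> adjoin R N y" by blast
  have ac: "a \<in> carrier R" using icarr[OF A a(1)] .
  obtain Q' where Q': "Q' \<in> associated_primes R (adjoin R N y)" "colon R (adjoin R N y) a \<subseteq> Q'"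
    using assoc_prime_above_colon[OF N' ac a(2)] .
  have "Q \<subseteq> colon R (adjoin R N y) a"
  proof
    fix q assume q: "q \<in> Q"
    have "a \<otimes> q \<in> adjoin R N y" using ideal_colonD[OF a(1) q] adjoin_sub[OF N yc] by blast
    then show "q \<in> colon R (adjoin R N y) a" unfolding colon_def using icarr[OF iQ q] ac by (simp add: m_comm)
  qed
  moreover have "y \<in> Q'" using assoc_prime_sub[OF N' Q'(1)] adjoin_mem[OF N yc] by blast
  moreover have "y \<notin> Q" using nonzerodivisor_notin_assoc[OF y(2) yc Q] .
  ultimately show ?thesis using that[OF Q'(1)] Q'(2) by blast
qed

text \<open>Bounds the dimension of \<open>R/Q\<close> from below by the length of a regular
  sequence on \<open>R/N\<close>.\<close>

lemma chain_above:
  "ideal N R \<Longrightarrow> Q \<in> associated_primes R N \<Longrightarrow> reg R N us \<Longrightarrow> set us \<subseteq> mm \<Longrightarrow>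
   \<exists>P. prime_chain R (length us) P \<and> P 0 = Q"
proof (induction us arbitrary: N Q)
  case Nil
  then show ?case unfolding prime_chain_def by (auto intro!: exI[of _ "\<lambda>_. Q"] assoc_prime)
next
  case (Cons y us)
  have y: "y \<in> mm" "nonzerodivisor R N y" "y \<in> carrier R" using Cons.prems by auto
  obtain Q' where Q': "Q' \<in> associated_primes R (adjoin R N y)" "Q \<subset> Q'"
    using assoc_prime_step[OF Cons.prems(1,2) y(1,2)] .
  obtain P where P: "prime_chain R (length us) P" "P 0 = Q'"
    using Cons.IH[OF ideal_adjoin[OF Cons.prems(1) y(3)] Q'(1)] Cons.prems by auto
  let ?P = "\<lambda>i. case i of 0 \<Rightarrow> Q | Suc j \<Rightarrow> P j"
  have "prime_chain R (length (y # us)) ?P"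
    using P Q'(2) assoc_prime[OF Cons.prems(2)] unfolding prime_chain_def
    by (auto split: nat.splits)
  then show ?case by (intro exI[of _ ?P]) simp
qed

end

section \<open>Passage to a quotient ring\<close>

context cring begin

lemma
  assumes I: "ideal I R"
  shows quot_cring: "cring (R Quot I)"
    and coset_add: "a \<in> carrier R \<Longrightarrow> b \<in> carrier R \<Longrightarrow> I +> (a \<oplus> b) = (I +> a) \<oplus>\<^bsub>R Quot I\<^esub> (I +> b)"
    and coset_mult: "a \<in> carrier R \<Longrightarrow> b \<in> carrier R \<Longrightarrow> I +> (a \<otimes> b) = (I +> a) \<otimes>\<^bsub>R Quot I\<^esub> (I +> b)"
    and coset_one: "I +> \<one> = \<one>\<^bsub>R Quot I\<^esub>"
    and coset_closed: "a \<in> carrier R \<Longrightarrow> I +> a \<in> carrier (R Quot I)"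
proof -
  show "cring (R Quot I)" by (rule ideal.quotient_is_cring[OF I is_cring])
  have h: "(+>) I \<in> ring_hom R (R Quot I)" by (rule ideal.rcos_ring_hom[OF I])
  show "a \<in> carrier R \<Longrightarrow> b \<in> carrier R \<Longrightarrow> I +> (a \<oplus> b) = (I +> a) \<oplus>\<^bsub>R Quot I\<^esub> (I +> b)" for a b
    using ring_hom_add[OF h] .
  show "a \<in> carrier R \<Longrightarrow> b \<in> carrier R \<Longrightarrow> I +> (a \<otimes> b) = (I +> a) \<otimes>\<^bsub>R Quot I\<^esub> (I +> b)" for a b
    using ring_hom_mult[OF h] .
  show "I +> \<one> = \<one>\<^bsub>R Quot I\<^esub>" using ring_hom_one[OF h] .
  show "a \<in> carrier R \<Longrightarrow> I +> a \<in> carrier (R Quot I)" for a using ring_hom_closed[OF h] .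
qed

lemma quot_carrierE:
  assumes "ideal I R" "c \<in> carrier (R Quot I)" obtains a where "a \<in> carrier R" "c = I +> a"
  using assms(2) that unfolding FactRing_def A_RCOSETS_def' by auto

lemma coset_mem_image:
  assumes I: "ideal I R" and N: "ideal N R" "I \<subseteq> N" and a: "a \<in> carrier R"
  shows "I +> a \<in> (+>) I ` N \<longleftrightarrow> a \<in> N"
proof
  assume "I +> a \<in> (+>) I ` N"
  then obtain n where n: "n \<in> N" "I +> a = I +> n" by blast
  have "a \<ominus> n \<in> I" using quotient_eq_iff_same_a_r_cos[OF I a icarr[OF N(1) n(1)]] n(2) by simp
  then show "a \<in> N" using iminus_cancel[OF N(1) _ n(1) a] N(2) by blast
qed simp

lemma adjoin_quot:
  assumes I: "ideal I R" and N: "ideal N R" and a: "a \<in> carrier R"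
  shows "adjoin (R Quot I) ((+>) I ` N) (I +> a) = (+>) I ` adjoin R N a"
proof
  have 1: "I +> (n \<oplus> r \<otimes> a) = (I +> n) \<oplus>\<^bsub>R Quot I\<^esub> (I +> r) \<otimes>\<^bsub>R Quot I\<^esub> (I +> a)"
    if "n \<in> N" "r \<in> carrier R" for n r
    using coset_add[OF I] coset_mult[OF I] icarr[OF N that(1)] that(2) a by simp
  show "adjoin (R Quot I) ((+>) I ` N) (I +> a) \<subseteq> (+>) I ` adjoin R N a"
  proof
    fix c assume "c \<in> adjoin (R Quot I) ((+>) I ` N) (I +> a)"
    then obtain n s where n: "n \<in> N" "s \<in> carrier (R Quot I)" "c = (I +> n) \<oplus>\<^bsub>R Quot I\<^esub> s \<otimes>\<^bsub>R Quot I\<^esub> (I +> a)"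
      unfolding adjoin_def by blast
    obtain r where r: "r \<in> carrier R" "s = I +> r" using quot_carrierE[OF I n(2)] .
    then have "c = I +> (n \<oplus> r \<otimes> a)" using 1 n by simp
    then show "c \<in> (+>) I ` adjoin R N a" using adjoinI[OF n(1) r(1)] by blast
  qed
  show "(+>) I ` adjoin R N a \<subseteq> adjoin (R Quot I) ((+>) I ` N) (I +> a)"
    unfolding adjoin_def using 1 coset_closed[OF I] by (auto simp: adjoin_def) blast
qed

lemma reg_quot:
  assumes I: "ideal I R"
  shows "ideal N R \<Longrightarrow> I \<subseteq> N \<Longrightarrow> set xs \<subseteq> carrier R \<Longrightarrow>
    reg (R Quot I) ((+>) I ` N) (map ((+>) I) xs) \<longleftrightarrow> reg R N xs"
proof (induction xs arbitrary: N)
  case (Cons x xs)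
  have x: "x \<in> carrier R" using Cons.prems by simp
  have "(I +> r) \<otimes>\<^bsub>R Quot I\<^esub> (I +> x) \<in> (+>) I ` N \<longleftrightarrow> r \<otimes> x \<in> N" if "r \<in> carrier R" for r
    using coset_mem_image[OF I Cons.prems(1,2), of "r \<otimes> x"] coset_mult[OF I that x] that x by simp
  then have "nonzerodivisor (R Quot I) ((+>) I ` N) (I +> x) \<longleftrightarrow> nonzerodivisor R N x"
    unfolding nonzerodivisor_def
    using coset_mem_image[OF I Cons.prems(1,2)] coset_closed[OF I] quot_carrierE[OF I] by metis
  moreover have "I \<subseteq> adjoin R N x" using adjoin_sub[OF Cons.prems(1) x] Cons.prems(2) by blast
  ultimately show ?case
    using Cons.IH[OF ideal_adjoin[OF Cons.prems(1) x]] Cons.prems x coset_closed[OF I x]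
    by (simp add: adjoin_quot[OF I Cons.prems(1) x])
qed simp

lemma image_zero_quot:
  assumes I: "ideal I R" shows "(+>) I ` I = {\<zero>\<^bsub>R Quot I\<^esub>}"
proof -
  have "I +> a = I" if "a \<in> I" for a
    using a_rcos_zero[OF I that] by (simp add: that)
  then show ?thesis using izero[OF I] unfolding FactRing_def by auto
qed

lemma reg_if_regular_on_quotient:
  assumes I: "ideal I R" and "regular_on_quotient R I xs"
  shows "set xs \<subseteq> carrier R" "reg R I xs"
proof -
  interpret S: cring "R Quot I" by (rule quot_cring[OF I])
  show xs: "set xs \<subseteq> carrier R" using assms(2) unfolding regular_on_quotient_def by simp
  have "reg (R Quot I) {\<zero>\<^bsub>R Quot I\<^esub>} (map ((+>) I) xs)"
    using assms(2) unfolding regular_on_quotient_def by (simp add: S.reg_iff_regular_sequence)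
  then show "reg R I xs" using reg_quot[OF I I _ xs] image_zero_quot[OF I] by simp
qed

lemma prime_quot:
  assumes I: "ideal I R" and P: "primeideal P R" "I \<subseteq> P"
  shows "primeideal ((+>) I ` P) (R Quot I)"
proof -
  interpret S: cring "R Quot I" by (rule quot_cring[OF I])
  note iP = prime_ideal[OF P(1)]
  note mem = coset_mem_image[OF I iP P(2)]
  have id: "ideal ((+>) I ` P) (R Quot I)"
  proof (rule S.idealI')
    show "(+>) I ` P \<subseteq> carrier (R Quot I)" using coset_closed[OF I] icarr[OF iP] by auto
    show "\<zero>\<^bsub>R Quot I\<^esub> \<in> (+>) I ` P" 
      using image_mono[OF P(2), of "(+>) I"] image_zero_quot[OF I] by simp
    show "c \<oplus>\<^bsub>R Quot I\<^esub> c' \<in> (+>) I ` P" if cc: "c \<in> (+>) I ` P" "c' \<in> (+>) I ` P" for c c'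
    proof -
      obtain p q where pq: "p \<in> P" "c = I +> p" "q \<in> P" "c' = I +> q" using cc by blast
      then have "c \<oplus>\<^bsub>R Quot I\<^esub> c' = I +> (p \<oplus> q)" using coset_add[OF I] icarr[OF iP] by simp
      then show ?thesis using iadd[OF iP pq(1,3)] by simp
    qed
    show "s \<otimes>\<^bsub>R Quot I\<^esub> c \<in> (+>) I ` P" if s: "s \<in> carrier (R Quot I)" and "c \<in> (+>) I ` P" for s c
    proof -
      obtain r where r: "r \<in> carrier R" "s = I +> r" using quot_carrierE[OF I s] .
      obtain p where p: "p \<in> P" "c = I +> p" using \<open>c \<in> _\<close> by blast
      then have "s \<otimes>\<^bsub>R Quot I\<^esub> c = I +> (r \<otimes> p)" using coset_mult[OF I] icarr[OF iP] r by simp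
      then show ?thesis using imult[OF iP p(1) r(1)] by simp
    qed
  qed
  show ?thesis
  proof (rule primeidealI[OF id S.is_cring])
    have "\<one>\<^bsub>R Quot I\<^esub> \<notin> (+>) I ` P" using mem[of \<one>] coset_one[OF I] prime_one[OF P(1)] by simp
    then show "carrier (R Quot I) \<noteq> (+>) I ` P" by blast
    fix c c' assume c: "c \<in> carrier (R Quot I)" "c' \<in> carrier (R Quot I)" "c \<otimes>\<^bsub>R Quot I\<^esub> c' \<in> (+>) I ` P"
    obtain a where a: "a \<in> carrier R" "c = I +> a" using quot_carrierE[OF I c(1)] .
    obtain b where b: "b \<in> carrier R" "c' = I +> b" using quot_carrierE[OF I c(2)] .
    have "a \<otimes> b \<in> P" using mem[of "a \<otimes> b"] coset_mult[OF I a(1) b(1)] a b c(3) by simp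
    then show "c \<in> (+>) I ` P \<or> c' \<in> (+>) I ` P" using prime_mult[OF P(1) a(1) b(1)] a b by blast
  qed
qed

lemma prime_chain_quot:
  assumes I: "ideal I R" and P: "prime_chain R n P" "I \<subseteq> P 0"
  shows "prime_chain (R Quot I) n (\<lambda>i. (+>) I ` P i)"
proof -
  have pr: "primeideal (P i) R" if "i \<le> n" for i using P(1) that unfolding prime_chain_def by simp
  have lt: "P i \<subset> P (Suc i)" if "i < n" for i using P(1) that unfolding prime_chain_def by simp
  have sub: "i \<le> n \<Longrightarrow> I \<subseteq> P i" for i
  proof (induction i)
    case (Suc i) then show ?case using lt[of i] by auto
  qed (rule P(2))
  have "(+>) I ` P i \<subset> (+>) I ` P (Suc i)" if i: "i < n" for i
  proof -
    obtain a where a: "a \<in> P (Suc i)" "a \<notin> P i" using lt[OF i] by blast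
    have "a \<in> carrier R" using icarr[OF prime_ideal[OF pr] a(1)] i by simp
    then have "I +> a \<notin> (+>) I ` P i" using coset_mem_image[OF I prime_ideal[OF pr] sub] a(2) i by simp
    then show ?thesis using a(1) lt[OF i] by blast
  qed
  then show ?thesis unfolding prime_chain_def using prime_quot[OF I pr sub] by simp
qed

end

context gor begin

text \<open>Complete \<open>xs\<close> by \<open>us\<close> to a maximal regular sequence. A chain
  above \<open>Q\<close> gives \<open>R/I\<close> dimension at least \<open>length us\<close>, hence
  depth at least that. A regular sequence \<open>ys\<close> on \<open>R/I\<close> of at least this
  length then carries the bound \<open>length xs + length us\<close>, valid for all ideals, from
  \<open>(I, ys)\<close> back to \<open>I\<close>.\<close>

lemma ext_bound_if_cohen_macaulay:
  assumes CM: "cohen_macaulay_ideal R I" and xs: "reg R {\<zero>} xs" "set xs \<subseteq> I"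
    and Q: "Q \<in> associated_primes R (ci xs)" "I \<subseteq> Q"
  shows "ext_bound (length xs) I"
proof -
  have I: "ideal I R" "I \<noteq> carrier R" and loc: "local_ring (R Quot I)" and dp: "ring_depth (R Quot I) = krull_dim (R Quot I)"
    using CM unfolding cohen_macaulay_ideal_def proper_ideal_def cohen_macaulay_local_ring_def by auto
  interpret S: cring "R Quot I" by (rule quot_cring[OF I(1)])
  have Imm: "I \<subseteq> mm" using proper_sub_mm[OF I(1)] ideal_oneI[OF I(1)] I(2) by blast
  note A = ideal_ci[OF xs(1)]
  obtain us Q' where us0: "reg R {\<zero>} (xs @ us)" "set us \<subseteq> mm" "Q' \<in> associated_primes R (ci (xs @ us))" "mm \<subseteq> Q'"
    by (rule maximal_regular[OF ideal_mm prime_one[OF prime_mm] xs(1) subset_trans[OF xs(2) Imm]])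
  then have us: "reg R {\<zero>} (xs @ us)" "set us \<subseteq> mm" "mm \<in> associated_primes R (ci (xs @ us))"
    using assoc_eq_mm[OF us0(3,4)] by simp_all
  let ?n = "length us"
  obtain ys where ys: "reg R I ys" "set ys \<subseteq> mm" "?n \<le> length ys"
  \<comment> \<open>The depth is a supremum: if no sequence had length at least
    \<open>Suc k\<close>, it would be at most \<open>k\<close>. The value \<open>0\<close> has no
    predecessor and takes the empty sequence.\<close>
  proof (cases "?n")
    case 0
    then show ?thesis using that[of "[]"] by simp
  next
    case (Suc k)
    have ru: "reg R (ci xs) us" using us(1) by simp
    obtain P where P: "prime_chain R ?n P" "P 0 = Q" using chain_above[OF A Q(1) ru us(2)] by blast
    then have "prime_chain (R Quot I) ?n (\<lambda>i. (+>) I ` P i)" using prime_chain_quot[OF I(1)] Q(2) by simp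
    then have "enat ?n \<le> krull_dim (R Quot I)" unfolding krull_dim_def by (intro Sup_upper) blast
    then have le: "enat (Suc k) \<le> ring_depth (R Quot I)" using dp Suc by simp
    have "\<exists>ys. regular_sequence (R Quot I) ys \<and> set ys \<subseteq> the_maximal_ideal (R Quot I) \<and> Suc k \<le> length ys"
    proof (rule ccontr)
      assume "\<not> ?thesis"
      then have "ring_depth (R Quot I) \<le> enat k"
        unfolding ring_depth_def by (intro Sup_least) (auto simp: not_less_eq_eq)
      then show False using le by (meson enat_ord_simps(1) not_less_eq_eq order_refl order_trans)
    qed
    then obtain ys where ys: "regular_sequence (R Quot I) ys" "set ys \<subseteq> the_maximal_ideal (R Quot I)" "Suc k \<le> length ys"
      by blast
    have mS: "maximalideal (the_maximal_ideal (R Quot I)) (R Quot I)"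
      using theI'[of "\<lambda>M. maximalideal M (R Quot I)"] loc unfolding local_ring_def the_maximal_ideal_def by blast
    have "\<forall>c\<in>set ys. \<exists>a. a \<in> carrier R \<and> c = I +> a"
      using ys(1) quot_carrierE[OF I(1)] unfolding regular_sequence_def by (metis subsetD)
    then obtain f where f: "\<And>c. c \<in> set ys \<Longrightarrow> f c \<in> carrier R \<and> c = I +> f c" by metis
    let ?ys = "map f ys"
    have yc: "set ?ys \<subseteq> carrier R" using f by auto
    have eq: "map ((+>) I) ?ys = ys" using f by (simp add: map_idI)
    have "reg (R Quot I) {\<zero>\<^bsub>R Quot I\<^esub>} ys" using ys(1) S.reg_iff_regular_sequence by blast
    then have "reg R I ?ys" using reg_quot[OF I(1) I(1) _ yc] eq image_zero_quot[OF I(1)] by simp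
    \<comment> \<open>A representative outside the maximal ideal would be a unit, and so would its
      class.\<close>
    moreover have "set ?ys \<subseteq> mm"
    proof
      fix a assume a: "a \<in> set ?ys"
      then obtain c where c: "c \<in> set ys" "a = f c" by auto
      show "a \<in> mm"
      proof (rule ccontr)
        assume "a \<notin> mm"
        then obtain t where t: "t \<in> carrier R" "t \<otimes> a = \<one>" using unit_notin_mm[of a] a yc by blast
        have "c \<in> the_maximal_ideal (R Quot I)" using c ys(2) by blast
        then have "(I +> t) \<otimes>\<^bsub>R Quot I\<^esub> (I +> a) \<in> the_maximal_ideal (R Quot I)"
          using S.imult[OF S.prime_ideal[OF S.maximalideal_prime[OF mS]]] coset_closed[OF I(1) t(1)] f[OF c(1)] c(2) by metis
        then have "\<one>\<^bsub>R Quot I\<^esub> \<in> the_maximal_ideal (R Quot I)"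
          using coset_mult[OF I(1) t(1)] t(2) a yc coset_one[OF I(1)] by (metis subsetD)
        then show False using S.prime_one[OF S.maximalideal_prime[OF mS]] by simp
      qed
    qed
    ultimately show ?thesis using that[of ?ys] ys(3) Suc by simp
  qed
  have yc: "set ys \<subseteq> carrier R" using ys(2) isub[OF ideal_mm] by blast
  have "ext_bound (length (xs @ us)) (gen R I ys)"
    by (rule ext_bound_if_mm_assoc[OF us(1,3) ideal_gen[OF I(1) yc]])
  then have "ext_bound (length xs + length ys) (gen R I ys)" using ext_bound_mono ys(3) by simp
  then show ?thesis by (rule ext_bound_of_gen[OF I(1) ys(1,2)])
qed

end

section \<open>Gorenstein rings\<close>

text \<open>Injectivity is tested on modules in the type of \<open>E\<close>, here
  \<open>'a list\<close>; ideals are copied there as singleton lists.\<close>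

definition list_module :: "('a, 'x) ring_scheme \<Rightarrow> 'a set \<Rightarrow> ('a, 'a list) module" where
  "list_module R J = \<lparr>carrier = (\<lambda>a. [a]) ` J, monoid.mult = (\<lambda>u v. [hd u \<otimes>\<^bsub>R\<^esub> hd v]), one = [\<one>\<^bsub>R\<^esub>],
     ring.zero = [\<zero>\<^bsub>R\<^esub>], ring.add = (\<lambda>u v. [hd u \<oplus>\<^bsub>R\<^esub> hd v]), smult = (\<lambda>r u. [r \<otimes>\<^bsub>R\<^esub> hd u])\<rparr>"

context cring begin

lemma module_list: assumes J: "ideal J R" shows "module R (list_module R J)"
proof (rule moduleI[OF is_cring])
  note c = icarr[OF J]
  show "abelian_group (list_module R J)"
  proof (rule abelian_groupI)
    show "\<exists>y\<in>carrier (list_module R J). y \<oplus>\<^bsub>list_module R J\<^esub> x = \<zero>\<^bsub>list_module R J\<^esub>"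
      if x: "x \<in> carrier (list_module R J)" for x
    proof -
      obtain a where a: "a \<in> J" "x = [a]" using x unfolding list_module_def by auto
      then show ?thesis using ineg[OF J a(1)] c[OF a(1)] unfolding list_module_def
        by (intro bexI[of _ "[\<ominus> a]"]) (auto simp: l_neg)
    qed
  qed (auto simp: list_module_def c iadd[OF J] izero[OF J] a_ac)
qed (auto simp: list_module_def icarr[OF J] imult[OF J] l_distr r_distr m_assoc)

lemma hom_ext_of_injective:
  fixes E :: "('a, 'a list) module"
  assumes inj: "injective_module R E" and J: "ideal J R"
    and f: "\<And>a. a \<in> J \<Longrightarrow> f a \<in> carrier E"
      "\<And>a b. a \<in> J \<Longrightarrow> b \<in> J \<Longrightarrow> f (a \<oplus> b) = f a \<oplus>\<^bsub>E\<^esub> f b"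
      "\<And>r a. r \<in> carrier R \<Longrightarrow> a \<in> J \<Longrightarrow> f (r \<otimes> a) = r \<odot>\<^bsub>E\<^esub> f a"
  shows "\<exists>\<eta>\<in>carrier E. \<forall>a\<in>J. f a = a \<odot>\<^bsub>E\<^esub> \<eta>"
proof -
  let ?A = "list_module R J" and ?B = "list_module R (carrier R)"
  have id: "id \<in> module_hom R ?A ?B"
    unfolding module_hom_def list_module_def using icarr[OF J] by auto
  have g: "(\<lambda>u. f (hd u)) \<in> module_hom R ?A E"
    unfolding module_hom_def list_module_def using f by auto
  have "\<exists>h\<in>module_hom R ?B E. \<forall>a\<in>carrier ?A. h (id a) = f (hd a)"
    using inj module_list[OF J] module_list[OF oneideal] id g unfolding injective_module_def by (metis inj_on_id)
  then obtain h where h: "h \<in> module_hom R ?B E" "\<And>a. a \<in> carrier ?A \<Longrightarrow> h a = f (hd a)" by auto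
  have one: "[\<one>] \<in> carrier ?B" unfolding list_module_def by simp
  have "f a = a \<odot>\<^bsub>E\<^esub> h [\<one>]" if a: "a \<in> J" for a
  proof -
    have ac: "a \<in> carrier R" using icarr[OF J a] .
    have "h [a] = f a" using h(2)[of "[a]"] a unfolding list_module_def by simp
    moreover have "[a] = a \<odot>\<^bsub>?B\<^esub> [\<one>]" unfolding list_module_def using ac by simp
    ultimately show ?thesis using h(1) ac one unfolding module_hom_def by auto
  qed
  moreover have "h [\<one>] \<in> carrier E" using h(1) one unfolding module_hom_def by auto
  ultimately show ?thesis by blast
qed

end

lemma gor_if_gorenstein:
  fixes R :: "('a, 'x) ring_scheme" (structure)
  assumes "gorenstein_local_ring R" "infinite (carrier (residue_field R))"
  obtains E :: "nat \<Rightarrow> ('a, 'a list) module" and d e1 n where "gor R E d e1 n"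
proof -
  obtain n \<epsilon> and E :: "nat \<Rightarrow> ('a, 'a list) module" and d
    where res: "injective_resolution R (regular_module R) n \<epsilon> E d"
    using assms(1) unfolding gorenstein_local_ring_def by blast
  have loc: "cring R" "noetherian_ring R" "\<exists>!m. maximalideal m R"
    using assms(1) unfolding gorenstein_local_ring_def local_ring_def by auto
  interpret noeth_cring R using loc by (simp add: noeth_cring_def)
  have inj: "injective_module R (E i)" for i using res unfolding injective_resolution_def by blast
  have mod: "module R (E i)" for i using inj unfolding injective_module_def by blast
  have d: "d i \<in> module_hom R (E i) (E (Suc i))" for i using res unfolding injective_resolution_def by blast
  have \<epsilon>: "\<epsilon> \<in> module_hom R (regular_module R) (E 0)" "inj_on \<epsilon> (carrier (regular_module R))"
    "\<epsilon> ` carrier (regular_module R) = a_kernel (E 0) (E 1) (d 0)"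
    using res unfolding injective_resolution_def by blast+
  have ex: "d i ` carrier (E i) = a_kernel (E (Suc i)) (E (Suc (Suc i))) (d (Suc i))" for i
    using res unfolding injective_resolution_def by blast
  have van: "carrier (E i) = {\<zero>\<^bsub>E i\<^esub>}" if "i > n" for i
    using res that unfolding injective_resolution_def by blast
  have \<epsilon>': "\<epsilon> r = r \<odot>\<^bsub>E 0\<^esub> \<epsilon> \<one>" if "r \<in> carrier R" for r
  proof -
    have "\<epsilon> (r \<otimes> \<one>) = r \<odot>\<^bsub>E 0\<^esub> \<epsilon> \<one>" using \<epsilon>(1) that one_closed unfolding module_hom_def regular_module_def by (auto simp del: r_one)
    then show ?thesis using that by simp
  qed
  have e1: "\<epsilon> \<one> \<in> carrier (E 0)" using \<epsilon>(1) unfolding module_hom_def regular_module_def by auto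
  have "injres R E d (\<epsilon> \<one>) n"
  proof (intro injres.intro injres_axioms.intro)
    show "noeth_cring R" by (rule noeth_cring_axioms)
    show "module R (E i)" for i by (rule mod)
    show "d i \<in> module_hom R (E i) (E (Suc i))" for i by (rule d)
    show "\<epsilon> \<one> \<in> carrier (E 0)" by (rule e1)
    show "r = \<zero>" if r: "r \<in> carrier R" "r \<odot>\<^bsub>E 0\<^esub> \<epsilon> \<one> = \<zero>\<^bsub>E 0\<^esub>" for r
    proof -
      interpret M: module R "E 0" by (rule mod)
      have "\<epsilon> r = \<epsilon> \<zero>" using \<epsilon>'[OF r(1)] \<epsilon>'[OF zero_closed] r(2) e1 by simp
      then show ?thesis using \<epsilon>(2) r(1) unfolding inj_on_def regular_module_def by auto
    qed
    show "d 0 e = \<zero>\<^bsub>E (Suc 0)\<^esub> \<longleftrightarrow> (\<exists>r\<in>carrier R. e = r \<odot>\<^bsub>E 0\<^esub> \<epsilon> \<one>)" if e: "e \<in> carrier (E 0)" for e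
    proof -
      have "d 0 e = \<zero>\<^bsub>E (Suc 0)\<^esub> \<longleftrightarrow> e \<in> \<epsilon> ` carrier R"
        using \<epsilon>(3) e unfolding a_kernel_def' regular_module_def by auto
      moreover have "\<epsilon> ` carrier R = (\<lambda>r. r \<odot>\<^bsub>E 0\<^esub> \<epsilon> \<one>) ` carrier R"
        by (rule image_cong[OF refl]) (rule \<epsilon>')
      ultimately show ?thesis by (simp only: image_iff)
    qed
    show "d (Suc i) e = \<zero>\<^bsub>E (Suc (Suc i))\<^esub> \<longleftrightarrow> e \<in> d i ` carrier (E i)" if "e \<in> carrier (E (Suc i))" for e i
      using ex[of i] that unfolding a_kernel_def' by auto
    show "carrier (E i) = {\<zero>\<^bsub>E i\<^esub>}" if "n < i" for i using van that by simp
    show "\<exists>\<eta>\<in>carrier (E i). \<forall>a\<in>J. f a = a \<odot>\<^bsub>E i\<^esub> \<eta>"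
      if "ideal J R" "\<And>a. a \<in> J \<Longrightarrow> f a \<in> carrier (E i)"
        "\<And>a b. a \<in> J \<Longrightarrow> b \<in> J \<Longrightarrow> f (a \<oplus> b) = f a \<oplus>\<^bsub>E i\<^esub> f b"
        "\<And>r a. r \<in> carrier R \<Longrightarrow> a \<in> J \<Longrightarrow> f (r \<otimes> a) = r \<odot>\<^bsub>E i\<^esub> f a" for J f i
      by (rule hom_ext_of_injective[OF inj that])
  qed
  then have "gor R E d (\<epsilon> \<one>) n" using loc(3) assms(2) by (simp add: gor_def gor_axioms_def)
  then show ?thesis using that by blast
qed

section \<open>Ideals containing all their direct links\<close>

context gor begin

text \<open>Unmixed Cohen-Macaulay ideals of height \<open>h\<close>, with the Cohen-Macaulay
  property in the form of an Ext bound. All parts are stable under proper links.\<close>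

definition cm_ideal :: "'a set \<Rightarrow> nat \<Rightarrow> bool" where
  "cm_ideal P h \<longleftrightarrow> ideal P R \<and> P \<subseteq> mm \<and> ext_bound h P \<and>
     (\<forall>Q\<in>associated_primes R P. prime_height R Q = enat h)"

lemma cm_idealD:
  assumes "cm_ideal P h"
  shows "ideal P R" "P \<subseteq> mm" "ext_bound h P" "Q \<in> associated_primes R P \<Longrightarrow> prime_height R Q = enat h"
  using assms unfolding cm_ideal_def by auto

lemma proper_idealI: "ideal P R \<Longrightarrow> P \<subseteq> mm \<Longrightarrow> proper_ideal R P"
  unfolding proper_ideal_def using prime_one[OF prime_mm] by auto

lemma proper_ideal_sub_mm: "proper_ideal R P \<Longrightarrow> P \<subseteq> mm"
  unfolding proper_ideal_def using proper_sub_mm ideal_oneI by blast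

lemma unmixed_if_heights:
  "ideal P R \<Longrightarrow> P \<subseteq> mm \<Longrightarrow> (\<And>Q. Q \<in> associated_primes R P \<Longrightarrow> prime_height R Q = h) \<Longrightarrow> unmixed_ideal R P"
  unfolding unmixed_ideal_def using proper_idealI by simp

text \<open>Primes associated to \<open>(ys) : P\<close> are associated to \<open>(ys)\<close>, so
  the linked ideal is unmixed; the double colon gives the symmetry of the link.\<close>

lemma direct_link:
  assumes P: "ideal P R" "P \<subseteq> mm" "\<And>Q. Q \<in> associated_primes R P \<Longrightarrow> prime_height R Q = enat (length ys)"
    and ys: "reg R {\<zero>} ys" "set ys \<subseteq> P" and J: "\<one> \<notin> ideal_colon R (ci ys) P"
  shows "(P, ideal_colon R (ci ys) P) \<in> direct_linkage R"
proof -
  let ?J = "ideal_colon R (ci ys) P"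
  note A = ideal_ci[OF ys(1)] and yc = reg_carrier[OF ys(1)]
  have sub: "ci ys \<subseteq> P" by (rule ci_sub[OF P(1) ys(2)])
  have iJ: "ideal ?J R" by (rule ideal_colon_ideal[OF A isub[OF P(1)]])
  have Jm: "?J \<subseteq> mm" by (rule proper_sub_mm[OF iJ J])
  have "\<one> \<notin> ci ys" using sub P(2) prime_one[OF prime_mm] by blast
  then have "ci ys \<noteq> carrier R" by auto
  then have "complete_intersection R (ci ys)"
    unfolding complete_intersection_def proper_ideal_def
    using A ys(1) yc reg_iff_regular_sequence[of ys] gen_zero_eq_Idl[OF yc] by (intro conjI exI[of _ ys]) auto
  moreover have "P = ideal_colon R (ci ys) ?J" using double_colon[OF ys P(1,3)] by simp
  ultimately have "directly_linked R P ?J"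
    unfolding directly_linked_def
    using proper_idealI[OF P(1,2)] proper_idealI[OF iJ Jm] sub ideal_colon_sub[OF A isub[OF P(1)]] by blast
  moreover have "unmixed_ideal R ?J"
    by (rule unmixed_if_heights[OF iJ Jm]) (use assoc_ideal_colon[OF A P(1)] prime_height_assoc[OF ys(1)] in blast)
  ultimately show ?thesis unfolding direct_linkage_def using unmixed_if_heights[OF P] by simp
qed

lemma maximal_contains_link:
  assumes mx: "maximal_in_linkage_class R P" and l: "(P, J) \<in> direct_linkage R" shows "J \<subseteq> P"
proof -
  have "(P, J) \<in> linkage R" using l unfolding linkage_def direct_linkage_def by auto
  then show ?thesis using mx unfolding maximal_in_linkage_class_def linkage_class_def by blast
qed

text \<open>A complete intersection \<open>(a_1, \<dots>, a_g)\<close> different from the maximal ideal is linked by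
  \<open>(a_1, \<dots>, b a_g)\<close> to an ideal containing \<open>b\<close>, so it is not maximal in its class.\<close>

lemma maximal_not_ci:
  assumes I: "cm_ideal I (length ys)" and mx: "maximal_in_linkage_class R I" and x: "\<not> mm \<subseteq> I"
    and ys: "reg R {\<zero>} ys" "ys \<noteq> []"
  shows "I \<noteq> ci ys"
proof
  assume eq: "I = ci ys"
  note iI = cm_idealD(1)[OF I]
  obtain zs a where za: "ys = zs @ [a]" using ys(2) by (cases ys rule: rev_cases) auto
  have zs: "reg R {\<zero>} zs" and a: "a \<in> carrier R" "nonzerodivisor R (ci zs) a" using ys(1) za by auto
  note Z = ideal_ci[OF zs]
  have Ieq: "I = adjoin R (ci zs) a" using eq za by simp
  have ysI: "set ys \<subseteq> I" unfolding eq by (rule gen_mem[OF zeroideal reg_carrier[OF ys(1)]])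
  \<comment> \<open>The longer regular sequence \<open>ys\<close> lies in the maximal ideal, so the
    latter is not inside an associated prime of \<open>(zs)\<close>.\<close>
  have "\<not> mm \<subseteq> Q" if Q: "Q \<in> associated_primes R (ci zs)" for Q
  proof
    assume "mm \<subseteq> Q"
    then have "set ys \<subseteq> Q" using ysI cm_idealD(2)[OF I] by blast
    then show False using reg_length_le[OF zs Q ys(1)] za by simp
  qed
  then obtain b where b: "b \<in> mm" "b \<notin> I" "nonzerodivisor R (ci zs) b"
    using regular_avoiding[OF ideal_mm, of "{I}" "{ci zs}"] iI x Z by auto
  have bc: "b \<in> carrier R" using icarr[OF ideal_mm b(1)] .
  let ?ys = "zs @ [b \<otimes> a]"
  have "nonzerodivisor R (ci zs) (b \<otimes> a)"
    unfolding nonzerodivisor_def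
  proof (intro ballI impI)
    fix r assume r: "r \<in> carrier R" "r \<otimes> (b \<otimes> a) \<in> ci zs"
    then have "(r \<otimes> b) \<otimes> a \<in> ci zs" using bc a by (simp add: m_assoc)
    then show "r \<in> ci zs" using nonzerodivisorD[OF a(2)] nonzerodivisorD[OF b(3)] r(1) bc by simp
  qed
  then have r: "reg R {\<zero>} ?ys" using zs bc a by simp
  have sub: "set ?ys \<subseteq> I" using ysI za imult[OF iI _ bc, of a] by auto
  have A': "ci ?ys = adjoin R (ci zs) (b \<otimes> a)" by simp
  \<comment> \<open>If the colon ideal were trivial, \<open>a\<close> would be \<open>s b a\<close>
    modulo \<open>(zs)\<close>; cancelling \<open>a\<close> makes \<open>1 - s b\<close> a member of
    \<open>(zs)\<close>, impossible for \<open>b\<close> in the maximal ideal.\<close>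
  have one: "\<one> \<notin> ideal_colon R (ci ?ys) I"
  proof
    assume "\<one> \<in> ideal_colon R (ci ?ys) I"
    then have "\<one> \<otimes> a \<in> adjoin R (ci zs) (b \<otimes> a)" using ideal_colonD ysI za A' by fastforce
    then obtain n s where n: "n \<in> ci zs" "s \<in> carrier R" "\<one> \<otimes> a = n \<oplus> s \<otimes> (b \<otimes> a)" by (rule adjoinE)
    have nc: "n \<in> carrier R" using icarr[OF Z n(1)] .
    have "(\<one> \<ominus> s \<otimes> b) \<otimes> a = \<one> \<otimes> a \<ominus> s \<otimes> (b \<otimes> a)" using n(2) bc a by algebra
    also have "\<dots> = n" unfolding n(3) using nc n(2) bc a by algebra
    finally have "\<one> \<ominus> s \<otimes> b \<in> ci zs" using nonzerodivisorD[OF a(2), of "\<one> \<ominus> s \<otimes> b"] n(1,2) bc by simp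
    then have "\<one> \<ominus> s \<otimes> b \<in> mm" using adjoin_sub[OF Z a(1)] Ieq cm_idealD(2)[OF I] by blast
    then have "\<one> \<in> mm" using iminus_cancel[OF ideal_mm _ imult[OF ideal_mm b(1) n(2)]] by simp
    then show False using prime_one[OF prime_mm] by simp
  qed
  have "(I, ideal_colon R (ci ?ys) I) \<in> direct_linkage R"
    using direct_link[OF iI cm_idealD(2)[OF I] _ r sub one] cm_idealD(4)[OF I] za by simp
  then have "ideal_colon R (ci ?ys) I \<subseteq> I" by (rule maximal_contains_link[OF mx])
  moreover have "b \<in> ideal_colon R (ci ?ys) I"
  proof -
    have "b \<otimes> i \<in> adjoin R (ci zs) (b \<otimes> a)" if i: "i \<in> I" for i
    proof -
      obtain n s where n: "n \<in> ci zs" "s \<in> carrier R" "i = n \<oplus> s \<otimes> a" using i unfolding Ieq by (rule adjoinE)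
      have nc: "n \<in> carrier R" using icarr[OF Z n(1)] .
      have "b \<otimes> i = b \<otimes> n \<oplus> s \<otimes> (b \<otimes> a)" unfolding n(3) using nc n(2) bc a by algebra
      then show ?thesis using adjoinI[OF imult[OF Z n(1) bc] n(2)] by simp
    qed
    then show ?thesis unfolding ideal_colon_def using bc A' by simp
  qed
  ultimately show False using b(2) by blast
qed

text \<open>The colon ideal is a proper link unless \<open>I = (ys)\<close>, which
  \<open>maximal_not_ci\<close> excludes.\<close>

lemma maximal_contains_links:
  assumes I: "cm_ideal I (length ys)" and mx: "maximal_in_linkage_class R I" and x: "\<not> mm \<subseteq> I"
    and ys: "reg R {\<zero>} ys" "ys \<noteq> []" "set ys \<subseteq> I"
  shows "ideal_colon R (ci ys) I \<subseteq> I"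
proof -
  note iI = cm_idealD(1)[OF I]
  have "\<one> \<notin> ideal_colon R (ci ys) I"
  proof
    assume "\<one> \<in> ideal_colon R (ci ys) I"
    then have "I \<subseteq> ci ys" using ideal_colonD[of \<one>] icarr[OF iI] by fastforce
    then have "I = ci ys" using ci_sub[OF iI ys(3)] by blast
    then show False using maximal_not_ci[OF I mx x ys(1,2)] by simp
  qed
  then show ?thesis
    using maximal_contains_link[OF mx] direct_link[OF iI cm_idealD(2)[OF I] _ ys(1,3)] cm_idealD(4)[OF I] by blast
qed

text \<open>A prime associated to \<open>(I, x)\<close> is associated to some complete intersection
  extending \<open>xs\<close> and \<open>x'\<close>. The Ext bound limits the length of the latter
  to \<open>g + 1\<close>, which fixes the height.\<close>

lemma cm_ideal_adjoin:
  assumes I: "cm_ideal I g" and xs: "reg R {\<zero>} xs" "set xs \<subseteq> I" "length xs = g"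
    and x: "x \<in> mm" "nonzerodivisor R I x"
  shows "cm_ideal (adjoin R I x) (Suc g)" "\<exists>x'\<in>adjoin R I x. reg R {\<zero>} (xs @ [x'])"
proof -
  note iI = cm_idealD(1)[OF I] and A = ideal_ci[OF xs(1)]
  have xc: "x \<in> carrier R" using icarr[OF ideal_mm x(1)] .
  have I': "ideal (adjoin R I x) R" by (rule ideal_adjoin[OF iI xc])
  \<comment> \<open>An associated prime of \<open>I\<close> inside such a \<open>Q\<close> would
    equal \<open>Q\<close> by minimality and contain \<open>x\<close>, which is regular modulo
    \<open>I\<close>.\<close>
  have nt: "\<not> adjoin R I x \<subseteq> Q" if Q: "Q \<in> associated_primes R (ci xs)" for Q
  proof
    assume sub: "adjoin R I x \<subseteq> Q"
    have "I \<subseteq> Q" "x \<in> Q" using sub adjoin_sub[OF iI xc] adjoin_mem[OF iI xc] by auto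
    then obtain Q1 where Q1: "Q1 \<in> associated_primes R I" "Q1 \<subseteq> Q"
      using assoc_prime_below[OF iI assoc_prime[OF Q]] by blast
    have "ci xs \<subseteq> Q1" using ci_sub[OF iI xs(2)] assoc_prime_sub[OF iI Q1(1)] by blast
    then have "Q1 = Q" using assoc_ci_minimal[OF xs(1) Q assoc_prime[OF Q1(1)] _ Q1(2)] by simp
    then show False using nonzerodivisor_notin_assoc[OF x(2) xc Q1(1)] \<open>x \<in> Q\<close> by simp
  qed
  obtain x' where x': "x' \<in> adjoin R I x" "nonzerodivisor R (ci xs) x'"
    using regular_avoiding[OF I', of "{}" "{ci xs}"] A nt by auto
  then have r: "reg R {\<zero>} (xs @ [x'])" using xs(1) icarr[OF I'] by simp
  then show "\<exists>x'\<in>adjoin R I x. reg R {\<zero>} (xs @ [x'])" using x' by blast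
  have V: "ext_bound (Suc g) (adjoin R I x)" by (rule ext_bound_adjoin[OF iI xc x(2) cm_idealD(3)[OF I]])
  have "prime_height R Q = enat (Suc g)" if Q: "Q \<in> associated_primes R (adjoin R I x)" for Q
  proof -
    note Qp = assoc_prime[OF Q]
    have s: "set (xs @ [x']) \<subseteq> Q" using assoc_prime_sub[OF I' Q] xs(2) x'(1) adjoin_sub[OF iI xc] by auto
    obtain us Q' where us: "reg R {\<zero>} ((xs @ [x']) @ us)" "set us \<subseteq> Q" "Q' \<in> associated_primes R (ci ((xs @ [x']) @ us))" "Q \<subseteq> Q'"
      by (rule maximal_regular[OF prime_ideal[OF Qp] prime_one[OF Qp] r s])
    let ?ys = "(xs @ [x']) @ us"
    have sy: "set ?ys \<subseteq> Q" using s us(2) by auto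
    have "Q = Q'" by (rule assoc_ci_minimal[OF us(1,3) Qp ci_sub[OF prime_ideal[OF Qp] sy] us(4)])
    then have Qy: "Q \<in> associated_primes R (ci ?ys)" using us(3) by simp
    have "length ?ys \<le> Suc g" by (rule ext_bound_assoc_le[OF I' V Q us(1) Qy])
    then have "length ?ys = Suc g" using xs(3) by simp
    then show ?thesis using prime_height_assoc[OF us(1) Qy] by simp
  qed
  then show "cm_ideal (adjoin R I x) (Suc g)"
    unfolding cm_ideal_def using I' V adjoin_proper[OF iI cm_idealD(2)[OF I] x(1)] by simp
qed

text \<open>An element of \<open>(I, x)\<close> outside this ideal has a unit coefficient at
  \<open>x\<close> in every representation and can replace \<open>x\<close> as a generator over
  \<open>I\<close>.\<close>

definition nonunit_part :: "'a set \<Rightarrow> 'a \<Rightarrow> 'a set" where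
  "nonunit_part I x = {n \<oplus> r \<otimes> x |n r. n \<in> I \<and> r \<in> mm}"

lemma ideal_nonunit_part:
  assumes I: "ideal I R" and x: "x \<in> carrier R" shows "ideal (nonunit_part I x) R"
  unfolding nonunit_part_def by (rule ideal_add_mult[OF I ideal_mm x])

text \<open>If one member \<open>e\<close> of a regular sequence in \<open>(I, x)\<close> has a unit coefficient at \<open>x\<close>, then
  the others can be moved into \<open>I\<close> by subtracting multiples of \<open>e\<close>; the resulting link of
  \<open>(I, x) = (I, e)\<close> comes from a link of \<open>I\<close>.\<close>

lemma link_of_unit_part:
  assumes I: "cm_ideal I g" and x: "x \<in> mm"
    and T: "\<And>ys. reg R {\<zero>} ys \<Longrightarrow> set ys \<subseteq> I \<Longrightarrow> length ys = g \<Longrightarrow> ideal_colon R (ci ys) I \<subseteq> I"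
    and cs: "reg R {\<zero>} (cs @ [e])" "set cs \<subseteq> adjoin R I x" "e \<in> adjoin R I x" "length cs = g"
    and e: "e \<notin> nonunit_part I x"
  shows "ideal_colon R (ci (cs @ [e])) (adjoin R I x) \<subseteq> adjoin R I x"
proof
  note iI = cm_idealD(1)[OF I]
  have xc: "x \<in> carrier R" using icarr[OF ideal_mm x] .
  have I': "ideal (adjoin R I x) R" by (rule ideal_adjoin[OF iI xc])
  have I'm: "adjoin R I x \<subseteq> mm" by (rule adjoin_proper[OF iI cm_idealD(2)[OF I] x])
  obtain n l where n: "n \<in> I" "l \<in> carrier R" "e = n \<oplus> l \<otimes> x" using cs(3) by (rule adjoinE)
  have "l \<in> carrier R - mm" using e n unfolding nonunit_part_def by blast
  then obtain t where t: "t \<in> carrier R" "t \<otimes> l = \<one>" by (rule unit_notin_mm)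
  have nc: "n \<in> carrier R" and ec: "e \<in> carrier R" using icarr[OF iI n(1)] icarr[OF I' cs(3)] by auto
  have "\<forall>c\<in>set cs. \<exists>c'. c' \<in> I \<and> c \<ominus> c' \<in> adjoin R {\<zero>} e"
  proof
    fix c assume "c \<in> set cs"
    then have "c \<in> adjoin R I x" using cs(2) by blast
    then obtain k r where k: "k \<in> I" "r \<in> carrier R" "c = k \<oplus> r \<otimes> x" by (rule adjoinE)
    have kc: "k \<in> carrier R" using icarr[OF iI k(1)] .
    \<comment> \<open>From \<open>e = n + l x\<close> and the inverse \<open>t\<close> of
      \<open>l\<close>, \<open>x\<close> is congruent to \<open>- t n\<close> modulo
      \<open>e\<close>; substituting this in \<open>k + r x\<close> gives
      \<open>?c'\<close>.\<close>
    let ?c' = "k \<ominus> (r \<otimes> t) \<otimes> n"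
    have "?c' \<in> I" using iminus[OF iI k(1) imult[OF iI n(1)]] k(2) t(1) by simp
    moreover have "c \<ominus> ?c' = \<zero> \<oplus> (r \<otimes> t) \<otimes> e"
    proof -
      have "(r \<otimes> t) \<otimes> e = (r \<otimes> t) \<otimes> n \<oplus> r \<otimes> (t \<otimes> l) \<otimes> x" unfolding n(3) using k(2) t(1) nc n(2) xc by algebra
      also have "\<dots> = (r \<otimes> t) \<otimes> n \<oplus> r \<otimes> x" using t(2) k(2) by simp
      finally have "(r \<otimes> t) \<otimes> e = (r \<otimes> t) \<otimes> n \<oplus> r \<otimes> x" .
      moreover have "(k \<oplus> r \<otimes> x) \<ominus> (k \<ominus> (r \<otimes> t) \<otimes> n) = (r \<otimes> t) \<otimes> n \<oplus> r \<otimes> x"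
        using kc k(2) t(1) nc xc by algebra
      ultimately show ?thesis using k(3) k(2) t(1) nc xc by simp
    qed
    ultimately show "\<exists>c'. c' \<in> I \<and> c \<ominus> c' \<in> adjoin R {\<zero>} e"
      using adjoinI[of \<zero> "{\<zero>}" "r \<otimes> t" e] k(2) t(1) by auto
  qed
  then obtain f where f: "\<And>c. c \<in> set cs \<Longrightarrow> f c \<in> I \<and> c \<ominus> f c \<in> adjoin R {\<zero>} e" by metis
  define cs' where "cs' = map f cs"
  have csc: "set cs \<subseteq> carrier R" using cs(2) isub[OF I'] by blast
  have cs'I: "set cs' \<subseteq> I" unfolding cs'_def using f by auto
  have cs'c: "set cs' \<subseteq> carrier R" using cs'I isub[OF iI] by blast
  have iE: "ideal (adjoin R {\<zero>} e) R" by (rule ideal_adjoin[OF zeroideal ec])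
  have m: "set (cs @ [e]) \<subseteq> mm" using cs(2,3) I'm by auto
  \<comment> \<open>\<open>e\<close> is moved to the front so that the other members may be changed
    modulo \<open>e\<close>, and afterwards back to the end.\<close>
  have r1: "reg R {\<zero>} (e # cs)" by (rule reg_perm[OF zeroideal m _ cs(1)]) simp
  have "list_all2 (\<lambda>x y. x \<in> carrier R \<and> y \<in> carrier R \<and> x \<ominus> y \<in> adjoin R {\<zero>} e) cs cs'"
    unfolding cs'_def using f csc icarr[OF iI] by (auto simp: list_all2_map2 intro!: list.rel_refl_strong)
  then have r2: "reg R (adjoin R {\<zero>} e) cs'" "gen R (adjoin R {\<zero>} e) cs = gen R (adjoin R {\<zero>} e) cs'"
    using reg_cong[OF iE] r1 by auto
  have r3: "reg R {\<zero>} (cs' @ [e])"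
  proof (rule reg_perm[OF zeroideal, of "e # cs'"])
    show "set (e # cs') \<subseteq> mm" using cs'I cm_idealD(2)[OF I] m by auto
    show "reg R {\<zero>} (e # cs')" using r2(1) r1 by simp
  qed simp
  have "ci (cs @ [e]) = ci (e # cs)" by (rule gen_cong[OF zeroideal]) (use csc ec in auto)
  also have "\<dots> = ci (e # cs')" using r2(2) by simp
  also have "\<dots> = ci (cs' @ [e])" by (rule gen_cong[OF zeroideal]) (use cs'c ec in auto)
  finally have ci_eq: "ci (cs @ [e]) = adjoin R (ci cs') e" by simp
  have len: "length cs' = g" unfolding cs'_def using cs(4) by simp
  fix v assume v: "v \<in> ideal_colon R (ci (cs @ [e])) (adjoin R I x)"
  then have "v \<in> ideal_colon R (adjoin R (ci cs') e) I"
    unfolding ci_eq ideal_colon_def using adjoin_sub[OF iI xc] by blast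
  moreover have "reg R {\<zero>} cs'" "nonzerodivisor R (ci cs') e" using r3 by auto
  ultimately obtain u where u: "u \<in> carrier R" "v \<ominus> u \<otimes> e \<in> ideal_colon R (ci cs') I"
    using colon_adjoin_lift[OF _ iI ci_sub[OF iI cs'I] _ ec] cm_idealD(3)[OF I] len by metis
  have "v \<ominus> u \<otimes> e \<in> adjoin R I x"
    using T[OF _ cs'I len] r3 u(2) adjoin_sub[OF iI xc] by auto
  moreover have "v \<in> carrier R" using v unfolding ideal_colon_def by simp
  ultimately show "v \<in> adjoin R I x" using iminus_cancel[OF I' _ imult[OF I' cs(3) u(1)]] by blast
qed

end

section \<open>Power series\<close>

text \<open>Cauchy product by splitting the first factor as \<open>f = f 0 + t f'\<close>. The
  recursion replaces a finite sum, so the ring laws follow by induction.\<close>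

primrec conv :: "('a, 'x) ring_scheme \<Rightarrow> nat \<Rightarrow> (nat \<Rightarrow> 'a) \<Rightarrow> (nat \<Rightarrow> 'a) \<Rightarrow> 'a" where
  "conv R 0 f g = f 0 \<otimes>\<^bsub>R\<^esub> g 0"
| "conv R (Suc n) f g = f 0 \<otimes>\<^bsub>R\<^esub> g (Suc n) \<oplus>\<^bsub>R\<^esub> conv R n (\<lambda>i. f (Suc i)) g"

definition fps_ring :: "('a, 'x) ring_scheme \<Rightarrow> (nat \<Rightarrow> 'a) ring" where
  "fps_ring R = \<lparr>carrier = {f. \<forall>n. f n \<in> carrier R}, monoid.mult = (\<lambda>f g n. conv R n f g),
     one = (\<lambda>n. if n = 0 then \<one>\<^bsub>R\<^esub> else \<zero>\<^bsub>R\<^esub>), ring.zero = (\<lambda>_. \<zero>\<^bsub>R\<^esub>),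
     ring.add = (\<lambda>f g n. f n \<oplus>\<^bsub>R\<^esub> g n)\<rparr>"

definition cst :: "('a, 'x) ring_scheme \<Rightarrow> 'a \<Rightarrow> nat \<Rightarrow> 'a" where
  "cst R a = (\<lambda>n. if n = 0 then a else \<zero>\<^bsub>R\<^esub>)"

text \<open>Multiplication by the variable.\<close>

definition sh :: "('a, 'x) ring_scheme \<Rightarrow> (nat \<Rightarrow> 'a) \<Rightarrow> nat \<Rightarrow> 'a" where
  "sh R f = (\<lambda>n. case n of 0 \<Rightarrow> \<zero>\<^bsub>R\<^esub> | Suc m \<Rightarrow> f m)"

context cring begin

abbreviation S :: "(nat \<Rightarrow> 'a) ring" where "S \<equiv> fps_ring R"

lemma S_carrier: "f \<in> carrier S \<longleftrightarrow> (\<forall>n. f n \<in> carrier R)" by (simp add: fps_ring_def)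
lemma S_coeff: "f \<in> carrier S \<Longrightarrow> f n \<in> carrier R" by (simp add: fps_ring_def)
lemma S_mult: "(f \<otimes>\<^bsub>S\<^esub> g) n = conv R n f g" by (simp add: fps_ring_def)
lemma S_add: "(f \<oplus>\<^bsub>S\<^esub> g) n = f n \<oplus> g n" by (simp add: fps_ring_def)
lemma S_zero: "\<zero>\<^bsub>S\<^esub> n = \<zero>" by (simp add: fps_ring_def)
lemma S_zero': "\<zero>\<^bsub>S\<^esub> = (\<lambda>_. \<zero>)" by (simp add: fps_ring_def)
lemma S_one: "\<one>\<^bsub>S\<^esub> = cst R \<one>" by (simp add: fps_ring_def cst_def)

lemma minus_self: "a \<in> carrier R \<Longrightarrow> a \<ominus> a = \<zero>" by (simp add: a_minus_def r_neg)

lemma conv_closed: "(\<And>i. f i \<in> carrier R) \<Longrightarrow> (\<And>i. g i \<in> carrier R) \<Longrightarrow> conv R n f g \<in> carrier R"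
  by (induction n arbitrary: f) auto

lemma conv_add_left:
  "(\<And>i. f i \<in> carrier R) \<Longrightarrow> (\<And>i. f' i \<in> carrier R) \<Longrightarrow> (\<And>i. g i \<in> carrier R) \<Longrightarrow>
   conv R n (\<lambda>i. f i \<oplus> f' i) g = conv R n f g \<oplus> conv R n f' g"
proof (induction n arbitrary: f f')
  case (Suc n)
  have c: "conv R n (\<lambda>i. f (Suc i)) g \<in> carrier R" "conv R n (\<lambda>i. f' (Suc i)) g \<in> carrier R"
    "f 0 \<in> carrier R" "f' 0 \<in> carrier R" "g (Suc n) \<in> carrier R"
    using Suc.prems by (auto intro: conv_closed)
  have "conv R n (\<lambda>i. f (Suc i) \<oplus> f' (Suc i)) g = conv R n (\<lambda>i. f (Suc i)) g \<oplus> conv R n (\<lambda>i. f' (Suc i)) g"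
    by (rule Suc.IH) (use Suc.prems in auto)
  then show ?case using c by (simp add: l_distr a_ac)
qed (simp add: l_distr)

lemma conv_smult_left:
  "a \<in> carrier R \<Longrightarrow> (\<And>i. f i \<in> carrier R) \<Longrightarrow> (\<And>i. g i \<in> carrier R) \<Longrightarrow>
   conv R n (\<lambda>i. a \<otimes> f i) g = a \<otimes> conv R n f g"
proof (induction n arbitrary: f)
  case (Suc n)
  have "conv R n (\<lambda>i. f (Suc i)) g \<in> carrier R" using Suc.prems by (auto intro: conv_closed)
  moreover have "conv R n (\<lambda>i. a \<otimes> f (Suc i)) g = a \<otimes> conv R n (\<lambda>i. f (Suc i)) g"
    by (rule Suc.IH) (use Suc.prems in auto)
  ultimately show ?case using Suc.prems by (simp add: r_distr m_assoc)
qed (simp add: m_assoc)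

lemma conv_Suc_right:
  "(\<And>i. f i \<in> carrier R) \<Longrightarrow> (\<And>i. g i \<in> carrier R) \<Longrightarrow>
   conv R (Suc n) f g = f (Suc n) \<otimes> g 0 \<oplus> conv R n f (\<lambda>i. g (Suc i))"
proof (induction n arbitrary: f)
  case 0 then show ?case by (simp add: a_comm)
next
  case (Suc n)
  have c: "conv R n (\<lambda>i. f (Suc i)) (\<lambda>i. g (Suc i)) \<in> carrier R" using Suc.prems by (auto intro: conv_closed)
  have "conv R (Suc n) (\<lambda>i. f (Suc i)) g = f (Suc (Suc n)) \<otimes> g 0 \<oplus> conv R n (\<lambda>i. f (Suc i)) (\<lambda>i. g (Suc i))"
    by (rule Suc.IH) (use Suc.prems in auto)
  then show ?case using c Suc.prems by (simp add: a_ac)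
qed

lemma conv_comm:
  "(\<And>i. f i \<in> carrier R) \<Longrightarrow> (\<And>i. g i \<in> carrier R) \<Longrightarrow> conv R n f g = conv R n g f"
proof (induction n arbitrary: f g)
  case 0 then show ?case by (simp add: m_comm)
next
  case (Suc n)
  have "conv R n (\<lambda>i. f (Suc i)) g = conv R n g (\<lambda>i. f (Suc i))" by (rule Suc.IH) (use Suc.prems in auto)
  then show ?case using conv_Suc_right[of g f n] Suc.prems by (simp add: m_comm)
qed

lemma conv_assoc:
  "(\<And>i. f i \<in> carrier R) \<Longrightarrow> (\<And>i. g i \<in> carrier R) \<Longrightarrow> (\<And>i. h i \<in> carrier R) \<Longrightarrow>
   conv R n (\<lambda>k. conv R k f g) h = conv R n f (\<lambda>k. conv R k g h)"
proof (induction n arbitrary: f)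
  case 0 then show ?case by (simp add: m_assoc)
next
  case (Suc n)
  let ?f = "\<lambda>i. f (Suc i)" and ?g = "\<lambda>i. g (Suc i)"
  have cl: "f 0 \<in> carrier R" "g 0 \<in> carrier R" "h (Suc n) \<in> carrier R"
    "conv R n ?g h \<in> carrier R" "conv R n ?f (\<lambda>k. conv R k g h) \<in> carrier R"
    using Suc.prems by (auto intro!: conv_closed)
  have "conv R n (\<lambda>i. f 0 \<otimes> ?g i \<oplus> conv R i ?f g) h = conv R n (\<lambda>i. f 0 \<otimes> ?g i) h \<oplus> conv R n (\<lambda>i. conv R i ?f g) h"
    by (rule conv_add_left) (use Suc.prems in \<open>auto intro!: conv_closed\<close>)
  also have "conv R n (\<lambda>i. f 0 \<otimes> ?g i) h = f 0 \<otimes> conv R n ?g h"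
    by (rule conv_smult_left) (use Suc.prems in auto)
  also have "conv R n (\<lambda>i. conv R i ?f g) h = conv R n ?f (\<lambda>k. conv R k g h)"
    by (rule Suc.IH) (use Suc.prems in auto)
  finally show ?case using cl by (simp add: r_distr m_assoc a_assoc)
qed

lemma cring_S: "cring S"
proof (rule cringI)
  show "abelian_group S"
  proof (rule abelian_groupI)
    show "\<exists>y\<in>carrier S. y \<oplus>\<^bsub>S\<^esub> x = \<zero>\<^bsub>S\<^esub>" if "x \<in> carrier S" for x
      using that by (intro bexI[of _ "\<lambda>n. \<ominus> x n"]) (auto simp: fps_ring_def l_neg)
  qed (auto simp: fps_ring_def a_ac)
  show "comm_monoid S"
  proof (rule comm_monoidI)
    show "x \<otimes>\<^bsub>S\<^esub> y \<otimes>\<^bsub>S\<^esub> z = x \<otimes>\<^bsub>S\<^esub> (y \<otimes>\<^bsub>S\<^esub> z)" if "x \<in> carrier S" "y \<in> carrier S" "z \<in> carrier S" for x y z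
      using that conv_assoc[of x y z] by (simp add: fps_ring_def)
    show "\<one>\<^bsub>S\<^esub> \<otimes>\<^bsub>S\<^esub> x = x" if x: "x \<in> carrier S" for x
    proof
      have z: "conv R n (\<lambda>i. \<zero>) x = \<zero>" for n using x by (induction n) (auto simp: fps_ring_def)
      fix n show "(\<one>\<^bsub>S\<^esub> \<otimes>\<^bsub>S\<^esub> x) n = x n" using x z by (cases n) (auto simp: fps_ring_def)
    qed
    show "x \<otimes>\<^bsub>S\<^esub> y = y \<otimes>\<^bsub>S\<^esub> x" if "x \<in> carrier S" "y \<in> carrier S" for x y
      using that conv_comm[of x y] by (simp add: fps_ring_def)
  qed (auto simp: fps_ring_def intro: conv_closed)
  show "(x \<oplus>\<^bsub>S\<^esub> y) \<otimes>\<^bsub>S\<^esub> z = x \<otimes>\<^bsub>S\<^esub> z \<oplus>\<^bsub>S\<^esub> y \<otimes>\<^bsub>S\<^esub> z" if "x \<in> carrier S" "y \<in> carrier S" "z \<in> carrier S" for x y z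
    using that conv_add_left[of x y z] by (simp add: fps_ring_def)
qed

interpretation S: cring S by (rule cring_S)

lemma S_neg: assumes f: "f \<in> carrier S" shows "(\<ominus>\<^bsub>S\<^esub> f) n = \<ominus> f n"
proof -
  have "(\<ominus>\<^bsub>S\<^esub> f \<oplus>\<^bsub>S\<^esub> f) n = \<zero>" using f by (simp add: S.l_neg S_zero)
  then show ?thesis using S_coeff[OF f] S_coeff[OF S.a_inv_closed[OF f]] by (simp add: S_add minus_equality)
qed

lemma S_minus: "f \<in> carrier S \<Longrightarrow> g \<in> carrier S \<Longrightarrow> (f \<ominus>\<^bsub>S\<^esub> g) n = f n \<ominus> g n"
  by (simp add: a_minus_def S_add S_neg)

lemma S_mult_0: "(f \<otimes>\<^bsub>S\<^esub> g) 0 = f 0 \<otimes> g 0" by (simp add: S_mult)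

lemma cst_closed: "a \<in> carrier R \<Longrightarrow> cst R a \<in> carrier S" by (simp add: S_carrier cst_def)
lemma cst_0: "cst R a 0 = a" by (simp add: cst_def)
lemma sh_closed: "f \<in> carrier S \<Longrightarrow> sh R f \<in> carrier S" by (simp add: S_carrier sh_def split: nat.split)
lemma sh_0: "sh R f 0 = \<zero>" by (simp add: sh_def)
lemma sh_Suc: "sh R f (Suc n) = f n" by (simp add: sh_def)
lemma conv_zero: "(\<And>i. g i \<in> carrier R) \<Longrightarrow> conv R n (\<lambda>_. \<zero>) g = \<zero>"
  by (induction n) auto

lemma cst_mult: assumes "a \<in> carrier R" "f \<in> carrier S" shows "(cst R a \<otimes>\<^bsub>S\<^esub> f) n = a \<otimes> f n"
  using assms conv_zero[of f] by (cases n) (auto simp: S_mult cst_def S_carrier)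

lemma sh_add: "sh R (f \<oplus>\<^bsub>S\<^esub> g) = sh R f \<oplus>\<^bsub>S\<^esub> sh R g"
  by (rule ext) (auto simp: sh_def S_add split: nat.split)

lemma sh_mult: assumes "f \<in> carrier S" "g \<in> carrier S" shows "sh R f \<otimes>\<^bsub>S\<^esub> g = sh R (f \<otimes>\<^bsub>S\<^esub> g)"
proof
  fix n show "(sh R f \<otimes>\<^bsub>S\<^esub> g) n = sh R (f \<otimes>\<^bsub>S\<^esub> g) n"
    using assms conv_closed[of f g] by (cases n) (auto simp: S_mult sh_def S_carrier)
qed

lemma sh_mult': "f \<in> carrier S \<Longrightarrow> g \<in> carrier S \<Longrightarrow> f \<otimes>\<^bsub>S\<^esub> sh R g = sh R (f \<otimes>\<^bsub>S\<^esub> g)"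
  using sh_mult[of g f] by (simp add: S.m_comm sh_closed)

lemma sh_minus: "f \<in> carrier S \<Longrightarrow> g \<in> carrier S \<Longrightarrow> sh R (f \<ominus>\<^bsub>S\<^esub> g) = sh R f \<ominus>\<^bsub>S\<^esub> sh R g"
proof -
  assume f: "f \<in> carrier S" and g: "g \<in> carrier S"
  show "sh R (f \<ominus>\<^bsub>S\<^esub> g) = sh R f \<ominus>\<^bsub>S\<^esub> sh R g"
  proof
    fix n show "sh R (f \<ominus>\<^bsub>S\<^esub> g) n = (sh R f \<ominus>\<^bsub>S\<^esub> sh R g) n"
      using f g by (cases n) (simp_all add: S_minus sh_closed sh_0 sh_Suc minus_self)
  qed
qed

lemma S_ideal_sh: assumes N: "ideal N S" and f: "f \<in> N" shows "sh R f \<in> N"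
proof -
  have fc: "f \<in> carrier S" using S.icarr[OF N f] .
  have "sh R f = sh R \<one>\<^bsub>S\<^esub> \<otimes>\<^bsub>S\<^esub> f" using sh_mult[OF S.one_closed fc] fc by simp
  then show ?thesis using S.imult[OF N f sh_closed[OF S.one_closed]] by simp
qed

lemma S_decomp: assumes "f \<in> carrier S" obtains f' where "f' \<in> carrier S" "f = cst R (f 0) \<oplus>\<^bsub>S\<^esub> sh R f'"
proof
  show "(\<lambda>n. f (Suc n)) \<in> carrier S" using assms by (simp add: S_carrier)
  show "f = cst R (f 0) \<oplus>\<^bsub>S\<^esub> sh R (\<lambda>n. f (Suc n))"
  proof
    fix n show "f n = (cst R (f 0) \<oplus>\<^bsub>S\<^esub> sh R (\<lambda>n. f (Suc n))) n"
      using assms by (cases n) (auto simp: S_add cst_def sh_0 sh_Suc S_carrier)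
  qed
qed

lemma S_divisible: assumes "f \<in> carrier S" "f 0 = \<zero>" obtains f' where "f' \<in> carrier S" "f = sh R f'"
proof
  show "(\<lambda>n. f (Suc n)) \<in> carrier S" using assms by (simp add: S_carrier)
  show "f = sh R (\<lambda>n. f (Suc n))"
  proof
    fix n show "f n = sh R (\<lambda>n. f (Suc n)) n" using assms by (cases n) (auto simp: sh_0 sh_Suc)
  qed
qed

section \<open>Constant terms, lifted regular sequences and infinite sums\<close>

abbreviation at0 :: "(nat \<Rightarrow> 'a) \<Rightarrow> 'a" where "at0 \<equiv> \<lambda>f. f 0"

abbreviation gS :: "(nat \<Rightarrow> 'a) list \<Rightarrow> (nat \<Rightarrow> 'a) set" where "gS as \<equiv> gen S {\<zero>\<^bsub>S\<^esub>} as"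

lemma ideal_gS: "set as \<subseteq> carrier S \<Longrightarrow> ideal (gS as) S"
  by (rule S.ideal_gen[OF S.zeroideal])

lemma ideal_ci_carrier: "set as \<subseteq> carrier R \<Longrightarrow> ideal (ci as) R"
  by (rule ideal_gen[OF zeroideal])

lemma at0_carrier: "set as \<subseteq> carrier S \<Longrightarrow> set (map at0 as) \<subseteq> carrier R"
  using S_coeff by auto

lemma at0_gS:
  "set as \<subseteq> carrier S \<Longrightarrow> at0 ` gS as = ci (map at0 as)"
proof (induction as rule: rev_induct)
  case Nil then show ?case by (simp add: S_zero)
next
  case (snoc a as)
  have a: "a \<in> carrier S" and IH: "at0 ` gS as = ci (map at0 as)" using snoc by auto
  show ?case
  proof (intro equalityI subsetI)
    fix r assume "r \<in> at0 ` gS (as @ [a])"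
    then obtain u where u: "u \<in> adjoin S (gS as) a" "r = u 0" by auto
    obtain n s where n: "n \<in> gS as" "s \<in> carrier S" "u = n \<oplus>\<^bsub>S\<^esub> s \<otimes>\<^bsub>S\<^esub> a" using u(1) by (rule S.adjoinE)
    have "n 0 \<in> ci (map at0 as)" using IH n(1) by blast
    then have "n 0 \<oplus> s 0 \<otimes> a 0 \<in> adjoin R (ci (map at0 as)) (a 0)"
      by (rule adjoinI) (rule S_coeff[OF n(2)])
    then show "r \<in> ci (map at0 (as @ [a]))" using u(2) n(3) by (simp add: S_add S_mult_0)
  next
    fix r assume "r \<in> ci (map at0 (as @ [a]))"
    then have "r \<in> adjoin R (ci (map at0 as)) (a 0)" by simp
    then obtain n s where n: "n \<in> ci (map at0 as)" "s \<in> carrier R" "r = n \<oplus> s \<otimes> a 0" by (rule adjoinE)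
    obtain n' where n': "n' \<in> gS as" "n = n' 0" using IH n(1) by blast
    have "n' \<oplus>\<^bsub>S\<^esub> cst R s \<otimes>\<^bsub>S\<^esub> a \<in> gS (as @ [a])"
      using S.adjoinI[OF n'(1) cst_closed[OF n(2)], of a] by simp
    moreover have "(n' \<oplus>\<^bsub>S\<^esub> cst R s \<otimes>\<^bsub>S\<^esub> a) 0 = r" using n(3) n'(2) by (simp add: S_add S_mult_0 cst_0)
    ultimately show "r \<in> at0 ` gS (as @ [a])" by force
  qed
qed

lemma gS_at0: "set as \<subseteq> carrier S \<Longrightarrow> f \<in> gS as \<Longrightarrow> f 0 \<in> ci (map at0 as)"
  using at0_gS by blast

lemma gS_decomp:
  assumes as: "set as \<subseteq> carrier S" and f: "f \<in> carrier S" "f 0 \<in> ci (map at0 as)"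
  obtains a f' where "a \<in> gS as" "f' \<in> carrier S" "f = a \<oplus>\<^bsub>S\<^esub> sh R f'"
proof -
  have "f 0 \<in> at0 ` gS as" using f(2) at0_gS[OF as] by simp
  then obtain a where a: "f 0 = a 0" "a \<in> gS as" by (rule imageE)
  have ac: "a \<in> carrier S" using S.icarr[OF ideal_gS[OF as] a(2)] .
  have "(f \<ominus>\<^bsub>S\<^esub> a) 0 = \<zero>" using a(1)[symmetric] f(1) ac S_coeff[OF f(1)] by (simp add: S_minus minus_self)
  then obtain f' where f': "f' \<in> carrier S" "f \<ominus>\<^bsub>S\<^esub> a = sh R f'" using S_divisible[of "f \<ominus>\<^bsub>S\<^esub> a"] f(1) ac by auto
  have "f = a \<oplus>\<^bsub>S\<^esub> (f \<ominus>\<^bsub>S\<^esub> a)" using f(1) ac by algebra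
  then show ?thesis using that[OF a(2) f'(1)] f'(2) by simp
qed

text \<open>In \<open>t f = n + s a\<close> regularity of the constant terms forces
  \<open>s = b + t s'\<close> with \<open>b\<close> in the ideal of the earlier members, so
  \<open>f - s' a\<close> falls under the induction hypothesis.\<close>

lemma sh_saturated:
  "set as \<subseteq> carrier S \<Longrightarrow> reg R {\<zero>} (map at0 as) \<Longrightarrow> f \<in> carrier S \<Longrightarrow> sh R f \<in> gS as \<Longrightarrow> f \<in> gS as"
proof (induction as arbitrary: f rule: rev_induct)
  case Nil
  then have "sh R f = \<zero>\<^bsub>S\<^esub>" by simp
  then have "f = \<zero>\<^bsub>S\<^esub>" using sh_Suc[of f] S_zero by (metis ext)
  then show ?case by simp
next
  case (snoc a as)
  have as: "set as \<subseteq> carrier S" and a: "a \<in> carrier S" using snoc.prems(1) by auto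
  have r: "reg R {\<zero>} (map at0 as)" "nonzerodivisor R (ci (map at0 as)) (a 0)" using snoc.prems(2) by auto
  note iG = ideal_gS[OF as]
  have iGR: "ideal (ci (map at0 as)) R" by (rule ideal_ci_carrier[OF at0_carrier[OF as]])
  have "sh R f \<in> adjoin S (gS as) a" using snoc.prems(4) by simp
  then obtain n s where n: "n \<in> gS as" "s \<in> carrier S" "sh R f = n \<oplus>\<^bsub>S\<^esub> s \<otimes>\<^bsub>S\<^esub> a" by (rule S.adjoinE)
  have nc: "n \<in> carrier S" using S.icarr[OF iG n(1)] .
  have c0: "n 0 \<in> carrier R" "s 0 \<in> carrier R" "a 0 \<in> carrier R" using nc n(2) a S_coeff by auto
  have "n 0 \<oplus> s 0 \<otimes> a 0 = \<zero>" using n(3) sh_0[of f] by (simp add: S_add S_mult_0)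
  then have "s 0 \<otimes> a 0 = \<ominus> n 0" using c0 by (metis a_comm m_closed minus_equality)
  then have "s 0 \<otimes> a 0 \<in> ci (map at0 as)" using ineg[OF iGR gS_at0[OF as n(1)]] by simp
  then have "s 0 \<in> ci (map at0 as)" using nonzerodivisorD[OF r(2) c0(2)] by simp
  then obtain b s' where b: "b \<in> gS as" "s' \<in> carrier S" "s = b \<oplus>\<^bsub>S\<^esub> sh R s'" using gS_decomp[OF as n(2)] by blast
  have bc: "b \<in> carrier S" using S.icarr[OF iG b(1)] .
  have "sh R (f \<ominus>\<^bsub>S\<^esub> s' \<otimes>\<^bsub>S\<^esub> a) = sh R f \<ominus>\<^bsub>S\<^esub> sh R s' \<otimes>\<^bsub>S\<^esub> a"
    using snoc.prems(3) b(2) a by (simp add: sh_minus sh_mult)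
  also have "\<dots> = n \<oplus>\<^bsub>S\<^esub> a \<otimes>\<^bsub>S\<^esub> b"
    unfolding n(3) b(3) using nc bc a sh_closed[OF b(2)] by algebra
  also have "\<dots> \<in> gS as" using S.iadd[OF iG n(1) S.imult[OF iG b(1) a]] .
  finally have "f \<ominus>\<^bsub>S\<^esub> s' \<otimes>\<^bsub>S\<^esub> a \<in> gS as" using snoc.IH[OF as r(1)] snoc.prems(3) b(2) a by simp
  then have "(f \<ominus>\<^bsub>S\<^esub> s' \<otimes>\<^bsub>S\<^esub> a) \<oplus>\<^bsub>S\<^esub> s' \<otimes>\<^bsub>S\<^esub> a \<in> adjoin S (gS as) a" using S.adjoinI[OF _ b(2)] by blast
  moreover have "(f \<ominus>\<^bsub>S\<^esub> s' \<otimes>\<^bsub>S\<^esub> a) \<oplus>\<^bsub>S\<^esub> s' \<otimes>\<^bsub>S\<^esub> a = f" using snoc.prems(3) b(2) a by algebra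
  ultimately show ?case by simp
qed

text \<open>The series \<open>\<Sum>n. t^n a_n\<close> for a sequence of power series \<open>a_n\<close>.\<close>

primrec series_coeff :: "nat \<Rightarrow> (nat \<Rightarrow> nat \<Rightarrow> 'a) \<Rightarrow> 'a" where
  "series_coeff 0 a = a 0 0"
| "series_coeff (Suc m) a = a 0 (Suc m) \<oplus> series_coeff m (\<lambda>n. a (Suc n))"

definition series :: "(nat \<Rightarrow> nat \<Rightarrow> 'a) \<Rightarrow> nat \<Rightarrow> 'a" where "series a = (\<lambda>m. series_coeff m a)"

lemma series_closed: "(\<And>n. a n \<in> carrier S) \<Longrightarrow> series a \<in> carrier S"
proof -
  have "(\<And>n. a n \<in> carrier S) \<Longrightarrow> series_coeff m a \<in> carrier R" for m
    by (induction m arbitrary: a) (auto simp: S_coeff)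
  then show "(\<And>n. a n \<in> carrier S) \<Longrightarrow> series a \<in> carrier S" unfolding series_def S_carrier by blast
qed

lemma series_step: "(\<And>n. a n \<in> carrier S) \<Longrightarrow> series a = a 0 \<oplus>\<^bsub>S\<^esub> sh R (series (\<lambda>n. a (Suc n)))"
proof
  fix m assume a: "\<And>n. a n \<in> carrier S"
  show "series a m = (a 0 \<oplus>\<^bsub>S\<^esub> sh R (series (\<lambda>n. a (Suc n)))) m"
    using S_coeff[OF a[of 0]] by (cases m) (auto simp: series_def S_add sh_0 sh_Suc)
qed

text \<open>The recursion leaves no freedom: coefficient \<open>m\<close> of \<open>f k\<close> is
  reached after \<open>m\<close> steps.\<close>

lemma series_unique:
  assumes "\<And>n. a n \<in> carrier S" "\<And>n. f n \<in> carrier S" "\<And>n. f n = a n \<oplus>\<^bsub>S\<^esub> sh R (f (Suc n))"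
  shows "f k = series (\<lambda>n. a (k + n))"
proof -
  have "f k m = series_coeff m (\<lambda>n. a (k + n))" for m
  proof (induction m arbitrary: k)
    case 0
    have "f k 0 = (a k \<oplus>\<^bsub>S\<^esub> sh R (f (Suc k))) 0" using assms(3)[of k] by simp
    then show ?case using S_coeff[OF assms(1)] by (simp add: S_add sh_0)
  next
    case (Suc m)
    have "f k (Suc m) = (a k \<oplus>\<^bsub>S\<^esub> sh R (f (Suc k))) (Suc m)" using assms(3)[of k] by simp
    then show ?case using Suc.IH[of "Suc k"] by (simp add: S_add sh_Suc)
  qed
  then show ?thesis unfolding series_def by blast
qed

text \<open>The coefficients at each of the finitely many generators are again summed as a series,
  so the ideal is closed under \<open>t\<close>-adic sums.\<close>

lemma series_in_gS:
  "set as \<subseteq> carrier S \<Longrightarrow> (\<And>n. a n \<in> gS as) \<Longrightarrow> series a \<in> gS as"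
proof (induction as arbitrary: a rule: rev_induct)
  case Nil
  have a: "a n = \<zero>\<^bsub>S\<^esub>" for n using Nil.prems(2)[of n] by simp
  have "series_coeff m a = \<zero>" if "\<And>n. a n = \<zero>\<^bsub>S\<^esub>" for m a
    using that by (induction m arbitrary: a) (auto simp: S_zero)
  then have "series a = \<zero>\<^bsub>S\<^esub>" using a unfolding series_def S_zero' by blast
  then show ?case by simp
next
  case (snoc c as)
  have as: "set as \<subseteq> carrier S" and c: "c \<in> carrier S" using snoc.prems(1) by auto
  have iG: "ideal (gS as) S" by (rule ideal_gS[OF as])
  have "\<exists>b s. b \<in> gS as \<and> s \<in> carrier S \<and> a n = b \<oplus>\<^bsub>S\<^esub> s \<otimes>\<^bsub>S\<^esub> c" for n
  proof -
    have "a n \<in> adjoin S (gS as) c" using snoc.prems(2)[of n] by simp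
    then show ?thesis by (auto elim: S.adjoinE)
  qed
  then obtain b s where bs: "\<And>n. b n \<in> gS as" "\<And>n. s n \<in> carrier S" "\<And>n. a n = b n \<oplus>\<^bsub>S\<^esub> s n \<otimes>\<^bsub>S\<^esub> c"
    by metis
  have bc: "b n \<in> carrier S" for n using S.icarr[OF iG bs(1)] .
  have ac: "a n \<in> carrier S" for n using bs bc c by simp
  \<comment> \<open>The tails of the two series are combined, so that \<open>series_unique\<close>
    identifies the combination with the series of \<open>a\<close>.\<close>
  let ?f = "\<lambda>k. series (\<lambda>n. b (k + n)) \<oplus>\<^bsub>S\<^esub> series (\<lambda>n. s (k + n)) \<otimes>\<^bsub>S\<^esub> c"
  have "?f 0 = series (\<lambda>n. a (0 + n))"
  proof (rule series_unique[OF ac])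
    fix k
    have lc: "series (\<lambda>n. b (k + n)) \<in> carrier S" "series (\<lambda>n. s (k + n)) \<in> carrier S" for k
      using bc bs(2) by (auto intro: series_closed)
    show "?f k \<in> carrier S" using lc c by simp
    have 1: "series (\<lambda>n. b (k + n)) = b k \<oplus>\<^bsub>S\<^esub> sh R (series (\<lambda>n. b (Suc k + n)))"
      using series_step[of "\<lambda>n. b (k + n)"] bc by simp
    have 2: "series (\<lambda>n. s (k + n)) = s k \<oplus>\<^bsub>S\<^esub> sh R (series (\<lambda>n. s (Suc k + n)))"
      using series_step[of "\<lambda>n. s (k + n)"] bs(2) by simp
    have 3: "sh R (?f (Suc k)) = sh R (series (\<lambda>n. b (Suc k + n))) \<oplus>\<^bsub>S\<^esub> sh R (series (\<lambda>n. s (Suc k + n))) \<otimes>\<^bsub>S\<^esub> c"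
      by (simp only: sh_add sh_mult[OF lc(2)[of "Suc k"] c])
    have alg: "(u \<oplus>\<^bsub>S\<^esub> u') \<oplus>\<^bsub>S\<^esub> (v \<oplus>\<^bsub>S\<^esub> v') \<otimes>\<^bsub>S\<^esub> c = (u \<oplus>\<^bsub>S\<^esub> v \<otimes>\<^bsub>S\<^esub> c) \<oplus>\<^bsub>S\<^esub> (u' \<oplus>\<^bsub>S\<^esub> v' \<otimes>\<^bsub>S\<^esub> c)"
      if "u \<in> carrier S" "u' \<in> carrier S" "v \<in> carrier S" "v' \<in> carrier S" for u u' v v'
      using that c by algebra
    show "?f k = a k \<oplus>\<^bsub>S\<^esub> sh R (?f (Suc k))"
      unfolding 1 2 3 bs(3)
      by (rule alg[OF bc sh_closed[OF lc(1)] bs(2) sh_closed[OF lc(2)]])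
  qed
  then have "series a = series b \<oplus>\<^bsub>S\<^esub> series s \<otimes>\<^bsub>S\<^esub> c" by simp
  then show ?case using S.adjoinI[OF snoc.IH[OF as bs(1)] series_closed[OF bs(2)], where a = c] by simp
qed

text \<open>Dividing repeatedly by \<open>t\<close> writes \<open>f\<close> as a series with terms
  in \<open>(as)\<close>. Membership is thus checked one coefficient at a time.\<close>

lemma gS_complete:
  assumes as: "set as \<subseteq> carrier S" and f: "f \<in> K" and K: "K \<subseteq> carrier S"
    and step: "\<And>f. f \<in> K \<Longrightarrow> \<exists>a\<in>gS as. \<exists>f'\<in>K. f = a \<oplus>\<^bsub>S\<^esub> sh R f'"
  shows "f \<in> gS as"
proof -
  have "\<exists>F. \<forall>n. (F n \<in> K \<and> (n = 0 \<longrightarrow> F n = f)) \<and> (\<exists>a\<in>gS as. F n = a \<oplus>\<^bsub>S\<^esub> sh R (F (Suc n)))"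
    by (rule dependent_nat_choice) (use f step in auto)
  then obtain F where F: "\<And>n. F n \<in> K" "F 0 = f" "\<forall>n. \<exists>a. a \<in> gS as \<and> F n = a \<oplus>\<^bsub>S\<^esub> sh R (F (Suc n))" by blast
  from choice[OF F(3)] obtain a where a: "\<And>n. a n \<in> gS as" "\<And>n. F n = a n \<oplus>\<^bsub>S\<^esub> sh R (F (Suc n))" by blast
  have "F 0 = series (\<lambda>n. a (0 + n))"
    by (rule series_unique[of a F 0, OF S.icarr[OF ideal_gS[OF as] a(1)] subsetD[OF K F(1)] a(2)])
  then show ?thesis using series_in_gS[OF as a(1)] F(2) by simp
qed

text \<open>If \<open>f a\<close> is in the ideal of the earlier members, then \<open>f\<close> is
  in it up to some \<open>t f'\<close>, and \<open>f' a\<close> is again in it because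
  \<open>t\<close> can be cancelled.\<close>

lemma reg_lift:
  "set as \<subseteq> carrier S \<Longrightarrow> reg R {\<zero>} (map at0 as) \<Longrightarrow> reg S {\<zero>\<^bsub>S\<^esub>} as"
proof (induction as rule: rev_induct)
  case (snoc a as)
  have as: "set as \<subseteq> carrier S" and a: "a \<in> carrier S" using snoc.prems(1) by auto
  have r: "reg R {\<zero>} (map at0 as)" "nonzerodivisor R (ci (map at0 as)) (a 0)" using snoc.prems(2) by auto
  have iG: "ideal (gS as) S" by (rule ideal_gS[OF as])
  have "nonzerodivisor S (gS as) a"
    unfolding nonzerodivisor_def
  proof (intro ballI impI)
    fix f assume f: "f \<in> carrier S" "f \<otimes>\<^bsub>S\<^esub> a \<in> gS as"
    show "f \<in> gS as"
    proof (rule gS_complete[OF as, of f "{f \<in> carrier S. f \<otimes>\<^bsub>S\<^esub> a \<in> gS as}"])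
      fix f assume "f \<in> {f \<in> carrier S. f \<otimes>\<^bsub>S\<^esub> a \<in> gS as}"
      then have f: "f \<in> carrier S" "f \<otimes>\<^bsub>S\<^esub> a \<in> gS as" by auto
      have "f 0 \<otimes> a 0 \<in> ci (map at0 as)" using gS_at0[OF as f(2)] by (simp add: S_mult_0)
      then have "f 0 \<in> ci (map at0 as)" using nonzerodivisorD[OF r(2) S_coeff[OF f(1)]] by simp
      then obtain b f' where b: "b \<in> gS as" "f' \<in> carrier S" "f = b \<oplus>\<^bsub>S\<^esub> sh R f'" using gS_decomp[OF as f(1)] by blast
      have bc: "b \<in> carrier S" using S.icarr[OF iG b(1)] .
      have "sh R (f' \<otimes>\<^bsub>S\<^esub> a) = f \<otimes>\<^bsub>S\<^esub> a \<ominus>\<^bsub>S\<^esub> a \<otimes>\<^bsub>S\<^esub> b"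
        unfolding b(3) sh_mult[OF b(2) a, symmetric] using bc a sh_closed[OF b(2)] by algebra
      also have "\<dots> \<in> gS as" using S.iminus[OF iG f(2) S.imult[OF iG b(1) a]] .
      finally have "f' \<otimes>\<^bsub>S\<^esub> a \<in> gS as" using sh_saturated[OF as r(1)] b(2) a by simp
      then show "\<exists>a'\<in>gS as. \<exists>f'\<in>{f \<in> carrier S. f \<otimes>\<^bsub>S\<^esub> a \<in> gS as}. f = a' \<oplus>\<^bsub>S\<^esub> sh R f'" using b by blast
    qed (use f in auto)
  qed
  then show ?case using snoc.IH[OF as r(1)] a by simp
qed simp

text \<open>A deformation of \<open>P\<close> over \<open>R[[t]]\<close>; flatness means that \<open>t\<close> is regular modulo \<open>Pt\<close>.\<close>

definition flat_lift :: "(nat \<Rightarrow> 'a) set \<Rightarrow> 'a set \<Rightarrow> bool" where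
  "flat_lift Pt P \<longleftrightarrow> ideal Pt S \<and> (\<forall>f\<in>carrier S. sh R f \<in> Pt \<longrightarrow> f \<in> Pt) \<and> at0 ` Pt = P"

definition fps_ext :: "'a set \<Rightarrow> (nat \<Rightarrow> 'a) set" where "fps_ext P = {f. \<forall>n. f n \<in> P}"

lemma ideal_fps_ext: assumes P: "ideal P R" shows "ideal (fps_ext P) S"
proof (rule S.idealI')
  show "fps_ext P \<subseteq> carrier S" using icarr[OF P] by (auto simp: fps_ext_def S_carrier)
  show "\<zero>\<^bsub>S\<^esub> \<in> fps_ext P" using izero[OF P] by (simp add: fps_ext_def S_zero)
  show "a \<oplus>\<^bsub>S\<^esub> b \<in> fps_ext P" if "a \<in> fps_ext P" "b \<in> fps_ext P" for a b
    using that iadd[OF P] by (simp add: fps_ext_def S_add)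
  show "r \<otimes>\<^bsub>S\<^esub> a \<in> fps_ext P" if r: "r \<in> carrier S" and a: "a \<in> fps_ext P" for r a
  proof -
    have "conv R n r a \<in> P" if "\<And>i. r i \<in> carrier R" for n r
      using that
    proof (induction n arbitrary: r)
      case (Suc n)
      have "conv R n (\<lambda>i. r (Suc i)) a \<in> P" by (rule Suc.IH) (rule Suc.prems)
      then show ?case using a Suc.prems iadd[OF P imult[OF P]] by (simp add: fps_ext_def)
    qed (use a imult[OF P] in \<open>simp add: fps_ext_def\<close>)
    then show ?thesis using S_coeff[OF r] by (simp add: fps_ext_def S_mult)
  qed
qed

lemma cst_fps_ext: "ideal P R \<Longrightarrow> a \<in> P \<Longrightarrow> cst R a \<in> fps_ext P"
  using izero by (simp add: fps_ext_def cst_def)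

lemma flat_lift_fps_ext: assumes P: "ideal P R" shows "flat_lift (fps_ext P) P"
  unfolding flat_lift_def
proof (intro conjI ballI impI)
  show "f \<in> fps_ext P" if f: "sh R f \<in> fps_ext P" for f
  proof -
    have "sh R f (Suc n) \<in> P" for n using f unfolding fps_ext_def by blast
    then show ?thesis unfolding fps_ext_def by (simp add: sh_Suc)
  qed
  show "at0 ` fps_ext P = P"
    using cst_fps_ext[OF P] cst_0 unfolding fps_ext_def by (auto intro!: rev_image_eqI)
qed (rule ideal_fps_ext[OF P])

text \<open>For finitely generated \<open>P\<close> the series with coefficients in \<open>P\<close>
  form the extended ideal. This makes constant generators available in
  \<open>R[[t]]\<close>.\<close>

lemma fps_ext_gen:
  assumes P: "P = ci ds" and ds: "set ds \<subseteq> carrier R" shows "fps_ext P = gS (map (cst R) ds)"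
proof
  have iP: "ideal P R" unfolding P by (rule ideal_ci_carrier[OF ds])
  have dc: "set (map (cst R) ds) \<subseteq> carrier S" using ds cst_closed by auto
  have eq: "map at0 (map (cst R) ds) = ds" by (simp add: cst_0 map_idI)
  show "fps_ext P \<subseteq> gS (map (cst R) ds)"
  proof
    fix f assume f: "f \<in> fps_ext P"
    show "f \<in> gS (map (cst R) ds)"
    proof (rule gS_complete[OF dc f S.isub[OF ideal_fps_ext[OF iP]]])
      fix f assume f: "f \<in> fps_ext P"
      have fc: "f \<in> carrier S" using S.icarr[OF ideal_fps_ext[OF iP] f] .
      have f0: "f 0 \<in> ci (map at0 (map (cst R) ds))" unfolding eq using f P by (simp add: fps_ext_def)
      obtain a f' where a: "a \<in> gS (map (cst R) ds)" "f' \<in> carrier S" "f = a \<oplus>\<^bsub>S\<^esub> sh R f'"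
        using gS_decomp[OF dc fc f0] .
      have "gS (map (cst R) ds) \<subseteq> fps_ext P"
        using cst_fps_ext[OF iP] gen_mem[OF zeroideal ds] P S.izero[OF ideal_fps_ext[OF iP]]
        by (intro S.gen_least[OF ideal_fps_ext[OF iP]]) auto
      then have aP: "a \<in> fps_ext P" using a(1) by blast
      have "f' n \<in> P" for n
      proof -
        have "f (Suc n) = (a \<oplus>\<^bsub>S\<^esub> sh R f') (Suc n)" using a(3) by simp
        also have "\<dots> = f' n \<oplus> a (Suc n)"
          using S_coeff[OF a(2)] S_coeff[OF S.icarr[OF ideal_fps_ext[OF iP] aP]] by (simp add: S_add sh_Suc a_comm)
        finally have "f (Suc n) = f' n \<oplus> a (Suc n)" .
        moreover have "f (Suc n) \<in> P" using f unfolding fps_ext_def by simp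
        ultimately have "f' n \<oplus> a (Suc n) \<in> P" by simp
        then show ?thesis
          using iadd_cancel[OF iP _ _ S_coeff[OF a(2)]] aP by (simp add: fps_ext_def)
      qed
      then have "f' \<in> fps_ext P" by (simp add: fps_ext_def)
      then show "\<exists>a\<in>gS (map (cst R) ds). \<exists>f'\<in>fps_ext P. f = a \<oplus>\<^bsub>S\<^esub> sh R f'" using a by blast
    qed
  qed
  show "gS (map (cst R) ds) \<subseteq> fps_ext P"
    using cst_fps_ext[OF iP] gen_mem[OF zeroideal ds] P S.izero[OF ideal_fps_ext[OF iP]]
    by (intro S.gen_least[OF ideal_fps_ext[OF iP]]) auto
qed

lemma icong_sym: "ideal I R \<Longrightarrow> a \<in> carrier R \<Longrightarrow> b \<in> carrier R \<Longrightarrow> a \<ominus> b \<in> I \<Longrightarrow> b \<ominus> a \<in> I"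
proof -
  assume I: "ideal I R" and c: "a \<in> carrier R" "b \<in> carrier R" and ab: "a \<ominus> b \<in> I"
  have "b \<ominus> a = \<ominus> (a \<ominus> b)" using c by algebra
  then show ?thesis using ineg[OF I ab] by simp
qed

lemma icong_trans:
  "ideal I R \<Longrightarrow> a \<in> carrier R \<Longrightarrow> b \<in> carrier R \<Longrightarrow> c \<in> carrier R \<Longrightarrow> a \<ominus> b \<in> I \<Longrightarrow> b \<ominus> c \<in> I \<Longrightarrow> a \<ominus> c \<in> I"
proof -
  assume I: "ideal I R" and c: "a \<in> carrier R" "b \<in> carrier R" "c \<in> carrier R" and ab: "a \<ominus> b \<in> I" "b \<ominus> c \<in> I"
  have "a \<ominus> c = (a \<ominus> b) \<oplus> (b \<ominus> c)" using c by algebra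
  then show ?thesis using iadd[OF I ab] by simp
qed

lemma icong_mem: "ideal I R \<Longrightarrow> a \<in> carrier R \<Longrightarrow> b \<in> I \<Longrightarrow> a \<ominus> b \<in> I \<Longrightarrow> a \<in> I"
  using iminus_cancel by blast

text \<open>Homomorphisms from \<open>P/A\<close> to \<open>R/A\<close>, given by representatives of
  the values; the laws hold only modulo \<open>A\<close> because the representatives are
  chosen.\<close>

definition lin_mod :: "'a set \<Rightarrow> 'a set \<Rightarrow> ('a \<Rightarrow> 'a) \<Rightarrow> bool" where
  "lin_mod P A w \<longleftrightarrow> (\<forall>p\<in>P. w p \<in> carrier R) \<and> (\<forall>p\<in>P. \<forall>q\<in>P. w (p \<oplus> q) \<ominus> (w p \<oplus> w q) \<in> A) \<and>
     (\<forall>r\<in>carrier R. \<forall>p\<in>P. w (r \<otimes> p) \<ominus> r \<otimes> w p \<in> A) \<and> (\<forall>a\<in>A. w a \<in> A)"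

lemma lin_modD:
  assumes "lin_mod P A w"
  shows "p \<in> P \<Longrightarrow> w p \<in> carrier R" "p \<in> P \<Longrightarrow> q \<in> P \<Longrightarrow> w (p \<oplus> q) \<ominus> (w p \<oplus> w q) \<in> A"
    "r \<in> carrier R \<Longrightarrow> p \<in> P \<Longrightarrow> w (r \<otimes> p) \<ominus> r \<otimes> w p \<in> A" "a \<in> A \<Longrightarrow> w a \<in> A"
  using assms unfolding lin_mod_def by auto

lemma lin_mod_mult:
  assumes A: "ideal A R" and P: "ideal P R" and c: "c \<in> carrier R"
  shows "lin_mod P A (\<lambda>p. c \<otimes> p)"
  unfolding lin_mod_def
proof (intro conjI ballI)
  note pc = icarr[OF P]
  show "c \<otimes> p \<in> carrier R" if "p \<in> P" for p using c pc that by simp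
  show "c \<otimes> (p \<oplus> q) \<ominus> (c \<otimes> p \<oplus> c \<otimes> q) \<in> A" if "p \<in> P" "q \<in> P" for p q
  proof -
    have "c \<otimes> (p \<oplus> q) \<ominus> (c \<otimes> p \<oplus> c \<otimes> q) = \<zero>" using c pc[OF that(1)] pc[OF that(2)] by algebra
    then show ?thesis using izero[OF A] by simp
  qed
  show "c \<otimes> (r \<otimes> p) \<ominus> r \<otimes> (c \<otimes> p) \<in> A" if "r \<in> carrier R" "p \<in> P" for r p
  proof -
    have "c \<otimes> (r \<otimes> p) \<ominus> r \<otimes> (c \<otimes> p) = \<zero>" using c pc[OF that(2)] that(1) by algebra
    then show ?thesis using izero[OF A] by simp
  qed
  show "c \<otimes> a \<in> A" if "a \<in> A" for a using imult[OF A that c] .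
qed

lemma lin_mod_minus_mult:
  assumes A: "ideal A R" and P: "ideal P R" and w: "lin_mod P A w" and c: "c \<in> carrier R"
  shows "lin_mod P A (\<lambda>p. w p \<ominus> c \<otimes> p)"
  unfolding lin_mod_def
proof (intro conjI ballI)
  note pc = icarr[OF P] and wc = lin_modD(1)[OF w]
  show "w p \<ominus> c \<otimes> p \<in> carrier R" if "p \<in> P" for p using c pc wc that by simp
  show "(w (p \<oplus> q) \<ominus> c \<otimes> (p \<oplus> q)) \<ominus> ((w p \<ominus> c \<otimes> p) \<oplus> (w q \<ominus> c \<otimes> q)) \<in> A" if pq: "p \<in> P" "q \<in> P" for p q
  proof -
    have "(w (p \<oplus> q) \<ominus> c \<otimes> (p \<oplus> q)) \<ominus> ((w p \<ominus> c \<otimes> p) \<oplus> (w q \<ominus> c \<otimes> q)) = w (p \<oplus> q) \<ominus> (w p \<oplus> w q)"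
      using c pc[OF pq(1)] pc[OF pq(2)] wc[OF pq(1)] wc[OF pq(2)] wc[OF iadd[OF P pq]] by algebra
    then show ?thesis using lin_modD(2)[OF w pq] by simp
  qed
  show "(w (r \<otimes> p) \<ominus> c \<otimes> (r \<otimes> p)) \<ominus> r \<otimes> (w p \<ominus> c \<otimes> p) \<in> A" if r: "r \<in> carrier R" "p \<in> P" for r p
  proof -
    have "(w (r \<otimes> p) \<ominus> c \<otimes> (r \<otimes> p)) \<ominus> r \<otimes> (w p \<ominus> c \<otimes> p) = w (r \<otimes> p) \<ominus> r \<otimes> w p"
      using c pc[OF r(2)] r(1) wc[OF r(2)] wc[OF imult[OF P r(2,1)]] by algebra
    then show ?thesis using lin_modD(3)[OF w r] by simp
  qed
  show "w a \<ominus> c \<otimes> a \<in> A" if "a \<in> A" for a using iminus[OF A lin_modD(4)[OF w that] imult[OF A that c]] .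
qed

lemma ideal_colonI: "v \<in> carrier R \<Longrightarrow> (\<And>p. p \<in> P \<Longrightarrow> v \<otimes> p \<in> A) \<Longrightarrow> v \<in> ideal_colon R A P"
  unfolding ideal_colon_def by simp

end

section \<open>Lifting of colon ideals to power series\<close>

context injres begin

interpretation S: cring S by (rule cring_S)

text \<open>A homomorphism with vanishing constant terms is \<open>t\<close> times another one; the
  laws for the latter follow by cancelling \<open>t\<close> modulo \<open>(as)\<close>.\<close>

lemma lift_colon_step:
  assumes Pt: "flat_lift Pt P" and P: "ideal P R" and as: "set as \<subseteq> Pt" and r: "reg R {\<zero>} (map at0 as)"
    and w: "S.lin_mod Pt (gS as) w" and w0: "\<And>p. p \<in> Pt \<Longrightarrow> w p 0 \<in> ci (map at0 as)"
  obtains e where "S.lin_mod Pt (gS as) e" "\<And>p. p \<in> Pt \<Longrightarrow> w p \<ominus>\<^bsub>S\<^esub> sh R (e p) \<in> gS as"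
proof -
  have iPt: "ideal Pt S" using Pt unfolding flat_lift_def by simp
  have asc: "set as \<subseteq> carrier S" using as S.isub[OF iPt] by blast
  note G = ideal_gS[OF asc] and pc = S.icarr[OF iPt] and wc = S.lin_modD(1)[OF w]
  have GP: "gS as \<subseteq> Pt" using S.izero[OF iPt] as by (intro S.gen_least[OF iPt]) auto
  have "\<exists>e. e \<in> carrier S \<and> w p \<ominus>\<^bsub>S\<^esub> sh R e \<in> gS as" if p: "p \<in> Pt" for p
  proof -
    obtain a e where a: "a \<in> gS as" "e \<in> carrier S" "w p = a \<oplus>\<^bsub>S\<^esub> sh R e"
      using gS_decomp[OF asc wc[OF p] w0[OF p]] .
    have "w p \<ominus>\<^bsub>S\<^esub> sh R e = a" unfolding a(3) using S.icarr[OF G a(1)] sh_closed[OF a(2)] by algebra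
    then show ?thesis using a by auto
  qed
  then obtain e where e: "\<And>p. p \<in> Pt \<Longrightarrow> e p \<in> carrier S" "\<And>p. p \<in> Pt \<Longrightarrow> w p \<ominus>\<^bsub>S\<^esub> sh R (e p) \<in> gS as"
    by metis
  note sat = sh_saturated[OF asc r] and shc = sh_closed
  have "S.lin_mod Pt (gS as) e"
    unfolding S.lin_mod_def
  proof (intro conjI ballI)
    show "e p \<in> carrier S" if "p \<in> Pt" for p using e(1)[OF that] .
    show "e (p \<oplus>\<^bsub>S\<^esub> q) \<ominus>\<^bsub>S\<^esub> (e p \<oplus>\<^bsub>S\<^esub> e q) \<in> gS as" if pq: "p \<in> Pt" "q \<in> Pt" for p q
    proof (rule sat)
      note pq' = S.iadd[OF iPt pq]
      note c = e(1)[OF pq(1)] e(1)[OF pq(2)] e(1)[OF pq']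
      show "e (p \<oplus>\<^bsub>S\<^esub> q) \<ominus>\<^bsub>S\<^esub> (e p \<oplus>\<^bsub>S\<^esub> e q) \<in> carrier S" using c by simp
      have "sh R (e (p \<oplus>\<^bsub>S\<^esub> q) \<ominus>\<^bsub>S\<^esub> (e p \<oplus>\<^bsub>S\<^esub> e q)) = sh R (e (p \<oplus>\<^bsub>S\<^esub> q)) \<ominus>\<^bsub>S\<^esub> (sh R (e p) \<oplus>\<^bsub>S\<^esub> sh R (e q))"
        using c by (simp add: sh_minus sh_add)
      also have "\<dots> = (w (p \<oplus>\<^bsub>S\<^esub> q) \<ominus>\<^bsub>S\<^esub> (w p \<oplus>\<^bsub>S\<^esub> w q)) \<oplus>\<^bsub>S\<^esub> (w p \<ominus>\<^bsub>S\<^esub> sh R (e p)) \<oplus>\<^bsub>S\<^esub> (w q \<ominus>\<^bsub>S\<^esub> sh R (e q))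
         \<ominus>\<^bsub>S\<^esub> (w (p \<oplus>\<^bsub>S\<^esub> q) \<ominus>\<^bsub>S\<^esub> sh R (e (p \<oplus>\<^bsub>S\<^esub> q)))"
        using wc[OF pq(1)] wc[OF pq(2)] wc[OF pq'] shc[OF c(1)] shc[OF c(2)] shc[OF c(3)] by algebra
      also have "\<dots> \<in> gS as"
        by (intro S.iminus[OF G] S.iadd[OF G] S.lin_modD(2)[OF w] e(2) pq pq')
      finally show "sh R (e (p \<oplus>\<^bsub>S\<^esub> q) \<ominus>\<^bsub>S\<^esub> (e p \<oplus>\<^bsub>S\<^esub> e q)) \<in> gS as" .
    qed
    show "e (s \<otimes>\<^bsub>S\<^esub> p) \<ominus>\<^bsub>S\<^esub> s \<otimes>\<^bsub>S\<^esub> e p \<in> gS as" if s: "s \<in> carrier S" and p: "p \<in> Pt" for s p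
    proof (rule sat)
      note sp = S.imult[OF iPt p s]
      note c = e(1)[OF p] e(1)[OF sp]
      show "e (s \<otimes>\<^bsub>S\<^esub> p) \<ominus>\<^bsub>S\<^esub> s \<otimes>\<^bsub>S\<^esub> e p \<in> carrier S" using c s by simp
      have "sh R (e (s \<otimes>\<^bsub>S\<^esub> p) \<ominus>\<^bsub>S\<^esub> s \<otimes>\<^bsub>S\<^esub> e p) = sh R (e (s \<otimes>\<^bsub>S\<^esub> p)) \<ominus>\<^bsub>S\<^esub> s \<otimes>\<^bsub>S\<^esub> sh R (e p)"
        using c s by (simp add: sh_minus sh_mult')
      also have "\<dots> = (w (s \<otimes>\<^bsub>S\<^esub> p) \<ominus>\<^bsub>S\<^esub> s \<otimes>\<^bsub>S\<^esub> w p) \<oplus>\<^bsub>S\<^esub> s \<otimes>\<^bsub>S\<^esub> (w p \<ominus>\<^bsub>S\<^esub> sh R (e p))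
         \<ominus>\<^bsub>S\<^esub> (w (s \<otimes>\<^bsub>S\<^esub> p) \<ominus>\<^bsub>S\<^esub> sh R (e (s \<otimes>\<^bsub>S\<^esub> p)))"
        using wc[OF p] wc[OF sp] shc[OF c(1)] shc[OF c(2)] s by algebra
      also have "\<dots> \<in> gS as"
        by (intro S.iminus[OF G] S.iadd[OF G] S.imult[OF G] S.lin_modD(3)[OF w] e(2) p sp s)
      finally show "sh R (e (s \<otimes>\<^bsub>S\<^esub> p) \<ominus>\<^bsub>S\<^esub> s \<otimes>\<^bsub>S\<^esub> e p) \<in> gS as" .
    qed
    show "e a \<in> gS as" if a: "a \<in> gS as" for a
    proof (rule sat)
      have aP: "a \<in> Pt" using a GP by blast
      show "e a \<in> carrier S" by (rule e(1)[OF aP])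
      have "sh R (e a) = w a \<ominus>\<^bsub>S\<^esub> (w a \<ominus>\<^bsub>S\<^esub> sh R (e a))" using wc[OF aP] shc[OF e(1)[OF aP]] by algebra
      also have "\<dots> \<in> gS as" by (intro S.iminus[OF G] S.lin_modD(4)[OF w] e(2) a aP)
      finally show "sh R (e a) \<in> gS as" .
    qed
  qed
  then show ?thesis using that e(2) by blast
qed

text \<open>At \<open>t = 0\<close>, \<open>e\<close> induces a homomorphism on \<open>P\<close>,
  which is a multiplication by \<open>hom_extends\<close>. It is well defined because of flatness:
  two elements of \<open>Pt\<close> with equal constant terms differ by \<open>t s\<close> with
  \<open>s\<close> in \<open>Pt\<close>.\<close>

lemma lift_hom_const:
  assumes Pt: "flat_lift Pt P" and P: "ideal P R" and as: "set as \<subseteq> Pt" and r: "reg R {\<zero>} (map at0 as)"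
    and V: "ext_bound (length as) P" and e: "S.lin_mod Pt (gS as) e"
  obtains u where "u \<in> carrier R" "\<And>p. p \<in> Pt \<Longrightarrow> (e p \<ominus>\<^bsub>S\<^esub> cst R u \<otimes>\<^bsub>S\<^esub> p) 0 \<in> ci (map at0 as)"
proof -
  let ?A = "ci (map at0 as)"
  have iPt: "ideal Pt S" and sat: "\<And>f. f \<in> carrier S \<Longrightarrow> sh R f \<in> Pt \<Longrightarrow> f \<in> Pt" and im: "at0 ` Pt = P"
    using Pt unfolding flat_lift_def by auto
  have asc: "set as \<subseteq> carrier S" using as S.isub[OF iPt] by blast
  note G = ideal_gS[OF asc] and pc = S.icarr[OF iPt] and ec = S.lin_modD(1)[OF e]
  have GP: "gS as \<subseteq> Pt" using S.izero[OF iPt] as by (intro S.gen_least[OF iPt]) auto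
  have A: "ideal ?A R" by (rule ideal_ci_carrier[OF at0_carrier[OF asc]])
  have ec0: "e p 0 \<in> carrier R" if "p \<in> Pt" for p using S_coeff[OF ec[OF that]] .
  have const: "x 0 \<ominus> y 0 \<in> ?A" if "x \<in> carrier S" "y \<in> carrier S" "x \<ominus>\<^bsub>S\<^esub> y \<in> gS as" for x y
    using gS_at0[OF asc that(3)] S_minus[OF that(1,2)] by simp
  have wd: "e p 0 \<ominus> e q 0 \<in> ?A" if pq: "p \<in> Pt" "q \<in> Pt" "p 0 = q 0" for p q
  proof -
    have "(p \<ominus>\<^bsub>S\<^esub> q) 0 = \<zero>" using pq(3) pc[OF pq(1)] pc[OF pq(2)] S_coeff[OF pc[OF pq(2)]] by (simp add: S_minus minus_self)
    then obtain s where s: "s \<in> carrier S" "p \<ominus>\<^bsub>S\<^esub> q = sh R s"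
      using S_divisible[of "p \<ominus>\<^bsub>S\<^esub> q"] pc[OF pq(1)] pc[OF pq(2)] by auto
    have sP: "s \<in> Pt" using sat[OF s(1)] S.iminus[OF iPt pq(1,2)] s(2) by simp
    let ?t = "sh R \<one>\<^bsub>S\<^esub>"
    have t: "?t \<in> carrier S" by (simp add: sh_closed)
    have ts: "?t \<otimes>\<^bsub>S\<^esub> s = sh R s" using sh_mult[OF S.one_closed s(1)] s(1) by simp
    have tsP: "?t \<otimes>\<^bsub>S\<^esub> s \<in> Pt" using S.imult[OF iPt sP t] .
    have "p = q \<oplus>\<^bsub>S\<^esub> (p \<ominus>\<^bsub>S\<^esub> q)" using pc[OF pq(1)] pc[OF pq(2)] by algebra
    then have pe: "p = q \<oplus>\<^bsub>S\<^esub> ?t \<otimes>\<^bsub>S\<^esub> s" using s(2) ts by simp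
    have "e p \<ominus>\<^bsub>S\<^esub> (e q \<oplus>\<^bsub>S\<^esub> ?t \<otimes>\<^bsub>S\<^esub> e s) = (e p \<ominus>\<^bsub>S\<^esub> (e q \<oplus>\<^bsub>S\<^esub> e (?t \<otimes>\<^bsub>S\<^esub> s))) \<oplus>\<^bsub>S\<^esub> (e (?t \<otimes>\<^bsub>S\<^esub> s) \<ominus>\<^bsub>S\<^esub> ?t \<otimes>\<^bsub>S\<^esub> e s)"
      using ec[OF pq(1)] ec[OF pq(2)] ec[OF tsP] ec[OF sP] t by algebra
    also have "\<dots> \<in> gS as"
      using S.lin_modD(2)[OF e pq(2) tsP] S.lin_modD(3)[OF e t sP] pe S.iadd[OF G] by simp
    finally have "e p 0 \<ominus> (e q \<oplus>\<^bsub>S\<^esub> ?t \<otimes>\<^bsub>S\<^esub> e s) 0 \<in> ?A"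
      using const ec[OF pq(1)] ec[OF pq(2)] ec[OF sP] t by simp
    moreover have "(e q \<oplus>\<^bsub>S\<^esub> ?t \<otimes>\<^bsub>S\<^esub> e s) 0 = e q 0"
      using ec0[OF pq(2)] ec0[OF sP] by (simp add: S_add S_mult_0 sh_0)
    ultimately show ?thesis by simp
  qed
  have "\<exists>p. p \<in> Pt \<and> p 0 = a" if "a \<in> P" for a using im that by blast
  then obtain rep where rep: "\<And>a. a \<in> P \<Longrightarrow> rep a \<in> Pt \<and> rep a 0 = a" by metis
  define f where "f a = e (rep a) 0" for a
  have f: "f (p 0) \<ominus> e p 0 \<in> ?A" if p: "p \<in> Pt" for p
    unfolding f_def using wd[of "rep (p 0)" p] rep[of "p 0"] im p by blast
  have fc: "f a \<in> carrier R" if "a \<in> P" for a unfolding f_def using rep[OF that] ec0 by blast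
  obtain u where u: "u \<in> carrier R" "\<And>a. a \<in> P \<Longrightarrow> f a \<ominus> a \<otimes> u \<in> ?A"
  proof (rule hom_extends[OF r P, of f])
    show "?A \<subseteq> P" using GP at0_gS[OF asc] im by blast
    show "ext_bound (length (map at0 as)) P" using V by simp
    show "f p \<in> carrier R" if "p \<in> P" for p by (rule fc[OF that])
    show "f (a \<oplus> b) \<ominus> (f a \<oplus> f b) \<in> ?A" if ab: "a \<in> P" "b \<in> P" for a b
    proof -
      have ra: "rep a \<in> Pt" "rep b \<in> Pt" using rep ab by auto
      note rab = S.iadd[OF iPt ra]
      have "(rep a \<oplus>\<^bsub>S\<^esub> rep b) 0 = a \<oplus> b" using rep ab by (simp add: S_add)
      then have h1: "f (a \<oplus> b) \<ominus> e (rep a \<oplus>\<^bsub>S\<^esub> rep b) 0 \<in> ?A" using f[OF rab] by simp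
      have h2: "e (rep a \<oplus>\<^bsub>S\<^esub> rep b) 0 \<ominus> (f a \<oplus> f b) \<in> ?A"
        using const[OF ec[OF rab] _ S.lin_modD(2)[OF e ra]] ec ra by (simp add: S_add f_def)
      show ?thesis by (rule icong_trans[OF A fc[OF iadd[OF P ab]] ec0[OF rab] a_closed[OF fc[OF ab(1)] fc[OF ab(2)]] h1 h2])
    qed
    show "f (s \<otimes> a) \<ominus> s \<otimes> f a \<in> ?A" if s: "s \<in> carrier R" and a: "a \<in> P" for s a
    proof -
      have ra: "rep a \<in> Pt" using rep a by auto
      note sc = cst_closed[OF s]
      note rsa = S.imult[OF iPt ra sc]
      have "(cst R s \<otimes>\<^bsub>S\<^esub> rep a) 0 = s \<otimes> a" using rep a by (simp add: S_mult_0 cst_0)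
      then have h1: "f (s \<otimes> a) \<ominus> e (cst R s \<otimes>\<^bsub>S\<^esub> rep a) 0 \<in> ?A" using f[OF rsa] by simp
      have h2: "e (cst R s \<otimes>\<^bsub>S\<^esub> rep a) 0 \<ominus> s \<otimes> f a \<in> ?A"
        using const[OF ec[OF rsa] _ S.lin_modD(3)[OF e sc ra]] ec[OF ra] sc by (simp add: S_mult_0 cst_0 f_def)
      show ?thesis
        by (rule icong_trans[OF A fc[OF imult[OF P a s]] ec0[OF rsa] m_closed[OF s fc[OF a]] h1 h2])
    qed
    show "f a \<in> ?A" if a: "a \<in> ?A" for a
    proof -
      obtain g where g: "a = g 0" "g \<in> gS as" using a unfolding at0_gS[OF asc, symmetric] by (rule imageE)
      have gP: "g \<in> Pt" using g GP by blast
      have "g 0 \<in> P" using im gP by blast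
      then show ?thesis
        using icong_mem[OF A fc gS_at0[OF asc S.lin_modD(4)[OF e g(2)]] f[OF gP]] g(1) by simp
    qed
  qed blast
  have "(e p \<ominus>\<^bsub>S\<^esub> cst R u \<otimes>\<^bsub>S\<^esub> p) 0 \<in> ?A" if p: "p \<in> Pt" for p
  proof -
    have p0: "p 0 \<in> P" using im p by blast
    have uc: "cst R u \<in> carrier S" by (rule cst_closed[OF u(1)])
    have p0c: "p 0 \<in> carrier R" using icarr[OF P p0] .
    have "e p 0 \<ominus> p 0 \<otimes> u \<in> ?A"
      using icong_trans[OF A ec0[OF p] fc[OF p0] _ icong_sym[OF A fc[OF p0] ec0[OF p] f[OF p]] u(2)[OF p0]] p0c u(1) by simp
    then show ?thesis using ec[OF p] uc pc[OF p] p0c u(1) by (simp add: S_minus S_mult_0 cst_0 m_comm)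
  qed
  then show ?thesis using that u(1) by blast
qed

text \<open>The obstruction to lifting is an \<open>Ext^1\<close> whose vanishing is expressed by \<open>hom_extends\<close>.\<close>

lemma lift_colon:
  assumes Pt: "flat_lift Pt P" and P: "ideal P R" and as: "set as \<subseteq> Pt" and r: "reg R {\<zero>} (map at0 as)"
    and V: "ext_bound (length as) P"
  shows "flat_lift (ideal_colon S (gS as) Pt) (ideal_colon R (ci (map at0 as)) P)"
  unfolding flat_lift_def
proof (intro conjI ballI impI equalityI subsetI)
  let ?A = "ci (map at0 as)"
  have iPt: "ideal Pt S" and im: "at0 ` Pt = P" using Pt unfolding flat_lift_def by auto
  have asc: "set as \<subseteq> carrier S" using as S.isub[OF iPt] by blast
  note G = ideal_gS[OF asc] and pc = S.icarr[OF iPt]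
  have A: "ideal ?A R" by (rule ideal_ci_carrier[OF at0_carrier[OF asc]])
  show "ideal (ideal_colon S (gS as) Pt) S" by (rule S.ideal_colon_ideal[OF G S.isub[OF iPt]])
  show "f \<in> ideal_colon S (gS as) Pt" if f: "f \<in> carrier S" "sh R f \<in> ideal_colon S (gS as) Pt" for f
  proof (rule S.ideal_colonI[OF f(1)])
    fix p assume p: "p \<in> Pt"
    have "sh R (f \<otimes>\<^bsub>S\<^esub> p) \<in> gS as" using S.ideal_colonD[OF f(2) p] sh_mult[OF f(1) pc[OF p]] by simp
    then show "f \<otimes>\<^bsub>S\<^esub> p \<in> gS as" using sh_saturated[OF asc r] f(1) pc[OF p] by simp
  qed
  show "v \<in> ideal_colon R ?A P" if "v \<in> at0 ` ideal_colon S (gS as) Pt" for v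
  proof -
    obtain f where f: "v = f 0" "f \<in> ideal_colon S (gS as) Pt" using \<open>v \<in> _\<close> by (rule imageE)
    have fc: "f \<in> carrier S" using f(2) unfolding ideal_colon_def by simp
    show ?thesis
    proof (rule ideal_colonI)
      show "v \<in> carrier R" using f(1) S_coeff[OF fc] by simp
      fix p assume "p \<in> P"
      then obtain q where q: "p = q 0" "q \<in> Pt" unfolding im[symmetric] by (rule imageE)
      show "v \<otimes> p \<in> ?A" using gS_at0[OF asc S.ideal_colonD[OF f(2) q(2)]] f(1) q(1) by (simp add: S_mult_0)
    qed
  qed
  show "v \<in> at0 ` ideal_colon S (gS as) Pt" if v: "v \<in> ideal_colon R ?A P" for v
  proof -
    have vc: "v \<in> carrier R" using v unfolding ideal_colon_def by simp
    note cv = cst_closed[OF vc]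
    have v0: "(cst R v \<otimes>\<^bsub>S\<^esub> p) 0 \<in> ?A" if p: "p \<in> Pt" for p
    proof -
      have "p 0 \<in> P" using im p by blast
      then show ?thesis using ideal_colonD[OF v] by (simp add: S_mult_0 cst_0)
    qed
    \<comment> \<open>At \<open>t = 0\<close> multiplication by the constant \<open>v\<close> maps
      into the ideal of the constant terms, so it is \<open>t e0\<close> modulo
      \<open>(as)\<close>.\<close>
    obtain e0 where e0: "S.lin_mod Pt (gS as) e0" "\<And>p. p \<in> Pt \<Longrightarrow> cst R v \<otimes>\<^bsub>S\<^esub> p \<ominus>\<^bsub>S\<^esub> sh R (e0 p) \<in> gS as"
      by (rule lift_colon_step[OF Pt P as r S.lin_mod_mult[OF G iPt cv] v0]) blast+
    have step: "\<exists>e'. S.lin_mod Pt (gS as) e' \<and> (\<exists>u. u \<in> carrier R \<and>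
        (\<forall>p\<in>Pt. (e p \<ominus>\<^bsub>S\<^esub> cst R u \<otimes>\<^bsub>S\<^esub> p) \<ominus>\<^bsub>S\<^esub> sh R (e' p) \<in> gS as))"
      if e: "S.lin_mod Pt (gS as) e" for e
    proof -
      obtain u where u: "u \<in> carrier R" "\<And>p. p \<in> Pt \<Longrightarrow> (e p \<ominus>\<^bsub>S\<^esub> cst R u \<otimes>\<^bsub>S\<^esub> p) 0 \<in> ?A"
        by (rule lift_hom_const[OF Pt P as r V e]) blast+
      obtain e' where e': "S.lin_mod Pt (gS as) e'"
        "\<And>p. p \<in> Pt \<Longrightarrow> (e p \<ominus>\<^bsub>S\<^esub> cst R u \<otimes>\<^bsub>S\<^esub> p) \<ominus>\<^bsub>S\<^esub> sh R (e' p) \<in> gS as"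
        by (rule lift_colon_step[OF Pt P as r S.lin_mod_minus_mult[OF G iPt e cst_closed[OF u(1)]] u(2)]) blast+
      show ?thesis using e' u(1) by blast
    qed
    have "\<exists>E. \<forall>n. (S.lin_mod Pt (gS as) (E n) \<and> (n = 0 \<longrightarrow> E n = e0)) \<and>
      (\<exists>u. u \<in> carrier R \<and> (\<forall>p\<in>Pt. (E n p \<ominus>\<^bsub>S\<^esub> cst R u \<otimes>\<^bsub>S\<^esub> p) \<ominus>\<^bsub>S\<^esub> sh R (E (Suc n) p) \<in> gS as))"
    proof (rule dependent_nat_choice)
      show "\<exists>e. S.lin_mod Pt (gS as) e \<and> ((0::nat) = 0 \<longrightarrow> e = e0)" using e0(1) by blast
      show "\<exists>y. (S.lin_mod Pt (gS as) y \<and> (Suc n = 0 \<longrightarrow> y = e0)) \<and>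
          (\<exists>u. u \<in> carrier R \<and> (\<forall>p\<in>Pt. (e p \<ominus>\<^bsub>S\<^esub> cst R u \<otimes>\<^bsub>S\<^esub> p) \<ominus>\<^bsub>S\<^esub> sh R (y p) \<in> gS as))"
        if "S.lin_mod Pt (gS as) e \<and> (n = 0 \<longrightarrow> e = e0)" for e n
        using step[of e] that by simp
    qed
    then obtain E' where E': "\<And>n. S.lin_mod Pt (gS as) (E' n)" "E' 0 = e0"
      "\<forall>n. \<exists>u. u \<in> carrier R \<and> (\<forall>p\<in>Pt. (E' n p \<ominus>\<^bsub>S\<^esub> cst R u \<otimes>\<^bsub>S\<^esub> p) \<ominus>\<^bsub>S\<^esub> sh R (E' (Suc n) p) \<in> gS as)"
      by blast
    from choice[OF E'(3)] obtain u where u: "\<And>n. u n \<in> carrier R"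
      "\<And>n p. p \<in> Pt \<Longrightarrow> (E' n p \<ominus>\<^bsub>S\<^esub> cst R (u n) \<otimes>\<^bsub>S\<^esub> p) \<ominus>\<^bsub>S\<^esub> sh R (E' (Suc n) p) \<in> gS as" by blast
    \<comment> \<open>The constants subtracted successively are collected into one series, so that
      \<open>e0\<close> is multiplication by \<open>U 0\<close> and \<open>v - t U 0\<close> is the
      lift of \<open>v\<close>.\<close>
    define U where "U n = series (\<lambda>k. cst R (u (n + k)))" for n
    have Uc: "U n \<in> carrier S" for n unfolding U_def by (rule series_closed) (rule cst_closed[OF u(1)])
    have Us: "U n = cst R (u n) \<oplus>\<^bsub>S\<^esub> sh R (U (Suc n))" for n
      unfolding U_def using series_step[of "\<lambda>k. cst R (u (n + k))"] cst_closed[OF u(1)] by simp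
    have main: "e0 p \<ominus>\<^bsub>S\<^esub> U 0 \<otimes>\<^bsub>S\<^esub> p \<in> gS as" if p: "p \<in> Pt" for p
    proof -
      note Ec = S.lin_modD(1)[OF E'(1) p] and pcp = pc[OF p]
      define a where "a n = (E' n p \<ominus>\<^bsub>S\<^esub> cst R (u n) \<otimes>\<^bsub>S\<^esub> p) \<ominus>\<^bsub>S\<^esub> sh R (E' (Suc n) p)" for n
      define f where "f n = E' n p \<ominus>\<^bsub>S\<^esub> U n \<otimes>\<^bsub>S\<^esub> p" for n
      have aG: "a n \<in> gS as" for n unfolding a_def by (rule u(2)[OF p])
      have fc: "f n \<in> carrier S" for n unfolding f_def using Ec Uc pcp by simp
      have alg: "x \<ominus>\<^bsub>S\<^esub> (c \<oplus>\<^bsub>S\<^esub> s) \<otimes>\<^bsub>S\<^esub> p = ((x \<ominus>\<^bsub>S\<^esub> c \<otimes>\<^bsub>S\<^esub> p) \<ominus>\<^bsub>S\<^esub> y) \<oplus>\<^bsub>S\<^esub> (y \<ominus>\<^bsub>S\<^esub> s \<otimes>\<^bsub>S\<^esub> p)"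
        if "x \<in> carrier S" "c \<in> carrier S" "s \<in> carrier S" "y \<in> carrier S" for x c s y
        using that pcp by algebra
      have fs: "f n = a n \<oplus>\<^bsub>S\<^esub> sh R (f (Suc n))" for n
      proof -
        have "sh R (f (Suc n)) = sh R (E' (Suc n) p) \<ominus>\<^bsub>S\<^esub> sh R (U (Suc n)) \<otimes>\<^bsub>S\<^esub> p"
          unfolding f_def using Ec Uc pcp by (simp add: sh_minus sh_mult)
        moreover have "f n = E' n p \<ominus>\<^bsub>S\<^esub> (cst R (u n) \<oplus>\<^bsub>S\<^esub> sh R (U (Suc n))) \<otimes>\<^bsub>S\<^esub> p"
          unfolding f_def using Us[of n] by simp
        ultimately show ?thesis
          unfolding a_def using alg[OF Ec cst_closed[OF u(1)] sh_closed[OF Uc] sh_closed[OF Ec]] by simp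
      qed
      have "f 0 = series (\<lambda>n. a (0 + n))"
        by (rule series_unique[of a f 0, OF S.icarr[OF G aG] fc fs])
      then have "f 0 \<in> gS as" using series_in_gS[OF asc aG] by simp
      then show ?thesis unfolding f_def E'(2) .
    qed
    let ?v = "cst R v \<ominus>\<^bsub>S\<^esub> sh R (U 0)"
    have vS: "?v \<in> carrier S" using cv sh_closed[OF Uc] by simp
    have "?v \<in> ideal_colon S (gS as) Pt"
    proof (rule S.ideal_colonI[OF vS])
      fix p assume p: "p \<in> Pt"
      note pcp = pc[OF p] and ec = S.lin_modD(1)[OF e0(1) p]
      have "?v \<otimes>\<^bsub>S\<^esub> p = (cst R v \<otimes>\<^bsub>S\<^esub> p \<ominus>\<^bsub>S\<^esub> sh R (e0 p)) \<oplus>\<^bsub>S\<^esub> (sh R (e0 p) \<ominus>\<^bsub>S\<^esub> sh R (U 0) \<otimes>\<^bsub>S\<^esub> p)"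
        using cv sh_closed[OF Uc] pcp sh_closed[OF ec] by algebra
      also have "sh R (e0 p) \<ominus>\<^bsub>S\<^esub> sh R (U 0) \<otimes>\<^bsub>S\<^esub> p = sh R (e0 p \<ominus>\<^bsub>S\<^esub> U 0 \<otimes>\<^bsub>S\<^esub> p)"
        using ec Uc pcp by (simp add: sh_minus sh_mult)
      finally show "?v \<otimes>\<^bsub>S\<^esub> p \<in> gS as"
        using S.iadd[OF G e0(2)[OF p] S_ideal_sh[OF G main[OF p]]] by simp
    qed
    moreover have "?v 0 = v" using vc cv sh_closed[OF Uc] by (simp add: S_minus cst_0 sh_0) (simp add: a_minus_def)
    ultimately show ?thesis by (metis imageI)
  qed
qed

end

section \<open>Linear algebra modulo a prime\<close>

context cring begin

primrec lsum :: "('i \<Rightarrow> 'a) \<Rightarrow> 'i list \<Rightarrow> 'a" where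
  "lsum f [] = \<zero>"
| "lsum f (x # xs) = f x \<oplus> lsum f xs"

lemma lsum_closed: "(\<And>x. f x \<in> carrier R) \<Longrightarrow> lsum f xs \<in> carrier R"
  by (induction xs) auto

lemma lsum_cong: "(\<And>x. x \<in> set xs \<Longrightarrow> f x = g x) \<Longrightarrow> lsum f xs = lsum g xs"
  by (induction xs) auto

lemma lsum_add:
  "(\<And>x. f x \<in> carrier R) \<Longrightarrow> (\<And>x. g x \<in> carrier R) \<Longrightarrow> lsum (\<lambda>x. f x \<oplus> g x) xs = lsum f xs \<oplus> lsum g xs"
  by (induction xs) (auto simp: lsum_closed a_ac)

lemma lsum_mult:
  "a \<in> carrier R \<Longrightarrow> (\<And>x. f x \<in> carrier R) \<Longrightarrow> lsum (\<lambda>x. a \<otimes> f x) xs = a \<otimes> lsum f xs"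
  by (induction xs) (auto simp: lsum_closed r_distr)

lemma lsum_multr:
  "a \<in> carrier R \<Longrightarrow> (\<And>x. f x \<in> carrier R) \<Longrightarrow> lsum (\<lambda>x. f x \<otimes> a) xs = lsum f xs \<otimes> a"
  by (induction xs) (auto simp: lsum_closed l_distr)

lemma lsum_minus:
  "(\<And>x. f x \<in> carrier R) \<Longrightarrow> (\<And>x. g x \<in> carrier R) \<Longrightarrow> lsum (\<lambda>x. f x \<ominus> g x) xs = lsum f xs \<ominus> lsum g xs"
proof (induction xs)
  case (Cons x xs)
  have c: "lsum f xs \<in> carrier R" "lsum g xs \<in> carrier R" "f x \<in> carrier R" "g x \<in> carrier R"
    using Cons.prems by (auto simp: lsum_closed)
  have "f x \<ominus> g x \<oplus> (lsum f xs \<ominus> lsum g xs) = f x \<oplus> lsum f xs \<ominus> (g x \<oplus> lsum g xs)"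
    using c by algebra
  then show ?case using Cons by simp
qed (simp add: minus_self)

lemma lsum_zero: "lsum (\<lambda>x. \<zero>) xs = \<zero>" by (induction xs) auto

lemma lsum_swap:
  "(\<And>x y. f x y \<in> carrier R) \<Longrightarrow> lsum (\<lambda>x. lsum (f x) ys) xs = lsum (\<lambda>y. lsum (\<lambda>x. f x y) xs) ys"
  by (induction xs) (auto simp: lsum_zero lsum_add lsum_closed)

lemma lsum_append:
  "(\<And>x. f x \<in> carrier R) \<Longrightarrow> lsum f (xs @ ys) = lsum f xs \<oplus> lsum f ys"
  by (induction xs) (auto simp: lsum_closed a_assoc)

lemma lsum_ideal: "ideal N R \<Longrightarrow> (\<And>x. x \<in> set xs \<Longrightarrow> f x \<in> N) \<Longrightarrow> lsum f xs \<in> N"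
proof (induction xs)
  case (Cons x xs)
  then show ?case using iadd[OF Cons.prems(1), of "f x" "lsum f xs"] by simp
qed (simp add: izero)

lemma lsum_map: "lsum f (map g xs) = lsum (\<lambda>x. f (g x)) xs"
  by (induction xs) auto

definition kron :: "'i \<Rightarrow> 'i \<Rightarrow> 'a" where "kron i j = (if i = j then \<one> else \<zero>)"

lemma kron_closed [simp]: "kron i j \<in> carrier R" by (simp add: kron_def)

lemma lsum_kron:
  assumes "distinct is" "i \<in> set is" "\<And>j. f j \<in> carrier R"
  shows "lsum (\<lambda>j. kron i j \<otimes> f j) is = f i"
proof -
  have z: "lsum (\<lambda>j. kron i j \<otimes> f j) is = \<zero>" if "i \<notin> set is" for "is"
    using that assms(3) by (induction "is") (auto simp: kron_def)
  show ?thesis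
    using assms(1,2)
  proof (induction "is")
    case (Cons k ks)
    then show ?case using z[of ks] assms(3) by (cases "i = k") (auto simp: kron_def)
  qed simp
qed

lemma lsum_kron':
  assumes "distinct is" "i \<in> set is" "\<And>j. f j \<in> carrier R"
  shows "lsum (\<lambda>j. f j \<otimes> kron j i) is = f i"
proof -
  have "lsum (\<lambda>j. f j \<otimes> kron j i) is = lsum (\<lambda>j. kron i j \<otimes> f j) is"
    by (rule lsum_cong) (use assms(3) in \<open>auto simp: kron_def\<close>)
  then show ?thesis using lsum_kron[OF assms] by simp
qed

lemma Idl_lsum:
  assumes "distinct is" "\<And>i. f i \<in> carrier R" "z \<in> Idl (f ` set is)"
  obtains l where "\<And>i. l i \<in> carrier R" "z = lsum (\<lambda>i. l i \<otimes> f i) is"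
proof -
  let ?N = "{lsum (\<lambda>i. l i \<otimes> f i) is |l. \<forall>i. l i \<in> carrier R}"
  have N: "ideal ?N R"
  proof (rule idealI')
    show "?N \<subseteq> carrier R" using assms(2) by (auto intro!: lsum_closed)
    have "\<zero> = lsum (\<lambda>i. \<zero> \<otimes> f i) is" using assms(2) by (simp add: lsum_zero)
    then show "\<zero> \<in> ?N" by (intro CollectI exI[of _ "\<lambda>_. \<zero>"]) simp
  next
    fix a b assume "a \<in> ?N" "b \<in> ?N"
    then obtain l m where l: "a = lsum (\<lambda>i. l i \<otimes> f i) is" "\<forall>i. l i \<in> carrier R"
      and m: "b = lsum (\<lambda>i. m i \<otimes> f i) is" "\<forall>i. m i \<in> carrier R" by auto
    have "a \<oplus> b = lsum (\<lambda>i. (l i \<oplus> m i) \<otimes> f i) is"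
      using l m assms(2) by (simp add: l_distr lsum_add)
    then show "a \<oplus> b \<in> ?N" using l(2) m(2) by (intro CollectI exI[of _ "\<lambda>i. l i \<oplus> m i"]) simp
  next
    fix r a assume r: "r \<in> carrier R" and "a \<in> ?N"
    then obtain l where l: "a = lsum (\<lambda>i. l i \<otimes> f i) is" "\<forall>i. l i \<in> carrier R" by auto
    have "r \<otimes> a = lsum (\<lambda>i. (r \<otimes> l i) \<otimes> f i) is"
      using l r assms(2) by (simp add: m_assoc lsum_mult)
    then show "r \<otimes> a \<in> ?N" using l(2) r by (intro CollectI exI[of _ "\<lambda>i. r \<otimes> l i"]) simp
  qed
  have "f ` set is \<subseteq> ?N"
  proof
    fix z assume "z \<in> f ` set is"
    then obtain i where i: "i \<in> set is" "z = f i" by blast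
    then have "z = lsum (\<lambda>j. kron i j \<otimes> f j) is" using lsum_kron[OF assms(1) i(1), of f] assms(2) by simp
    then show "z \<in> ?N" using kron_closed by (intro CollectI exI[of _ "kron i"]) simp
  qed
  then have "z \<in> ?N" using genideal_minimal[OF N] assms(3) by blast
  then show ?thesis using that by auto
qed

text \<open>Gaussian elimination without division over the domain \<open>R/Q\<close>: a pivot
  \<open>v b j\<close> outside \<open>Q\<close> clears coordinate \<open>j\<close> by cross
  multiplication, and the coefficient at \<open>b\<close> is solved for afterwards.\<close>

lemma linear_dependence:
  assumes Q: "primeideal Q R"
  shows "length cs < length as \<Longrightarrow> distinct as \<Longrightarrow> (\<And>a j. v a j \<in> carrier R) \<Longrightarrow>
    \<exists>c. (\<forall>a. c a \<in> carrier R) \<and> (\<exists>a\<in>set as. c a \<notin> Q) \<and> (\<forall>j\<in>set cs. lsum (\<lambda>a. c a \<otimes> v a j) as \<in> Q)"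
proof (induction cs arbitrary: as v)
  case Nil
  then have "hd as \<in> set as" by (cases as) auto
  then show ?case using prime_one[OF Q] by (intro exI[of _ "\<lambda>_. \<one>"]) auto
next
  case (Cons j cs)
  note IQ = prime_ideal[OF Q] and v = Cons.prems(3)
  show ?case
  proof (cases "\<forall>a\<in>set as. v a j \<in> Q")
    case True
    obtain c where c: "\<forall>a. c a \<in> carrier R" "\<exists>a\<in>set as. c a \<notin> Q" "\<forall>j\<in>set cs. lsum (\<lambda>a. c a \<otimes> v a j) as \<in> Q"
      using Cons.IH[of as v] Cons.prems by auto
    have "lsum (\<lambda>a. c a \<otimes> v a j) as \<in> Q"
      by (rule lsum_ideal[OF IQ]) (use True c(1) imult[OF IQ] in blast)
    then show ?thesis using c by (intro exI[of _ c]) simp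
  next
    case False
    then obtain b where b: "b \<in> set as" "v b j \<notin> Q" by blast
    obtain us vs where as: "as = us @ b # vs" using split_list[OF b(1)] by blast
    define as' where "as' = us @ vs"
    define w where "w a i = v b j \<otimes> v a i \<ominus> v a j \<otimes> v b i" for a i
    have bn: "b \<notin> set as'" and das: "distinct as'" and las: "length cs < length as'"
      using Cons.prems(1,2) unfolding as as'_def by auto
    have wc: "w a i \<in> carrier R" for a i unfolding w_def using v by simp
    obtain c where c: "\<And>a. c a \<in> carrier R" "\<exists>a\<in>set as'. c a \<notin> Q"
      and cQ: "\<forall>i\<in>set cs. lsum (\<lambda>a. c a \<otimes> w a i) as' \<in> Q"
    proof -
      have "\<exists>c. (\<forall>a. c a \<in> carrier R) \<and> (\<exists>a\<in>set as'. c a \<notin> Q) \<and> (\<forall>i\<in>set cs. lsum (\<lambda>a. c a \<otimes> w a i) as' \<in> Q)"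
        by (rule Cons.IH[OF las das wc])
      then show ?thesis using that by auto
    qed
    define s where "s = lsum (\<lambda>a. c a \<otimes> v a j) as'"
    define e where "e a = (if a = b then \<ominus> s else v b j \<otimes> c a)" for a
    have sc: "s \<in> carrier R" unfolding s_def using c v by (auto intro: lsum_closed)
    have ec: "e a \<in> carrier R" for a unfolding e_def using sc c v by simp
    have split: "lsum f as = f b \<oplus> lsum f as'" if "\<And>a. f a \<in> carrier R" for f
      unfolding as as'_def using that by (simp add: lsum_append lsum_closed a_lcomm)
    have key: "lsum (\<lambda>a. e a \<otimes> v a i) as = lsum (\<lambda>a. c a \<otimes> w a i) as'" for i
    proof -
      have "lsum (\<lambda>a. e a \<otimes> v a i) as' = lsum (\<lambda>a. v b j \<otimes> (c a \<otimes> v a i)) as'"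
        by (rule lsum_cong) (use bn c v in \<open>auto simp: e_def m_assoc\<close>)
      also have "\<dots> = v b j \<otimes> lsum (\<lambda>a. c a \<otimes> v a i) as'"
        using lsum_mult[of "v b j" "\<lambda>a. c a \<otimes> v a i"] c v by simp
      finally have l: "lsum (\<lambda>a. e a \<otimes> v a i) as = \<ominus> s \<otimes> v b i \<oplus> v b j \<otimes> lsum (\<lambda>a. c a \<otimes> v a i) as'"
        using split[of "\<lambda>a. e a \<otimes> v a i"] ec v by (simp add: e_def)
      have "c a \<otimes> w a i = v b j \<otimes> (c a \<otimes> v a i) \<ominus> (c a \<otimes> v a j) \<otimes> v b i" for a
        unfolding w_def using c(1)[of a] v[of b j] v[of a i] v[of a j] v[of b i] by algebra
      then have "lsum (\<lambda>a. c a \<otimes> w a i) as' = lsum (\<lambda>a. v b j \<otimes> (c a \<otimes> v a i)) as' \<ominus> lsum (\<lambda>a. (c a \<otimes> v a j) \<otimes> v b i) as'"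
        using lsum_minus[of "\<lambda>a. v b j \<otimes> (c a \<otimes> v a i)" "\<lambda>a. (c a \<otimes> v a j) \<otimes> v b i"] c v by simp
      then have r: "lsum (\<lambda>a. c a \<otimes> w a i) as' = v b j \<otimes> lsum (\<lambda>a. c a \<otimes> v a i) as' \<ominus> s \<otimes> v b i"
        using lsum_mult[of "v b j" "\<lambda>a. c a \<otimes> v a i"] lsum_multr[of "v b i" "\<lambda>a. c a \<otimes> v a j"] c v
        by (simp add: s_def)
      have "lsum (\<lambda>a. c a \<otimes> v a i) as' \<in> carrier R" using c v by (simp add: lsum_closed)
      moreover have "\<ominus> s \<otimes> v b i \<oplus> v b j \<otimes> x = v b j \<otimes> x \<ominus> s \<otimes> v b i" if "x \<in> carrier R" for x
        using sc v[of b i] v[of b j] that by algebra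
      ultimately show ?thesis unfolding l r by simp
    qed
    have wj: "w a j = \<zero>" for a unfolding w_def using v[of b j] v[of a j] by algebra
    have "lsum (\<lambda>a. c a \<otimes> w a j) as' \<in> Q"
      by (rule lsum_ideal[OF IQ]) (simp add: wj c izero[OF IQ])
    then have "\<forall>i\<in>set (j # cs). lsum (\<lambda>a. e a \<otimes> v a i) as \<in> Q" using cQ key by simp
    moreover have "\<exists>a\<in>set as. e a \<notin> Q"
    proof -
      obtain a where a: "a \<in> set as'" "c a \<notin> Q" using c(2) by blast
      have "e a = v b j \<otimes> c a" using a bn unfolding e_def by auto
      then have "e a \<notin> Q" using prime_mult[OF Q v c(1) _ b(2)] a(2) by auto
      then show ?thesis using a unfolding as as'_def by auto
    qed
    ultimately show ?thesis using ec by blast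
  qed
qed

text \<open>The usual argument modulo \<open>Q\<close>: applying the matrix to a relation and adding
  \<open>\<mu> k\<close> times the relation leaves, up to sign, a shorter one with coefficients
  \<open>c m (\<mu> m - \<mu> k)\<close>.\<close>

lemma eigenvectors_independent:
  assumes Q: "primeideal Q R" and L: "\<And>i j. L i j \<in> carrier R" and w: "\<And>m i. w m i \<in> carrier R"
    and \<mu>: "\<And>m. \<mu> m \<in> carrier R" "\<And>m m'. m \<noteq> m' \<Longrightarrow> \<mu> m \<ominus> \<mu> m' \<notin> Q"
    and eig: "\<And>m j. m \<in> set ms \<Longrightarrow> j \<in> set is \<Longrightarrow> lsum (\<lambda>i. w m i \<otimes> L i j) is \<oplus> \<mu> m \<otimes> w m j \<in> Q"
    and nz: "\<And>m. m \<in> set ms \<Longrightarrow> \<exists>i\<in>set is. w m i \<notin> Q"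
  shows "distinct ms \<Longrightarrow> (\<And>m. c m \<in> carrier R) \<Longrightarrow> (\<And>j. j \<in> set is \<Longrightarrow> lsum (\<lambda>m. c m \<otimes> w m j) ms \<in> Q) \<Longrightarrow>
    m \<in> set ms \<Longrightarrow> c m \<in> Q"
  using eig nz
proof (induction ms arbitrary: c m)
  case (Cons k ms)
  note IQ = prime_ideal[OF Q] and c = Cons.prems(2) and rel = Cons.prems(3)
    and eig = Cons.prems(5) and nz = Cons.prems(6)
  have rest: "c m \<in> Q" if m: "m \<in> set ms" for m
  proof -
    define c' where "c' m = c m \<otimes> (\<mu> m \<ominus> \<mu> k)" for m
    have c'c: "c' m \<in> carrier R" for m unfolding c'_def using c \<mu> by simp
    have rel': "lsum (\<lambda>m. c' m \<otimes> w m j) ms \<in> Q" if j: "j \<in> set is" for j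
    proof -
      let ?ms = "k # ms"
      have f1: "lsum (\<lambda>m. c m \<otimes> (lsum (\<lambda>i. w m i \<otimes> L i j) is \<oplus> \<mu> m \<otimes> w m j)) ?ms \<in> Q"
        by (rule lsum_ideal[OF IQ]) (use eig[OF _ j] imult[OF IQ] c in blast)
      have f2: "lsum (\<lambda>m. c m \<otimes> lsum (\<lambda>i. w m i \<otimes> L i j) is) ?ms \<in> Q"
      proof -
        have e: "c m \<otimes> (w m i \<otimes> L i j) = (c m \<otimes> w m i) \<otimes> L i j" for m i using c w L by (simp add: m_assoc)
        have "lsum (\<lambda>m. c m \<otimes> lsum (\<lambda>i. w m i \<otimes> L i j) is) ?ms
            = lsum (\<lambda>m. lsum (\<lambda>i. c m \<otimes> (w m i \<otimes> L i j)) is) ?ms"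
          by (rule lsum_cong) (use c w L in \<open>simp add: lsum_mult\<close>)
        also have "\<dots> = lsum (\<lambda>i. lsum (\<lambda>m. c m \<otimes> (w m i \<otimes> L i j)) ?ms) is"
          by (rule lsum_swap) (use c w L in simp)
        also have "\<dots> = lsum (\<lambda>i. lsum (\<lambda>m. c m \<otimes> w m i) ?ms \<otimes> L i j) is"
          by (rule lsum_cong) (unfold e, rule lsum_multr, use c w L in simp_all)
        also have "\<dots> \<in> Q"
          by (rule lsum_ideal[OF IQ]) (rule imultr[OF IQ rel L])
        finally show ?thesis .
      qed
      have f3: "lsum (\<lambda>m. c m \<otimes> (lsum (\<lambda>i. w m i \<otimes> L i j) is \<oplus> \<mu> m \<otimes> w m j)) ?ms
          = lsum (\<lambda>m. c m \<otimes> (\<mu> m \<otimes> w m j)) ?ms \<oplus> lsum (\<lambda>m. c m \<otimes> lsum (\<lambda>i. w m i \<otimes> L i j) is) ?ms"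
      proof -
        have lc: "lsum (\<lambda>i. w m i \<otimes> L i j) is \<in> carrier R" for m using w L by (simp add: lsum_closed)
        have "lsum (\<lambda>m. c m \<otimes> (lsum (\<lambda>i. w m i \<otimes> L i j) is \<oplus> \<mu> m \<otimes> w m j)) ?ms
          = lsum (\<lambda>m. c m \<otimes> (\<mu> m \<otimes> w m j) \<oplus> c m \<otimes> lsum (\<lambda>i. w m i \<otimes> L i j) is) ?ms"
          by (rule lsum_cong) (use c lc w \<mu> in \<open>simp add: r_distr a_comm\<close>)
        also have "\<dots> = lsum (\<lambda>m. c m \<otimes> (\<mu> m \<otimes> w m j)) ?ms \<oplus> lsum (\<lambda>m. c m \<otimes> lsum (\<lambda>i. w m i \<otimes> L i j) is) ?ms"
          by (rule lsum_add) (use c lc w \<mu> in simp_all)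
        finally show ?thesis .
      qed
      have mc: "lsum (\<lambda>m. c m \<otimes> (\<mu> m \<otimes> w m j)) ?ms \<in> carrier R"
        by (rule lsum_closed) (use c w \<mu> in simp)
      have 1: "lsum (\<lambda>m. c m \<otimes> (\<mu> m \<otimes> w m j)) ?ms \<in> Q"
        using iadd_cancel[OF IQ f1[unfolded f3] f2 mc] .
      have 2: "\<mu> k \<otimes> lsum (\<lambda>m. c m \<otimes> w m j) ?ms \<in> Q" using imult[OF IQ rel[OF j] \<mu>(1)] .
      have "lsum (\<lambda>m. c' m \<otimes> w m j) ?ms = lsum (\<lambda>m. c m \<otimes> (\<mu> m \<otimes> w m j) \<ominus> \<mu> k \<otimes> (c m \<otimes> w m j)) ?ms"
      proof (rule lsum_cong)
        fix m show "c' m \<otimes> w m j = c m \<otimes> (\<mu> m \<otimes> w m j) \<ominus> \<mu> k \<otimes> (c m \<otimes> w m j)"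
          unfolding c'_def using c[of m] w[of m j] \<mu>(1)[of m] \<mu>(1)[of k] by algebra
      qed
      also have "\<dots> = lsum (\<lambda>m. c m \<otimes> (\<mu> m \<otimes> w m j)) ?ms \<ominus> lsum (\<lambda>m. \<mu> k \<otimes> (c m \<otimes> w m j)) ?ms"
        by (rule lsum_minus) (use c w \<mu> in simp_all)
      also have "lsum (\<lambda>m. \<mu> k \<otimes> (c m \<otimes> w m j)) ?ms = \<mu> k \<otimes> lsum (\<lambda>m. c m \<otimes> w m j) ?ms"
        by (rule lsum_mult) (use c w \<mu> in simp_all)
      finally have 3: "lsum (\<lambda>m. c' m \<otimes> w m j) ?ms \<in> Q" using iminus[OF IQ 1 2] by simp
      have "c' k = \<zero>" unfolding c'_def using c \<mu>(1) by (simp add: minus_self)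
      then have "lsum (\<lambda>m. c' m \<otimes> w m j) ?ms = lsum (\<lambda>m. c' m \<otimes> w m j) ms"
        using w c'c by (simp add: lsum_closed)
      then show ?thesis using 3 by simp
    qed
    have "c' m \<in> Q"
      by (rule Cons.IH[OF _ c'c rel' m]) (use Cons.prems(1) eig nz in auto)
    moreover have "m \<noteq> k" using m Cons.prems(1) by auto
    ultimately show ?thesis
      unfolding c'_def using prime_mult[OF Q, of "\<mu> m \<ominus> \<mu> k" "c m"] \<mu> c by (simp add: m_comm)
  qed
  have "c k \<in> Q"
  proof -
    obtain i where i: "i \<in> set is" "w k i \<notin> Q" using nz by force
    have "lsum (\<lambda>m. c m \<otimes> w m i) ms \<in> Q"
      by (rule lsum_ideal[OF IQ]) (use rest imultr[OF IQ] w in blast)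
    then have "c k \<otimes> w k i \<in> Q" using iadd_cancel[OF IQ _ _ m_closed[OF c w]] rel[OF i(1)] by simp
    then show ?thesis using prime_mult[OF Q w c _ i(2)] c w by (simp add: m_comm)
  qed
  then show ?case using rest Cons.prems(4) by auto
qed simp

text \<open>Let \<open>L\<close> be a matrix expressing the \<open>G i\<close> by the \<open>f i\<close>. If no \<open>\<mu> m\<close> worked, there would be too
  many distinct \<open>\<mu> m\<close> such that \<open>- \<mu> m\<close> is an eigenvalue of \<open>L\<close> modulo \<open>Q\<close>.\<close>

lemma generic_shift:
  assumes Q: "primeideal Q R" and dis: "distinct is"
    and c: "\<And>i. f i \<in> carrier R" and G: "\<And>i. i \<in> set is \<Longrightarrow> G i \<in> Idl (f ` set is)"
    and \<mu>: "\<And>m. \<mu> m \<in> carrier R" "\<And>m m'. m \<noteq> m' \<Longrightarrow> \<mu> m \<ominus> \<mu> m' \<notin> Q"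
    and ms: "distinct ms" "length is < length ms"
  obtains m s where "m \<in> set ms" "s \<in> carrier R - Q"
    "\<And>i. i \<in> set is \<Longrightarrow> s \<otimes> f i \<in> Idl ((\<lambda>i. G i \<oplus> \<mu> m \<otimes> f i) ` set is)"
proof -
  have "\<exists>l. (\<forall>j. l j \<in> carrier R) \<and> (i \<in> set is \<longrightarrow> G i = lsum (\<lambda>j. l j \<otimes> f j) is)" for i
  proof (cases "i \<in> set is")
    case True
    show ?thesis using Idl_lsum[OF dis c G[OF True]] by metis
  qed (auto intro: exI[of _ "\<lambda>_. \<zero>"])
  then obtain L where L: "\<And>i j. L i j \<in> carrier R"
    and GL: "\<And>i. i \<in> set is \<Longrightarrow> G i = lsum (\<lambda>j. L i j \<otimes> f j) is" by metis
  note IQ = prime_ideal[OF Q]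
  \<comment> \<open>\<open>row m\<close> is the matrix \<open>L + \<mu> m\<close> that expresses the
    shifted elements by the \<open>f j\<close>.\<close>
  define row where "row m i j = L i j \<oplus> \<mu> m \<otimes> kron i j" for m i j
  have rowc: "row m i j \<in> carrier R" for m i j unfolding row_def using L \<mu> by simp
  have rowG: "lsum (\<lambda>j. row m i j \<otimes> f j) is = G i \<oplus> \<mu> m \<otimes> f i" if i: "i \<in> set is" for m i
  proof -
    have "row m i j \<otimes> f j = L i j \<otimes> f j \<oplus> \<mu> m \<otimes> (kron i j \<otimes> f j)" for j
      unfolding row_def using L c \<mu> kron_closed by (simp add: l_distr m_assoc)
    then have "lsum (\<lambda>j. row m i j \<otimes> f j) is = lsum (\<lambda>j. L i j \<otimes> f j) is \<oplus> lsum (\<lambda>j. \<mu> m \<otimes> (kron i j \<otimes> f j)) is"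
      using lsum_add[of "\<lambda>j. L i j \<otimes> f j" "\<lambda>j. \<mu> m \<otimes> (kron i j \<otimes> f j)"] L c \<mu> by simp
    also have "lsum (\<lambda>j. \<mu> m \<otimes> (kron i j \<otimes> f j)) is = \<mu> m \<otimes> f i"
      using lsum_mult[of "\<mu> m" "\<lambda>j. kron i j \<otimes> f j"] lsum_kron[OF dis i c] \<mu> c by simp
    finally show ?thesis using GL[OF i] by simp
  qed
  \<comment> \<open>Some \<open>row m\<close> is nonsingular modulo \<open>Q\<close>: kernel vectors
    for all \<open>m\<close> would be eigenvectors of \<open>L\<close> for distinct values, more of
    them than coordinates.\<close>
  have "\<exists>m\<in>set ms. \<forall>w. (\<forall>i. w i \<in> carrier R) \<and> (\<forall>j\<in>set is. lsum (\<lambda>i. w i \<otimes> row m i j) is \<in> Q) \<longrightarrow> (\<forall>i\<in>set is. w i \<in> Q)"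
  proof (rule ccontr)
    assume "\<not> ?thesis"
    then have "\<forall>m\<in>set ms. \<exists>w. (\<forall>i. w i \<in> carrier R) \<and> (\<forall>j\<in>set is. lsum (\<lambda>i. w i \<otimes> row m i j) is \<in> Q) \<and> (\<exists>i\<in>set is. w i \<notin> Q)"
      by auto
    then obtain W where W: "\<forall>m\<in>set ms. (\<forall>i. W m i \<in> carrier R) \<and> (\<forall>j\<in>set is. lsum (\<lambda>i. W m i \<otimes> row m i j) is \<in> Q) \<and> (\<exists>i\<in>set is. W m i \<notin> Q)"
      by (rule bchoice[THEN exE])
    define w where "w m = (if m \<in> set ms then W m else (\<lambda>_. \<zero>))" for m
    have w: "\<And>m i. w m i \<in> carrier R"
      "\<And>m j. m \<in> set ms \<Longrightarrow> j \<in> set is \<Longrightarrow> lsum (\<lambda>i. w m i \<otimes> row m i j) is \<in> Q"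
      "\<And>m. m \<in> set ms \<Longrightarrow> \<exists>i\<in>set is. w m i \<notin> Q"
      using W unfolding w_def by auto
    have eig: "lsum (\<lambda>i. w m i \<otimes> L i j) is \<oplus> \<mu> m \<otimes> w m j \<in> Q" if m: "m \<in> set ms" and j: "j \<in> set is" for m j
    proof -
      have "w m i \<otimes> row m i j = w m i \<otimes> L i j \<oplus> \<mu> m \<otimes> (w m i \<otimes> kron i j)" for i
        unfolding row_def using w(1)[of m i] L[of i j] \<mu>(1)[of m] kron_closed[of i j] by algebra
      then have "lsum (\<lambda>i. w m i \<otimes> row m i j) is = lsum (\<lambda>i. w m i \<otimes> L i j) is \<oplus> lsum (\<lambda>i. \<mu> m \<otimes> (w m i \<otimes> kron i j)) is"
        using lsum_add[of "\<lambda>i. w m i \<otimes> L i j" "\<lambda>i. \<mu> m \<otimes> (w m i \<otimes> kron i j)"] L w(1) \<mu> by simp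
      also have "lsum (\<lambda>i. \<mu> m \<otimes> (w m i \<otimes> kron i j)) is = \<mu> m \<otimes> w m j"
        using lsum_mult[of "\<mu> m" "\<lambda>i. w m i \<otimes> kron i j"] lsum_kron'[OF dis j, of "w m"] w(1) \<mu> by simp
      finally show ?thesis using w(2)[OF m j] by simp
    qed
    obtain e where e: "\<And>m. e m \<in> carrier R" "\<exists>m\<in>set ms. e m \<notin> Q"
      "\<And>j. j \<in> set is \<Longrightarrow> lsum (\<lambda>m. e m \<otimes> w m j) ms \<in> Q"
    proof -
      have "\<exists>e. (\<forall>m. e m \<in> carrier R) \<and> (\<exists>m\<in>set ms. e m \<notin> Q) \<and> (\<forall>j\<in>set is. lsum (\<lambda>m. e m \<otimes> w m j) ms \<in> Q)"
        by (rule linear_dependence[OF Q ms(2,1) w(1)])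
      then show ?thesis using that by auto
    qed
    obtain m where m: "m \<in> set ms" "e m \<notin> Q" using e(2) by blast
    have "e m \<in> Q"
      by (rule eigenvectors_independent[OF Q L w(1) \<mu> eig w(3) ms(1) e(1) e(3) m(1)])
    then show False using m(2) by simp
  qed
  then obtain m where m: "m \<in> set ms"
    and ker: "\<And>w i. (\<And>i. w i \<in> carrier R) \<Longrightarrow> (\<And>j. j \<in> set is \<Longrightarrow> lsum (\<lambda>i. w i \<otimes> row m i j) is \<in> Q) \<Longrightarrow> i \<in> set is \<Longrightarrow> w i \<in> Q"
    by blast
  let ?D = "(\<lambda>i. G i \<oplus> \<mu> m \<otimes> f i) ` set is"
  have Gc: "G i \<in> carrier R" if "i \<in> set is" for i using GL[OF that] L c by (simp add: lsum_closed)
  have Dc: "?D \<subseteq> carrier R" using Gc c \<mu> by auto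
  have "\<exists>s\<in>carrier R - Q. \<forall>y\<in>f ` set is. s \<otimes> y \<in> Idl ?D"
  proof (rule nakayama_ideal[OF Q genideal_ideal[OF Dc]])
    show "f ` set is \<subseteq> carrier R" using c by auto
    fix y N assume y: "y \<in> f ` set is" and N: "ideal N R" "Idl ?D \<subseteq> N"
      and qN: "\<And>q z. q \<in> Q \<Longrightarrow> z \<in> f ` set is \<Longrightarrow> q \<otimes> z \<in> N"
    obtain i where i: "i \<in> set is" "y = f i" using y by blast
    \<comment> \<open>The unit vector at \<open>i\<close>, indexed by \<open>None\<close>, is added
      to the rows. One vector too many gives a relation, and its coefficient at \<open>None\<close>
      is outside \<open>Q\<close> since the rows are independent.\<close>
    define v where "v a j = (case a of None \<Rightarrow> kron i j | Some x \<Rightarrow> row m x j)" for a j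
    have vc: "v a j \<in> carrier R" for a j unfolding v_def using kron_closed rowc by (cases a) auto
    obtain e where e: "\<And>a. e a \<in> carrier R" "\<exists>a\<in>set (None # map Some is). e a \<notin> Q"
      "\<And>j. j \<in> set is \<Longrightarrow> lsum (\<lambda>a. e a \<otimes> v a j) (None # map Some is) \<in> Q"
    proof -
      have "\<exists>e. (\<forall>a. e a \<in> carrier R) \<and> (\<exists>a\<in>set (None # map Some is). e a \<notin> Q) \<and>
          (\<forall>j\<in>set is. lsum (\<lambda>a. e a \<otimes> v a j) (None # map Some is) \<in> Q)"
        by (rule linear_dependence[OF Q _ _ vc]) (use dis in \<open>auto simp: distinct_map\<close>)
      then show ?thesis using that by auto
    qed
    define s where "s = e None"
    define k where "k x = e (Some x)" for x
    have sc: "s \<in> carrier R" and kc: "\<And>x. k x \<in> carrier R" unfolding s_def k_def using e(1) by auto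
    have rel: "s \<otimes> kron i j \<oplus> lsum (\<lambda>x. k x \<otimes> row m x j) is \<in> Q" if "j \<in> set is" for j
      using e(3)[OF that] by (simp add: lsum_map v_def s_def k_def comp_def)
    have sQ: "s \<notin> Q"
    proof
      assume sQ: "s \<in> Q"
      have "lsum (\<lambda>x. k x \<otimes> row m x j) is \<in> Q" if j: "j \<in> set is" for j
      proof -
        have lc: "lsum (\<lambda>x. k x \<otimes> row m x j) is \<in> carrier R" using kc rowc by (simp add: lsum_closed)
        have "lsum (\<lambda>x. k x \<otimes> row m x j) is \<oplus> s \<otimes> kron i j \<in> Q" using rel[OF j] lc sc by (simp add: a_comm)
        then show ?thesis by (rule iadd_cancel[OF IQ _ imultr[OF IQ sQ kron_closed] lc])
      qed
      then have "k x \<in> Q" if "x \<in> set is" for x using ker[of k x] kc that by blast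
      then show False using e(2) sQ unfolding s_def k_def by auto
    qed
    have "lsum (\<lambda>j. (s \<otimes> kron i j \<oplus> lsum (\<lambda>x. k x \<otimes> row m x j) is) \<otimes> f j) is \<in> N"
      by (rule lsum_ideal[OF N(1)]) (use rel qN in blast)
    moreover have "lsum (\<lambda>j. (s \<otimes> kron i j \<oplus> lsum (\<lambda>x. k x \<otimes> row m x j) is) \<otimes> f j) is
        = s \<otimes> f i \<oplus> lsum (\<lambda>x. k x \<otimes> (G x \<oplus> \<mu> m \<otimes> f x)) is"
    proof -
      have e1: "(s \<otimes> kron i j \<oplus> lsum (\<lambda>x. k x \<otimes> row m x j) is) \<otimes> f j
          = s \<otimes> (kron i j \<otimes> f j) \<oplus> lsum (\<lambda>x. k x \<otimes> (row m x j \<otimes> f j)) is" for j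
      proof -
        have "lsum (\<lambda>x. k x \<otimes> row m x j) is \<otimes> f j = lsum (\<lambda>x. k x \<otimes> row m x j \<otimes> f j) is"
          by (rule lsum_multr[symmetric]) (use c kc rowc in simp_all)
        also have "\<dots> = lsum (\<lambda>x. k x \<otimes> (row m x j \<otimes> f j)) is"
          by (rule lsum_cong) (use c kc rowc in \<open>simp add: m_assoc\<close>)
        finally show ?thesis using c kc rowc sc kron_closed by (simp add: l_distr lsum_closed m_assoc)
      qed
      have "lsum (\<lambda>j. s \<otimes> (kron i j \<otimes> f j) \<oplus> lsum (\<lambda>x. k x \<otimes> (row m x j \<otimes> f j)) is) is
          = lsum (\<lambda>j. s \<otimes> (kron i j \<otimes> f j)) is \<oplus> lsum (\<lambda>j. lsum (\<lambda>x. k x \<otimes> (row m x j \<otimes> f j)) is) is"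
        by (rule lsum_add) (use c kc rowc sc in \<open>simp_all add: lsum_closed\<close>)
      also have "lsum (\<lambda>j. s \<otimes> (kron i j \<otimes> f j)) is = s \<otimes> f i"
        using lsum_mult[of s "\<lambda>j. kron i j \<otimes> f j"] lsum_kron[OF dis i(1) c] sc c by simp
      also have "lsum (\<lambda>j. lsum (\<lambda>x. k x \<otimes> (row m x j \<otimes> f j)) is) is
          = lsum (\<lambda>x. lsum (\<lambda>j. k x \<otimes> (row m x j \<otimes> f j)) is) is"
        by (rule lsum_swap) (use c kc rowc in simp)
      also have "\<dots> = lsum (\<lambda>x. k x \<otimes> (G x \<oplus> \<mu> m \<otimes> f x)) is"
      proof (rule lsum_cong)
        fix x assume x: "x \<in> set is"
        have "lsum (\<lambda>j. k x \<otimes> (row m x j \<otimes> f j)) is = k x \<otimes> lsum (\<lambda>j. row m x j \<otimes> f j) is"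
          by (rule lsum_mult) (use c kc rowc in simp_all)
        then show "lsum (\<lambda>j. k x \<otimes> (row m x j \<otimes> f j)) is = k x \<otimes> (G x \<oplus> \<mu> m \<otimes> f x)" using rowG[OF x] by simp
      qed
      finally show ?thesis unfolding e1 .
    qed
    moreover have "lsum (\<lambda>x. k x \<otimes> (G x \<oplus> \<mu> m \<otimes> f x)) is \<in> N"
    proof (rule lsum_ideal[OF N(1)])
      fix x assume "x \<in> set is"
      then have "G x \<oplus> \<mu> m \<otimes> f x \<in> N" using N(2) genideal_self[OF Dc] by blast
      then show "k x \<otimes> (G x \<oplus> \<mu> m \<otimes> f x) \<in> N" using imult[OF N(1)] kc by blast
    qed
    ultimately have "s \<otimes> f i \<in> N" using iadd_cancel[OF N(1)] m_closed[OF sc c] by metis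
    then show "\<exists>s\<in>carrier R - Q. s \<otimes> y \<in> N" using sc sQ i(2) by blast
  qed simp
  then show ?thesis using that[OF m] by auto
qed

end

section \<open>Power series over a local ring\<close>

context cring begin

interpretation S: cring S by (rule cring_S)

lemma ideal_preimage_mult:
  assumes D: "ideal D R" and v: "v \<in> carrier R" shows "ideal {f \<in> carrier R. v \<otimes> f \<in> D} R"
proof -
  have "{f \<in> carrier R. v \<otimes> f \<in> D} = colon R D v" unfolding colon_def using v by (auto simp: m_comm)
  then show ?thesis using ideal_colon[OF D v] by simp
qed

lemma coeff_in_if_leading:
  assumes N: "ideal N R" and h: "\<And>i. h i \<in> carrier R" and h0: "\<And>a. a \<in> carrier R \<Longrightarrow> h 0 \<otimes> a \<in> N \<Longrightarrow> a \<in> N"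
  shows "(\<And>i. f i \<in> carrier R) \<Longrightarrow> (\<And>m. conv R m f h \<in> N) \<Longrightarrow> f k \<in> N"
proof (induction k arbitrary: f)
  case 0
  then have "f 0 \<otimes> h 0 \<in> N" using conv.simps(1)[of R f h] by metis
  then show ?case using h0[of "f 0"] h[of 0] 0(1)[of 0] by (simp add: m_comm)
next
  case (Suc k)
  have "f 0 \<otimes> h 0 \<in> N" using Suc.prems(2)[of 0] by simp
  then have f0: "f 0 \<in> N" using h0[of "f 0"] h[of 0] Suc.prems(1)[of 0] by (simp add: m_comm)
  have "conv R m (\<lambda>i. f (Suc i)) h \<in> N" for m
  proof -
    have c: "conv R m (\<lambda>i. f (Suc i)) h \<in> carrier R" using Suc.prems(1) h by (simp add: conv_closed)
    have fh: "f 0 \<otimes> h (Suc m) \<in> N" using imultr[OF N f0 h] .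
    have "conv R m (\<lambda>i. f (Suc i)) h \<oplus> f 0 \<otimes> h (Suc m) \<in> N"
      using Suc.prems(2)[of "Suc m"] c icarr[OF N fh] by (simp add: a_comm)
    then show ?thesis using iadd_cancel[OF N _ fh c] by simp
  qed
  then show ?case using Suc.IH[of "\<lambda>i. f (Suc i)"] Suc.prems(1) by simp
qed

text \<open>The coefficients of \<open>h\<close> below \<open>n\<close> may be stripped off because
  they multiply the coefficients of \<open>f\<close> into \<open>N\<close>; then \<open>h n\<close>
  leads and can be cancelled.\<close>

lemma coeff_in_if_product:
  assumes N: "ideal N R" and f: "\<And>i. f i \<in> carrier R"
  shows "(\<And>i. h i \<in> carrier R) \<Longrightarrow> (\<And>i j. i < n \<Longrightarrow> h i \<otimes> f j \<in> N) \<Longrightarrow>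
    (\<And>a. a \<in> carrier R \<Longrightarrow> h n \<otimes> a \<in> N \<Longrightarrow> a \<in> N) \<Longrightarrow> (\<And>m. conv R m h f \<in> N) \<Longrightarrow> f k \<in> N"
proof (induction n arbitrary: h)
  case 0
  have "conv R m f h \<in> N" for m using 0(4)[of m] conv_comm[of h f m] 0(1) f by simp
  then show ?case using coeff_in_if_leading[of N h f k] N 0(1,3) f by blast
next
  case (Suc n)
  have cN: "conv R m (\<lambda>i. h (Suc i)) f \<in> N" for m
  proof -
    have c: "conv R m (\<lambda>i. h (Suc i)) f \<in> carrier R" using Suc.prems(1) f by (simp add: conv_closed)
    have hf: "h 0 \<otimes> f (Suc m) \<in> N" using Suc.prems(2) by simp
    have "conv R m (\<lambda>i. h (Suc i)) f \<oplus> h 0 \<otimes> f (Suc m) \<in> N"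
      using Suc.prems(4)[of "Suc m"] c icarr[OF N hf] by (simp add: a_comm)
    then show ?thesis using iadd_cancel[OF N _ hf c] by simp
  qed
  show ?case
  proof (rule Suc.IH[of "\<lambda>i. h (Suc i)"])
    show "h (Suc i) \<in> carrier R" for i by (rule Suc.prems(1))
    show "h (Suc i) \<otimes> f j \<in> N" if "i < n" for i j using Suc.prems(2)[of "Suc i"] that by simp
    show "a \<in> N" if "a \<in> carrier R" "h (Suc n) \<otimes> a \<in> N" for a by (rule Suc.prems(3)[OF that])
    show "conv R m (\<lambda>i. h (Suc i)) f \<in> N" for m by (rule cN)
  qed
qed

lemma notin_fps_extE:
  assumes "h \<notin> fps_ext Q" obtains n where "h n \<notin> Q" "\<And>i. i < n \<Longrightarrow> h i \<in> Q"
proof (rule that[of "LEAST n. h n \<notin> Q"])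
  have "\<exists>n. h n \<notin> Q" using assms unfolding fps_ext_def by blast
  then show "h (LEAST n. h n \<notin> Q) \<notin> Q" by (rule LeastI_ex)
  show "\<And>i. i < (LEAST n. h n \<notin> Q) \<Longrightarrow> h i \<in> Q" using not_less_Least by blast
qed

text \<open>The first coefficient of \<open>b\<close> outside \<open>Q\<close> can be cancelled
  modulo \<open>Q\<close>, and those before it vanish there.\<close>

lemma prime_fps_ext: assumes Q: "primeideal Q R" shows "primeideal (fps_ext Q) S"
proof (rule primeidealI[OF ideal_fps_ext[OF prime_ideal[OF Q]] cring_S])
  note IQ = prime_ideal[OF Q]
  have "\<one>\<^bsub>S\<^esub> \<notin> fps_ext Q"
  proof
    assume "\<one>\<^bsub>S\<^esub> \<in> fps_ext Q"
    then have "\<one>\<^bsub>S\<^esub> 0 \<in> Q" unfolding fps_ext_def by blast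
    then show False using prime_one[OF Q] by (simp add: S_one cst_0)
  qed
  then show "carrier S \<noteq> fps_ext Q" by auto
  show "a \<in> fps_ext Q \<or> b \<in> fps_ext Q" if a: "a \<in> carrier S" and b: "b \<in> carrier S" and ab: "a \<otimes>\<^bsub>S\<^esub> b \<in> fps_ext Q" for a b
  proof (rule disjCI)
    assume "b \<notin> fps_ext Q"
    then obtain n where n: "b n \<notin> Q" "\<And>i. i < n \<Longrightarrow> b i \<in> Q" by (rule notin_fps_extE) blast
    have "a k \<in> Q" for k
    proof (rule coeff_in_if_product[OF IQ, of a b n])
      show "b i \<otimes> a j \<in> Q" if "i < n" for i j using imultr[OF IQ n(2)[OF that] S_coeff[OF a]] .
      show "x \<in> Q" if "x \<in> carrier R" "b n \<otimes> x \<in> Q" for x using prime_mult[OF Q S_coeff[OF b] that n(1)] .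
      show "conv R m b a \<in> Q" for m
        using ab S.m_comm[OF a b] unfolding fps_ext_def by (simp flip: S_mult)
    qed (use a b S_coeff in auto)
    then show "a \<in> fps_ext Q" unfolding fps_ext_def by simp
  qed
qed

definition tpow :: "nat \<Rightarrow> nat \<Rightarrow> 'a" where "tpow m = (\<lambda>n. if n = m then \<one> else \<zero>)"

lemma tpow_closed: "tpow m \<in> carrier S" by (simp add: tpow_def S_carrier)

text \<open>The powers of \<open>t\<close> are infinitely many values distinct modulo
  \<open>fps_ext Q\<close>, as needed for \<open>generic_shift\<close>.\<close>

lemma tpow_diff: assumes "primeideal Q R" "m \<noteq> m'" shows "tpow m \<ominus>\<^bsub>S\<^esub> tpow m' \<notin> fps_ext Q"
proof
  assume "tpow m \<ominus>\<^bsub>S\<^esub> tpow m' \<in> fps_ext Q"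
  then have "(tpow m \<ominus>\<^bsub>S\<^esub> tpow m') m \<in> Q" unfolding fps_ext_def by blast
  then have "\<one> \<ominus> \<zero> \<in> Q" using assms(2) S_minus[OF tpow_closed tpow_closed] by (simp add: tpow_def)
  then show False using prime_one[OF assms(1)] by (simp add: a_minus_def)
qed

end

context gor begin

interpretation S: cring S by (rule cring_S)

text \<open>The ideal \<open>C\<close> of the coefficients of \<open>f\<close> satisfies \<open>C \<subseteq> P + mm C\<close>.\<close>

lemma fps_ext_cancel:
  assumes P: "ideal P R" and h: "h \<in> carrier S - fps_ext mm" and f: "f \<in> carrier S" "h \<otimes>\<^bsub>S\<^esub> f \<in> fps_ext P"
  shows "f \<in> fps_ext P"
proof -
  obtain n where n: "h n \<notin> mm" "\<And>i. i < n \<Longrightarrow> h i \<in> mm" using h by (auto elim: notin_fps_extE)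
  define C where "C = Idl (range f)"
  have fr: "range f \<subseteq> carrier R" using S_coeff[OF f(1)] by auto
  have C: "ideal C R" unfolding C_def by (rule genideal_ideal[OF fr])
  obtain xs where xs: "set xs \<subseteq> C" "C = gen R {\<zero>} xs" using fin_gen[OF C] by blast
  have xc: "set xs \<subseteq> carrier R" using xs(1) isub[OF C] by blast
  have "\<exists>s\<in>carrier R - mm. \<forall>y\<in>set xs. s \<otimes> y \<in> P"
  proof (rule nakayama_ideal[OF prime_mm P _ xc])
    fix y N assume y: "y \<in> set xs" and N: "ideal N R" "P \<subseteq> N"
      and qN: "\<And>q z. q \<in> mm \<Longrightarrow> z \<in> set xs \<Longrightarrow> q \<otimes> z \<in> N"
    have mC: "q \<otimes> z \<in> N" if q: "q \<in> mm" and z: "z \<in> C" for q z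
    proof -
      have "C \<subseteq> {f \<in> carrier R. q \<otimes> f \<in> N}"
        unfolding xs(2) using qN[OF q] xc izero[OF N(1)] icarr[OF ideal_mm q]
        by (intro gen_least[OF ideal_preimage_mult[OF N(1) icarr[OF ideal_mm q]]]) auto
      then show ?thesis using z by blast
    qed
    have fC: "f j \<in> C" for j unfolding C_def using genideal_self[OF fr] by blast
    \<comment> \<open>\<open>N\<close> contains \<open>mm C\<close>, so modulo \<open>N\<close> the
      coefficients of \<open>h\<close> before \<open>n\<close> act as zero on those of
      \<open>f\<close>, while \<open>h n\<close> is a unit.\<close>
    have "f k \<in> N" for k
    proof (rule coeff_in_if_product[OF N(1), of f h n])
      show "h i \<otimes> f j \<in> N" if "i < n" for i j using mC[OF n(2)[OF that] fC] .
      show "a \<in> N" if "a \<in> carrier R" "h n \<otimes> a \<in> N" for a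
        using in_ideal_unit[OF N(1) _ that] n(1) S_coeff h by auto
      show "conv R m h f \<in> N" for m using f(2) N(2) unfolding fps_ext_def by (auto simp: S_mult)
    qed (use f h S_coeff in auto)
    then have "C \<subseteq> N" unfolding C_def by (intro genideal_minimal[OF N(1)]) auto
    then have "\<one> \<otimes> y \<in> N" using subsetD[OF xs(1) y] l_one[OF subsetD[OF xc y]] by auto
    then show "\<exists>s\<in>carrier R - mm. s \<otimes> y \<in> N" using prime_one[OF prime_mm] by blast
  qed simp
  then obtain s where s: "s \<in> carrier R - mm" "\<And>y. y \<in> set xs \<Longrightarrow> s \<otimes> y \<in> P" by blast
  have "set xs \<subseteq> P" using in_ideal_unit[OF P s(1) _ s(2)] xc by blast
  then have "C \<subseteq> P" unfolding xs(2) using izero[OF P] by (intro gen_least[OF P]) auto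
  then show ?thesis using genideal_self[OF fr] unfolding C_def fps_ext_def by blast
qed

text \<open>Generators are added one at a time, each outside \<open>N\<close>, outside the ideal
  generated so far and outside the associated primes of all shorter mixtures of members of
  \<open>as\<close> and earlier generators. \<open>J\<close> lies in none of these primes because it
  contains the longer regular sequence \<open>as\<close>.\<close>

lemma general_gens:
  assumes J: "ideal J R" "J \<subseteq> mm" and N: "ideal N R" "\<not> J \<subseteq> N"
    and as: "reg R {\<zero>} as" "set as \<subseteq> J"
  obtains ds where "set ds \<subseteq> J" "J = ci ds" "\<And>d. d \<in> set ds \<Longrightarrow> d \<notin> N"
    "\<And>A B. mset A \<subseteq># mset as \<Longrightarrow> distinct B \<Longrightarrow> set B \<subseteq> set ds \<Longrightarrow> length A + length B \<le> length as \<Longrightarrow> reg R {\<zero>} (A @ B)"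
proof -
  define ok where "ok ds \<longleftrightarrow> set ds \<subseteq> J \<and> (\<forall>d\<in>set ds. d \<notin> N) \<and> (\<forall>A B. mset A \<subseteq># mset as \<longrightarrow> distinct B \<longrightarrow>
    set B \<subseteq> set ds \<longrightarrow> length A + length B \<le> length as \<longrightarrow> reg R {\<zero>} (A @ B))" for ds
  define F where "F = ci ` {ds. ok ds}"
  have asm: "set as \<subseteq> mm" using as(2) J(2) by blast
  have ok0: "ok []" unfolding ok_def using reg_subset[OF zeroideal asm _ as(1)] by auto
  have Fi: "ideal K R" if "K \<in> F" for K
    using that isub[OF J(1)] unfolding F_def ok_def by (auto intro!: ideal_gen[OF zeroideal])
  have "F \<noteq> {}" using ok0 unfolding F_def by blast
  then obtain K where K: "K \<in> F" "\<And>L. L \<in> F \<Longrightarrow> K \<subseteq> L \<Longrightarrow> L = K"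
    using noeth_maximal_ex[of F, OF _ Fi] by auto
  obtain ds where ds: "ok ds" "K = ci ds" using K(1) unfolding F_def by blast
  have dsJ: "set ds \<subseteq> J" and dsN: "\<And>d. d \<in> set ds \<Longrightarrow> d \<notin> N"
    and dsr: "\<And>A B. mset A \<subseteq># mset as \<Longrightarrow> distinct B \<Longrightarrow> set B \<subseteq> set ds \<Longrightarrow> length A + length B \<le> length as \<Longrightarrow> reg R {\<zero>} (A @ B)"
    using ds(1) unfolding ok_def by auto
  have Ki: "ideal K R" by (rule Fi[OF K(1)])
  have KJ: "K \<subseteq> J" unfolding ds(2) by (rule ci_sub[OF J(1) dsJ])
  have "J \<subseteq> K"
  proof (rule ccontr)
    assume JK: "\<not> J \<subseteq> K"
    \<comment> \<open>\<open>G\<close> lists the mixtures that still have room for one more member;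
      there are finitely many.\<close>
    define G where "G = {(A, B). mset A \<subseteq># mset as \<and> distinct B \<and> set B \<subseteq> set ds \<and> length A + length B < length as}"
    let ?L = "{xs. set xs \<subseteq> set as \<union> set ds \<and> length xs \<le> length as}"
    have sub: "set A \<subseteq> set as" if "mset A \<subseteq># mset as" for A using set_mset_mono[OF that] by simp
    have "G \<subseteq> ?L \<times> ?L" unfolding G_def using sub by fastforce
    then have fG: "finite G" by (rule finite_subset) (simp add: finite_lists_length_le)
    define KK where "KK = (\<lambda>(A, B). ci (A @ B)) ` G"
    have GE: "\<exists>A B. k = ci (A @ B) \<and> reg R {\<zero>} (A @ B) \<and> length (A @ B) < length as" if "k \<in> KK" for k
    proof -
      obtain A B where ab: "(A, B) \<in> G" "k = ci (A @ B)" using \<open>k \<in> KK\<close> unfolding KK_def by auto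
      have "reg R {\<zero>} (A @ B)" by (rule dsr) (use ab(1) in \<open>auto simp: G_def\<close>)
      then show ?thesis using ab unfolding G_def by (intro exI[of _ A] exI[of _ B]) auto
    qed
    obtain d where d: "d \<in> J" "\<And>M. M \<in> {K, N} \<Longrightarrow> d \<notin> M" "\<And>k. k \<in> KK \<Longrightarrow> nonzerodivisor R k d"
    proof (rule regular_avoiding[OF J(1), of "{K, N}" KK])
      show "finite KK" unfolding KK_def using fG by simp
      show "ideal M R \<and> \<not> J \<subseteq> M" if "M \<in> {K, N}" for M using that Ki JK N by auto
      show "ideal k R" if "k \<in> KK" for k using GE[OF that] ideal_ci by metis
      show "\<not> J \<subseteq> Q" if k: "k \<in> KK" "Q \<in> associated_primes R k" for k Q
      proof
        assume JQ: "J \<subseteq> Q"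
        obtain A B where ab: "k = ci (A @ B)" "reg R {\<zero>} (A @ B)" "length (A @ B) < length as" using GE[OF k(1)] by blast
        have "length as \<le> length (A @ B)" by (rule reg_length_le[OF ab(2) _ as(1)]) (use k(2)[unfolded ab(1)] as(2) JQ in blast)+
        then show False using ab(3) by simp
      qed
    qed (simp, blast)
    have dc: "d \<in> carrier R" using icarr[OF J(1) d(1)] .
    have "ok (ds @ [d])"
      unfolding ok_def
    proof (intro conjI allI impI)
      show "set (ds @ [d]) \<subseteq> J" using dsJ d(1) by simp
      show "\<forall>x\<in>set (ds @ [d]). x \<notin> N" using dsN d(2) by auto
      fix A B assume AB: "mset A \<subseteq># mset as" "distinct B" "set B \<subseteq> set (ds @ [d])" "length A + length B \<le> length as"
      show "reg R {\<zero>} (A @ B)"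
      proof (cases "d \<in> set B")
        case False
        then show ?thesis using dsr[OF AB(1,2)] AB(3,4) by auto
      next
        case True
        then obtain us vs where B: "B = us @ d # vs" using split_list by metis
        have g: "(A, us @ vs) \<in> G" using AB B unfolding G_def by auto
        have r: "reg R {\<zero>} (A @ us @ vs)" by (rule dsr) (use g in \<open>auto simp: G_def\<close>)
        have "ci (A @ us @ vs) \<in> KK" unfolding KK_def using g by force
        then have "reg R {\<zero>} ((A @ us @ vs) @ [d])"
          using r d(3)[of "ci (A @ us @ vs)"] dc unfolding reg_append[of R "{\<zero>}" "A @ us @ vs"] by simp
        then show ?thesis
        proof (rule reg_perm[OF zeroideal, rotated 2])
          have "set B \<subseteq> mm" using AB(3) dsJ d(1) J(2) by auto
          then show "set ((A @ us @ vs) @ [d]) \<subseteq> mm" using sub[OF AB(1)] asm unfolding B by auto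
          show "mset ((A @ us @ vs) @ [d]) = mset (A @ B)" unfolding B by simp
        qed
      qed
    qed
    then have "ci (ds @ [d]) \<in> F" unfolding F_def by blast
    moreover have "K \<subseteq> ci (ds @ [d])" "d \<in> ci (ds @ [d])"
      using adjoin_sub[OF Ki dc] adjoin_mem[OF Ki dc] unfolding ds(2) by auto
    ultimately show False using K(2)[of "ci (ds @ [d])"] d(2)[of K] by auto
  qed
  then show ?thesis using that[OF dsJ _ dsN dsr] KJ ds(2) by auto
qed

section \<open>Links of extended ideals\<close>

lemma gS_perm: "set as \<subseteq> carrier S \<Longrightarrow> set as = set bs \<Longrightarrow> gS as = gS bs"
  using S.gen_cong[OF S.zeroideal] by blast

lemma gS_snoc: "gS (as @ [a]) = adjoin S (gS as) a" by simp

text \<open>One lifted slot \<open>a\<close> of a regular sequence is compared with the constant slots \<open>cst d\<close>: if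
  \<open>v * d = k + s * a\<close>, then \<open>s\<close> lies in the colon ideal of the sequence with \<open>a\<close> replaced by \<open>d\<close>.\<close>

lemma replace_slot:
  assumes J: "ideal J R" "J \<subseteq> mm" "J = ci ds" "set ds \<subseteq> J"
    and a: "a \<in> fps_ext J" and A: "set A \<subseteq> fps_ext J" and bs: "set bs \<subseteq> set ds"
    and r: "reg R {\<zero>} (map at0 (A @ [a]) @ bs)"
    and IH: "\<And>d u. d \<in> set ds \<Longrightarrow> d \<notin> set bs \<Longrightarrow> u \<in> ideal_colon S (gS (A @ map (cst R) (bs @ [d]))) (fps_ext J) \<Longrightarrow> u \<in> fps_ext J"
    and v: "v \<in> ideal_colon S (gS (A @ map (cst R) bs @ [a])) (fps_ext J)" and f: "f \<in> fps_ext J"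
  obtains k s where "k \<in> gS (A @ map (cst R) bs)" "s \<in> fps_ext J" "v \<otimes>\<^bsub>S\<^esub> f = k \<oplus>\<^bsub>S\<^esub> s \<otimes>\<^bsub>S\<^esub> a"
proof -
  note iJ = ideal_fps_ext[OF J(1)] and jc = S.icarr[OF ideal_fps_ext[OF J(1)]]
  let ?L = "A @ map (cst R) bs"
  let ?K = "gS ?L"
  have dJ: "cst R d \<in> fps_ext J" if "d \<in> set ds" for d using cst_fps_ext[OF J(1)] J(4) that by blast
  have LJ: "set ?L \<subseteq> fps_ext J" using A bs dJ by auto
  have Lc: "set ?L \<subseteq> carrier S" using LJ S.isub[OF iJ] by blast
  note K = ideal_gS[OF Lc] and ac = jc[OF a]
  have r': "reg R {\<zero>} (map at0 (?L @ [a]))"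
  proof (rule reg_perm[OF zeroideal _ _ r])
    have at: "f 0 \<in> mm" if "f \<in> fps_ext J" for f using that J(2) unfolding fps_ext_def by auto
    have "set bs \<subseteq> mm" using bs J(2,4) by blast
    then show "set (map at0 (A @ [a]) @ bs) \<subseteq> mm" using A a at by auto
    show "mset (map at0 (A @ [a]) @ bs) = mset (map at0 (?L @ [a]))"
      by (simp add: comp_def cst_0)
  qed
  have nz: "nonzerodivisor S ?K a"
  proof -
    have "reg S {\<zero>\<^bsub>S\<^esub>} (?L @ [a])" by (rule reg_lift[OF _ r']) (use Lc ac in auto)
    then show ?thesis unfolding reg_append[of S _ ?L] by simp
  qed
  have vc: "v \<in> carrier S" using v unfolding ideal_colon_def by simp
  have vf: "\<exists>k s. k \<in> ?K \<and> s \<in> carrier S \<and> v \<otimes>\<^bsub>S\<^esub> f = k \<oplus>\<^bsub>S\<^esub> s \<otimes>\<^bsub>S\<^esub> a" if f: "f \<in> fps_ext J" for f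
  proof -
    have "v \<otimes>\<^bsub>S\<^esub> f \<in> gS (?L @ [a])" using S.ideal_colonD[OF v f] by simp
    then have "v \<otimes>\<^bsub>S\<^esub> f \<in> adjoin S ?K a" unfolding gS_snoc .
    then show ?thesis by (rule S.adjoinE) blast
  qed
  let ?D = "{n \<oplus>\<^bsub>S\<^esub> s \<otimes>\<^bsub>S\<^esub> a |n s. n \<in> ?K \<and> s \<in> fps_ext J}"
  have D: "ideal ?D S" by (rule S.ideal_add_mult[OF K iJ ac])
  \<comment> \<open>Coefficients in \<open>J[[t]]\<close> at \<open>a\<close> have to be found for
    the constant generators only, as these generate \<open>J[[t]]\<close>.\<close>
  have vd: "v \<otimes>\<^bsub>S\<^esub> cst R d \<in> ?D" if d: "d \<in> set ds" for d
  proof (cases "d \<in> set bs")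
    case True
    then have "cst R d \<in> ?K" using S.gen_mem[OF S.zeroideal Lc] by auto
    then have vk: "v \<otimes>\<^bsub>S\<^esub> cst R d \<in> ?K" using S.imult[OF K _ vc] by blast
    then have "v \<otimes>\<^bsub>S\<^esub> cst R d = v \<otimes>\<^bsub>S\<^esub> cst R d \<oplus>\<^bsub>S\<^esub> \<zero>\<^bsub>S\<^esub> \<otimes>\<^bsub>S\<^esub> a" using S.icarr[OF K vk] ac by simp
    then show ?thesis using vk S.izero[OF iJ] by blast
  next
    case False
    note dc = jc[OF dJ[OF d]]
    obtain k s where k: "k \<in> ?K" "s \<in> carrier S" "v \<otimes>\<^bsub>S\<^esub> cst R d = k \<oplus>\<^bsub>S\<^esub> s \<otimes>\<^bsub>S\<^esub> a" using vf[OF dJ[OF d]] by blast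
    \<comment> \<open>Comparing \<open>(v d) f\<close> with \<open>(v f) d\<close> and cancelling
      \<open>a\<close> shows that \<open>s f\<close> is congruent to \<open>s' d\<close> modulo
      \<open>?K\<close>.\<close>
    have "s \<in> ideal_colon S (gS (A @ map (cst R) (bs @ [d]))) (fps_ext J)"
    proof (rule S.ideal_colonI[OF k(2)])
      fix f assume f: "f \<in> fps_ext J"
      obtain k' s' where k': "k' \<in> ?K" "s' \<in> carrier S" "v \<otimes>\<^bsub>S\<^esub> f = k' \<oplus>\<^bsub>S\<^esub> s' \<otimes>\<^bsub>S\<^esub> a" using vf[OF f] by blast
      note c = S.icarr[OF K k(1)] S.icarr[OF K k'(1)] k(2) k'(2) jc[OF f] dc ac vc
      have "(s \<otimes>\<^bsub>S\<^esub> f \<ominus>\<^bsub>S\<^esub> s' \<otimes>\<^bsub>S\<^esub> cst R d) \<otimes>\<^bsub>S\<^esub> a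
          = ((k \<oplus>\<^bsub>S\<^esub> s \<otimes>\<^bsub>S\<^esub> a) \<otimes>\<^bsub>S\<^esub> f \<ominus>\<^bsub>S\<^esub> (k' \<oplus>\<^bsub>S\<^esub> s' \<otimes>\<^bsub>S\<^esub> a) \<otimes>\<^bsub>S\<^esub> cst R d) \<oplus>\<^bsub>S\<^esub> (cst R d \<otimes>\<^bsub>S\<^esub> k' \<ominus>\<^bsub>S\<^esub> f \<otimes>\<^bsub>S\<^esub> k)"
        using c by algebra
      also have "(k \<oplus>\<^bsub>S\<^esub> s \<otimes>\<^bsub>S\<^esub> a) \<otimes>\<^bsub>S\<^esub> f \<ominus>\<^bsub>S\<^esub> (k' \<oplus>\<^bsub>S\<^esub> s' \<otimes>\<^bsub>S\<^esub> a) \<otimes>\<^bsub>S\<^esub> cst R d = \<zero>\<^bsub>S\<^esub>"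
      proof -
        have "(v \<otimes>\<^bsub>S\<^esub> cst R d) \<otimes>\<^bsub>S\<^esub> f \<ominus>\<^bsub>S\<^esub> (v \<otimes>\<^bsub>S\<^esub> f) \<otimes>\<^bsub>S\<^esub> cst R d = \<zero>\<^bsub>S\<^esub>" using c by algebra
        then show ?thesis unfolding k(3) k'(3) .
      qed
      also have "\<zero>\<^bsub>S\<^esub> \<oplus>\<^bsub>S\<^esub> (cst R d \<otimes>\<^bsub>S\<^esub> k' \<ominus>\<^bsub>S\<^esub> f \<otimes>\<^bsub>S\<^esub> k) \<in> ?K"
        using S.iminus[OF K S.imult[OF K k'(1) dc] S.imult[OF K k(1) jc[OF f]]] c by simp
      finally have sK: "s \<otimes>\<^bsub>S\<^esub> f \<ominus>\<^bsub>S\<^esub> s' \<otimes>\<^bsub>S\<^esub> cst R d \<in> ?K"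
        using S.nonzerodivisorD[OF nz] c by simp
      have "s \<otimes>\<^bsub>S\<^esub> f = (s \<otimes>\<^bsub>S\<^esub> f \<ominus>\<^bsub>S\<^esub> s' \<otimes>\<^bsub>S\<^esub> cst R d) \<oplus>\<^bsub>S\<^esub> s' \<otimes>\<^bsub>S\<^esub> cst R d" using c by algebra
      then have "s \<otimes>\<^bsub>S\<^esub> f \<in> adjoin S ?K (cst R d)" using S.adjoinI[OF sK k'(2)] by metis
      then show "s \<otimes>\<^bsub>S\<^esub> f \<in> gS (A @ map (cst R) (bs @ [d]))" by simp
    qed
    then have "s \<in> fps_ext J" using IH[OF d False] by blast
    then show ?thesis using k by blast
  qed
  have "fps_ext J = gS (map (cst R) ds)" using fps_ext_gen[OF J(3)] J(4) isub[OF J(1)] by blast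
  moreover have "gS (map (cst R) ds) \<subseteq> {f \<in> carrier S. v \<otimes>\<^bsub>S\<^esub> f \<in> ?D}"
  proof (rule S.gen_least[OF S.ideal_preimage_mult[OF D vc]])
    show "{\<zero>\<^bsub>S\<^esub>} \<subseteq> {f \<in> carrier S. v \<otimes>\<^bsub>S\<^esub> f \<in> ?D}" using S.izero[OF S.ideal_preimage_mult[OF D vc]] by blast
    show "set (map (cst R) ds) \<subseteq> {f \<in> carrier S. v \<otimes>\<^bsub>S\<^esub> f \<in> ?D}" using vd jc[OF dJ] by auto
  qed
  ultimately show ?thesis using f that by blast
qed

text \<open>Induction on the number of lifted slots, which are exchanged for constants by
  \<open>replace_slot\<close>. With constants only, the colon ideal is computed coefficientwise over
  \<open>R\<close>.\<close>

lemma colon_in_fps_ext: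
  assumes J: "ideal J R" "J \<subseteq> mm" "J = ci ds" "set ds \<subseteq> J" and as: "set as \<subseteq> fps_ext J"
    and gen: "\<And>A bs. mset A \<subseteq># mset (map at0 as) \<Longrightarrow> distinct bs \<Longrightarrow> set bs \<subseteq> set ds \<Longrightarrow> length A + length bs \<le> h \<Longrightarrow> reg R {\<zero>} (A @ bs)"
    and base: "\<And>bs. distinct bs \<Longrightarrow> set bs \<subseteq> set ds \<Longrightarrow> length bs = h \<Longrightarrow> reg R {\<zero>} bs \<Longrightarrow> ideal_colon R (ci bs) J \<subseteq> J"
  shows "mset A \<subseteq># mset as \<Longrightarrow> distinct bs \<Longrightarrow> set bs \<subseteq> set ds \<Longrightarrow> length A + length bs = h \<Longrightarrow>
    v \<in> ideal_colon S (gS (A @ map (cst R) bs)) (fps_ext J) \<Longrightarrow> v \<in> fps_ext J"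
proof (induction A arbitrary: bs v rule: rev_induct)
  case Nil
  have bsc: "set bs \<subseteq> carrier R" using Nil.prems(3) J(4) isub[OF J(1)] by blast
  have r: "reg R {\<zero>} bs" using gen[of "[]" bs] Nil.prems by simp
  have g: "gS (map (cst R) bs) = fps_ext (ci bs)" using fps_ext_gen[OF refl bsc] by simp
  have vc: "v \<in> carrier S" using Nil.prems(5) unfolding ideal_colon_def by simp
  have "v n \<in> ideal_colon R (ci bs) J" for n
  proof (rule ideal_colonI[OF S_coeff[OF vc]])
    fix j assume j: "j \<in> J"
    have "v \<otimes>\<^bsub>S\<^esub> cst R j \<in> gS (map (cst R) bs)" using S.ideal_colonD[OF Nil.prems(5) cst_fps_ext[OF J(1) j]] by simp
    then have "(v \<otimes>\<^bsub>S\<^esub> cst R j) n \<in> ci bs" unfolding g fps_ext_def by blast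
    moreover have jc: "j \<in> carrier R" using icarr[OF J(1) j] .
    ultimately show "v n \<otimes> j \<in> ci bs"
      using cst_mult[OF jc vc] S_coeff[OF vc, of n] S.m_comm[OF vc cst_closed[OF jc]] by (simp add: m_comm)
  qed
  then show ?case using base[OF Nil.prems(2,3) _ r] Nil.prems(4) unfolding fps_ext_def by auto
next
  case (snoc a A)
  have aA: "set (A @ [a]) \<subseteq> fps_ext J" using set_mset_mono[OF snoc.prems(1)] as by auto
  then have a: "a \<in> fps_ext J" and A: "set A \<subseteq> fps_ext J" by auto
  have A': "mset A \<subseteq># mset as" using snoc.prems(1) by (auto intro: subset_mset.order_trans[rotated])
  note iJ = ideal_fps_ext[OF J(1)] and jc = S.icarr[OF ideal_fps_ext[OF J(1)]]
  let ?L = "A @ map (cst R) bs"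
  have Lc: "set ?L \<subseteq> fps_ext J" using A snoc.prems(3) cst_fps_ext[OF J(1)] J(4) by auto
  have "gS ((A @ [a]) @ map (cst R) bs) = gS (A @ map (cst R) bs @ [a])"
    by (rule gS_perm) (use Lc a S.isub[OF iJ] in auto)
  then have v: "v \<in> ideal_colon S (gS (A @ map (cst R) bs @ [a])) (fps_ext J)" using snoc.prems(5) by simp
  have r: "reg R {\<zero>} (map at0 (A @ [a]) @ bs)"
    using gen[OF image_mset_subseteq_mono[OF snoc.prems(1), of at0, folded mset_map] snoc.prems(2,3)] snoc.prems(4) by simp
  \<comment> \<open>\<open>replace_slot\<close> is applied to \<open>a\<close> itself: then
    \<open>v - s\<close> sends \<open>a\<close> into the ideal of the other slots and so lies in
    that ideal.\<close>
  obtain k s where k: "k \<in> gS ?L" "s \<in> fps_ext J" "v \<otimes>\<^bsub>S\<^esub> a = k \<oplus>\<^bsub>S\<^esub> s \<otimes>\<^bsub>S\<^esub> a"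
  proof (rule replace_slot[OF J a A snoc.prems(3) r _ v a])
    show "u \<in> fps_ext J" if "d \<in> set ds" "d \<notin> set bs" "u \<in> ideal_colon S (gS (A @ map (cst R) (bs @ [d]))) (fps_ext J)" for d u
      by (rule snoc.IH[OF A' _ _ _ that(3)]) (use snoc.prems that in auto)
  qed blast
  have Lcc: "set ?L \<subseteq> carrier S" using Lc S.isub[OF iJ] by blast
  note K = ideal_gS[OF Lcc]
  have KJ: "gS ?L \<subseteq> fps_ext J" using S.gen_least[OF iJ _ Lc] S.izero[OF iJ] by auto
  have vc: "v \<in> carrier S" using v unfolding ideal_colon_def by simp
  have nz: "nonzerodivisor S (gS ?L) a"
  proof -
    have "reg R {\<zero>} (map at0 (?L @ [a]))"
    proof (rule reg_perm[OF zeroideal _ _ r])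
      have at: "f 0 \<in> mm" if "f \<in> fps_ext J" for f using that J(2) unfolding fps_ext_def by auto
      have "set bs \<subseteq> mm" using snoc.prems(3) J(2,4) by blast
      then show "set (map at0 (A @ [a]) @ bs) \<subseteq> mm" using A a at by auto
      show "mset (map at0 (A @ [a]) @ bs) = mset (map at0 (?L @ [a]))"
        by (simp add: comp_def cst_0)
    qed
    then have "reg S {\<zero>\<^bsub>S\<^esub>} (?L @ [a])" by (rule reg_lift[rotated]) (use Lcc jc[OF a] in auto)
    then show ?thesis unfolding reg_append[of S _ ?L] by simp
  qed
  have "(v \<ominus>\<^bsub>S\<^esub> s) \<otimes>\<^bsub>S\<^esub> a = v \<otimes>\<^bsub>S\<^esub> a \<ominus>\<^bsub>S\<^esub> s \<otimes>\<^bsub>S\<^esub> a" using vc jc[OF k(2)] jc[OF a] by algebra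
  also have "\<dots> = k" unfolding k(3) using S.icarr[OF K k(1)] jc[OF k(2)] jc[OF a] by algebra
  finally have "v \<ominus>\<^bsub>S\<^esub> s \<in> gS ?L" using S.nonzerodivisorD[OF nz] k(1) vc jc[OF k(2)] by simp
  then have "v \<ominus>\<^bsub>S\<^esub> s \<in> fps_ext J" using KJ by blast
  then show ?case using S.iminus_cancel[OF iJ _ k(2) vc] by blast
qed

text \<open>Every link of \<open>J[[t]]\<close> by a lifted regular sequence \<open>a\<close> lies in \<open>J[[t]]\<close> and multiplies \<open>J[[t]]\<close>
  into the product \<open>a J[[t]]\<close>, not only into \<open>(a)\<close>; the product is encoded by the ideals \<open>D\<close>
  containing it.\<close>

definition tight :: "'a set \<Rightarrow> nat \<Rightarrow> bool" where
  "tight J h \<longleftrightarrow> cm_ideal J h \<and> (\<forall>as v. set as \<subseteq> fps_ext J \<longrightarrow> reg R {\<zero>} (map at0 as) \<longrightarrow> length as = h \<longrightarrow>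
     v \<in> ideal_colon S (gS as) (fps_ext J) \<longrightarrow> v \<in> fps_ext J \<and>
     (\<forall>f D. f \<in> fps_ext J \<longrightarrow> ideal D S \<longrightarrow> (\<forall>c\<in>fps_ext J. \<forall>a\<in>set as. c \<otimes>\<^bsub>S\<^esub> a \<in> D) \<longrightarrow> v \<otimes>\<^bsub>S\<^esub> f \<in> D))"

text \<open>The general generators avoid \<open>nonunit_part\<close>, so every sequence made of them
  ends in a member with unit coefficient at \<open>x\<close>; its link is reduced to a link of
  \<open>I\<close>, which \<open>T\<close> controls.\<close>

lemma tight_adjoin:
  assumes I: "cm_ideal I g" and x: "x \<in> mm" "nonzerodivisor R I x" and J: "cm_ideal (adjoin R I x) (Suc g)"
    and T: "\<And>ys. reg R {\<zero>} ys \<Longrightarrow> set ys \<subseteq> I \<Longrightarrow> length ys = g \<Longrightarrow> ideal_colon R (ci ys) I \<subseteq> I"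
  shows "tight (adjoin R I x) (Suc g)"
  unfolding tight_def
proof (intro conjI allI impI)
  let ?J = "adjoin R I x"
  note iI = cm_idealD(1)[OF I] and J1 = cm_idealD(1,2)[OF J]
  note iJ = ideal_fps_ext[OF J1(1)] and jc = S.icarr[OF ideal_fps_ext[OF J1(1)]]
  have xc: "x \<in> carrier R" using icarr[OF ideal_mm x(1)] .
  show "cm_ideal ?J (Suc g)" by (rule J)
  fix as v assume as: "set as \<subseteq> fps_ext ?J" and r: "reg R {\<zero>} (map at0 as)" and len: "length as = Suc g"
    and v: "v \<in> ideal_colon S (gS as) (fps_ext ?J)"
  \<comment> \<open>Otherwise \<open>(1 - q) x\<close> is in \<open>I\<close> for some
    \<open>q\<close> in the maximal ideal; as \<open>x\<close> is regular modulo \<open>I\<close>,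
    the unit \<open>1 - q\<close> would be in \<open>I\<close>.\<close>
  have xN: "\<not> ?J \<subseteq> nonunit_part I x"
  proof
    assume "?J \<subseteq> nonunit_part I x"
    then have "x \<in> nonunit_part I x" using adjoin_mem[OF iI xc] by blast
    then obtain n q where n: "n \<in> I" "q \<in> mm" "x = n \<oplus> q \<otimes> x" unfolding nonunit_part_def by blast
    have qc: "q \<in> carrier R" using icarr[OF ideal_mm n(2)] .
    have nc: "n \<in> carrier R" using icarr[OF iI n(1)] .
    have "(\<one> \<ominus> q) \<otimes> x = x \<ominus> q \<otimes> x" using qc xc by algebra
    also have "\<dots> = n"
    proof -
      have "n \<oplus> q \<otimes> x \<ominus> q \<otimes> x = n" using nc qc xc by algebra
      then show ?thesis using n(3) by simp
    qed
    finally have "\<one> \<ominus> q \<in> I" using nonzerodivisorD[OF x(2)] n(1) qc by simp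
    then have "\<one> \<ominus> q \<in> mm" using cm_idealD(2)[OF I] by blast
    then have "\<one> \<in> mm" using iminus_cancel[OF ideal_mm _ n(2)] by simp
    then show False using prime_one[OF prime_mm] by simp
  qed
  have at: "f 0 \<in> ?J" if "f \<in> fps_ext ?J" for f using that unfolding fps_ext_def by auto
  obtain ds where ds: "set ds \<subseteq> ?J" "?J = ci ds" "\<And>d. d \<in> set ds \<Longrightarrow> d \<notin> nonunit_part I x"
    "\<And>A bs. mset A \<subseteq># mset (map at0 as) \<Longrightarrow> distinct bs \<Longrightarrow> set bs \<subseteq> set ds \<Longrightarrow> length A + length bs \<le> length (map at0 as) \<Longrightarrow> reg R {\<zero>} (A @ bs)"
  proof (rule general_gens[OF J1 ideal_nonunit_part[OF iI xc] xN r])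
    show "set (map at0 as) \<subseteq> ?J" using as at by auto
  qed blast
  have gen: "reg R {\<zero>} (A @ bs)" if "mset A \<subseteq># mset (map at0 as)" "distinct bs" "set bs \<subseteq> set ds" "length A + length bs \<le> Suc g" for A bs
    by (rule ds(4)[OF that(1-3)]) (use that(4) len in simp)
  have base: "ideal_colon R (ci bs) ?J \<subseteq> ?J" if bs: "distinct bs" "set bs \<subseteq> set ds" "length bs = Suc g" "reg R {\<zero>} bs" for bs
  proof -
    obtain cs e where ce: "bs = cs @ [e]" using bs(3) by (cases bs rule: rev_cases) auto
    show ?thesis unfolding ce
      by (rule link_of_unit_part[OF I x(1) T]) (use bs ds(1,3) ce in auto)
  qed
  have colon: "u \<in> fps_ext ?J" if l: "mset A \<subseteq># mset as" "distinct bs" "set bs \<subseteq> set ds" "length A + length bs = Suc g"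
      and u: "u \<in> ideal_colon S (gS (A @ map (cst R) bs)) (fps_ext ?J)" for A bs u
  proof (rule colon_in_fps_ext[OF J1 ds(2,1) as _ _ l u])
    show "reg R {\<zero>} (A @ bs)" if "mset A \<subseteq># mset (map at0 as)" "distinct bs" "set bs \<subseteq> set ds" "length A + length bs \<le> Suc g" for A bs
      by (rule gen[OF that])
    show "ideal_colon R (ci bs) ?J \<subseteq> ?J" if "distinct bs" "set bs \<subseteq> set ds" "length bs = Suc g" "reg R {\<zero>} bs" for bs
      by (rule base[OF that])
  qed
  show vJ: "v \<in> fps_ext ?J" by (rule colon[of as "[]"]) (use len v in auto)
  fix f D assume f: "f \<in> fps_ext ?J" and D: "ideal D S" and cD: "\<forall>c\<in>fps_ext ?J. \<forall>a\<in>set as. c \<otimes>\<^bsub>S\<^esub> a \<in> D"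
  have asc: "set as \<subseteq> carrier S" using as S.isub[OF iJ] by blast
  have vc: "v \<in> carrier S" and fc: "f \<in> carrier S" using jc[OF vJ] jc[OF f] by auto
  define w where "w = v \<otimes>\<^bsub>S\<^esub> f"
  have wc: "w \<in> carrier S" unfolding w_def using vc fc by simp
  \<comment> \<open>\<open>v f\<close> is rewritten slot by slot from the end: \<open>us\<close> are
    the slots still with arbitrary coefficients, \<open>vs\<close> those whose contribution is
    already known to lie in \<open>D\<close>.\<close>
  have "\<exists>u p. u \<in> gS us \<and> p \<in> D \<inter> gS vs \<and> w = u \<oplus>\<^bsub>S\<^esub> p" if "as = us @ vs" for us vs
    using that
  proof (induction vs arbitrary: us)
    case Nil
    have "w \<in> gS us" unfolding w_def using S.ideal_colonD[OF v f] Nil by simp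
    then show ?case using S.izero[OF D] wc by (intro exI[of _ w] exI[of _ "\<zero>\<^bsub>S\<^esub>"]) auto
  next
    case (Cons a vs)
    have "as = (us @ [a]) @ vs" using Cons.prems by simp
    then obtain u p where u: "u \<in> gS (us @ [a])" "p \<in> D \<inter> gS vs" "w = u \<oplus>\<^bsub>S\<^esub> p" using Cons.IH by blast
    have a: "a \<in> fps_ext ?J" and usc: "set us \<subseteq> fps_ext ?J" and vsc: "set vs \<subseteq> fps_ext ?J"
      using as Cons.prems by auto
    have uscc: "set us \<subseteq> carrier S" and vscc: "set vs \<subseteq> carrier S" and ac: "a \<in> carrier S"
      using asc Cons.prems by auto
    have "u \<in> adjoin S (gS us) a" using u(1) by simp
    then obtain u' s where u': "u' \<in> gS us" "s \<in> carrier S" "u = u' \<oplus>\<^bsub>S\<^esub> s \<otimes>\<^bsub>S\<^esub> a" by (rule S.adjoinE)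
    let ?L = "us @ vs"
    have LJ: "set ?L \<subseteq> fps_ext ?J" using usc vsc by simp
    have Lc: "set ?L \<subseteq> carrier S" using uscc vscc by simp
    note K = ideal_gS[OF Lc]
    have KJ: "gS ?L \<subseteq> fps_ext ?J" using S.gen_least[OF iJ _ LJ] S.izero[OF iJ] by auto
    have g: "gS as = gS (?L @ map (cst R) [] @ [a])" unfolding Cons.prems
      by (rule gS_perm) (use Lc ac in auto)
    have ms: "mset (?L @ [a]) = mset as" using Cons.prems by simp
    have r1: "reg R {\<zero>} (map at0 (?L @ [a]))"
    proof (rule reg_perm[OF zeroideal _ _ r])
      show "set (map at0 as) \<subseteq> mm" using as at J1(2) by auto
      show "mset (map at0 as) = mset (map at0 (?L @ [a]))" unfolding mset_map ms ..
    qed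
    have L': "mset ?L \<subseteq># mset as" unfolding Cons.prems by simp
    \<comment> \<open>A second expression of \<open>v f\<close>, with coefficient in
      \<open>J[[t]]\<close> at \<open>a\<close>. The coefficients at \<open>a\<close> in the two
      expressions differ by an element of the ideal of the other slots, so the first one is in
      \<open>J[[t]]\<close> too.\<close>
    obtain k c where k: "k \<in> gS (?L @ map (cst R) [])" "c \<in> fps_ext ?J" "v \<otimes>\<^bsub>S\<^esub> f = k \<oplus>\<^bsub>S\<^esub> c \<otimes>\<^bsub>S\<^esub> a"
    proof (rule replace_slot[OF J1 ds(2,1) a LJ, of "[]" v f])
      show "reg R {\<zero>} (map at0 (?L @ [a]) @ [])" using r1 by simp
      show "u \<in> fps_ext ?J" if d: "d \<in> set ds" and u: "u \<in> ideal_colon S (gS (?L @ map (cst R) ([] @ [d]))) (fps_ext ?J)" for d u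
        by (rule colon[OF L' _ _ _ u]) (use d len Cons.prems in auto)
      show "v \<in> ideal_colon S (gS (?L @ map (cst R) [] @ [a])) (fps_ext ?J)" using v unfolding g .
      show "f \<in> fps_ext ?J" by (rule f)
    qed auto
    have kK: "k \<in> gS ?L" using k(1) by simp
    have nz: "nonzerodivisor S (gS ?L) a"
    proof -
      have "reg S {\<zero>\<^bsub>S\<^esub>} (?L @ [a])" by (rule reg_lift[OF _ r1]) (use Lc ac in auto)
      then show ?thesis unfolding reg_append[of S _ ?L] by simp
    qed
    have uK: "gS us \<subseteq> gS ?L" "gS vs \<subseteq> gS ?L"
      by (rule S.gen_least[OF K]; use S.izero[OF K] S.gen_mem[OF S.zeroideal Lc] in auto)+
    have u'K: "u' \<in> gS ?L" and pK: "p \<in> gS ?L" using uK u'(1) u(2) by auto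
    note cc = S.icarr[OF K kK] S.icarr[OF K u'K] S.icarr[OF K pK] u'(2) jc[OF k(2)] ac
    have w1: "w = k \<oplus>\<^bsub>S\<^esub> c \<otimes>\<^bsub>S\<^esub> a" unfolding w_def by (rule k(3))
    have w2: "w = u' \<oplus>\<^bsub>S\<^esub> s \<otimes>\<^bsub>S\<^esub> a \<oplus>\<^bsub>S\<^esub> p" using u(3) u'(3) by simp
    have "(s \<ominus>\<^bsub>S\<^esub> c) \<otimes>\<^bsub>S\<^esub> a = ((u' \<oplus>\<^bsub>S\<^esub> s \<otimes>\<^bsub>S\<^esub> a \<oplus>\<^bsub>S\<^esub> p) \<ominus>\<^bsub>S\<^esub> (k \<oplus>\<^bsub>S\<^esub> c \<otimes>\<^bsub>S\<^esub> a)) \<oplus>\<^bsub>S\<^esub> (k \<ominus>\<^bsub>S\<^esub> u' \<ominus>\<^bsub>S\<^esub> p)"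
      using cc by algebra
    also have "(u' \<oplus>\<^bsub>S\<^esub> s \<otimes>\<^bsub>S\<^esub> a \<oplus>\<^bsub>S\<^esub> p) \<ominus>\<^bsub>S\<^esub> (k \<oplus>\<^bsub>S\<^esub> c \<otimes>\<^bsub>S\<^esub> a) = w \<ominus>\<^bsub>S\<^esub> w" using w1 w2 by simp
    also have "w \<ominus>\<^bsub>S\<^esub> w \<oplus>\<^bsub>S\<^esub> (k \<ominus>\<^bsub>S\<^esub> u' \<ominus>\<^bsub>S\<^esub> p) = k \<ominus>\<^bsub>S\<^esub> u' \<ominus>\<^bsub>S\<^esub> p" using wc cc by algebra
    finally have "s \<ominus>\<^bsub>S\<^esub> c \<in> gS ?L"
      using S.nonzerodivisorD[OF nz] S.iminus[OF K S.iminus[OF K kK u'K] pK] cc by simp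
    then have "s \<ominus>\<^bsub>S\<^esub> c \<in> fps_ext ?J" using KJ by blast
    then have sJ: "s \<in> fps_ext ?J" using S.iminus_cancel[OF iJ _ k(2) u'(2)] by blast
    have "a \<in> set as" using Cons.prems by simp
    then have saD: "s \<otimes>\<^bsub>S\<^esub> a \<in> D" using cD sJ by blast
    have avc: "set (a # vs) \<subseteq> carrier S" using vscc ac by simp
    note V = ideal_gS[OF avc]
    have "gS vs \<subseteq> gS (a # vs)" by (rule S.gen_least[OF V]; use S.izero[OF V] S.gen_mem[OF S.zeroideal avc] in auto)
    then have "p \<in> gS (a # vs)" using u(2) by blast
    moreover have "a \<in> gS (a # vs)" using S.gen_mem[OF S.zeroideal avc] by auto
    ultimately have "s \<otimes>\<^bsub>S\<^esub> a \<oplus>\<^bsub>S\<^esub> p \<in> D \<inter> gS (a # vs)"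
      using S.iadd[OF V S.imult[OF V _ u'(2)]] S.iadd[OF D saD] u(2) by blast
    moreover have "w = u' \<oplus>\<^bsub>S\<^esub> (s \<otimes>\<^bsub>S\<^esub> a \<oplus>\<^bsub>S\<^esub> p)" unfolding w2 using cc by algebra
    ultimately show ?case using u'(1) by blast
  qed
  from this[of "[]" as] obtain u p where "u = \<zero>\<^bsub>S\<^esub>" "p \<in> D" "w = u \<oplus>\<^bsub>S\<^esub> p" by auto
  then show "v \<otimes>\<^bsub>S\<^esub> f \<in> D" using S.icarr[OF D] unfolding w_def by simp
qed

text \<open>By flatness the constant term of \<open>u\<close> lies in the double colon over
  \<open>R\<close>, which is \<open>J\<close>. Subtracting it and dividing by \<open>t\<close> stays
  in the double colon, so all coefficients follow.\<close>

lemma double_colon_fps_ext: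
  assumes J: "cm_ideal J (length as)" and as: "set as \<subseteq> fps_ext J" and r: "reg R {\<zero>} (map at0 as)"
  shows "ideal_colon S (gS as) (ideal_colon S (gS as) (fps_ext J)) \<subseteq> fps_ext J"
proof
  note J1 = cm_idealD[OF J] and iJ = ideal_fps_ext[OF cm_idealD(1)[OF J]]
  let ?L = "ideal_colon S (gS as) (fps_ext J)"
  let ?LL = "ideal_colon S (gS as) ?L"
  let ?A = "ci (map at0 as)"
  have asc: "set as \<subseteq> carrier S" using as S.isub[OF iJ] by blast
  note G = ideal_gS[OF asc]
  have A: "ideal ?A R" by (rule ideal_ci_carrier[OF at0_carrier[OF asc]])
  have at0J: "set (map at0 as) \<subseteq> J" using as unfolding fps_ext_def by auto
  have fl: "flat_lift ?L (ideal_colon R ?A J)"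
    by (rule lift_colon[OF flat_lift_fps_ext[OF J1(1)] J1(1) as r J1(3)])
  then have iL: "ideal ?L S" and im: "at0 ` ?L = ideal_colon R ?A J" unfolding flat_lift_def by auto
  have iLL: "ideal ?LL S" by (rule S.ideal_colon_ideal[OF G S.isub[OF iL]])
  have dc: "ideal_colon R ?A (ideal_colon R ?A J) = J"
    by (rule double_colon[OF r at0J J1(1)]) (use J1(4) in simp)
  have step: "u 0 \<in> J \<and> (\<exists>u'\<in>?LL. u = cst R (u 0) \<oplus>\<^bsub>S\<^esub> sh R u')" if u: "u \<in> ?LL" for u
  proof -
    have uc: "u \<in> carrier S" using S.icarr[OF iLL u] .
    have "u 0 \<in> ideal_colon R ?A (ideal_colon R ?A J)"
    proof (rule ideal_colonI[OF S_coeff[OF uc]])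
      fix l assume "l \<in> ideal_colon R ?A J"
      then obtain m where m: "l = m 0" "m \<in> ?L" unfolding im[symmetric] by (rule imageE)
      show "u 0 \<otimes> l \<in> ?A" using gS_at0[OF asc S.ideal_colonD[OF u m(2)]] m(1) by (simp add: S_mult_0)
    qed
    then have u0: "u 0 \<in> J" using dc by simp
    note c0 = cst_closed[OF S_coeff[OF uc, of 0]]
    have cLL: "cst R (u 0) \<in> ?LL"
    proof (rule S.ideal_colonI[OF c0])
      fix l assume l: "l \<in> ?L"
      have "l \<otimes>\<^bsub>S\<^esub> cst R (u 0) \<in> gS as" using S.ideal_colonD[OF l cst_fps_ext[OF J1(1) u0]] .
      then show "cst R (u 0) \<otimes>\<^bsub>S\<^esub> l \<in> gS as" using S.m_comm[OF c0 S.icarr[OF iL l]] by simp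
    qed
    obtain u' where u': "u' \<in> carrier S" "u = cst R (u 0) \<oplus>\<^bsub>S\<^esub> sh R u'" using S_decomp[OF uc] .
    have "sh R u' \<oplus>\<^bsub>S\<^esub> cst R (u 0) \<in> ?LL" using u u'(2) S.a_comm[OF c0 sh_closed[OF u'(1)]] by simp
    then have sLL: "sh R u' \<in> ?LL" using S.iadd_cancel[OF iLL _ cLL sh_closed[OF u'(1)]] by blast
    have "u' \<in> ?LL"
    proof (rule S.ideal_colonI[OF u'(1)])
      fix l assume l: "l \<in> ?L"
      have lc: "l \<in> carrier S" using S.icarr[OF iL l] .
      have "sh R (u' \<otimes>\<^bsub>S\<^esub> l) \<in> gS as" using S.ideal_colonD[OF sLL l] sh_mult[OF u'(1) lc] by simp
      then show "u' \<otimes>\<^bsub>S\<^esub> l \<in> gS as" using sh_saturated[OF asc r] u'(1) lc by simp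
    qed
    then show ?thesis using u0 u'(2) by blast
  qed
  fix u assume "u \<in> ?LL"
  then have "u n \<in> J" for n
  proof (induction n arbitrary: u)
    case (Suc n)
    obtain u' where u': "u' \<in> ?LL" "u = cst R (u 0) \<oplus>\<^bsub>S\<^esub> sh R u'" using step[OF Suc.prems] by blast
    have "u (Suc n) = (cst R (u 0) \<oplus>\<^bsub>S\<^esub> sh R u') (Suc n)" using u'(2) by simp
    also have "\<dots> = u' n" using S_coeff[OF S.icarr[OF iLL u'(1)]] by (simp add: S_add cst_def sh_Suc)
    finally show ?case using Suc.IH[OF u'(1)] by simp
  qed (use step in blast)
  then show "u \<in> fps_ext J" unfolding fps_ext_def by simp
qed

section \<open>Chains of links\<close>

definition absorbs :: "'a set \<Rightarrow> (nat \<Rightarrow> 'a) list \<Rightarrow> (nat \<Rightarrow> 'a) set \<Rightarrow> bool" where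
  "absorbs J as D \<longleftrightarrow> ideal D S \<and> (\<forall>c\<in>fps_ext J. \<forall>a\<in>set as. c \<otimes>\<^bsub>S\<^esub> a \<in> D)"

lemma tightD:
  assumes "tight J h" "set as \<subseteq> fps_ext J" "reg R {\<zero>} (map at0 as)" "length as = h"
    "v \<in> ideal_colon S (gS as) (fps_ext J)"
  shows "v \<in> fps_ext J" "f \<in> fps_ext J \<Longrightarrow> absorbs J as D \<Longrightarrow> v \<otimes>\<^bsub>S\<^esub> f \<in> D"
  using assms unfolding tight_def absorbs_def by blast+

text \<open>The invariants of the lifts at the even and odd steps of a chain of links starting at \<open>J\<close>. At
  an odd step \<open>as\<close> is the lifted sequence that defined the last link.\<close>

definition even_link :: "'a set \<Rightarrow> 'a set \<Rightarrow> bool" where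
  "even_link J P \<longleftrightarrow> (\<exists>Pt k. flat_lift Pt P \<and> Pt \<subseteq> fps_ext J \<and> k \<in> carrier S - fps_ext mm \<and>
     (\<forall>f\<in>fps_ext J. k \<otimes>\<^bsub>S\<^esub> f \<in> Pt))"

definition odd_link :: "'a set \<Rightarrow> nat \<Rightarrow> 'a set \<Rightarrow> bool" where
  "odd_link J h Q \<longleftrightarrow> (\<exists>Qt as k. flat_lift Qt Q \<and> Qt \<subseteq> fps_ext J \<and> set as \<subseteq> Qt \<and> length as = h \<and>
     reg R {\<zero>} (map at0 as) \<and> ideal_colon S (gS as) (fps_ext J) \<subseteq> Qt \<and> k \<in> carrier S - fps_ext mm \<and>
     (\<forall>f\<in>fps_ext J. \<forall>q\<in>Qt. \<forall>D. absorbs J as D \<longrightarrow> k \<otimes>\<^bsub>S\<^esub> (f \<otimes>\<^bsub>S\<^esub> q) \<in> D))"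

lemma flat_liftD: "flat_lift Pt P \<Longrightarrow> ideal Pt S" "flat_lift Pt P \<Longrightarrow> at0 ` Pt = P"
  unfolding flat_lift_def by auto

lemma link_in_fps_ext:
  assumes "flat_lift Pt P" "Pt \<subseteq> fps_ext J" shows "P \<subseteq> J"
  using flat_liftD(2)[OF assms(1)] assms(2) unfolding fps_ext_def by blast

lemma lift_list:
  assumes "flat_lift Pt P" "set ys \<subseteq> P" obtains as where "set as \<subseteq> Pt" "map at0 as = ys"
proof -
  have "set ys \<subseteq> P \<Longrightarrow> \<exists>as. set as \<subseteq> Pt \<and> map at0 as = ys"
  proof (induction ys)
    case (Cons y ys)
    then obtain as where as: "set as \<subseteq> Pt" "map at0 as = ys" by auto
    have "y \<in> at0 ` Pt" using Cons.prems flat_liftD(2)[OF assms(1)] by simp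
    then obtain a where "y = a 0" "a \<in> Pt" by (rule imageE)
    then show ?case using as by (intro exI[of _ "a # as"]) simp
  qed simp
  then show ?thesis using that assms(2) by blast
qed

lemma even_link_refl: "even_link J J" if "cm_ideal J h"
proof -
  note iJ = ideal_fps_ext[OF cm_idealD(1)[OF that]]
  have "\<one>\<^bsub>S\<^esub> \<in> carrier S - fps_ext mm" using S.prime_one[OF prime_fps_ext[OF prime_mm]] by simp
  moreover have "\<forall>f\<in>fps_ext J. \<one>\<^bsub>S\<^esub> \<otimes>\<^bsub>S\<^esub> f \<in> fps_ext J" using S.icarr[OF iJ] by simp
  ultimately show ?thesis
    unfolding even_link_def using flat_lift_fps_ext[OF cm_idealD(1)[OF that]] by blast
qed

text \<open>Up to the multiplier \<open>k\<close> the ideal \<open>Pt\<close> is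
  \<open>J[[t]]\<close>, so its link by \<open>as\<close> is controlled by tightness;
  \<open>fps_ext_cancel\<close> removes \<open>k\<close> from the resulting inclusion.\<close>

lemma odd_link_if_even_link:
  assumes J: "tight J h" and P: "cm_ideal P h" and ev: "even_link J P"
    and ys: "reg R {\<zero>} ys" "set ys \<subseteq> P" "length ys = h"
  shows "odd_link J h (ideal_colon R (ci ys) P)"
proof -
  have iJ: "ideal (fps_ext J) S" and iJR: "ideal J R"
    using J ideal_fps_ext cm_idealD(1) unfolding tight_def by blast+
  obtain Pt k where Pt: "flat_lift Pt P" "Pt \<subseteq> fps_ext J" and k: "k \<in> carrier S - fps_ext mm"
    and kf: "\<And>f. f \<in> fps_ext J \<Longrightarrow> k \<otimes>\<^bsub>S\<^esub> f \<in> Pt" using ev unfolding even_link_def by auto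
  note iPt = flat_liftD(1)[OF Pt(1)]
  obtain as where as: "set as \<subseteq> Pt" "map at0 as = ys" using lift_list[OF Pt(1) ys(2)] .
  have len: "length as = h" using as(2) ys(3) by auto
  let ?Q = "ideal_colon S (gS as) Pt"
  have r: "reg R {\<zero>} (map at0 as)" using ys(1) as(2) by simp
  have asJ: "set as \<subseteq> fps_ext J" using as(1) Pt(2) by blast
  have asc: "set as \<subseteq> carrier S" using asJ S.isub[OF iJ] by blast
  note G = ideal_gS[OF asc]
  have fl: "flat_lift ?Q (ideal_colon R (ci ys) P)"
    using lift_colon[OF Pt(1) cm_idealD(1)[OF P] as(1) r] cm_idealD(3)[OF P] len as(2) by simp
  have asQ: "set as \<subseteq> ?Q" using S.gen_mem[OF S.zeroideal asc] S.ideal_colon_sub[OF G S.isub[OF iPt]] by blast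
  have kq: "k \<otimes>\<^bsub>S\<^esub> q \<in> ideal_colon S (gS as) (fps_ext J)" if q: "q \<in> ?Q" for q
  proof -
    have qc: "q \<in> carrier S" using q unfolding ideal_colon_def by simp
    show ?thesis
    proof (rule S.ideal_colonI)
      show "k \<otimes>\<^bsub>S\<^esub> q \<in> carrier S" using k qc by simp
      fix f assume f: "f \<in> fps_ext J"
      have "k \<otimes>\<^bsub>S\<^esub> q \<otimes>\<^bsub>S\<^esub> f = q \<otimes>\<^bsub>S\<^esub> (k \<otimes>\<^bsub>S\<^esub> f)" using k qc S.icarr[OF iJ f] by (simp add: S.m_ac)
      then show "k \<otimes>\<^bsub>S\<^esub> q \<otimes>\<^bsub>S\<^esub> f \<in> gS as" using S.ideal_colonD[OF q kf[OF f]] by simp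
    qed
  qed
  note t = tightD[OF J asJ r len kq]
  have QJ: "?Q \<subseteq> fps_ext J"
  proof
    fix q assume q: "q \<in> ?Q"
    then have "q \<in> carrier S" unfolding ideal_colon_def by simp
    then show "q \<in> fps_ext J" using fps_ext_cancel[OF iJR k] t(1)[OF q] by blast
  qed
  have sub: "ideal_colon S (gS as) (fps_ext J) \<subseteq> ?Q" using Pt(2) unfolding ideal_colon_def by blast
  have "k \<otimes>\<^bsub>S\<^esub> (f \<otimes>\<^bsub>S\<^esub> q) \<in> D" if f: "f \<in> fps_ext J" and q: "q \<in> ?Q" and D: "absorbs J as D" for f q D
  proof -
    have qc: "q \<in> carrier S" using q unfolding ideal_colon_def by simp
    have "k \<otimes>\<^bsub>S\<^esub> (f \<otimes>\<^bsub>S\<^esub> q) = k \<otimes>\<^bsub>S\<^esub> q \<otimes>\<^bsub>S\<^esub> f" using k qc S.icarr[OF iJ f] by (simp add: S.m_ac)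
    then show ?thesis using t(2)[OF q f D] by simp
  qed
  then show ?thesis unfolding odd_link_def using fl QJ asQ len r sub k by blast
qed

text \<open>\<open>bh\<close> lifts the new sequence and \<open>bt\<close> is its perturbation. As
  \<open>bh\<close> is in \<open>Qt\<close>, \<open>k J[[t]] bh\<close> lies in the product of
  \<open>J[[t]]\<close> with \<open>as\<close>; \<open>generic_shift\<close> on generators of this
  product gives a multiplier \<open>s\<close> moving it into \<open>(bt)\<close>. Hence
  \<open>s k J[[t]]\<close> lies in \<open>(bt) : Qt\<close>. The converse inclusion comes from the
  double link of \<open>J[[t]]\<close> by \<open>bt\<close>.\<close>

lemma even_link_if_odd_link:
  assumes J: "tight J h" and Q: "cm_ideal Q h" and od: "odd_link J h Q"
    and ys: "reg R {\<zero>} ys" "set ys \<subseteq> Q" "length ys = h"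
  shows "even_link J (ideal_colon R (ci ys) Q)"
proof -
  have cmJ: "cm_ideal J h" using J unfolding tight_def by blast
  note iJR = cm_idealD(1)[OF cmJ]
  note iJ = ideal_fps_ext[OF iJR]
  note jc = S.icarr[OF iJ]
  obtain Qt as k where Qt: "flat_lift Qt Q" "Qt \<subseteq> fps_ext J" and as: "set as \<subseteq> Qt" "length as = h"
    and ras: "reg R {\<zero>} (map at0 as)" and colQ: "ideal_colon S (gS as) (fps_ext J) \<subseteq> Qt"
    and k: "k \<in> carrier S - fps_ext mm"
    and kD: "\<And>f q D. f \<in> fps_ext J \<Longrightarrow> q \<in> Qt \<Longrightarrow> absorbs J as D \<Longrightarrow> k \<otimes>\<^bsub>S\<^esub> (f \<otimes>\<^bsub>S\<^esub> q) \<in> D"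
    using od unfolding odd_link_def by auto
  note iQt = flat_liftD(1)[OF Qt(1)] and qc = S.icarr[OF flat_liftD(1)[OF Qt(1)]]
  note prm = prime_fps_ext[OF prime_mm]
  have kc: "k \<in> carrier S" using k by simp
  obtain bh where bh: "set bh \<subseteq> Qt" "map at0 bh = ys" using lift_list[OF Qt(1) ys(2)] .
  have lbh: "length bh = h" using bh(2) ys(3) by auto
  obtain ds where ds: "set ds \<subseteq> J" "J = ci ds" using fin_gen[OF iJR] by blast
  define fs where "fs = map (cst R) ds"
  have fsJ: "set fs \<subseteq> fps_ext J" unfolding fs_def using cst_fps_ext[OF iJR] ds(1) by auto
  have fsg: "fps_ext J = gS fs" unfolding fs_def using fps_ext_gen[OF ds(2)] ds(1) isub[OF iJR] by blast
  \<comment> \<open>Index pairs for the products of generators of \<open>J[[t]]\<close> with members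
    of \<open>as\<close>.\<close>
  define ps where "ps = List.product [0..<length fs] [0..<h]"
  have ps: "p \<in> set ps \<longleftrightarrow> fst p < length fs \<and> snd p < h" for p
    unfolding ps_def by (cases p) auto
  have dps: "distinct ps" unfolding ps_def by (simp add: distinct_product)
  \<comment> \<open>The default zero keeps \<open>x\<close> in the carrier at every index, as
    \<open>generic_shift\<close> asks.\<close>
  define x where "x p = (if p \<in> set ps then fs ! fst p \<otimes>\<^bsub>S\<^esub> as ! snd p else \<zero>\<^bsub>S\<^esub>)" for p
  define y where "y p = k \<otimes>\<^bsub>S\<^esub> (fs ! fst p \<otimes>\<^bsub>S\<^esub> bh ! snd p)" for p
  have nth: "fs ! fst p \<in> fps_ext J" "as ! snd p \<in> Qt" "bh ! snd p \<in> Qt" if "p \<in> set ps" for p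
    using that[unfolded ps] fsJ as bh(1) lbh by (auto simp: subset_iff)
  have xc: "x p \<in> carrier S" for p unfolding x_def using nth jc qc by auto
  have xcs: "x ` set ps \<subseteq> carrier S" using xc by auto
  let ?X = "Idl\<^bsub>S\<^esub> (x ` set ps)"
  have iX: "ideal ?X S" by (rule S.genideal_ideal[OF xcs])
  have abX: "absorbs J as ?X"
    unfolding absorbs_def
  proof (intro conjI ballI iX)
    fix c a assume c: "c \<in> fps_ext J" and "a \<in> set as"
    then obtain i where i: "i < h" "a = as ! i" using as(2) by (auto simp: in_set_conv_nth)
    have ac: "a \<in> carrier S" using \<open>a \<in> set as\<close> as(1) qc by blast
    have "gS fs \<subseteq> {f \<in> carrier S. a \<otimes>\<^bsub>S\<^esub> f \<in> ?X}"
    proof (rule S.gen_least[OF S.ideal_preimage_mult[OF iX ac]])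
      show "{\<zero>\<^bsub>S\<^esub>} \<subseteq> {f \<in> carrier S. a \<otimes>\<^bsub>S\<^esub> f \<in> ?X}" using S.izero[OF S.ideal_preimage_mult[OF iX ac]] by blast
      show "set fs \<subseteq> {f \<in> carrier S. a \<otimes>\<^bsub>S\<^esub> f \<in> ?X}"
      proof
        fix f assume f: "f \<in> set fs"
        then obtain l where l: "l < length fs" "f = fs ! l" by (auto simp: in_set_conv_nth)
        have fc: "f \<in> carrier S" using f fsJ jc by blast
        have p: "(l, i) \<in> set ps" using l i by (simp add: ps)
        have "x (l, i) = a \<otimes>\<^bsub>S\<^esub> f" unfolding x_def using p l i fc ac by (simp add: S.m_comm)
        then have "a \<otimes>\<^bsub>S\<^esub> f \<in> ?X" using S.genideal_self[OF xcs] p by (metis imageI subsetD)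
        then show "f \<in> {f \<in> carrier S. a \<otimes>\<^bsub>S\<^esub> f \<in> ?X}" using fc by blast
      qed
    qed
    then have "a \<otimes>\<^bsub>S\<^esub> c \<in> ?X" using c fsg by blast
    then show "c \<otimes>\<^bsub>S\<^esub> a \<in> ?X" using S.m_comm[OF ac jc[OF c]] by simp
  qed
  have yX: "y p \<in> ?X" if "p \<in> set ps" for p unfolding y_def using kD[OF nth(1,3)[OF that] abX] .
  \<comment> \<open>The factor \<open>k\<close> matches the one in \<open>y\<close>, so that
    \<open>y p + \<mu> m x p\<close> is \<open>k\<close> times a generator of \<open>J[[t]]\<close>
    times a member of \<open>bt\<close>. The exponent \<open>Suc m\<close> makes the perturbation
    vanish at \<open>t = 0\<close>.\<close>
  define \<mu> where "\<mu> m = k \<otimes>\<^bsub>S\<^esub> tpow (Suc m)" for m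
  have \<mu>c: "\<mu> m \<in> carrier S" for m unfolding \<mu>_def using kc tpow_closed by simp
  have \<mu>d: "\<mu> m \<ominus>\<^bsub>S\<^esub> \<mu> m' \<notin> fps_ext mm" if "m \<noteq> m'" for m m'
  proof -
    have c: "tpow (Suc m) \<ominus>\<^bsub>S\<^esub> tpow (Suc m') \<in> carrier S" using tpow_closed by simp
    have "\<mu> m \<ominus>\<^bsub>S\<^esub> \<mu> m' = k \<otimes>\<^bsub>S\<^esub> (tpow (Suc m) \<ominus>\<^bsub>S\<^esub> tpow (Suc m'))"
      unfolding \<mu>_def using kc tpow_closed[of "Suc m"] tpow_closed[of "Suc m'"] by algebra
    then show ?thesis using S.prime_mult[OF prm kc c] k tpow_diff[OF prime_mm, of "Suc m" "Suc m'"] that by auto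
  qed
  obtain m s where s: "s \<in> carrier S - fps_ext mm"
    and sx: "\<And>p. p \<in> set ps \<Longrightarrow> s \<otimes>\<^bsub>S\<^esub> x p \<in> Idl\<^bsub>S\<^esub> ((\<lambda>p. y p \<oplus>\<^bsub>S\<^esub> \<mu> m \<otimes>\<^bsub>S\<^esub> x p) ` set ps)"
  \<comment> \<open>One candidate exponent more than there are generators.\<close>
  proof (rule S.generic_shift[OF prm dps xc yX \<mu>c \<mu>d, where ms = "[0..<Suc (length ps)]"])
    show "distinct [0..<Suc (length ps)]" "length ps < length [0..<Suc (length ps)]" by simp_all
  qed auto
  have sc: "s \<in> carrier S" using s by simp
  let ?t = "tpow (Suc m)"
  define bt where "bt = map (\<lambda>i. bh ! i \<oplus>\<^bsub>S\<^esub> ?t \<otimes>\<^bsub>S\<^esub> as ! i) [0..<h]"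
  have lbt: "length bt = h" unfolding bt_def by simp
  have btn: "bt ! i = bh ! i \<oplus>\<^bsub>S\<^esub> ?t \<otimes>\<^bsub>S\<^esub> as ! i" if "i < h" for i unfolding bt_def using that by simp
  have btQ: "set bt \<subseteq> Qt"
  proof
    fix b assume "b \<in> set bt"
    then obtain i where i: "i < h" "b = bh ! i \<oplus>\<^bsub>S\<^esub> ?t \<otimes>\<^bsub>S\<^esub> as ! i" unfolding bt_def by auto
    have "bh ! i \<in> Qt" "as ! i \<in> Qt" using i bh(1) lbh as by (auto simp: subset_iff)
    then show "b \<in> Qt" unfolding i(2) using S.iadd[OF iQt] S.imult[OF iQt _ tpow_closed] by blast
  qed
  have bt0: "map at0 bt = ys"
  proof (rule nth_equalityI)
    show "length (map at0 bt) = length ys" using lbt ys(3) by simp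
    fix i assume "i < length (map at0 bt)"
    then have i: "i < h" using lbt by simp
    have c: "bh ! i \<in> carrier S" "as ! i \<in> carrier S" using i bh(1) lbh as qc by (auto simp: subset_iff)
    have "bt ! i = bh ! i \<oplus>\<^bsub>S\<^esub> ?t \<otimes>\<^bsub>S\<^esub> as ! i" using btn[OF i] .
    then have "(bt ! i) 0 = (bh ! i) 0" using S_coeff[OF c(1)] S_coeff[OF c(2)] by (simp add: S_add S_mult_0 tpow_def)
    then show "map at0 bt ! i = ys ! i" using i lbt lbh bh(2) by auto
  qed
  have rbt: "reg R {\<zero>} (map at0 bt)" using ys(1) bt0 by simp
  have btJ: "set bt \<subseteq> fps_ext J" using btQ Qt(2) by blast
  have btc: "set bt \<subseteq> carrier S" using btJ S.isub[OF iJ] by blast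
  note Gb = ideal_gS[OF btc]
  have asJ: "set as \<subseteq> fps_ext J" using as(1) Qt(2) by blast
  have asc: "set as \<subseteq> carrier S" using asJ S.isub[OF iJ] by blast
  note Ga = ideal_gS[OF asc]
  have shift: "y p \<oplus>\<^bsub>S\<^esub> \<mu> m \<otimes>\<^bsub>S\<^esub> x p \<in> gS bt" if p: "p \<in> set ps" for p
  proof -
    have i: "snd p < h" using p ps by simp
    have c: "fs ! fst p \<in> carrier S" "as ! snd p \<in> carrier S" "bh ! snd p \<in> carrier S"
      using nth[OF p] jc qc by auto
    have "k \<otimes>\<^bsub>S\<^esub> (fs ! fst p \<otimes>\<^bsub>S\<^esub> bh ! snd p) \<oplus>\<^bsub>S\<^esub> k \<otimes>\<^bsub>S\<^esub> ?t \<otimes>\<^bsub>S\<^esub> (fs ! fst p \<otimes>\<^bsub>S\<^esub> as ! snd p)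
        = (k \<otimes>\<^bsub>S\<^esub> fs ! fst p) \<otimes>\<^bsub>S\<^esub> (bh ! snd p \<oplus>\<^bsub>S\<^esub> ?t \<otimes>\<^bsub>S\<^esub> as ! snd p)"
      using c kc tpow_closed[of "Suc m"] by algebra
    then have e: "y p \<oplus>\<^bsub>S\<^esub> \<mu> m \<otimes>\<^bsub>S\<^esub> x p = (k \<otimes>\<^bsub>S\<^esub> fs ! fst p) \<otimes>\<^bsub>S\<^esub> bt ! snd p"
      unfolding y_def \<mu>_def x_def using p btn[OF i] by simp
    have "bt ! snd p \<in> gS bt" using S.gen_mem[OF S.zeroideal btc] i lbt by (auto simp: subset_iff)
    then show ?thesis unfolding e using S.imult[OF Gb] c kc by simp
  qed
  have "Idl\<^bsub>S\<^esub> ((\<lambda>p. y p \<oplus>\<^bsub>S\<^esub> \<mu> m \<otimes>\<^bsub>S\<^esub> x p) ` set ps) \<subseteq> gS bt"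
    by (rule S.genideal_minimal[OF Gb]) (use shift in auto)
  then have sxb: "s \<otimes>\<^bsub>S\<^esub> x p \<in> gS bt" if "p \<in> set ps" for p using sx[OF that] by blast
  have sD: "absorbs J as {d \<in> carrier S. s \<otimes>\<^bsub>S\<^esub> d \<in> gS bt}"
  proof -
    let ?D = "{d \<in> carrier S. s \<otimes>\<^bsub>S\<^esub> d \<in> gS bt}"
    have iD: "ideal ?D S" by (rule S.ideal_preimage_mult[OF Gb sc])
    have "?X \<subseteq> ?D" by (rule S.genideal_minimal[OF iD]) (use sxb xc in auto)
    then show ?thesis using abX iD unfolding absorbs_def by blast
  qed
  let ?P = "ideal_colon S (gS bt) Qt"
  have fl: "flat_lift ?P (ideal_colon R (ci ys) Q)"
    using lift_colon[OF Qt(1) cm_idealD(1)[OF Q] btQ rbt] cm_idealD(3)[OF Q] lbt bt0 by simp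
  have skP: "s \<otimes>\<^bsub>S\<^esub> k \<otimes>\<^bsub>S\<^esub> f \<in> ?P" if f: "f \<in> fps_ext J" for f
  proof (rule S.ideal_colonI)
    show "s \<otimes>\<^bsub>S\<^esub> k \<otimes>\<^bsub>S\<^esub> f \<in> carrier S" using sc kc jc[OF f] by simp
    fix q assume q: "q \<in> Qt"
    have "s \<otimes>\<^bsub>S\<^esub> k \<otimes>\<^bsub>S\<^esub> f \<otimes>\<^bsub>S\<^esub> q = s \<otimes>\<^bsub>S\<^esub> (k \<otimes>\<^bsub>S\<^esub> (f \<otimes>\<^bsub>S\<^esub> q))" using sc kc jc[OF f] qc[OF q] by (simp add: S.m_assoc)
    then show "s \<otimes>\<^bsub>S\<^esub> k \<otimes>\<^bsub>S\<^esub> f \<otimes>\<^bsub>S\<^esub> q \<in> gS bt" using kD[OF f q sD] by simp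
  qed
  have PJ: "?P \<subseteq> fps_ext J"
  proof
    fix p assume p: "p \<in> ?P"
    have pc: "p \<in> carrier S" using p unfolding ideal_colon_def by simp
    \<comment> \<open>For \<open>v\<close> in \<open>(bt) : J[[t]]\<close> tightness puts
      \<open>v J[[t]]\<close> into the product with \<open>bt\<close>, which \<open>k\<close> moves
      into \<open>(as)\<close>. Thus \<open>k v\<close> lies in \<open>(as) : J[[t]]\<close>, a part
      of \<open>Qt\<close>, and \<open>p\<close> sends it into \<open>(bt)\<close>.\<close>
    have "k \<otimes>\<^bsub>S\<^esub> p \<in> ideal_colon S (gS bt) (ideal_colon S (gS bt) (fps_ext J))"
    proof (rule S.ideal_colonI)
      show "k \<otimes>\<^bsub>S\<^esub> p \<in> carrier S" using kc pc by simp
      fix v assume v: "v \<in> ideal_colon S (gS bt) (fps_ext J)"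
      have vc: "v \<in> carrier S" using v unfolding ideal_colon_def by simp
      let ?D = "{d \<in> carrier S. k \<otimes>\<^bsub>S\<^esub> d \<in> gS as}"
      have aa: "absorbs J as (gS as)"
        unfolding absorbs_def using Ga S.gen_mem[OF S.zeroideal asc] S.imult[OF Ga] jc by blast
      have "absorbs J bt ?D"
        unfolding absorbs_def
      proof (intro conjI ballI S.ideal_preimage_mult[OF Ga kc])
        fix c b assume cb: "c \<in> fps_ext J" "b \<in> set bt"
        have "k \<otimes>\<^bsub>S\<^esub> (c \<otimes>\<^bsub>S\<^esub> b) \<in> gS as" using kD[OF cb(1) _ aa] btQ cb(2) by blast
        then show "c \<otimes>\<^bsub>S\<^esub> b \<in> ?D" using jc[OF cb(1)] btc cb(2) by auto
      qed
      note vf = tightD(2)[OF J btJ rbt lbt v _ this]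
      have "k \<otimes>\<^bsub>S\<^esub> v \<in> ideal_colon S (gS as) (fps_ext J)"
      proof (rule S.ideal_colonI)
        show "k \<otimes>\<^bsub>S\<^esub> v \<in> carrier S" using kc vc by simp
        fix f assume f: "f \<in> fps_ext J"
        show "k \<otimes>\<^bsub>S\<^esub> v \<otimes>\<^bsub>S\<^esub> f \<in> gS as" using vf[OF f] S.m_assoc[OF kc vc jc[OF f]] by simp
      qed
      then have "p \<otimes>\<^bsub>S\<^esub> (k \<otimes>\<^bsub>S\<^esub> v) \<in> gS bt" using S.ideal_colonD[OF p] colQ by blast
      moreover have "k \<otimes>\<^bsub>S\<^esub> p \<otimes>\<^bsub>S\<^esub> v = p \<otimes>\<^bsub>S\<^esub> (k \<otimes>\<^bsub>S\<^esub> v)" using kc pc vc by (simp add: S.m_ac)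
      ultimately show "k \<otimes>\<^bsub>S\<^esub> p \<otimes>\<^bsub>S\<^esub> v \<in> gS bt" by simp
    qed
    then have "k \<otimes>\<^bsub>S\<^esub> p \<in> fps_ext J" using double_colon_fps_ext[OF _ btJ rbt] cmJ lbt by auto
    then show "p \<in> fps_ext J" using fps_ext_cancel[OF iJR k pc] by blast
  qed
  have "s \<otimes>\<^bsub>S\<^esub> k \<in> carrier S - fps_ext mm" by (rule S.prime_mult_notin[OF prm s k])
  then show ?thesis unfolding even_link_def using fl PJ skP by blast
qed

text \<open>The length of the linking sequence is forced: a prime associated to
  \<open>P = A : Q\<close> is associated to \<open>A\<close>, so its height is both \<open>h\<close>
  and that length.\<close>

lemma direct_linkage_step:
  assumes P: "cm_ideal P h" and l: "(P, Q) \<in> direct_linkage R"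
  obtains ys where "reg R {\<zero>} ys" "set ys \<subseteq> P" "length ys = h" "Q = ideal_colon R (ci ys) P" "cm_ideal Q h"
proof -
  obtain A where PQ: "proper_ideal R P" "proper_ideal R Q" and A: "complete_intersection R A" "A \<subseteq> P \<inter> Q"
    "P = ideal_colon R A Q" "Q = ideal_colon R A P"
    using l unfolding direct_linkage_def directly_linked_def by blast
  obtain ys where ys: "regular_sequence R ys" "A = Idl (set ys)" using A(1) unfolding complete_intersection_def by blast
  have r: "reg R {\<zero>} ys" and yc: "set ys \<subseteq> carrier R" using ys(1) unfolding reg_iff_regular_sequence by auto
  have Ay: "A = ci ys" unfolding ys(2) gen_zero_eq_Idl[OF yc] ..
  have yP: "set ys \<subseteq> P" using gen_mem[OF zeroideal yc] A(2) Ay by blast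
  note iP = cm_idealD(1)[OF P]
  have iQ: "ideal Q R" using PQ(2) unfolding proper_ideal_def by blast
  have iA: "ideal A R" unfolding Ay by (rule ideal_ci[OF r])
  have "\<one> \<notin> P" using cm_idealD(2)[OF P] prime_one[OF prime_mm] by blast
  then obtain M where M: "M \<in> associated_primes R P" using assoc_prime_above_colon[OF iP one_closed] by blast
  have "M \<in> associated_primes R A" using assoc_ideal_colon[OF iA iQ, of M] M A(3) by simp
  then have "prime_height R M = enat (length ys)" using prime_height_assoc[OF r] Ay by simp
  then have len: "length ys = h" using cm_idealD(4)[OF P M] by simp
  have Qe: "Q = ideal_colon R (ci ys) P" using A(4) Ay by simp
  have "cm_ideal Q h"
    unfolding cm_ideal_def
  proof (intro conjI ballI iQ)
    show "Q \<subseteq> mm" by (rule proper_ideal_sub_mm[OF PQ(2)])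
    show "ext_bound h Q"
      using ext_bound_link[OF r iP cm_idealD(2)[OF P] ci_sub[OF iP yP]] cm_idealD(3)[OF P] len Qe by simp
    fix M assume "M \<in> associated_primes R Q"
    then have "M \<in> associated_primes R (ci ys)" using assoc_ideal_colon[OF iA iP, of M] A(4) Ay by simp
    then show "prime_height R M = enat h" using prime_height_assoc[OF r] len by simp
  qed
  then show ?thesis using that r yP len Qe by blast
qed

text \<open>The two invariants alternate along a chain and each gives inclusion in \<open>J\<close>
  at \<open>t = 0\<close>; their disjunction is carried through the induction, without recording the
  parity.\<close>

lemma tight_maximal:
  assumes J: "tight J h" shows "maximal_in_linkage_class R J"
proof -
  have cmJ: "cm_ideal J h" using J unfolding tight_def by blast
  have sym: "(Q, P) \<in> direct_linkage R" if "(P, Q) \<in> direct_linkage R" for P Q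
    using that unfolding direct_linkage_def directly_linked_def by (auto simp: Int_commute)
  have link: "cm_ideal Q h \<and> (even_link J Q \<or> odd_link J h Q)"
    if P: "cm_ideal P h" "even_link J P \<or> odd_link J h P" and l: "(P, Q) \<in> direct_linkage R" for P Q
  proof -
    obtain ys where ys: "reg R {\<zero>} ys" "set ys \<subseteq> P" "length ys = h" "Q = ideal_colon R (ci ys) P" "cm_ideal Q h"
      using direct_linkage_step[OF P(1) l] .
    show ?thesis
      using P(2) odd_link_if_even_link[OF J P(1) _ ys(1-3)] even_link_if_odd_link[OF J P(1) _ ys(1-3)] ys(4,5) by auto
  qed
  have "K \<subseteq> J" if "K \<in> linkage_class R J" for K
  proof -
    have "(J, K) \<in> (direct_linkage R \<union> (direct_linkage R)\<inverse>)\<^sup>*" using that unfolding linkage_class_def linkage_def by auto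
    then have "cm_ideal K h \<and> (even_link J K \<or> odd_link J h K)"
    proof (induction rule: rtrancl_induct)
      case base show ?case using cmJ even_link_refl[OF cmJ] by blast
    next
      case (step P Q)
      then have "(P, Q) \<in> direct_linkage R" using sym by blast
      then show ?case using link step.IH by blast
    qed
    then show ?thesis using link_in_fps_ext unfolding even_link_def odd_link_def by blast
  qed
  moreover have "unmixed_ideal R J" by (rule unmixed_if_heights[OF cm_idealD(1,2)[OF cmJ] cm_idealD(4)[OF cmJ]])
  ultimately show ?thesis unfolding maximal_in_linkage_class_def by blast
qed

section \<open>Adjoining a regular sequence to \<open>I\<close>\<close>

lemma regular_below_assoc:
  assumes I: "ideal I R" "I \<subseteq> mm"
  obtains us Q where "reg R {\<zero>} us" "set us \<subseteq> I" "Q \<in> associated_primes R (ci us)" "Q \<in> associated_primes R I"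
proof -
  have one: "\<one> \<notin> I" using I(2) prime_one[OF prime_mm] by blast
  obtain us Q where us: "reg R {\<zero>} ([] @ us)" "set us \<subseteq> I" "Q \<in> associated_primes R (ci ([] @ us))" "I \<subseteq> Q"
    using maximal_regular[OF I(1) one, of "[]"] by auto
  obtain P where P: "P \<in> associated_primes R I" "P \<subseteq> Q" using assoc_prime_below[OF I(1) assoc_prime[OF us(3)] us(4)] .
  have "ci us \<subseteq> P" using ci_sub[OF I(1) us(2)] assoc_prime_sub[OF I(1) P(1)] by blast
  then have "P = Q" using assoc_ci_minimal[of us Q P] us(1,3) assoc_prime[OF P(1)] P(2) by simp
  then show ?thesis using that us P(1) by simp
qed

lemma cm_ideal_regular:
  assumes I: "cm_ideal I g" obtains xs where "reg R {\<zero>} xs" "set xs \<subseteq> I" "length xs = g"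
proof -
  obtain us Q where us: "reg R {\<zero>} us" "set us \<subseteq> I" "Q \<in> associated_primes R (ci us)" "Q \<in> associated_primes R I"
    using regular_below_assoc[OF cm_idealD(1,2)[OF I]] .
  have "length us = g" using prime_height_assoc[OF us(1,3)] cm_idealD(4)[OF I us(4)] by simp
  then show ?thesis using that us(1,2) by blast
qed

lemma maximal_adjoin:
  assumes I: "cm_ideal I g" "0 < g" and mx: "maximal_in_linkage_class R I" and x: "x \<in> mm" "nonzerodivisor R I x"
  shows "cm_ideal (adjoin R I x) (Suc g)" "maximal_in_linkage_class R (adjoin R I x)"
proof -
  obtain xs where xs: "reg R {\<zero>} xs" "set xs \<subseteq> I" "length xs = g" using cm_ideal_regular[OF I(1)] .
  show cm: "cm_ideal (adjoin R I x) (Suc g)" by (rule cm_ideal_adjoin(1)[OF I(1) xs x])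
  have xc: "x \<in> carrier R" using icarr[OF ideal_mm x(1)] .
  \<comment> \<open>The element \<open>x\<close> of the maximal ideal is regular modulo
    \<open>I\<close>, hence not in \<open>I\<close>. \<open>maximal_not_ci\<close> needs such room
    to choose its \<open>b\<close>.\<close>
  have "\<not> mm \<subseteq> I"
  proof
    assume "mm \<subseteq> I"
    then have "\<one> \<otimes> x \<in> I" using x(1) xc by auto
    then have "\<one> \<in> I" using nonzerodivisorD[OF x(2)] by blast
    then show False using cm_idealD(2)[OF I(1)] prime_one[OF prime_mm] by blast
  qed
  \<comment> \<open>\<open>0 < g\<close> makes \<open>ys\<close> nonempty, as
    \<open>maximal_not_ci\<close> requires: it modifies the last member.\<close>
  then have T: "ideal_colon R (ci ys) I \<subseteq> I" if "reg R {\<zero>} ys" "set ys \<subseteq> I" "length ys = g" for ys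
    using maximal_contains_links[of I ys] I mx that by auto
  show "maximal_in_linkage_class R (adjoin R I x)"
    by (rule tight_maximal[OF tight_adjoin[OF I(1) x cm T]])
qed

lemma maximal_gen:
  "cm_ideal I g \<Longrightarrow> 0 < g \<Longrightarrow> maximal_in_linkage_class R I \<Longrightarrow> set xs \<subseteq> mm \<Longrightarrow> reg R I xs \<Longrightarrow>
   maximal_in_linkage_class R (gen R I xs)"
proof (induction xs arbitrary: I g)
  case (Cons x xs)
  note m = maximal_adjoin[OF Cons.prems(1-3), of x]
  show ?case using Cons.IH[of "adjoin R I x" "Suc g"] m Cons.prems(4,5) by simp
qed simp

text \<open>\<open>length us\<close> is the height of one associated prime of \<open>I\<close> and,
  by unmixedness, of all; positive codimension makes it nonzero.\<close>

lemma cm_ideal_if_cohen_macaulay: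
  assumes CM: "cohen_macaulay_ideal R I" and u: "unmixed_ideal R I" and ht: "0 < ideal_height R I"
  obtains g where "cm_ideal I g" "0 < g"
proof -
  have p: "proper_ideal R I" using CM unfolding cohen_macaulay_ideal_def by blast
  have I: "ideal I R" "I \<subseteq> mm" using p proper_ideal_sub_mm unfolding proper_ideal_def by auto
  obtain us Q where us: "reg R {\<zero>} us" "set us \<subseteq> I" "Q \<in> associated_primes R (ci us)" "Q \<in> associated_primes R I"
    using regular_below_assoc[OF I] .
  note IQ = assoc_prime_sub[OF I(1) us(4)] and hQ = prime_height_assoc[OF us(1,3)]
  have le: "ideal_height R I \<le> prime_height R Q"
    unfolding ideal_height_def by (rule Inf_lower) (use assoc_prime[OF us(4)] IQ in blast)
  have "0 < enat (length us)" using less_le_trans[OF ht le] hQ by simp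
  then have "0 < length us" by (simp add: zero_enat_def)
  moreover have "cm_ideal I (length us)"
    unfolding cm_ideal_def
  proof (intro conjI ballI I)
    show "ext_bound (length us) I" by (rule ext_bound_if_cohen_macaulay[OF CM us(1,2,3) IQ])
    show "prime_height R P = enat (length us)" if "P \<in> associated_primes R I" for P
      using u us(4) that hQ unfolding unmixed_ideal_def by metis
  qed
  ultimately show ?thesis using that by blast
qed

end

theorem corollary3p3:
  fixes R :: "('a, 'x) ring_scheme" and I :: "'a set" and xs :: "'a list"
  assumes "gorenstein_local_ring R"
    and "infinite (carrier (residue_field R))"
    and "cohen_macaulay_ideal R I"
    and "0 < ideal_height R I"
    and "regular_sequence R xs"
    and "regular_on_quotient R I xs"
    and "maximal_in_linkage_class R I"
  shows "maximal_in_linkage_class R (Idl\<^bsub>R\<^esub> (I \<union> set xs))"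
proof -
  obtain E :: "nat \<Rightarrow> ('a, 'a list) module" and d e1 n where "gor R E d e1 n"
    using gor_if_gorenstein[OF assms(1,2)] .
  then interpret gor R E d e1 n .
  have u: "unmixed_ideal R I" using assms(7) unfolding maximal_in_linkage_class_def by blast
  obtain g where g: "cm_ideal I g" "0 < g" using cm_ideal_if_cohen_macaulay[OF assms(3) u assms(4)] .
  note iI = cm_idealD(1)[OF g(1)]
  note xs = reg_if_regular_on_quotient[OF iI assms(6)]
  \<comment> \<open>A regular sequence generates a proper ideal, so in the local ring its members
    lie in the maximal ideal.\<close>
  have iX: "ideal (Idl\<^bsub>R\<^esub> (set xs)) R" by (rule genideal_ideal[OF xs(1)])
  have "Idl\<^bsub>R\<^esub> (set xs) \<subseteq> mm"
    using proper_sub_mm[OF iX] ideal_oneI[OF iX] assms(5) unfolding regular_sequence_def by blast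
  then have "set xs \<subseteq> mm" using genideal_self[OF xs(1)] by blast
  then have "maximal_in_linkage_class R (gen R I xs)" by (rule maximal_gen[OF g assms(7) _ xs(2)])
  then show ?thesis unfolding gen_eq_Idl[OF iI xs(1)] .
qed

end
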